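(* Let $k$ be a field and $\alpha,\beta,\gamma\in k$ with $\beta\ne0$. The down-up algebra $A(\alpha,\beta,\gamma)$ is $3$-Calabi-Yau if and only if $\beta=-1$.
   Context: $A(\alpha,\beta,\gamma)$ is the quotient of the free algebra $k\langle d,u\rangle$ by the two-sided ideal generated by $d^2u-\alpha dud-\beta ud^2-\gamma d$ and $du^2-\alpha udu-\beta u^2d-\gamma u$. For an associative $k$-algebra $A$, put $A^e=A\otimes_k A^{op}$. $A$ is called $n$-Calabi-Yau if there are isomorphisms of $A$-bimodules $\operatorname{Ext}^i_{A^e}(A,A^e)\cong 0$ for $i\ne n$ and $\operatorname{Ext}^n_{A^e}(A,A^e)\cong A$, where the outer $A$-bimodule structure of $A^e$ is used to compute $\operatorname{Ext}_{A^e}^i(A,A^e)$ and the inner bimodule structure of $A^e$ gives the $A$-bimodule structure on $\operatorname{Ext}_{A^e}^i(A,A^e)$. *)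

theory Defs
  imports "HOL-Algebra.QuotRing" "HOL-Algebra.Module" "HOL-Library.Poly_Mapping"
begin

section \<open>Algebras over a field\<close>

text \<open>
  An associative unital algebra over a field \<open>'k\<close> is represented by a record of type
  \<open>('k, 'a) module\<close>, whose ring part need not be commutative and whose \<open>smult\<close> is the action
  of the scalars.
\<close>

definition monoid_algebra :: "('g, 'x) monoid_scheme \<Rightarrow> ('k::field, 'g \<Rightarrow>\<^sub>0 'k) module" where
  "monoid_algebra G =
    \<lparr>carrier = {f. Poly_Mapping.keys f \<subseteq> carrier G},
     mult = (\<lambda>f g. \<Sum>x\<in>Poly_Mapping.keys f. \<Sum>y\<in>Poly_Mapping.keys g.
               Poly_Mapping.single (x \<otimes>\<^bsub>G\<^esub> y)
                 (Poly_Mapping.lookup f x * Poly_Mapping.lookup g y)),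
     one = Poly_Mapping.single \<one>\<^bsub>G\<^esub> 1,
     zero = 0,
     add = (+),
     smult = (\<lambda>c. Poly_Mapping.map (\<lambda>v. c * v))\<rparr>"

definition quotient_algebra :: "('k::field, 'a) module \<Rightarrow> 'a set \<Rightarrow> ('k, 'a set) module" where
  "quotient_algebra A I =
    \<lparr>carrier = carrier (A Quot I),
     mult = mult (A Quot I),
     one = one (A Quot I),
     zero = zero (A Quot I),
     add = add (A Quot I),
     smult = (\<lambda>c X. \<Union>x\<in>X. I +>\<^bsub>A\<^esub> (c \<odot>\<^bsub>A\<^esub> x))\<rparr>"

definition free_algebra :: "('k::field, 'x list \<Rightarrow>\<^sub>0 'k) module" where
  "free_algebra = monoid_algebra \<lparr>carrier = UNIV, mult = (@), one = []\<rparr>"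

definition opposite_algebra :: "('k::field, 'a) module \<Rightarrow> ('k, 'a) module" where
  "opposite_algebra A = A\<lparr>mult := (\<lambda>x y. y \<otimes>\<^bsub>A\<^esub> x)\<rparr>"

text \<open>
  The tensor product over \<open>'k\<close> is the free vector space on pairs, multiplied by
  \<open>(a, b)(a', b') = (aa', bb')\<close>, modulo the bilinearity relations.  The linear span of these
  relations is already a two-sided ideal, so that the ideal generated by them is the usual
  subspace of relations.
\<close>

definition tensor_relations ::
    "('k::field, 'a) module \<Rightarrow> ('k, 'b) module \<Rightarrow> ('a \<times> 'b \<Rightarrow>\<^sub>0 'k) set" where
  "tensor_relations A B =
    {Poly_Mapping.single (a \<oplus>\<^bsub>A\<^esub> a', b) 1 - Poly_Mapping.single (a, b) 1
       - Poly_Mapping.single (a', b) 1 | a a' b.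
       a \<in> carrier A \<and> a' \<in> carrier A \<and> b \<in> carrier B} \<union>
    {Poly_Mapping.single (a, b \<oplus>\<^bsub>B\<^esub> b') 1 - Poly_Mapping.single (a, b) 1
       - Poly_Mapping.single (a, b') 1 | a b b'.
       a \<in> carrier A \<and> b \<in> carrier B \<and> b' \<in> carrier B} \<union>
    {Poly_Mapping.single (c \<odot>\<^bsub>A\<^esub> a, b) 1 - Poly_Mapping.single (a, b) c | c a b.
       a \<in> carrier A \<and> b \<in> carrier B} \<union>
    {Poly_Mapping.single (a, c \<odot>\<^bsub>B\<^esub> b) 1 - Poly_Mapping.single (a, b) c | c a b.
       a \<in> carrier A \<and> b \<in> carrier B}"

definition tensor_ideal ::
    "('k::field, 'a) module \<Rightarrow> ('k, 'b) module \<Rightarrow> ('a \<times> 'b \<Rightarrow>\<^sub>0 'k) set" where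
  "tensor_ideal A B = genideal (monoid_algebra (A \<times>\<times> B)) (tensor_relations A B)"

definition tensor_product ::
    "('k::field, 'a) module \<Rightarrow> ('k, 'b) module \<Rightarrow> ('k, ('a \<times> 'b \<Rightarrow>\<^sub>0 'k) set) module" where
  "tensor_product A B = quotient_algebra (monoid_algebra (A \<times>\<times> B)) (tensor_ideal A B)"

definition pure_tensor ::
    "('k::field, 'a) module \<Rightarrow> ('k, 'b) module \<Rightarrow> 'a \<Rightarrow> 'b \<Rightarrow> ('a \<times> 'b \<Rightarrow>\<^sub>0 'k) set" where
  "pure_tensor A B a b =
    tensor_ideal A B +>\<^bsub>monoid_algebra (A \<times>\<times> B)\<^esub> Poly_Mapping.single (a, b) 1"

definition enveloping_algebra ::
    "('k::field, 'a) module \<Rightarrow> ('k, ('a \<times> 'a \<Rightarrow>\<^sub>0 'k) set) module" where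
  "enveloping_algebra A = tensor_product A (opposite_algebra A)"


section \<open>Ext of left modules over a noncommutative ring\<close>

text \<open>
  A left module over a ring is again a record of type \<open>('r, 'm) module\<close>; its fields \<open>mult\<close> and
  \<open>one\<close> play no role.  (The locale \<open>module\<close> of HOL-Algebra is restricted to commutative rings.)
\<close>

definition lin_maps ::
    "('r, 'x) ring_scheme \<Rightarrow> ('r, 'm) module \<Rightarrow> ('r, 'n) module \<Rightarrow> ('m \<Rightarrow> 'n) set" where
  "lin_maps R M N =
    {f \<in> carrier M \<rightarrow>\<^sub>E carrier N.
       (\<forall>x\<in>carrier M. \<forall>y\<in>carrier M. f (x \<oplus>\<^bsub>M\<^esub> y) = f x \<oplus>\<^bsub>N\<^esub> f y) \<and>
       (\<forall>r\<in>carrier R. \<forall>x\<in>carrier M. f (r \<odot>\<^bsub>M\<^esub> x) = r \<odot>\<^bsub>N\<^esub> f x)}"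

definition Hom_group ::
    "('r, 'x) ring_scheme \<Rightarrow> ('r, 'm) module \<Rightarrow> ('r, 'n) module \<Rightarrow> ('m \<Rightarrow> 'n) ring" where
  "Hom_group R M N =
    \<lparr>carrier = lin_maps R M N,
     mult = undefined,
     one = undefined,
     zero = (\<lambda>x\<in>carrier M. \<zero>\<^bsub>N\<^esub>),
     add = (\<lambda>f g. \<lambda>x\<in>carrier M. f x \<oplus>\<^bsub>N\<^esub> g x)\<rparr>"

definition free_module :: "('r, 'x) ring_scheme \<Rightarrow> 'i set \<Rightarrow> ('r, 'i \<Rightarrow> 'r) module" where
  "free_module R I =
    \<lparr>carrier = {f. (\<forall>i\<in>I. f i \<in> carrier R) \<and> (\<forall>i. i \<notin> I \<longrightarrow> f i = \<zero>\<^bsub>R\<^esub>) \<and>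
                   finite {i. f i \<noteq> \<zero>\<^bsub>R\<^esub>}},
     mult = undefined,
     one = undefined,
     zero = (\<lambda>_. \<zero>\<^bsub>R\<^esub>),
     add = (\<lambda>f g i. f i \<oplus>\<^bsub>R\<^esub> g i),
     smult = (\<lambda>r f i. r \<otimes>\<^bsub>R\<^esub> f i)\<rparr>"

text \<open>
  The free resolution \<open>\<dots> \<rightarrow> F 1 \<rightarrow> F 0 \<rightarrow> M \<rightarrow> 0\<close> has \<open>F n = free_module R (I n)\<close>; the differential
  \<open>d n\<close> maps \<open>F (n + 1)\<close> to \<open>F n\<close>, and \<open>\<epsilon>\<close> is the augmentation.
\<close>

definition free_resolution ::
    "('r, 'x) ring_scheme \<Rightarrow> ('r, 'm) module \<Rightarrow> (nat \<Rightarrow> 'i set) \<Rightarrow>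
     (nat \<Rightarrow> ('i \<Rightarrow> 'r) \<Rightarrow> ('i \<Rightarrow> 'r)) \<Rightarrow> (('i \<Rightarrow> 'r) \<Rightarrow> 'm) \<Rightarrow> bool" where
  "free_resolution R M I d \<epsilon> \<longleftrightarrow>
    \<epsilon> \<in> lin_maps R (free_module R (I 0)) M \<and>
    (\<forall>n. d n \<in> lin_maps R (free_module R (I (Suc n))) (free_module R (I n))) \<and>
    \<epsilon> ` carrier (free_module R (I 0)) = carrier M \<and>
    {x \<in> carrier (free_module R (I 0)). \<epsilon> x = \<zero>\<^bsub>M\<^esub>} =
      d 0 ` carrier (free_module R (I 1)) \<and>
    (\<forall>n. {x \<in> carrier (free_module R (I (Suc n))). d n x = (\<lambda>_. \<zero>\<^bsub>R\<^esub>)} =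
      d (Suc n) ` carrier (free_module R (I (Suc (Suc n)))))"

text \<open>
  Ext does not depend, up to natural isomorphism, on the projective resolution; we fix a free
  one.  The index type \<open>'m \<times> 'r \<times> nat\<close> is infinite and at least as large as \<open>'m\<close> and \<open>'r\<close>.
  A free module with basis in this type has at most as many elements as the type, so each
  successive module of syzygies again has a generating set indexed by the type, and a free
  resolution exists for every left module.
\<close>

definition resolution ::
    "('r, 'x) ring_scheme \<Rightarrow> ('r, 'm) module \<Rightarrow>
     (nat \<Rightarrow> ('m \<times> 'r \<times> nat) set) \<times>
     (nat \<Rightarrow> ('m \<times> 'r \<times> nat \<Rightarrow> 'r) \<Rightarrow> ('m \<times> 'r \<times> nat \<Rightarrow> 'r))" where
  "resolution R M = (SOME P. \<exists>\<epsilon>. free_resolution R M (fst P) (snd P) \<epsilon>)"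

definition res_module ::
    "('r, 'x) ring_scheme \<Rightarrow> ('r, 'm) module \<Rightarrow> nat \<Rightarrow> ('r, 'm \<times> 'r \<times> nat \<Rightarrow> 'r) module" where
  "res_module R M n = free_module R (fst (resolution R M) n)"

definition res_diff ::
    "('r, 'x) ring_scheme \<Rightarrow> ('r, 'm) module \<Rightarrow> nat \<Rightarrow>
     ('m \<times> 'r \<times> nat \<Rightarrow> 'r) \<Rightarrow> ('m \<times> 'r \<times> nat \<Rightarrow> 'r)" where
  "res_diff R M = snd (resolution R M)"

definition cocycles ::
    "('r, 'x) ring_scheme \<Rightarrow> ('r, 'm) module \<Rightarrow> ('r, 'n) module \<Rightarrow> nat \<Rightarrow>
     (('m \<times> 'r \<times> nat \<Rightarrow> 'r) \<Rightarrow> 'n) ring" where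
  "cocycles R M N i = (Hom_group R (res_module R M i) N)
    \<lparr>carrier := {f \<in> lin_maps R (res_module R M i) N.
       \<forall>x\<in>carrier (res_module R M (Suc i)). f (res_diff R M i x) = \<zero>\<^bsub>N\<^esub>}\<rparr>"

definition coboundaries ::
    "('r, 'x) ring_scheme \<Rightarrow> ('r, 'm) module \<Rightarrow> ('r, 'n) module \<Rightarrow> nat \<Rightarrow>
     (('m \<times> 'r \<times> nat \<Rightarrow> 'r) \<Rightarrow> 'n) set" where
  "coboundaries R M N i = (case i of
      0 \<Rightarrow> {\<lambda>x\<in>carrier (res_module R M 0). \<zero>\<^bsub>N\<^esub>}
    | Suc j \<Rightarrow> {compose (carrier (res_module R M (Suc j))) g (res_diff R M j) | g.
                g \<in> lin_maps R (res_module R M j) N})"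

definition Ext ::
    "('r, 'x) ring_scheme \<Rightarrow> nat \<Rightarrow> ('r, 'm) module \<Rightarrow> ('r, 'n) module \<Rightarrow>
     (('m \<times> 'r \<times> nat \<Rightarrow> 'r) \<Rightarrow> 'n) set ring" where
  "Ext R i M N =
    \<lparr>carrier = a_rcosets\<^bsub>cocycles R M N i\<^esub> (coboundaries R M N i),
     mult = undefined,
     one = undefined,
     zero = coboundaries R M N i,
     add = set_add (cocycles R M N i)\<rparr>"

text \<open>The map \<open>Ext R i M N \<rightarrow> Ext R i M N'\<close> induced by a linear map \<open>\<phi>\<close> from \<open>N\<close> to \<open>N'\<close>.\<close>

definition Ext_map ::
    "('r, 'x) ring_scheme \<Rightarrow> nat \<Rightarrow> ('r, 'm) module \<Rightarrow> ('r, 'n') module \<Rightarrow> ('n \<Rightarrow> 'n') \<Rightarrow>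
     (('m \<times> 'r \<times> nat \<Rightarrow> 'r) \<Rightarrow> 'n) set \<Rightarrow> (('m \<times> 'r \<times> nat \<Rightarrow> 'r) \<Rightarrow> 'n') set" where
  "Ext_map R i M N' \<phi> X =
    (\<Union>f\<in>X. coboundaries R M N' i +>\<^bsub>cocycles R M N' i\<^esub>
       compose (carrier (res_module R M i)) \<phi> f)"


section \<open>Bimodules and the Calabi-Yau property\<close>

record ('a, 'm) bimodule = "'m ring" +
  lact :: "'a \<Rightarrow> 'm \<Rightarrow> 'm"
  ract :: "'m \<Rightarrow> 'a \<Rightarrow> 'm"

definition bimodule_iso ::
    "('a, 'x) ring_scheme \<Rightarrow> ('a, 'm) bimodule \<Rightarrow> ('a, 'n) bimodule \<Rightarrow> bool" where
  "bimodule_iso A M N \<longleftrightarrow>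
    (\<exists>f. bij_betw f (carrier M) (carrier N) \<and>
       (\<forall>x\<in>carrier M. \<forall>y\<in>carrier M. f (x \<oplus>\<^bsub>M\<^esub> y) = f x \<oplus>\<^bsub>N\<^esub> f y) \<and>
       (\<forall>a\<in>carrier A. \<forall>x\<in>carrier M. f (lact M a x) = lact N a (f x)) \<and>
       (\<forall>a\<in>carrier A. \<forall>x\<in>carrier M. f (ract M x a) = ract N (f x) a))"

definition zero_bimodule :: "('a, unit) bimodule" where
  "zero_bimodule =
    \<lparr>carrier = {()}, mult = undefined, one = undefined, zero = (), add = (\<lambda>_ _. ()),
     lact = (\<lambda>_ _. ()), ract = (\<lambda>_ _. ())\<rparr>"

definition regular_bimodule :: "('k::field, 'a) module \<Rightarrow> ('a, 'a) bimodule" where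
  "regular_bimodule A =
    \<lparr>carrier = carrier A, mult = mult A, one = one A, zero = zero A, add = add A,
     lact = mult A, ract = mult A\<rparr>"

text \<open>
  A bimodule is a left module over the enveloping algebra through \<open>(a \<otimes> b) x = a x b\<close>.
  All representatives of an element of the enveloping algebra act in the same way; the action is
  the only element of the image in the definition.
\<close>

definition env_module ::
    "('k::field, 'a) module \<Rightarrow> ('a, 'm) bimodule \<Rightarrow> (('a \<times> 'a \<Rightarrow>\<^sub>0 'k) set, 'm) module" where
  "env_module A M =
    \<lparr>carrier = carrier M, mult = mult M, one = one M, zero = zero M, add = add M,
     smult = (\<lambda>X x. the_elem
       ((\<lambda>t. \<Oplus>\<^bsub>M\<^esub>p\<in>Poly_Mapping.keys t.
          lact M (Poly_Mapping.lookup t p \<odot>\<^bsub>A\<^esub> fst p) (ract M x (snd p))) ` X))\<rparr>"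

text \<open>
  The enveloping algebra has the outer bimodule structure \<open>a (x \<otimes> y) b = ax \<otimes> yb\<close> and the inner
  one \<open>a (x \<otimes> y) b = xb \<otimes> ay\<close>.  Since the second tensor factor carries the opposite
  multiplication, the outer structure is left multiplication by \<open>a \<otimes> 1\<close> and \<open>1 \<otimes> b\<close>, and the
  inner structure is right multiplication by \<open>1 \<otimes> a\<close> and \<open>b \<otimes> 1\<close>.
\<close>

definition outer_bimodule ::
    "('k::field, 'a) module \<Rightarrow> ('a, ('a \<times> 'a \<Rightarrow>\<^sub>0 'k) set) bimodule" where
  "outer_bimodule A = (let E = enveloping_algebra A; t = pure_tensor A (opposite_algebra A) in
    \<lparr>carrier = carrier E, mult = mult E, one = one E, zero = zero E, add = add E,
     lact = (\<lambda>a X. t a \<one>\<^bsub>A\<^esub> \<otimes>\<^bsub>E\<^esub> X),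
     ract = (\<lambda>X b. t \<one>\<^bsub>A\<^esub> b \<otimes>\<^bsub>E\<^esub> X)\<rparr>)"

definition inner_bimodule ::
    "('k::field, 'a) module \<Rightarrow> ('a, ('a \<times> 'a \<Rightarrow>\<^sub>0 'k) set) bimodule" where
  "inner_bimodule A = (let E = enveloping_algebra A; t = pure_tensor A (opposite_algebra A) in
    \<lparr>carrier = carrier E, mult = mult E, one = one E, zero = zero E, add = add E,
     lact = (\<lambda>a X. X \<otimes>\<^bsub>E\<^esub> t \<one>\<^bsub>A\<^esub> a),
     ract = (\<lambda>X b. X \<otimes>\<^bsub>E\<^esub> t b \<one>\<^bsub>A\<^esub>)\<rparr>)"

text \<open>
  The bimodule \<open>Ext\<^sup>i(A, A \<otimes> A\<^sup>o\<^sup>p)\<close> over the enveloping algebra: the group is computed with the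
  outer structure, and the actions are induced by functoriality from the inner structure.
\<close>

definition Ext_env_bimodule ::
    "('k::field, 'a) module \<Rightarrow> nat \<Rightarrow>
     ('a, (('a \<times> ('a \<times> 'a \<Rightarrow>\<^sub>0 'k) set \<times> nat \<Rightarrow> ('a \<times> 'a \<Rightarrow>\<^sub>0 'k) set)
            \<Rightarrow> ('a \<times> 'a \<Rightarrow>\<^sub>0 'k) set) set) bimodule" where
  "Ext_env_bimodule A i =
    (let E = enveloping_algebra A;
         M = env_module A (regular_bimodule A);
         N = env_module A (outer_bimodule A);
         H = Ext E i M N
     in
    \<lparr>carrier = carrier H, mult = mult H, one = one H, zero = zero H, add = add H,
     lact = (\<lambda>a. Ext_map E i M N (\<lambda>x. lact (inner_bimodule A) a x)),
     ract = (\<lambda>X b. Ext_map E i M N (\<lambda>x. ract (inner_bimodule A) x b) X)\<rparr>)"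

definition calabi_yau :: "nat \<Rightarrow> ('k::field, 'a) module \<Rightarrow> bool" where
  "calabi_yau n A \<longleftrightarrow>
    (\<forall>i. i \<noteq> n \<longrightarrow> bimodule_iso A (Ext_env_bimodule A i) zero_bimodule) \<and>
    bimodule_iso A (Ext_env_bimodule A n) (regular_bimodule A)"


section \<open>Down-up algebras\<close>

datatype down_up_gen = Down | Up

definition down_up_relations ::
    "'k::field \<Rightarrow> 'k \<Rightarrow> 'k \<Rightarrow> (down_up_gen list \<Rightarrow>\<^sub>0 'k) set" where
  "down_up_relations \<alpha> \<beta> \<gamma> =
    {Poly_Mapping.single [Down, Down, Up] 1 - Poly_Mapping.single [Down, Up, Down] \<alpha>
       - Poly_Mapping.single [Up, Down, Down] \<beta> - Poly_Mapping.single [Down] \<gamma>,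
     Poly_Mapping.single [Down, Up, Up] 1 - Poly_Mapping.single [Up, Down, Up] \<alpha>
       - Poly_Mapping.single [Up, Up, Down] \<beta> - Poly_Mapping.single [Up] \<gamma>}"

definition down_up_algebra ::
    "'k::field \<Rightarrow> 'k \<Rightarrow> 'k \<Rightarrow> ('k, (down_up_gen list \<Rightarrow>\<^sub>0 'k) set) module" where
  "down_up_algebra \<alpha> \<beta> \<gamma> =
    quotient_algebra free_algebra (genideal free_algebra (down_up_relations \<alpha> \<beta> \<gamma>))"

end

(* The normal monomials u^i (du)^j d^k span A by rewriting, and they are independent because A acts
   on generic sequences by weighted shifts.  Put E = A^e.  The complex of free modules
   0 -> E -> E^2 -> E^2 -> E -> A -> 0 given by the Fox derivatives of the relations is exact: in
   normal form coordinates its maps are triangular for the degree in one tensor factor.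
   Dualising it returns, after exchanging the tensor factors, the same complex twisted by the
   automorphism sigma: d |-> -beta^(-1) d, u |-> -beta u.  Hence Ext^i(A, E) = 0 for i \<noteq> 3, and
   Ext^3(A, E) is A with the left action twisted by sigma.  For beta = -1 the twist is trivial.
   Otherwise a bimodule isomorphism with A would produce an element c with a left inverse such that
   d c = -beta^(-1) c d, and no such element exists by the action on sequences. *)

theory Submission
  imports Defs "HOL-Computational_Algebra.Polynomial"
begin

section \<open>Monoid algebras, quotients and tensor products\<close>

text \<open>The leading words \<open>ddu\<close> and \<open>duu\<close> of the relations overlap
  only in \<open>dduu\<close>, whence the ranks 1, 2, 2, 1; the normal monomials are the words
  avoiding both, so exactness can be decided on leading terms. The twist originates in the
  coefficient \<beta> of the overlap identity: the dual of the last map becomes a pair of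
  commutators with \<open>d\<close> and \<open>u\<close> only after these are rescaled by -1/\<beta>
  and -\<beta> in one factor. Ext is defined by an arbitrarily chosen resolution, on which nothing
  can be computed. Resolutions are therefore compared over general rings, naturally in endomorphisms
  of the coefficients, since the bimodule structure of Ext consists of such maps. The small complex
  also witnesses that the choice is not empty. The nonexistence of \<open>c\<close> has two cases.
  If the recurrence of the weights has a constant solution, constant sequences form a representation
  where \<open>c\<close> acts as 0. Otherwise \<alpha> + \<beta> = 1 and an arithmetic progression
  solves it; commuting with the shift is then locally nilpotent on the operators of
  \<open>A\<close>, but multiplies \<open>c\<close>, up to shifts, by -1/\<beta> - 1, which is
  nonzero.\<close>

lemma poly_mapping_sum_single:
  "(f :: 'a \<Rightarrow>\<^sub>0 'b::ab_group_add) =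
    (\<Sum>x\<in>Poly_Mapping.keys f. Poly_Mapping.single x (Poly_Mapping.lookup f x))"
proof (rule poly_mapping_eqI)
  fix k
  have "(\<Sum>x\<in>Poly_Mapping.keys f. Poly_Mapping.lookup (Poly_Mapping.single x (Poly_Mapping.lookup f x)) k)
      = (\<Sum>x\<in>Poly_Mapping.keys f. if x = k then Poly_Mapping.lookup f x else 0)"
    by (rule sum.cong) (auto simp: lookup_single when_def)
  also have "\<dots> = Poly_Mapping.lookup f k"
    by (auto simp: sum.delta in_keys_iff)
  finally show "Poly_Mapping.lookup f k = Poly_Mapping.lookup
      (\<Sum>x\<in>Poly_Mapping.keys f. Poly_Mapping.single x (Poly_Mapping.lookup f x)) k"
    by (simp add: lookup_sum)
qed

text \<open>Identities in a monoid algebra are additive in each argument, so this rule reduces them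
  to single basis elements; \<open>S\<close> keeps it available that the keys lie in the
  carrier.\<close>

lemma poly_mapping_keys_induct [consumes 1, case_names zero single add]:
  fixes f :: "'a \<Rightarrow>\<^sub>0 'b::ab_group_add"
  assumes "Poly_Mapping.keys f \<subseteq> S"
    and "P 0"
    and "\<And>x c. x \<in> S \<Longrightarrow> P (Poly_Mapping.single x c)"
    and "\<And>f g. Poly_Mapping.keys f \<subseteq> S \<Longrightarrow> Poly_Mapping.keys g \<subseteq> S \<Longrightarrow> P f \<Longrightarrow> P g \<Longrightarrow> P (f + g)"
  shows "P f"
proof -
  have "P (\<Sum>x\<in>X. Poly_Mapping.single x (Poly_Mapping.lookup f x)) \<and>
      Poly_Mapping.keys (\<Sum>x\<in>X. Poly_Mapping.single x (Poly_Mapping.lookup f x)) \<subseteq> S"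
    if "finite X" "X \<subseteq> Poly_Mapping.keys f" for X
    using that
  proof (induction X rule: finite_induct)
    case empty
    then show ?case using assms(2) by simp
  next
    case (insert x X)
    let ?s = "Poly_Mapping.single x (Poly_Mapping.lookup f x)"
    have x: "x \<in> S" using insert.prems assms(1) by auto
    then have "Poly_Mapping.keys ?s \<subseteq> S" by simp
    then show ?case
      using insert x assms(3,4) keys_add[of ?s "\<Sum>x\<in>X. Poly_Mapping.single x (Poly_Mapping.lookup f x)"]
      by (auto simp: subset_iff)
  qed
  from this[of "Poly_Mapping.keys f"] show ?thesis
    using poly_mapping_sum_single[of f] by simp
qed

lemma keys_diff_subset: "Poly_Mapping.keys f \<subseteq> S \<Longrightarrow> Poly_Mapping.keys g \<subseteq> S \<Longrightarrow>
    Poly_Mapping.keys (f - g :: 'a \<Rightarrow>\<^sub>0 'b::ab_group_add) \<subseteq> S"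
  using keys_diff[of f g] by blast

lemma keys_add_subset: "Poly_Mapping.keys f \<subseteq> S \<Longrightarrow> Poly_Mapping.keys g \<subseteq> S \<Longrightarrow>
    Poly_Mapping.keys (f + g) \<subseteq> S"
  using keys_add[of f g] by blast

lemma keys_sum_subset: "(\<And>x. x \<in> X \<Longrightarrow> Poly_Mapping.keys (f x) \<subseteq> S) \<Longrightarrow>
    Poly_Mapping.keys (\<Sum>x\<in>X. f x) \<subseteq> S"
  by (induction X rule: infinite_finite_induct) (auto dest: keys_add[THEN subsetD])

text \<open>A separate name for the scalar action inside \<open>monoid_algebra\<close>, so that
  simplification works with \<open>lookup_scale\<close> instead of the underlying map.\<close>

definition scale :: "'k::field \<Rightarrow> ('a \<Rightarrow>\<^sub>0 'k) \<Rightarrow> ('a \<Rightarrow>\<^sub>0 'k)" where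
  "scale c = Poly_Mapping.map (\<lambda>v. c * v)"

lemma lookup_scale [simp]: "Poly_Mapping.lookup (scale c f) x = c * Poly_Mapping.lookup f x"
  by (simp add: scale_def Poly_Mapping.map.rep_eq when_def)

lemma scale_single [simp]: "scale c (Poly_Mapping.single x b) = Poly_Mapping.single x (c * b)"
  by (rule poly_mapping_eqI) (simp add: lookup_single when_def)

lemma scale_add: "scale c (f + g) = scale c f + scale c g"
  by (rule poly_mapping_eqI) (simp add: lookup_add algebra_simps)

lemma scale_zero [simp]: "scale c 0 = 0"
  by (rule poly_mapping_eqI) simp

lemma keys_scale_subset: "Poly_Mapping.keys f \<subseteq> S \<Longrightarrow> Poly_Mapping.keys (scale c f) \<subseteq> S"
  by (auto simp: in_keys_iff subset_iff)

section \<open>Arithmetic in monoid algebras\<close>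

lemma monoid_algebra_simps [simp]:
  "carrier (monoid_algebra G) = {f. Poly_Mapping.keys f \<subseteq> carrier G}"
  "\<one>\<^bsub>monoid_algebra G\<^esub> = Poly_Mapping.single \<one>\<^bsub>G\<^esub> 1"
  "\<zero>\<^bsub>monoid_algebra G\<^esub> = 0"
  "f \<oplus>\<^bsub>monoid_algebra G\<^esub> g = f + g"
  "c \<odot>\<^bsub>monoid_algebra G\<^esub> f = scale c f"
  by (simp_all add: monoid_algebra_def scale_def)

text \<open>The product sums over the exact key sets, which change under addition. Summing over
  larger finite sets makes additivity in both factors visible.\<close>

lemma monoid_algebra_mult_superset:
  assumes "finite S" "finite T" "Poly_Mapping.keys f \<subseteq> S" "Poly_Mapping.keys g \<subseteq> T"
  shows "f \<otimes>\<^bsub>monoid_algebra G\<^esub> g = (\<Sum>x\<in>S. \<Sum>y\<in>T. Poly_Mapping.single (x \<otimes>\<^bsub>G\<^esub> y)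
      (Poly_Mapping.lookup f x * Poly_Mapping.lookup g y))"
proof -
  have "(\<Sum>x\<in>Poly_Mapping.keys f. \<Sum>y\<in>Poly_Mapping.keys g. Poly_Mapping.single (x \<otimes>\<^bsub>G\<^esub> y)
        (Poly_Mapping.lookup f x * Poly_Mapping.lookup g y))
      = (\<Sum>x\<in>Poly_Mapping.keys f. \<Sum>y\<in>T. Poly_Mapping.single (x \<otimes>\<^bsub>G\<^esub> y)
        (Poly_Mapping.lookup f x * Poly_Mapping.lookup g y))"
    using assms by (intro sum.cong refl sum.mono_neutral_left) (auto simp: in_keys_iff)
  also have "\<dots> = (\<Sum>x\<in>S. \<Sum>y\<in>T. Poly_Mapping.single (x \<otimes>\<^bsub>G\<^esub> y)
      (Poly_Mapping.lookup f x * Poly_Mapping.lookup g y))"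
    using assms by (intro sum.mono_neutral_left) (auto simp: in_keys_iff)
  finally show ?thesis by (simp add: monoid_algebra_def)
qed

lemma monoid_algebra_mult_single:
  "Poly_Mapping.single x b \<otimes>\<^bsub>monoid_algebra G\<^esub> Poly_Mapping.single y c =
    Poly_Mapping.single (x \<otimes>\<^bsub>G\<^esub> y) (b * c)"
  by (subst monoid_algebra_mult_superset[of "{x}" "{y}"]) auto

lemma monoid_algebra_mult_add_left:
  "(f + g) \<otimes>\<^bsub>monoid_algebra G\<^esub> h = f \<otimes>\<^bsub>monoid_algebra G\<^esub> h + g \<otimes>\<^bsub>monoid_algebra G\<^esub> h"
proof -
  let ?S = "Poly_Mapping.keys f \<union> Poly_Mapping.keys g"
  show ?thesis
    using keys_add[of f g]
    by (subst (1 2 3) monoid_algebra_mult_superset[of ?S "Poly_Mapping.keys h"])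
      (auto simp: lookup_add algebra_simps single_add sum.distrib)
qed

lemma monoid_algebra_mult_add_right:
  "h \<otimes>\<^bsub>monoid_algebra G\<^esub> (f + g) = h \<otimes>\<^bsub>monoid_algebra G\<^esub> f + h \<otimes>\<^bsub>monoid_algebra G\<^esub> g"
proof -
  let ?S = "Poly_Mapping.keys f \<union> Poly_Mapping.keys g"
  show ?thesis
    using keys_add[of f g]
    by (subst (1 2 3) monoid_algebra_mult_superset[of "Poly_Mapping.keys h" ?S])
      (auto simp: lookup_add algebra_simps single_add sum.distrib)
qed

lemma monoid_algebra_mult_zero [simp]:
  "0 \<otimes>\<^bsub>monoid_algebra G\<^esub> f = 0" "f \<otimes>\<^bsub>monoid_algebra G\<^esub> 0 = 0"
  by (simp_all add: monoid_algebra_def)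

locale k_algebra = ring A for A :: "('k::field, 'a) module" (structure) +
  assumes smult_closed [simp, intro]: "x \<in> carrier A \<Longrightarrow> c \<odot> x \<in> carrier A"
    and smult_l_distr: "x \<in> carrier A \<Longrightarrow> (c + c') \<odot> x = c \<odot> x \<oplus> c' \<odot> x"
    and smult_r_distr: "x \<in> carrier A \<Longrightarrow> y \<in> carrier A \<Longrightarrow> c \<odot> (x \<oplus> y) = c \<odot> x \<oplus> c \<odot> y"
    and smult_smult: "x \<in> carrier A \<Longrightarrow> (c * c') \<odot> x = c \<odot> (c' \<odot> x)"
    and smult_one [simp]: "x \<in> carrier A \<Longrightarrow> 1 \<odot> x = x"
    and smult_mult_left: "x \<in> carrier A \<Longrightarrow> y \<in> carrier A \<Longrightarrow> (c \<odot> x) \<otimes> y = c \<odot> (x \<otimes> y)"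
    and smult_mult_right: "x \<in> carrier A \<Longrightarrow> y \<in> carrier A \<Longrightarrow> x \<otimes> (c \<odot> y) = c \<odot> (x \<otimes> y)"

context monoid
begin

lemma monoid_algebra_mult_closed:
  assumes "f \<in> carrier (monoid_algebra G)" "g \<in> carrier (monoid_algebra G)"
  shows "f \<otimes>\<^bsub>monoid_algebra G\<^esub> g \<in> carrier (monoid_algebra G)"
proof -
  have "Poly_Mapping.keys (\<Sum>x\<in>Poly_Mapping.keys f. \<Sum>y\<in>Poly_Mapping.keys g.
      Poly_Mapping.single (x \<otimes> y) (Poly_Mapping.lookup f x * Poly_Mapping.lookup g y)) \<subseteq> carrier G"
  proof (intro keys_sum_subset)
    fix x y assume "x \<in> Poly_Mapping.keys f" "y \<in> Poly_Mapping.keys g"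
    then have "x \<otimes> y \<in> carrier G" using assms by (simp add: subset_iff)
    then show "Poly_Mapping.keys (Poly_Mapping.single (x \<otimes> y)
        (Poly_Mapping.lookup f x * Poly_Mapping.lookup g y)) \<subseteq> carrier G" by simp
  qed
  then show ?thesis by (simp add: monoid_algebra_def)
qed

lemma monoid_algebra_mult_assoc:
  assumes "f \<in> carrier (monoid_algebra G)" "g \<in> carrier (monoid_algebra G)"
    "h \<in> carrier (monoid_algebra G)"
  shows "(f \<otimes>\<^bsub>monoid_algebra G\<^esub> g) \<otimes>\<^bsub>monoid_algebra G\<^esub> h =
    f \<otimes>\<^bsub>monoid_algebra G\<^esub> (g \<otimes>\<^bsub>monoid_algebra G\<^esub> h)"
proof -
  have f: "Poly_Mapping.keys f \<subseteq> carrier G" and g: "Poly_Mapping.keys g \<subseteq> carrier G"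
    and h: "Poly_Mapping.keys h \<subseteq> carrier G" using assms by auto
  from f show ?thesis
  proof (induction f rule: poly_mapping_keys_induct)
    case (single x c)
    from g show ?case
    proof (induction g rule: poly_mapping_keys_induct)
      case (single y c')
      from h show ?case
        by (induction h rule: poly_mapping_keys_induct)
          (use single \<open>x \<in> carrier G\<close> in \<open>auto simp: monoid_algebra_mult_single m_assoc mult.assoc
             monoid_algebra_mult_add_right\<close>)
    qed (auto simp: monoid_algebra_mult_add_left monoid_algebra_mult_add_right)
  qed (auto simp: monoid_algebra_mult_add_left)
qed

lemma monoid_algebra_mult_one:
  assumes "f \<in> carrier (monoid_algebra G)"
  shows "Poly_Mapping.single \<one> 1 \<otimes>\<^bsub>monoid_algebra G\<^esub> f = f"
    and "f \<otimes>\<^bsub>monoid_algebra G\<^esub> Poly_Mapping.single \<one> 1 = f"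
proof -
  have f: "Poly_Mapping.keys f \<subseteq> carrier G" using assms by auto
  then show "Poly_Mapping.single \<one> 1 \<otimes>\<^bsub>monoid_algebra G\<^esub> f = f"
    by (induction f rule: poly_mapping_keys_induct)
      (auto simp: monoid_algebra_mult_single monoid_algebra_mult_add_right)
  from f show "f \<otimes>\<^bsub>monoid_algebra G\<^esub> Poly_Mapping.single \<one> 1 = f"
    by (induction f rule: poly_mapping_keys_induct)
      (auto simp: monoid_algebra_mult_single monoid_algebra_mult_add_left)
qed

lemma monoid_algebra_smult_mult:
  assumes "f \<in> carrier (monoid_algebra G)" "g \<in> carrier (monoid_algebra G)"
  shows "scale c f \<otimes>\<^bsub>monoid_algebra G\<^esub> g = scale c (f \<otimes>\<^bsub>monoid_algebra G\<^esub> g)"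
    and "f \<otimes>\<^bsub>monoid_algebra G\<^esub> scale c g = scale c (f \<otimes>\<^bsub>monoid_algebra G\<^esub> g)"
proof -
  have f: "Poly_Mapping.keys f \<subseteq> carrier G" and g: "Poly_Mapping.keys g \<subseteq> carrier G"
    using assms by auto
  from f show "scale c f \<otimes>\<^bsub>monoid_algebra G\<^esub> g = scale c (f \<otimes>\<^bsub>monoid_algebra G\<^esub> g)"
  proof (induction f rule: poly_mapping_keys_induct)
    case (single x b)
    from g show ?case
      by (induction g rule: poly_mapping_keys_induct)
        (auto simp: monoid_algebra_mult_single monoid_algebra_mult_add_right scale_add mult.assoc)
  qed (auto simp: monoid_algebra_mult_add_left scale_add)
  from f show "f \<otimes>\<^bsub>monoid_algebra G\<^esub> scale c g = scale c (f \<otimes>\<^bsub>monoid_algebra G\<^esub> g)"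
  proof (induction f rule: poly_mapping_keys_induct)
    case (single x b)
    from g show ?case
      by (induction g rule: poly_mapping_keys_induct)
        (auto simp: monoid_algebra_mult_single monoid_algebra_mult_add_right scale_add mult.left_commute)
  qed (auto simp: monoid_algebra_mult_add_left scale_add)
qed

lemma k_algebra_monoid_algebra: "k_algebra (monoid_algebra G :: ('k::field, _) module)"
proof -
  let ?M = "monoid_algebra G :: ('k, _) module"
  have "abelian_group ?M"
  proof (rule abelian_groupI)
    fix x assume "x \<in> carrier ?M"
    then have "- x \<in> carrier ?M" by auto
    then show "\<exists>y\<in>carrier ?M. y \<oplus>\<^bsub>?M\<^esub> x = \<zero>\<^bsub>?M\<^esub>" by (intro bexI[of _ "- x"]) auto
  qed (auto intro: keys_add_subset[THEN subsetD] simp: algebra_simps)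
  moreover have "Group.monoid ?M"
    by (rule Group.monoidI)
      (auto simp del: monoid_algebra_simps(1) simp: monoid_algebra_mult_closed
        monoid_algebra_mult_assoc monoid_algebra_mult_one, simp)
  ultimately have "ring ?M"
    by (rule ringI) (auto simp: monoid_algebra_mult_add_left monoid_algebra_mult_add_right)
  then show ?thesis
  proof (intro k_algebra.intro k_algebra_axioms.intro)
    fix x y :: "'a \<Rightarrow>\<^sub>0 'k" and c c' :: 'k
    assume x: "x \<in> carrier ?M"
    then show "c \<odot>\<^bsub>?M\<^esub> x \<in> carrier ?M" by (simp add: keys_scale_subset)
    show "(c + c') \<odot>\<^bsub>?M\<^esub> x = c \<odot>\<^bsub>?M\<^esub> x \<oplus>\<^bsub>?M\<^esub> c' \<odot>\<^bsub>?M\<^esub> x"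
      "(c * c') \<odot>\<^bsub>?M\<^esub> x = c \<odot>\<^bsub>?M\<^esub> (c' \<odot>\<^bsub>?M\<^esub> x)" "1 \<odot>\<^bsub>?M\<^esub> x = x"
      by (auto intro!: poly_mapping_eqI simp: lookup_add algebra_simps)
    assume y: "y \<in> carrier ?M"
    show "c \<odot>\<^bsub>?M\<^esub> (x \<oplus>\<^bsub>?M\<^esub> y) = c \<odot>\<^bsub>?M\<^esub> x \<oplus>\<^bsub>?M\<^esub> c \<odot>\<^bsub>?M\<^esub> y"
      by (simp add: scale_add)
    show "(c \<odot>\<^bsub>?M\<^esub> x) \<otimes>\<^bsub>?M\<^esub> y = c \<odot>\<^bsub>?M\<^esub> (x \<otimes>\<^bsub>?M\<^esub> y)"
      "x \<otimes>\<^bsub>?M\<^esub> (c \<odot>\<^bsub>?M\<^esub> y) = c \<odot>\<^bsub>?M\<^esub> (x \<otimes>\<^bsub>?M\<^esub> y)"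
      using x y by (simp_all add: monoid_algebra_smult_mult)
  qed
qed

end

text \<open>\<open>quotient_algebra\<close> copies the ring fields of \<open>A Quot I\<close> into
  another record type; the ring laws have to be carried across.\<close>

lemma ring_cong:
  assumes "ring R" "carrier S = carrier R" "monoid.mult S = monoid.mult R" "one S = one R" "zero S = zero R"
    "add S = add R"
  shows "ring S"
proof -
  interpret R: ring R by fact
  have "abelian_group S"
    by (rule abelian_groupI) (use assms in \<open>auto simp: R.a_ac intro: R.l_neg\<close>)
  moreover have "Group.monoid S"
    by (rule Group.monoidI) (use assms in \<open>auto simp: R.m_assoc\<close>)
  ultimately show ?thesis
    by (rule ringI) (use assms in \<open>auto simp: R.l_distr R.r_distr\<close>)
qed

context k_algebra
begin

lemma ring_opposite_algebra: "ring (opposite_algebra A)"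
proof -
  have "abelian_group (opposite_algebra A)"
    by (rule abelian_groupI) (auto simp: opposite_algebra_def a_ac intro: l_neg)
  moreover have "Group.monoid (opposite_algebra A)"
    by (rule Group.monoidI) (auto simp: opposite_algebra_def m_assoc)
  ultimately show ?thesis
    by (rule ringI) (auto simp: opposite_algebra_def l_distr r_distr)
qed

lemma k_algebra_opposite_algebra: "k_algebra (opposite_algebra A)"
  using ring_opposite_algebra unfolding k_algebra_def k_algebra_axioms_def
  by (auto simp: opposite_algebra_def smult_l_distr smult_r_distr smult_smult smult_mult_left
      smult_mult_right)

lemma smult_eq_mult: "x \<in> carrier A \<Longrightarrow> c \<odot> x = (c \<odot> \<one>) \<otimes> x"
  by (simp add: smult_mult_left)

lemma smult_zero_right [simp]: "c \<odot> \<zero> = \<zero>"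
  using smult_mult_left[of \<zero> \<zero> c] by simp

lemma smult_zero_left [simp]: "x \<in> carrier A \<Longrightarrow> 0 \<odot> x = \<zero>"
  using smult_l_distr[of x 0 0] by simp

lemma smult_minus_right: "x \<in> carrier A \<Longrightarrow> c \<odot> (\<ominus> x) = \<ominus> (c \<odot> x)"
  using smult_r_distr[of "\<ominus> x" x c] by (simp add: minus_equality l_neg)

end

section \<open>Quotients by two-sided ideals\<close>

locale algebra_ideal = k_algebra A + ideal I A for A :: "('k::field, 'a) module" (structure) and I
begin

text \<open>A scalar multiple is a product with \<open>c \<odot> \<one>\<close>, so a ring ideal is
  automatically a subspace.\<close>

lemma I_smult_closed: "x \<in> I \<Longrightarrow> c \<odot> x \<in> I"
  using I_l_closed[of x "c \<odot> \<one>"] smult_eq_mult[of x c] a_Hcarr[of x] by simp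

abbreviation "Q \<equiv> quotient_algebra A I"

abbreviation "cls x \<equiv> I +> x"

lemma quotient_algebra_fields:
  "carrier Q = carrier (A Quot I)" "monoid.mult Q = monoid.mult (A Quot I)" "one Q = one (A Quot I)"
  "zero Q = zero (A Quot I)" "add Q = add (A Quot I)"
  by (simp_all add: quotient_algebra_def)

lemma ring_quotient_algebra: "ring Q"
  by (rule ring_cong[OF quotient_is_ring]) (simp_all add: quotient_algebra_fields)

lemma carrier_Q: "carrier Q = cls ` carrier A"
  by (auto simp: quotient_algebra_fields FactRing_def A_RCOSETS_def' a_r_coset_def)

lemma cls_closed: "x \<in> carrier A \<Longrightarrow> cls x \<in> carrier Q"
  by (simp add: carrier_Q)

lemma cls_mult: "x \<in> carrier A \<Longrightarrow> y \<in> carrier A \<Longrightarrow> cls x \<otimes>\<^bsub>Q\<^esub> cls y = cls (x \<otimes> y)"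
  by (simp add: quotient_algebra_fields FactRing_def rcoset_mult_add)

lemma cls_add: "x \<in> carrier A \<Longrightarrow> y \<in> carrier A \<Longrightarrow> cls x \<oplus>\<^bsub>Q\<^esub> cls y = cls (x \<oplus> y)"
  by (simp add: quotient_algebra_fields FactRing_def a_rcos_sum)

lemma cls_one: "\<one>\<^bsub>Q\<^esub> = cls \<one>"
  by (simp add: quotient_algebra_fields FactRing_def)

lemma cls_zero: "\<zero>\<^bsub>Q\<^esub> = cls \<zero>"
  by (simp add: quotient_algebra_fields FactRing_def a_coset_add_zero a_subset)

lemma cls_eq_iff: "x \<in> carrier A \<Longrightarrow> y \<in> carrier A \<Longrightarrow> cls x = cls y \<longleftrightarrow> x \<ominus> y \<in> I"
  using quotient_eq_iff_same_a_r_cos[OF ideal_axioms] by blast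

lemma cls_eqI: "x \<in> carrier A \<Longrightarrow> y \<in> carrier A \<Longrightarrow> x \<ominus> y \<in> I \<Longrightarrow> cls x = cls y"
  by (simp add: cls_eq_iff)

lemma mem_cls: "x \<in> carrier A \<Longrightarrow> y \<in> cls x \<longleftrightarrow> y \<in> carrier A \<and> cls y = cls x"
  using a_elemrcos_carrier a_rcos_self a_repr_independence a_subgroup by blast

text \<open>The union over representatives in \<open>quotient_algebra\<close> collapses, because all
  of them yield the same coset.\<close>

lemma cls_smult:
  assumes x: "x \<in> carrier A"
  shows "c \<odot>\<^bsub>Q\<^esub> cls x = cls (c \<odot> x)"
proof -
  have eq: "cls (c \<odot> y) = cls (c \<odot> x)" if "y \<in> cls x" for y
  proof -
    have y: "y \<in> carrier A" "cls y = cls x" using that x by (simp_all add: mem_cls)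
    then have "y \<ominus> x \<in> I" using x cls_eq_iff by blast
    then have "c \<odot> (y \<ominus> x) \<in> I" by (rule I_smult_closed)
    also have "c \<odot> (y \<ominus> x) = c \<odot> y \<ominus> c \<odot> x"
      using x y by (simp add: a_minus_def smult_r_distr smult_minus_right)
    finally show ?thesis using x y by (intro cls_eqI) auto
  qed
  have "x \<in> cls x" using x a_rcos_self by blast
  then have "(\<Union>y\<in>cls x. cls (c \<odot> y)) = cls (c \<odot> x)" using eq by blast
  then show ?thesis by (simp add: quotient_algebra_def)
qed

lemma k_algebra_quotient: "k_algebra Q"
  using ring_quotient_algebra unfolding k_algebra_def k_algebra_axioms_def carrier_Q
  by (auto simp: cls_smult cls_add cls_mult smult_l_distr smult_r_distr smult_smult smult_mult_left
      smult_mult_right)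

end

lemma monoid_algebra_mult_diff_left:
  "(f - g) \<otimes>\<^bsub>monoid_algebra G\<^esub> h = f \<otimes>\<^bsub>monoid_algebra G\<^esub> h - g \<otimes>\<^bsub>monoid_algebra G\<^esub> h"
  using monoid_algebra_mult_add_left[of G "f - g" g h] by simp

lemma monoid_algebra_mult_diff_right:
  "h \<otimes>\<^bsub>monoid_algebra G\<^esub> (f - g) = h \<otimes>\<^bsub>monoid_algebra G\<^esub> f - h \<otimes>\<^bsub>monoid_algebra G\<^esub> g"
  using monoid_algebra_mult_add_right[of G h "f - g" g] by simp

section \<open>Tensor products of algebras\<close>

locale tensor = A: k_algebra A + B: k_algebra B
  for A :: "('k::field, 'a) module" and B :: "('k, 'b) module"
begin

definition "P = (monoid_algebra (A \<times>\<times> B) :: ('k, 'a \<times> 'b \<Rightarrow>\<^sub>0 'k) module)"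

abbreviation "T \<equiv> tensor_ideal A B"
abbreviation "E \<equiv> tensor_product A B"
abbreviation "t \<equiv> pure_tensor A B"

lemma monoid_DirProd: "Group.monoid (A \<times>\<times> B)"
  using A.monoid_axioms B.monoid_axioms by (rule DirProd_monoid)

lemma carrier_P: "carrier P = {f. Poly_Mapping.keys f \<subseteq> carrier A \<times> carrier B}"
  by (simp add: P_def)

lemma P_simps [simp]:
  "\<zero>\<^bsub>P\<^esub> = 0" "f \<oplus>\<^bsub>P\<^esub> g = f + g" "c \<odot>\<^bsub>P\<^esub> f = scale c f"
  "\<one>\<^bsub>P\<^esub> = Poly_Mapping.single (\<one>\<^bsub>A\<^esub>, \<one>\<^bsub>B\<^esub>) 1"
  by (simp_all add: P_def)

lemma P_mult_single: "Poly_Mapping.single (a, b) c \<otimes>\<^bsub>P\<^esub> Poly_Mapping.single (a', b') c' =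
    Poly_Mapping.single (a \<otimes>\<^bsub>A\<^esub> a', b \<otimes>\<^bsub>B\<^esub> b') (c * c')"
  by (simp add: P_def monoid_algebra_mult_single)

lemma P_mult_diff:
  "(f - g) \<otimes>\<^bsub>P\<^esub> h = f \<otimes>\<^bsub>P\<^esub> h - g \<otimes>\<^bsub>P\<^esub> h"
  "h \<otimes>\<^bsub>P\<^esub> (f - g) = h \<otimes>\<^bsub>P\<^esub> f - h \<otimes>\<^bsub>P\<^esub> g"
  by (simp_all add: P_def monoid_algebra_mult_diff_left monoid_algebra_mult_diff_right)

lemma single_in_P [simp]:
  "a \<in> carrier A \<Longrightarrow> b \<in> carrier B \<Longrightarrow> Poly_Mapping.single (a, b) c \<in> carrier P"
  by (simp add: carrier_P)

lemma P_diff_closed: "f \<in> carrier P \<Longrightarrow> g \<in> carrier P \<Longrightarrow> f - g \<in> carrier P"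
  by (simp add: carrier_P keys_diff_subset)

lemma k_algebra_P: "k_algebra P"
  unfolding P_def by (rule monoid.k_algebra_monoid_algebra[OF monoid_DirProd])

lemma tensor_relations_closed: "tensor_relations A B \<subseteq> carrier P"
  unfolding tensor_relations_def by (auto intro!: P_diff_closed)

lemma algebra_ideal_T: "algebra_ideal P T"
proof -
  interpret P: k_algebra P by (rule k_algebra_P)
  have "ideal T P"
    unfolding tensor_ideal_def P_def[symmetric] by (rule P.genideal_ideal[OF tensor_relations_closed])
  then show ?thesis by (intro algebra_ideal.intro k_algebra_P)
qed

sublocale P: algebra_ideal P T by (rule algebra_ideal_T)

lemma E_eq: "E = quotient_algebra P T"
  by (simp add: tensor_product_def P_def)

lemma t_eq: "t a b = T +>\<^bsub>P\<^esub> Poly_Mapping.single (a, b) 1"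
  by (simp add: pure_tensor_def P_def)

sublocale E: k_algebra E
  unfolding E_eq by (rule P.k_algebra_quotient)

lemma P_minus: "f \<in> carrier P \<Longrightarrow> \<ominus>\<^bsub>P\<^esub> f = - f"
  by (rule P.minus_equality) (auto simp: carrier_P)

lemma P_a_minus: "f \<in> carrier P \<Longrightarrow> g \<in> carrier P \<Longrightarrow> f \<ominus>\<^bsub>P\<^esub> g = f - g"
  by (simp add: a_minus_def P_minus)

lemma relation_in_T: "x \<in> tensor_relations A B \<Longrightarrow> x \<in> T"
  unfolding tensor_ideal_def P_def[symmetric]
  using P.genideal_self[OF tensor_relations_closed] by blast

lemma tensor_relations_intros:
  "a \<in> carrier A \<Longrightarrow> a' \<in> carrier A \<Longrightarrow> b \<in> carrier B \<Longrightarrow>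
    Poly_Mapping.single (a \<oplus>\<^bsub>A\<^esub> a', b) 1 - Poly_Mapping.single (a, b) 1
      - Poly_Mapping.single (a', b) 1 \<in> tensor_relations A B"
  "a \<in> carrier A \<Longrightarrow> b \<in> carrier B \<Longrightarrow> b' \<in> carrier B \<Longrightarrow>
    Poly_Mapping.single (a, b \<oplus>\<^bsub>B\<^esub> b') 1 - Poly_Mapping.single (a, b) 1
      - Poly_Mapping.single (a, b') 1 \<in> tensor_relations A B"
  "a \<in> carrier A \<Longrightarrow> b \<in> carrier B \<Longrightarrow>
    Poly_Mapping.single (c \<odot>\<^bsub>A\<^esub> a, b) 1 - Poly_Mapping.single (a, b) c \<in> tensor_relations A B"
  "a \<in> carrier A \<Longrightarrow> b \<in> carrier B \<Longrightarrow>
    Poly_Mapping.single (a, c \<odot>\<^bsub>B\<^esub> b) 1 - Poly_Mapping.single (a, b) c \<in> tensor_relations A B"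
  unfolding tensor_relations_def by blast+

lemma t_closed [simp, intro]: "a \<in> carrier A \<Longrightarrow> b \<in> carrier B \<Longrightarrow> t a b \<in> carrier E"
  by (simp add: t_eq E_eq P.cls_closed)

lemma t_mult:
  "a \<in> carrier A \<Longrightarrow> b \<in> carrier B \<Longrightarrow> a' \<in> carrier A \<Longrightarrow> b' \<in> carrier B \<Longrightarrow>
    t a b \<otimes>\<^bsub>E\<^esub> t a' b' = t (a \<otimes>\<^bsub>A\<^esub> a') (b \<otimes>\<^bsub>B\<^esub> b')"
  by (simp add: t_eq E_eq P.cls_mult P_mult_single)

lemma t_one: "\<one>\<^bsub>E\<^esub> = t \<one>\<^bsub>A\<^esub> \<one>\<^bsub>B\<^esub>"
  by (simp add: t_eq E_eq P.cls_one)

lemma t_add_left: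
  assumes "a \<in> carrier A" "a' \<in> carrier A" "b \<in> carrier B"
  shows "t (a \<oplus>\<^bsub>A\<^esub> a') b = t a b \<oplus>\<^bsub>E\<^esub> t a' b"
proof -
  have "Poly_Mapping.single (a \<oplus>\<^bsub>A\<^esub> a', b) 1 \<ominus>\<^bsub>P\<^esub>
      (Poly_Mapping.single (a, b) 1 \<oplus>\<^bsub>P\<^esub> Poly_Mapping.single (a', b) 1) \<in> T"
    using assms P.add.m_closed[of "Poly_Mapping.single (a, b) 1" "Poly_Mapping.single (a', b) 1"]
    by (subst P_a_minus)
      (auto simp: diff_diff_eq[symmetric] intro!: relation_in_T tensor_relations_intros)
  then show ?thesis
    using assms P.add.m_closed[of "Poly_Mapping.single (a, b) 1" "Poly_Mapping.single (a', b) 1"]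
    by (subst t_eq)+ (simp add: E_eq P.cls_add P.cls_eqI)
qed

lemma t_add_right:
  assumes "a \<in> carrier A" "b \<in> carrier B" "b' \<in> carrier B"
  shows "t a (b \<oplus>\<^bsub>B\<^esub> b') = t a b \<oplus>\<^bsub>E\<^esub> t a b'"
proof -
  have "Poly_Mapping.single (a, b \<oplus>\<^bsub>B\<^esub> b') 1 \<ominus>\<^bsub>P\<^esub>
      (Poly_Mapping.single (a, b) 1 \<oplus>\<^bsub>P\<^esub> Poly_Mapping.single (a, b') 1) \<in> T"
    using assms P.add.m_closed[of "Poly_Mapping.single (a, b) 1" "Poly_Mapping.single (a, b') 1"]
    by (subst P_a_minus)
      (auto simp: diff_diff_eq[symmetric] intro!: relation_in_T tensor_relations_intros)
  then show ?thesis
    using assms P.add.m_closed[of "Poly_Mapping.single (a, b) 1" "Poly_Mapping.single (a, b') 1"]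
    by (subst t_eq)+ (simp add: E_eq P.cls_add P.cls_eqI)
qed

lemma cls_single:
  assumes "a \<in> carrier A" "b \<in> carrier B"
  shows "T +>\<^bsub>P\<^esub> Poly_Mapping.single (a, b) c = t (c \<odot>\<^bsub>A\<^esub> a) b"
    and "T +>\<^bsub>P\<^esub> Poly_Mapping.single (a, b) c = t a (c \<odot>\<^bsub>B\<^esub> b)"
proof -
  have "Poly_Mapping.single (c \<odot>\<^bsub>A\<^esub> a, b) 1 \<ominus>\<^bsub>P\<^esub> Poly_Mapping.single (a, b) c \<in> T"
    using assms by (subst P_a_minus) (auto intro!: relation_in_T tensor_relations_intros)
  then show "T +>\<^bsub>P\<^esub> Poly_Mapping.single (a, b) c = t (c \<odot>\<^bsub>A\<^esub> a) b"
    using assms by (subst eq_commute) (simp add: t_eq P.cls_eqI)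
  have "Poly_Mapping.single (a, c \<odot>\<^bsub>B\<^esub> b) 1 \<ominus>\<^bsub>P\<^esub> Poly_Mapping.single (a, b) c \<in> T"
    using assms by (subst P_a_minus) (auto intro!: relation_in_T tensor_relations_intros)
  then show "T +>\<^bsub>P\<^esub> Poly_Mapping.single (a, b) c = t a (c \<odot>\<^bsub>B\<^esub> b)"
    using assms by (subst eq_commute) (simp add: t_eq P.cls_eqI)
qed

lemma t_smult:
  assumes "a \<in> carrier A" "b \<in> carrier B"
  shows "t (c \<odot>\<^bsub>A\<^esub> a) b = c \<odot>\<^bsub>E\<^esub> t a b" and "t a (c \<odot>\<^bsub>B\<^esub> b) = c \<odot>\<^bsub>E\<^esub> t a b"
  using assms cls_single[OF assms, of c] by (simp_all add: t_eq E_eq P.cls_smult)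

text \<open>The coefficients of a representative can be absorbed into the first factor by
  \<open>cls_single\<close>, so sums of pure tensors without scalars reach every element.\<close>

lemma tensor_induct [consumes 1, case_names tensor add]:
  assumes X: "X \<in> carrier E"
    and tensor: "\<And>a b. a \<in> carrier A \<Longrightarrow> b \<in> carrier B \<Longrightarrow> R (t a b)"
    and add: "\<And>X Y. X \<in> carrier E \<Longrightarrow> Y \<in> carrier E \<Longrightarrow> R X \<Longrightarrow> R Y \<Longrightarrow> R (X \<oplus>\<^bsub>E\<^esub> Y)"
  shows "R X"
proof -
  obtain f where f: "f \<in> carrier P" "X = T +>\<^bsub>P\<^esub> f"
    using X by (auto simp: E_eq P.carrier_Q)
  from f(1) have "Poly_Mapping.keys f \<subseteq> carrier A \<times> carrier B" by (simp add: carrier_P)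
  then have "R (T +>\<^bsub>P\<^esub> f)"
  proof (induction f rule: poly_mapping_keys_induct)
    case zero
    have "T +>\<^bsub>P\<^esub> Poly_Mapping.single (\<one>\<^bsub>A\<^esub>, \<one>\<^bsub>B\<^esub>) 0 = t (0 \<odot>\<^bsub>A\<^esub> \<one>\<^bsub>A\<^esub>) \<one>\<^bsub>B\<^esub>"
      by (rule cls_single) auto
    then show ?case using tensor[of "0 \<odot>\<^bsub>A\<^esub> \<one>\<^bsub>A\<^esub>" "\<one>\<^bsub>B\<^esub>"] by simp
  next
    case (single x c)
    then show ?case by (cases x) (auto simp: cls_single intro!: tensor)
  next
    case (add f g)
    then have "T +>\<^bsub>P\<^esub> (f + g) = (T +>\<^bsub>P\<^esub> f) \<oplus>\<^bsub>E\<^esub> (T +>\<^bsub>P\<^esub> g)"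
      using P.cls_add[of f g] by (simp add: E_eq carrier_P)
    with add assms(3)[of "T +>\<^bsub>P\<^esub> f" "T +>\<^bsub>P\<^esub> g"] show ?case
      by (simp add: E_eq carrier_P P.cls_closed)
  qed
  with f(2) show ?thesis by simp
qed

end

text \<open>The target is a mere abelian group, so compatibility with scalars is expressed by moving
  them from one argument to the other. This covers both the action on a bimodule and the later
  coordinate map.\<close>

locale balanced_map = tensor A B + G: abelian_group G
  for A :: "('k::field, 'a) module" and B :: "('k, 'b) module" and G :: "('g, 'z) ring_scheme" +
  fixes h :: "'a \<Rightarrow> 'b \<Rightarrow> 'g"
  assumes h_closed [simp, intro]: "a \<in> carrier A \<Longrightarrow> b \<in> carrier B \<Longrightarrow> h a b \<in> carrier G"
    and h_add_left: "a \<in> carrier A \<Longrightarrow> a' \<in> carrier A \<Longrightarrow> b \<in> carrier B \<Longrightarrow>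
      h (a \<oplus>\<^bsub>A\<^esub> a') b = h a b \<oplus>\<^bsub>G\<^esub> h a' b"
    and h_add_right: "a \<in> carrier A \<Longrightarrow> b \<in> carrier B \<Longrightarrow> b' \<in> carrier B \<Longrightarrow>
      h a (b \<oplus>\<^bsub>B\<^esub> b') = h a b \<oplus>\<^bsub>G\<^esub> h a b'"
    and h_balanced: "a \<in> carrier A \<Longrightarrow> b \<in> carrier B \<Longrightarrow> h (c \<odot>\<^bsub>A\<^esub> a) b = h a (c \<odot>\<^bsub>B\<^esub> b)"
begin

text \<open>The scalar is folded into the first argument exactly as in the action of
  \<open>env_module\<close>; with \<open>lift\<close> defined by \<open>the_elem\<close>, that
  action is an instance of \<open>lift\<close> by unfolding.\<close>

definition "L f = (\<Oplus>\<^bsub>G\<^esub>p\<in>Poly_Mapping.keys f. h (Poly_Mapping.lookup f p \<odot>\<^bsub>A\<^esub> fst p) (snd p))"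

definition "lift X = the_elem (L ` X)"

lemma h_zero [simp]: "b \<in> carrier B \<Longrightarrow> h \<zero>\<^bsub>A\<^esub> b = \<zero>\<^bsub>G\<^esub>"
  using h_add_left[of "\<zero>\<^bsub>A\<^esub>" "\<zero>\<^bsub>A\<^esub>" b] by simp

lemma L_superset:
  assumes "finite S" "Poly_Mapping.keys f \<subseteq> S" "S \<subseteq> carrier A \<times> carrier B"
  shows "L f = (\<Oplus>\<^bsub>G\<^esub>p\<in>S. h (Poly_Mapping.lookup f p \<odot>\<^bsub>A\<^esub> fst p) (snd p))"
  unfolding L_def
  by (rule G.add.finprod_mono_neutral_cong_left) (use assms in \<open>auto simp: in_keys_iff\<close>)

lemma L_closed: "f \<in> carrier P \<Longrightarrow> L f \<in> carrier G"
  unfolding L_def by (rule G.finsum_closed) (auto simp: carrier_P)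

lemma L_add:
  assumes "f \<in> carrier P" "g \<in> carrier P"
  shows "L (f + g) = L f \<oplus>\<^bsub>G\<^esub> L g"
proof -
  let ?S = "Poly_Mapping.keys f \<union> Poly_Mapping.keys g"
  have S: "finite ?S" "?S \<subseteq> carrier A \<times> carrier B" "Poly_Mapping.keys (f + g) \<subseteq> ?S"
    using assms keys_add[of f g] by (auto simp: carrier_P)
  have "L (f + g) = (\<Oplus>\<^bsub>G\<^esub>p\<in>?S. h (Poly_Mapping.lookup f p \<odot>\<^bsub>A\<^esub> fst p) (snd p) \<oplus>\<^bsub>G\<^esub>
      h (Poly_Mapping.lookup g p \<odot>\<^bsub>A\<^esub> fst p) (snd p))"
    using S by (subst L_superset[of ?S])
      (auto simp: lookup_add A.smult_l_distr h_add_left intro!: G.add.finprod_cong')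
  also have "\<dots> = L f \<oplus>\<^bsub>G\<^esub> L g"
    using S by (subst G.finsum_addf) (auto simp: L_superset[of ?S])
  finally show ?thesis .
qed

lemma L_zero [simp]: "L 0 = \<zero>\<^bsub>G\<^esub>"
  by (simp add: L_def)

lemma L_single:
  assumes "a \<in> carrier A" "b \<in> carrier B"
  shows "L (Poly_Mapping.single (a, b) c) = h (c \<odot>\<^bsub>A\<^esub> a) b"
  using assms by (subst L_superset[of "{(a, b)}"]) auto

lemma L_diff:
  assumes "f \<in> carrier P" "g \<in> carrier P"
  shows "L (f - g) = L f \<ominus>\<^bsub>G\<^esub> L g"
proof -
  have "L (f - g + g) = L (f - g) \<oplus>\<^bsub>G\<^esub> L g"
    using assms by (intro L_add P_diff_closed)
  then show ?thesis
    using assms by (simp add: L_closed P_diff_closed a_minus_def G.add.m_assoc G.r_neg)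
qed

lemma sum_cancel:
  assumes "x \<in> carrier G" "y \<in> carrier G"
  shows "x \<oplus>\<^bsub>G\<^esub> (y \<oplus>\<^bsub>G\<^esub> (\<ominus>\<^bsub>G\<^esub> x \<oplus>\<^bsub>G\<^esub> \<ominus>\<^bsub>G\<^esub> y)) = \<zero>\<^bsub>G\<^esub>"
proof -
  have "x \<oplus>\<^bsub>G\<^esub> (y \<oplus>\<^bsub>G\<^esub> (\<ominus>\<^bsub>G\<^esub> x \<oplus>\<^bsub>G\<^esub> \<ominus>\<^bsub>G\<^esub> y)) = (x \<oplus>\<^bsub>G\<^esub> y) \<oplus>\<^bsub>G\<^esub> \<ominus>\<^bsub>G\<^esub> (x \<oplus>\<^bsub>G\<^esub> y)"
    using assms by (simp add: G.minus_add G.add.m_assoc)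
  then show ?thesis using assms by (simp add: G.r_neg)
qed

text \<open>\<open>L\<close> is not multiplicative, so the relations are tested between arbitrary
  factors on both sides. By additivity these factors may be basis elements, where bilinearity and
  balancedness of \<open>h\<close> give the cancellation.\<close>

lemma L_relation:
  assumes r: "r \<in> tensor_relations A B" and y: "y \<in> carrier P" and z: "z \<in> carrier P"
  shows "L (y \<otimes>\<^bsub>P\<^esub> r \<otimes>\<^bsub>P\<^esub> z) = \<zero>\<^bsub>G\<^esub>"
proof -
  have rP: "r \<in> carrier P" using r tensor_relations_closed by blast
  have pure: "L (Poly_Mapping.single (a, b) c \<otimes>\<^bsub>P\<^esub> r \<otimes>\<^bsub>P\<^esub> Poly_Mapping.single (a', b') c') = \<zero>\<^bsub>G\<^esub>"
    if "a \<in> carrier A" "b \<in> carrier B" "a' \<in> carrier A" "b' \<in> carrier B" for a b c a' b' c'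
    using r that unfolding tensor_relations_def
    by (auto simp: P_mult_diff P_mult_single L_diff L_single
        P_diff_closed A.r_distr A.l_distr B.r_distr B.l_distr A.smult_r_distr h_add_left h_add_right
        A.smult_mult_left A.smult_mult_right B.smult_mult_left B.smult_mult_right A.smult_smult[symmetric]
        h_balanced[symmetric] a_minus_def G.minus_add G.r_neg G.a_ac sum_cancel mult_ac)
  from y have "Poly_Mapping.keys y \<subseteq> carrier A \<times> carrier B" by (simp add: carrier_P)
  then show ?thesis
  proof (induction y rule: poly_mapping_keys_induct)
    case zero
    show ?case using rP z by (simp add: P.l_null[simplified])
  next
    case (single x c)
    obtain a b where x: "x = (a, b)" "a \<in> carrier A" "b \<in> carrier B" using single by auto
    from z have "Poly_Mapping.keys z \<subseteq> carrier A \<times> carrier B" by (simp add: carrier_P)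
    then show ?case
    proof (induction z rule: poly_mapping_keys_induct)
      case zero
      show ?case using rP x P.r_null[of "Poly_Mapping.single x c \<otimes>\<^bsub>P\<^esub> r"] by simp
    next
      case (single x' c')
      then show ?case using x pure by auto
    next
      case (add f g)
      have fg: "f \<in> carrier P" "g \<in> carrier P" using add by (simp_all add: carrier_P)
      have "Poly_Mapping.single x c \<otimes>\<^bsub>P\<^esub> r \<in> carrier P" using x rP by simp
      then show ?case
        using add.IH fg P.r_distr[of f g "Poly_Mapping.single x c \<otimes>\<^bsub>P\<^esub> r"] by (simp add: L_add)
    qed
  next
    case (add f g)
    have fg: "f \<in> carrier P" "g \<in> carrier P" using add by (simp_all add: carrier_P)
    then show ?case
      using add.IH rP z P.l_distr[of f g r] P.l_distr[of "f \<otimes>\<^bsub>P\<^esub> r" "g \<otimes>\<^bsub>P\<^esub> r" z]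
      by (simp add: L_add)
  qed
qed


text \<open>The kernel of \<open>L\<close> is not known to be an ideal. \<open>?N\<close> is the
  largest two-sided ideal inside it and contains the relations by \<open>L_relation\<close>, hence
  the ideal generated by them; the factors 1 then give the claim.\<close>

lemma L_ideal:
  assumes "f \<in> T"
  shows "L f = \<zero>\<^bsub>G\<^esub>"
proof -
  let ?N = "{x \<in> carrier P. \<forall>y\<in>carrier P. \<forall>z\<in>carrier P. L (y \<otimes>\<^bsub>P\<^esub> x \<otimes>\<^bsub>P\<^esub> z) = \<zero>\<^bsub>G\<^esub>}"
  have add: "L (y \<otimes>\<^bsub>P\<^esub> (x + x') \<otimes>\<^bsub>P\<^esub> z) = L (y \<otimes>\<^bsub>P\<^esub> x \<otimes>\<^bsub>P\<^esub> z) \<oplus>\<^bsub>G\<^esub> L (y \<otimes>\<^bsub>P\<^esub> x' \<otimes>\<^bsub>P\<^esub> z)"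
    if "x \<in> carrier P" "x' \<in> carrier P" "y \<in> carrier P" "z \<in> carrier P" for x x' y z
    using that P.r_distr[of x x' y] P.l_distr[of "y \<otimes>\<^bsub>P\<^esub> x" "y \<otimes>\<^bsub>P\<^esub> x'" z] by (simp add: L_add)
  have "ideal ?N P"
  proof (rule idealI)
    show "ring P" by (rule P.ring_axioms)
    show "subgroup ?N (add_monoid P)"
    proof (rule subgroup.intro)
      show "?N \<subseteq> carrier (add_monoid P)" by auto
      show "\<one>\<^bsub>add_monoid P\<^esub> \<in> ?N" using P.zero_closed P.r_null P.l_null by simp
    next
      fix x x' assume x: "x \<in> ?N" and x': "x' \<in> ?N"
      have "x + x' \<in> carrier P" using x x' P.add.m_closed[of x x'] by simp
      then show "x \<otimes>\<^bsub>add_monoid P\<^esub> x' \<in> ?N" using x x' by (simp add: add)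
    next
      fix x assume x: "x \<in> ?N"
      have m: "- x \<in> carrier P" using x P.add.inv_closed[of x] P_minus[of x]
        by (simp add: a_inv_def)
      have "L (y \<otimes>\<^bsub>P\<^esub> (- x) \<otimes>\<^bsub>P\<^esub> z) = \<zero>\<^bsub>G\<^esub>" if yz: "y \<in> carrier P" "z \<in> carrier P" for y z
        using add[of x "- x" y z] x m yz P.r_null[of y] P.l_null[of z]
        by (simp add: L_closed)
      then show "inv\<^bsub>add_monoid P\<^esub> x \<in> ?N"
        using x m P_minus[of x] by (simp add: a_inv_def)
    qed
    fix a x assume a: "a \<in> ?N" and x: "x \<in> carrier P"
    show "x \<otimes>\<^bsub>P\<^esub> a \<in> ?N" using a x by (auto simp: P.m_assoc[symmetric])
    show "a \<otimes>\<^bsub>P\<^esub> x \<in> ?N"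
    proof -
      have "y \<otimes>\<^bsub>P\<^esub> (a \<otimes>\<^bsub>P\<^esub> x) \<otimes>\<^bsub>P\<^esub> z = y \<otimes>\<^bsub>P\<^esub> a \<otimes>\<^bsub>P\<^esub> (x \<otimes>\<^bsub>P\<^esub> z)"
        if "y \<in> carrier P" "z \<in> carrier P" for y z
        using that a x by (simp add: P.m_assoc)
      then show ?thesis using a x by simp
    qed
  qed
  moreover have "tensor_relations A B \<subseteq> ?N"
    using L_relation tensor_relations_closed by blast
  ultimately have "T \<subseteq> ?N"
    unfolding tensor_ideal_def P_def[symmetric] by (rule P.genideal_minimal)
  with assms have "L (\<one>\<^bsub>P\<^esub> \<otimes>\<^bsub>P\<^esub> f \<otimes>\<^bsub>P\<^esub> \<one>\<^bsub>P\<^esub>) = \<zero>\<^bsub>G\<^esub>" "f \<in> carrier P" using P.one_closed by blast+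
  then show ?thesis using P.l_one P.r_one by (simp del: P_simps)
qed

lemma lift_cls:
  assumes f: "f \<in> carrier P"
  shows "lift (T +>\<^bsub>P\<^esub> f) = L f"
proof -
  have "L g = L f" if "g \<in> T +>\<^bsub>P\<^esub> f" for g
  proof -
    have g: "g \<in> carrier P" "g \<ominus>\<^bsub>P\<^esub> f \<in> T" using that f P.mem_cls[OF f, of g] P.cls_eq_iff[of g f] by simp_all
    have "L (g - f + f) = L (g - f) \<oplus>\<^bsub>G\<^esub> L f" using f g by (intro L_add P_diff_closed)
    then show ?thesis using f g L_ideal[of "g - f"] by (simp add: P_a_minus L_closed)
  qed
  then have "L ` (T +>\<^bsub>P\<^esub> f) = {L f}" using P.a_rcos_self[OF f] by blast
  then show ?thesis by (simp add: lift_def)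
qed

lemma lift_tensor: "a \<in> carrier A \<Longrightarrow> b \<in> carrier B \<Longrightarrow> lift (t a b) = h a b"
  by (simp add: t_eq lift_cls L_single)

lemma lift_add:
  assumes "X \<in> carrier E" "Y \<in> carrier E"
  shows "lift (X \<oplus>\<^bsub>E\<^esub> Y) = lift X \<oplus>\<^bsub>G\<^esub> lift Y"
proof -
  obtain f g where "f \<in> carrier P" "X = T +>\<^bsub>P\<^esub> f" "g \<in> carrier P" "Y = T +>\<^bsub>P\<^esub> g"
    using assms by (auto simp: E_eq P.carrier_Q)
  then show ?thesis
    using P.cls_add[of f g] P.add.m_closed[of f g] by (simp add: E_eq lift_cls L_add)
qed

lemma lift_closed: "X \<in> carrier E \<Longrightarrow> lift X \<in> carrier G"
  by (auto simp: E_eq P.carrier_Q lift_cls L_closed)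

end

section \<open>Left modules and bimodules\<close>

locale lmodule = R: ring R + M: abelian_group M
  for R :: "('r, 'x) ring_scheme" (structure) and M :: "('r, 'm) module" +
  assumes smult_closed [simp, intro]: "r \<in> carrier R \<Longrightarrow> x \<in> carrier M \<Longrightarrow> r \<odot>\<^bsub>M\<^esub> x \<in> carrier M"
    and smult_l_distr: "r \<in> carrier R \<Longrightarrow> s \<in> carrier R \<Longrightarrow> x \<in> carrier M \<Longrightarrow>
      (r \<oplus> s) \<odot>\<^bsub>M\<^esub> x = r \<odot>\<^bsub>M\<^esub> x \<oplus>\<^bsub>M\<^esub> s \<odot>\<^bsub>M\<^esub> x"
    and smult_r_distr: "r \<in> carrier R \<Longrightarrow> x \<in> carrier M \<Longrightarrow> y \<in> carrier M \<Longrightarrow>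
      r \<odot>\<^bsub>M\<^esub> (x \<oplus>\<^bsub>M\<^esub> y) = r \<odot>\<^bsub>M\<^esub> x \<oplus>\<^bsub>M\<^esub> r \<odot>\<^bsub>M\<^esub> y"
    and smult_assoc: "r \<in> carrier R \<Longrightarrow> s \<in> carrier R \<Longrightarrow> x \<in> carrier M \<Longrightarrow>
      (r \<otimes> s) \<odot>\<^bsub>M\<^esub> x = r \<odot>\<^bsub>M\<^esub> (s \<odot>\<^bsub>M\<^esub> x)"
    and smult_one [simp]: "x \<in> carrier M \<Longrightarrow> \<one> \<odot>\<^bsub>M\<^esub> x = x"

text \<open>The record \<open>bimodule\<close> carries no scalar action. That the field acts in the
  same way from both sides is therefore expressed by \<open>lact_smult\<close>.\<close>

locale bimodule_over = k_algebra A + M: abelian_group M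
  for A :: "('k::field, 'a) module" (structure) and M :: "('a, 'm) bimodule" +
  assumes lact_closed [simp, intro]: "a \<in> carrier A \<Longrightarrow> x \<in> carrier M \<Longrightarrow> lact M a x \<in> carrier M"
    and ract_closed [simp, intro]: "a \<in> carrier A \<Longrightarrow> x \<in> carrier M \<Longrightarrow> ract M x a \<in> carrier M"
    and lact_l_distr: "a \<in> carrier A \<Longrightarrow> b \<in> carrier A \<Longrightarrow> x \<in> carrier M \<Longrightarrow>
      lact M (a \<oplus> b) x = lact M a x \<oplus>\<^bsub>M\<^esub> lact M b x"
    and lact_r_distr: "a \<in> carrier A \<Longrightarrow> x \<in> carrier M \<Longrightarrow> y \<in> carrier M \<Longrightarrow>
      lact M a (x \<oplus>\<^bsub>M\<^esub> y) = lact M a x \<oplus>\<^bsub>M\<^esub> lact M a y"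
    and ract_l_distr: "a \<in> carrier A \<Longrightarrow> b \<in> carrier A \<Longrightarrow> x \<in> carrier M \<Longrightarrow>
      ract M x (a \<oplus> b) = ract M x a \<oplus>\<^bsub>M\<^esub> ract M x b"
    and ract_r_distr: "a \<in> carrier A \<Longrightarrow> x \<in> carrier M \<Longrightarrow> y \<in> carrier M \<Longrightarrow>
      ract M (x \<oplus>\<^bsub>M\<^esub> y) a = ract M x a \<oplus>\<^bsub>M\<^esub> ract M y a"
    and lact_mult: "a \<in> carrier A \<Longrightarrow> b \<in> carrier A \<Longrightarrow> x \<in> carrier M \<Longrightarrow>
      lact M (a \<otimes> b) x = lact M a (lact M b x)"
    and ract_mult: "a \<in> carrier A \<Longrightarrow> b \<in> carrier A \<Longrightarrow> x \<in> carrier M \<Longrightarrow>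
      ract M x (a \<otimes> b) = ract M (ract M x a) b"
    and lact_ract: "a \<in> carrier A \<Longrightarrow> b \<in> carrier A \<Longrightarrow> x \<in> carrier M \<Longrightarrow>
      lact M a (ract M x b) = ract M (lact M a x) b"
    and lact_one [simp]: "x \<in> carrier M \<Longrightarrow> lact M \<one> x = x"
    and ract_one [simp]: "x \<in> carrier M \<Longrightarrow> ract M x \<one> = x"
    and lact_smult: "a \<in> carrier A \<Longrightarrow> b \<in> carrier A \<Longrightarrow> x \<in> carrier M \<Longrightarrow>
      lact M (c \<odot> a) (ract M x b) = lact M a (ract M x (c \<odot> b))"
begin

abbreviation "Op \<equiv> opposite_algebra A"

lemma Op_simps [simp]: "carrier Op = carrier A" "\<one>\<^bsub>Op\<^esub> = \<one>" "\<zero>\<^bsub>Op\<^esub> = \<zero>" "a \<otimes>\<^bsub>Op\<^esub> b = b \<otimes> a"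
  "a \<oplus>\<^bsub>Op\<^esub> b = a \<oplus> b" "c \<odot>\<^bsub>Op\<^esub> a = c \<odot> a"
  by (simp_all add: opposite_algebra_def)

lemma balanced_map_action:
  assumes "x \<in> carrier M"
  shows "balanced_map A Op M (\<lambda>a b. lact M a (ract M x b))"
  using assms k_algebra_axioms k_algebra_opposite_algebra M.abelian_group_axioms
  unfolding balanced_map_def tensor_def balanced_map_axioms_def
  by (auto simp: lact_l_distr lact_r_distr ract_l_distr lact_smult)

lemma smult_env_eq_lift:
  assumes "x \<in> carrier M"
  shows "X \<odot>\<^bsub>env_module A M\<^esub> x = balanced_map.lift A M (\<lambda>a b. lact M a (ract M x b)) X"
proof -
  interpret L: balanced_map A Op M "\<lambda>a b. lact M a (ract M x b)"
    by (rule balanced_map_action[OF assms])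
  show ?thesis by (simp add: env_module_def L.lift_def L.L_def[abs_def])
qed

lemma env_module_fields [simp]:
  "carrier (env_module A M) = carrier M" "\<zero>\<^bsub>env_module A M\<^esub> = \<zero>\<^bsub>M\<^esub>"
  "x \<oplus>\<^bsub>env_module A M\<^esub> y = x \<oplus>\<^bsub>M\<^esub> y"
  by (simp_all add: env_module_def)

lemma smult_env_tensor:
  assumes "x \<in> carrier M" "a \<in> carrier A" "b \<in> carrier A"
  shows "pure_tensor A Op a b \<odot>\<^bsub>env_module A M\<^esub> x = lact M a (ract M x b)"
proof -
  interpret L: balanced_map A Op M "\<lambda>a b. lact M a (ract M x b)"
    by (rule balanced_map_action[OF assms(1)])
  show ?thesis using assms by (simp add: smult_env_eq_lift L.lift_tensor)
qed

lemma smult_env_closed: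
  assumes "x \<in> carrier M" "X \<in> carrier (enveloping_algebra A)"
  shows "X \<odot>\<^bsub>env_module A M\<^esub> x \<in> carrier M"
proof -
  interpret L: balanced_map A Op M "\<lambda>a b. lact M a (ract M x b)"
    by (rule balanced_map_action[OF assms(1)])
  show ?thesis using assms by (simp add: smult_env_eq_lift L.lift_closed enveloping_algebra_def)
qed

lemma smult_env_add:
  assumes "x \<in> carrier M" "X \<in> carrier (enveloping_algebra A)" "Y \<in> carrier (enveloping_algebra A)"
  shows "(X \<oplus>\<^bsub>enveloping_algebra A\<^esub> Y) \<odot>\<^bsub>env_module A M\<^esub> x =
    X \<odot>\<^bsub>env_module A M\<^esub> x \<oplus>\<^bsub>M\<^esub> Y \<odot>\<^bsub>env_module A M\<^esub> x"
proof -
  interpret L: balanced_map A Op M "\<lambda>a b. lact M a (ract M x b)"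
    by (rule balanced_map_action[OF assms(1)])
  show ?thesis using assms by (simp add: smult_env_eq_lift L.lift_add enveloping_algebra_def)
qed

text \<open>All laws are additive in the elements of the enveloping algebra and are checked on pure
  tensors. There, associativity rests on the opposite multiplication of the second factor.\<close>

lemma lmodule_env_module: "lmodule (enveloping_algebra A) (env_module A M)"
proof -
  interpret T: tensor A Op
    using k_algebra_axioms k_algebra_opposite_algebra by (simp add: tensor_def)
  let ?E = "enveloping_algebra A" and ?N = "env_module A M"
  have E: "?E = T.E" by (simp add: enveloping_algebra_def)
  have ab: "abelian_group ?N"
    by (rule abelian_groupI) (auto simp: M.a_ac intro: M.l_neg)
  have distr: "X \<odot>\<^bsub>?N\<^esub> (x \<oplus>\<^bsub>M\<^esub> y) = X \<odot>\<^bsub>?N\<^esub> x \<oplus>\<^bsub>M\<^esub> X \<odot>\<^bsub>?N\<^esub> y"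
    if "X \<in> carrier ?E" and x: "x \<in> carrier M" "y \<in> carrier M" for X x y
    using that(1) unfolding E
  proof (induction X rule: T.tensor_induct)
    case (tensor a b)
    then show ?case using x by (simp add: smult_env_tensor ract_r_distr lact_r_distr)
  next
    case (add X Y)
    then show ?case
      using x by (simp add: smult_env_add[unfolded E] smult_env_closed[unfolded E] M.a_ac)
  qed
  have assoc: "(X \<otimes>\<^bsub>?E\<^esub> Y) \<odot>\<^bsub>?N\<^esub> x = X \<odot>\<^bsub>?N\<^esub> (Y \<odot>\<^bsub>?N\<^esub> x)"
    if "X \<in> carrier ?E" and Y: "Y \<in> carrier ?E" and x: "x \<in> carrier M" for X Y x
    using that(1) unfolding E
  proof (induction X rule: T.tensor_induct)
    case (tensor a b)
    from Y show ?case unfolding E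
    proof (induction Y rule: T.tensor_induct)
      case (tensor a' b')
      then show ?case
        using x \<open>a \<in> carrier A\<close> \<open>b \<in> carrier Op\<close>
        by (simp add: T.t_mult smult_env_tensor lact_mult ract_mult lact_ract)
    next
      case (add Y Z)
      then show ?case
        using x \<open>a \<in> carrier A\<close> \<open>b \<in> carrier Op\<close>
        by (simp add: T.E.r_distr smult_env_add[unfolded E] smult_env_closed[unfolded E]
            distr[unfolded E])
    qed
  next
    case (add X Z)
    then show ?case
      using x Y by (simp add: E T.E.l_distr smult_env_add[unfolded E] smult_env_closed[unfolded E])
  qed
  have one: "\<one>\<^bsub>?E\<^esub> \<odot>\<^bsub>?N\<^esub> x = x" if "x \<in> carrier M" for x
    using that by (simp add: E T.t_one smult_env_tensor)
  show ?thesis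
    using ab T.E.ring_axioms distr assoc one smult_env_add smult_env_closed
    unfolding lmodule_def lmodule_axioms_def by (simp add: E)
qed

end

context k_algebra
begin

lemma bimodule_over_regular: "bimodule_over A (regular_bimodule A)"
proof -
  have "abelian_group (regular_bimodule A)"
    by (rule abelian_groupI) (auto simp: regular_bimodule_def a_ac intro: l_neg)
  then show ?thesis
    using k_algebra_axioms unfolding bimodule_over_def bimodule_over_axioms_def
    by (simp add: regular_bimodule_def l_distr r_distr m_assoc smult_mult_left smult_mult_right)
qed

lemma bimodule_over_outer: "bimodule_over A (outer_bimodule A)"
proof -
  interpret T: tensor A "opposite_algebra A"
    using k_algebra_axioms k_algebra_opposite_algebra by (simp add: tensor_def)
  have ab: "abelian_group (outer_bimodule A)"
    by (rule abelian_groupI)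
      (auto simp: outer_bimodule_def Let_def enveloping_algebra_def T.E.a_ac intro: T.E.l_neg)
  have [simp]: "carrier (opposite_algebra A) = carrier A" "a \<otimes>\<^bsub>opposite_algebra A\<^esub> b = b \<otimes> a"
    "a \<oplus>\<^bsub>opposite_algebra A\<^esub> b = a \<oplus> b" "\<one>\<^bsub>opposite_algebra A\<^esub> = \<one>"
    "c \<odot>\<^bsub>opposite_algebra A\<^esub> a = c \<odot> a" for a b c
    by (simp_all add: opposite_algebra_def)
  have T1: "T.t a \<one> \<otimes>\<^bsub>T.E\<^esub> (T.t \<one> b \<otimes>\<^bsub>T.E\<^esub> X) = T.t a b \<otimes>\<^bsub>T.E\<^esub> X"
    "T.t \<one> b \<otimes>\<^bsub>T.E\<^esub> (T.t a \<one> \<otimes>\<^bsub>T.E\<^esub> X) = T.t a b \<otimes>\<^bsub>T.E\<^esub> X"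
    if "a \<in> carrier A" "b \<in> carrier A" "X \<in> carrier T.E" for a b X
    using that by (simp_all add: T.E.m_assoc[symmetric] T.t_mult)
  have T2: "T.t (a \<otimes> b) \<one> \<otimes>\<^bsub>T.E\<^esub> X = T.t a \<one> \<otimes>\<^bsub>T.E\<^esub> (T.t b \<one> \<otimes>\<^bsub>T.E\<^esub> X)"
    "T.t \<one> (a \<otimes> b) \<otimes>\<^bsub>T.E\<^esub> X = T.t \<one> b \<otimes>\<^bsub>T.E\<^esub> (T.t \<one> a \<otimes>\<^bsub>T.E\<^esub> X)"
    if "a \<in> carrier A" "b \<in> carrier A" "X \<in> carrier T.E" for a b X
    using that by (simp_all add: T.E.m_assoc[symmetric] T.t_mult)
  have T3: "T.t (a \<oplus> b) \<one> = T.t a \<one> \<oplus>\<^bsub>T.E\<^esub> T.t b \<one>" "T.t \<one> (a \<oplus> b) = T.t \<one> a \<oplus>\<^bsub>T.E\<^esub> T.t \<one> b"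
    if "a \<in> carrier A" "b \<in> carrier A" for a b
    using that T.t_add_left[of a b \<one>] T.t_add_right[of \<one> a b] by simp_all
  have T4: "T.t a (c \<odot> b) = c \<odot>\<^bsub>T.E\<^esub> T.t a b" if "a \<in> carrier A" "b \<in> carrier A" for a b c
    using that T.t_smult(2)[of a b c] by simp
  have "T.t \<one> \<one> = \<one>\<^bsub>T.E\<^esub>" using T.t_one by simp
  then show ?thesis
    using k_algebra_axioms ab unfolding bimodule_over_def bimodule_over_axioms_def
    by (simp add: outer_bimodule_def Let_def enveloping_algebra_def T1 T2 T3 T4
        T.t_smult(1) T.E.smult_mult_left T.E.smult_mult_right T.E.l_distr T.E.r_distr)
qed

text \<open>The outer structure consists of left multiplications by \<open>a \<otimes> 1\<close> and
  \<open>1 \<otimes> b\<close>, so the coefficient module of Ext is the left regular module of the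
  enveloping algebra.\<close>

lemma smult_env_outer:
  assumes "X \<in> carrier (enveloping_algebra A)" "Y \<in> carrier (enveloping_algebra A)"
  shows "X \<odot>\<^bsub>env_module A (outer_bimodule A)\<^esub> Y = X \<otimes>\<^bsub>enveloping_algebra A\<^esub> Y"
proof -
  interpret T: tensor A "opposite_algebra A"
    using k_algebra_axioms k_algebra_opposite_algebra by (simp add: tensor_def)
  interpret O: bimodule_over A "outer_bimodule A" by (rule bimodule_over_outer)
  have Y: "Y \<in> carrier (outer_bimodule A)" using assms by (simp add: outer_bimodule_def Let_def)
  from assms(1) show ?thesis unfolding enveloping_algebra_def
  proof (induction X rule: T.tensor_induct)
    case (tensor a b)
    then show ?case
      using Y assms by (simp add: O.smult_env_tensor)
        (simp add: outer_bimodule_def Let_def enveloping_algebra_def T.E.m_assoc[symmetric] T.t_mult)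
  next
    case (add X Z)
    then show ?case
      using Y assms O.smult_env_add[OF Y, of X Z]
      by (simp add: enveloping_algebra_def T.E.l_distr) (simp add: outer_bimodule_def Let_def enveloping_algebra_def)
  qed
qed

end

section \<open>Comparison of free resolutions\<close>

lemma lin_maps_memI:
  assumes "f \<in> extensional (carrier M)"
    and "\<And>x. x \<in> carrier M \<Longrightarrow> f x \<in> carrier N"
    and "\<And>x y. x \<in> carrier M \<Longrightarrow> y \<in> carrier M \<Longrightarrow> f (x \<oplus>\<^bsub>M\<^esub> y) = f x \<oplus>\<^bsub>N\<^esub> f y"
    and "\<And>r x. r \<in> carrier R \<Longrightarrow> x \<in> carrier M \<Longrightarrow> f (r \<odot>\<^bsub>M\<^esub> x) = r \<odot>\<^bsub>N\<^esub> f x"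
  shows "f \<in> lin_maps R M N"
  using assms by (simp add: lin_maps_def PiE_def Pi_def)

lemma lin_mapsD:
  assumes "f \<in> lin_maps R M N"
  shows lin_maps_ext: "f \<in> extensional (carrier M)"
    and lin_maps_closed: "x \<in> carrier M \<Longrightarrow> f x \<in> carrier N"
    and lin_maps_add: "x \<in> carrier M \<Longrightarrow> y \<in> carrier M \<Longrightarrow> f (x \<oplus>\<^bsub>M\<^esub> y) = f x \<oplus>\<^bsub>N\<^esub> f y"
    and lin_maps_smult: "r \<in> carrier R \<Longrightarrow> x \<in> carrier M \<Longrightarrow> f (r \<odot>\<^bsub>M\<^esub> x) = r \<odot>\<^bsub>N\<^esub> f x"
  using assms by (auto simp: lin_maps_def PiE_def)

lemma lin_maps_restrictI:
  assumes "lmodule R M"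
    and "\<And>x. x \<in> carrier M \<Longrightarrow> f x \<in> carrier N"
    and "\<And>x y. x \<in> carrier M \<Longrightarrow> y \<in> carrier M \<Longrightarrow> f (x \<oplus>\<^bsub>M\<^esub> y) = f x \<oplus>\<^bsub>N\<^esub> f y"
    and "\<And>r x. r \<in> carrier R \<Longrightarrow> x \<in> carrier M \<Longrightarrow> f (r \<odot>\<^bsub>M\<^esub> x) = r \<odot>\<^bsub>N\<^esub> f x"
  shows "restrict f (carrier M) \<in> lin_maps R M N"
proof -
  interpret M: lmodule R M by fact
  show ?thesis by (rule lin_maps_memI) (use assms in auto)
qed

lemma lin_maps_zero:
  assumes "lmodule R M" "lmodule R N" "f \<in> lin_maps R M N"
  shows "f \<zero>\<^bsub>M\<^esub> = \<zero>\<^bsub>N\<^esub>"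
proof -
  interpret M: lmodule R M by fact
  interpret N: lmodule R N by fact
  have "f \<zero>\<^bsub>M\<^esub> \<oplus>\<^bsub>N\<^esub> f \<zero>\<^bsub>M\<^esub> = f \<zero>\<^bsub>M\<^esub>"
    using lin_maps_add[OF assms(3), of "\<zero>\<^bsub>M\<^esub>" "\<zero>\<^bsub>M\<^esub>"] by simp
  then show ?thesis using lin_maps_closed[OF assms(3), of "\<zero>\<^bsub>M\<^esub>"] by simp
qed

lemma lin_maps_minus:
  assumes "lmodule R M" "lmodule R N" "f \<in> lin_maps R M N" "x \<in> carrier M"
  shows "f (\<ominus>\<^bsub>M\<^esub> x) = \<ominus>\<^bsub>N\<^esub> f x"
proof -
  interpret M: lmodule R M by fact
  interpret N: lmodule R N by fact
  have "f (\<ominus>\<^bsub>M\<^esub> x) \<oplus>\<^bsub>N\<^esub> f x = \<zero>\<^bsub>N\<^esub>"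
    using assms lin_maps_zero[OF assms(1-3)] lin_maps_add[OF assms(3), of "\<ominus>\<^bsub>M\<^esub> x" x]
    by (simp add: M.M.l_neg)
  then show ?thesis
    using assms lin_maps_closed[OF assms(3)] by (metis N.M.minus_equality M.M.a_inv_closed)
qed

lemma lin_maps_diff:
  assumes "lmodule R M" "lmodule R N" "f \<in> lin_maps R M N" "x \<in> carrier M" "y \<in> carrier M"
  shows "f (x \<ominus>\<^bsub>M\<^esub> y) = f x \<ominus>\<^bsub>N\<^esub> f y"
proof -
  interpret M: lmodule R M by fact
  show ?thesis
    using assms lin_maps_add[OF assms(3), of x "\<ominus>\<^bsub>M\<^esub> y"] lin_maps_minus[OF assms(1-3)]
    by (simp add: a_minus_def)
qed

lemma (in lmodule) smult_zero_right: "r \<in> carrier R \<Longrightarrow> r \<odot>\<^bsub>M\<^esub> \<zero>\<^bsub>M\<^esub> = \<zero>\<^bsub>M\<^esub>"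
  using smult_r_distr[of r "\<zero>\<^bsub>M\<^esub>" "\<zero>\<^bsub>M\<^esub>"] by simp

lemma (in lmodule) smult_zero_left: "x \<in> carrier M \<Longrightarrow> \<zero> \<odot>\<^bsub>M\<^esub> x = \<zero>\<^bsub>M\<^esub>"
  using smult_l_distr[of \<zero> \<zero> x] by simp

lemma (in lmodule) smult_minus:
  assumes "r \<in> carrier R" "x \<in> carrier M"
  shows "r \<odot>\<^bsub>M\<^esub> (\<ominus>\<^bsub>M\<^esub> x) = \<ominus>\<^bsub>M\<^esub> (r \<odot>\<^bsub>M\<^esub> x)"
  using assms smult_r_distr[of r "\<ominus>\<^bsub>M\<^esub> x" x] smult_zero_right[of r]
  by (simp add: M.l_neg M.minus_equality)

lemma (in lmodule) smult_diff:
  assumes "r \<in> carrier R" "x \<in> carrier M" "y \<in> carrier M"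
  shows "r \<odot>\<^bsub>M\<^esub> (x \<ominus>\<^bsub>M\<^esub> y) = r \<odot>\<^bsub>M\<^esub> x \<ominus>\<^bsub>M\<^esub> r \<odot>\<^bsub>M\<^esub> y"
  using assms by (simp add: a_minus_def smult_r_distr smult_minus)

lemma (in lmodule) smult_finsum:
  assumes "finite T" "r \<in> carrier R" "\<And>i. i \<in> T \<Longrightarrow> f i \<in> carrier M"
  shows "r \<odot>\<^bsub>M\<^esub> (\<Oplus>\<^bsub>M\<^esub>i\<in>T. f i) = (\<Oplus>\<^bsub>M\<^esub>i\<in>T. r \<odot>\<^bsub>M\<^esub> f i)"
  using assms
proof (induction T rule: finite_induct)
  case empty
  then show ?case by (simp add: smult_zero_right)
next
  case (insert i T)
  then have "(\<Oplus>\<^bsub>M\<^esub>i\<in>T. f i) \<in> carrier M" by (intro M.finsum_closed) auto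
  then show ?case
    using insert by (subst (1 2) M.finsum_insert) (auto simp: smult_r_distr)
qed

lemma lin_maps_compose:
  assumes "lmodule R M" "f \<in> lin_maps R M N" "g \<in> lin_maps R N K"
  shows "compose (carrier M) g f \<in> lin_maps R M K"
proof -
  interpret M: lmodule R M by fact
  show ?thesis unfolding compose_def
    by (rule lin_maps_restrictI[OF assms(1)])
      (simp_all add: lin_mapsD[OF assms(2)] lin_mapsD[OF assms(3)])
qed

lemma lin_maps_add_fun:
  assumes "lmodule R M" "lmodule R N" "f \<in> lin_maps R M N" "g \<in> lin_maps R M N"
  shows "(\<lambda>x\<in>carrier M. f x \<oplus>\<^bsub>N\<^esub> g x) \<in> lin_maps R M N"
proof -
  interpret M: lmodule R M by fact
  interpret N: lmodule R N by fact
  show ?thesis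
    by (rule lin_maps_restrictI[OF assms(1)])
      (simp_all add: lin_mapsD[OF assms(3)] lin_mapsD[OF assms(4)] N.smult_r_distr N.M.a_ac)
qed

lemma lin_maps_diff_fun:
  assumes "lmodule R M" "lmodule R N" "f \<in> lin_maps R M N" "g \<in> lin_maps R M N"
  shows "(\<lambda>x\<in>carrier M. f x \<ominus>\<^bsub>N\<^esub> g x) \<in> lin_maps R M N"
proof -
  interpret M: lmodule R M by fact
  interpret N: lmodule R N by fact
  show ?thesis
    by (rule lin_maps_restrictI[OF assms(1)])
      (simp_all add: lin_mapsD[OF assms(3)] lin_mapsD[OF assms(4)] N.smult_diff,
        simp add: a_minus_def N.M.minus_add N.M.a_ac lin_mapsD[OF assms(3)] lin_mapsD[OF assms(4)])
qed

lemma lin_maps_zero_fun: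
  assumes "lmodule R M" "lmodule R N"
  shows "(\<lambda>x\<in>carrier M. \<zero>\<^bsub>N\<^esub>) \<in> lin_maps R M N"
proof -
  interpret N: lmodule R N by fact
  show ?thesis
    by (rule lin_maps_restrictI[OF assms(1)]) (simp_all add: N.smult_zero_right)
qed

lemma lin_maps_id:
  assumes "lmodule R M"
  shows "(\<lambda>x\<in>carrier M. x) \<in> lin_maps R M M"
  by (rule lin_maps_restrictI[OF assms]) simp_all

section \<open>Free modules and lifting along surjections onto images\<close>

context ring
begin

abbreviation "FM I \<equiv> free_module R I"

lemma free_module_simps [simp]:
  "\<zero>\<^bsub>FM I\<^esub> = (\<lambda>_. \<zero>)" "(x \<oplus>\<^bsub>FM I\<^esub> y) = (\<lambda>i. x i \<oplus> y i)" "r \<odot>\<^bsub>FM I\<^esub> x = (\<lambda>i. r \<otimes> x i)"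
  by (simp_all add: free_module_def)

lemma free_module_carrier: "x \<in> carrier (FM I) \<longleftrightarrow>
    (\<forall>i\<in>I. x i \<in> carrier R) \<and> (\<forall>i. i \<notin> I \<longrightarrow> x i = \<zero>) \<and> finite {i. x i \<noteq> \<zero>}"
  by (simp add: free_module_def)

lemma free_module_closed: "x \<in> carrier (FM I) \<Longrightarrow> x i \<in> carrier R"
  by (cases "i \<in> I") (auto simp: free_module_carrier)

lemma lmodule_free_module: "lmodule R (FM I)"
proof -
  have add: "(\<lambda>i. x i \<oplus> y i) \<in> carrier (FM I)" if "x \<in> carrier (FM I)" "y \<in> carrier (FM I)" for x y
  proof -
    have "{i. x i \<oplus> y i \<noteq> \<zero>} \<subseteq> {i. x i \<noteq> \<zero>} \<union> {i. y i \<noteq> \<zero>}" by auto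
    then show ?thesis using that unfolding free_module_carrier by (auto intro: finite_subset)
  qed
  have neg: "(\<lambda>i. \<ominus> x i) \<in> carrier (FM I)" if "x \<in> carrier (FM I)" for x
  proof -
    have "{i. \<ominus> x i \<noteq> \<zero>} \<subseteq> {i. x i \<noteq> \<zero>}" by auto
    then show ?thesis using that unfolding free_module_carrier by (auto intro: finite_subset)
  qed
  have mult: "(\<lambda>i. r \<otimes> x i) \<in> carrier (FM I)" if "r \<in> carrier R" "x \<in> carrier (FM I)" for r x
  proof -
    have "{i. r \<otimes> x i \<noteq> \<zero>} \<subseteq> {i. x i \<noteq> \<zero>}" using that by auto
    then show ?thesis using that unfolding free_module_carrier by (auto intro: finite_subset)
  qed
  have "abelian_group (FM I)"
  proof (rule abelian_groupI)
    show "\<zero>\<^bsub>FM I\<^esub> \<in> carrier (FM I)" by (simp add: free_module_carrier)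
    fix x assume x: "x \<in> carrier (FM I)"
    then show "\<exists>y\<in>carrier (FM I). y \<oplus>\<^bsub>FM I\<^esub> x = \<zero>\<^bsub>FM I\<^esub>"
      by (intro bexI[OF _ neg[OF x]]) (auto simp: l_neg free_module_closed)
  qed (auto simp: add free_module_closed a_ac)
  then show ?thesis
    unfolding lmodule_def lmodule_axioms_def
    by (auto simp: ring_axioms mult free_module_closed l_distr r_distr m_assoc)
qed

definition basis_vec :: "'i \<Rightarrow> 'i \<Rightarrow> 'a" where
  "basis_vec i = (\<lambda>j. if j = i then \<one> else \<zero>)"

lemma basis_vec_closed [simp]: "i \<in> I \<Longrightarrow> basis_vec i \<in> carrier (FM I)"
  by (auto simp: free_module_carrier basis_vec_def)

lemma free_module_induct [consumes 1, case_names zero step]: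
  assumes x: "x \<in> carrier (FM I)"
    and zero: "P \<zero>\<^bsub>FM I\<^esub>"
    and step: "\<And>i r y. i \<in> I \<Longrightarrow> r \<in> carrier R \<Longrightarrow> y \<in> carrier (FM I) \<Longrightarrow> P y \<Longrightarrow>
      P (r \<odot>\<^bsub>FM I\<^esub> basis_vec i \<oplus>\<^bsub>FM I\<^esub> y)"
  shows "P x"
proof -
  have "P x" if "finite S" "x \<in> carrier (FM I)" "{i. x i \<noteq> \<zero>} \<subseteq> S" for S x
    using that
  proof (induction S arbitrary: x rule: finite_induct)
    case empty
    then have "x = \<zero>\<^bsub>FM I\<^esub>" by auto
    then show ?case using zero by simp
  next
    case (insert i S)
    show ?case
    proof (cases "x i = \<zero>")
      case True
      then show ?thesis using insert by (intro insert.IH) auto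
    next
      case False
      let ?y = "x(i := \<zero>)"
      have i: "i \<in> I" using insert.prems False by (auto simp: free_module_carrier)
      have "{j. ?y j \<noteq> \<zero>} \<subseteq> {j. x j \<noteq> \<zero>}" by auto
      then have y: "?y \<in> carrier (FM I)"
        using insert.prems unfolding free_module_carrier by (auto intro: finite_subset)
      have "P ?y" by (rule insert.IH[OF y]) (use insert.prems(2) in auto)
      then have "P (x i \<odot>\<^bsub>FM I\<^esub> basis_vec i \<oplus>\<^bsub>FM I\<^esub> ?y)"
        using step[OF i _ y] insert.prems by (auto simp: free_module_closed)
      also have "x i \<odot>\<^bsub>FM I\<^esub> basis_vec i \<oplus>\<^bsub>FM I\<^esub> ?y = x"
        using insert.prems by (auto simp: basis_vec_def free_module_closed intro!: ext)
      finally show ?thesis .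
    qed
  qed
  then show ?thesis using x by (auto simp: free_module_carrier)
qed

lemma free_module_map_eqI:
  assumes N: "lmodule R N" and f: "f \<in> lin_maps R (FM I) N" and g: "g \<in> lin_maps R (FM I) N"
    and eq: "\<And>i. i \<in> I \<Longrightarrow> f (basis_vec i) = g (basis_vec i)" and x: "x \<in> carrier (FM I)"
  shows "f x = g x"
proof -
  interpret F: lmodule R "FM I" by (rule lmodule_free_module)
  interpret N: lmodule R N by fact
  from x show ?thesis
  proof (induction x rule: free_module_induct)
    case zero
    then show ?case using lin_maps_zero[OF lmodule_free_module N] f g by metis
  next
    case (step i r y)
    have "r \<odot>\<^bsub>FM I\<^esub> basis_vec i \<in> carrier (FM I)" using step by (intro F.smult_closed) auto
    then show ?case
      using step eq f g by (simp only: lin_maps_add[OF f] lin_maps_add[OF g] lin_maps_smult[OF f]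
        lin_maps_smult[OF g] basis_vec_closed)
  qed
qed

lemma free_module_map_exists:
  assumes N: "lmodule R N" and v: "\<And>i. i \<in> I \<Longrightarrow> v i \<in> carrier N"
  shows "\<exists>f\<in>lin_maps R (FM I) N. \<forall>i\<in>I. f (basis_vec i) = v i"
proof -
  interpret N: lmodule R N by fact
  interpret F: lmodule R "FM I" by (rule lmodule_free_module)
  define f where "f x = (\<Oplus>\<^bsub>N\<^esub>i\<in>{i. x i \<noteq> \<zero>}. x i \<odot>\<^bsub>N\<^esub> v i)" for x
  have sup: "f x = (\<Oplus>\<^bsub>N\<^esub>i\<in>S. x i \<odot>\<^bsub>N\<^esub> v i)"
    if "x \<in> carrier (FM I)" "finite S" "{i. x i \<noteq> \<zero>} \<subseteq> S" "S \<subseteq> I" for x S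
    unfolding f_def using that v
    by (intro N.M.add.finprod_mono_neutral_cong_left) (auto simp: free_module_closed N.smult_zero_left)
  have supp: "{i. x i \<noteq> \<zero>} \<subseteq> I" "finite {i. x i \<noteq> \<zero>}" if "x \<in> carrier (FM I)" for x
    using that by (auto simp: free_module_carrier)
  have "restrict f (carrier (FM I)) \<in> lin_maps R (FM I) N"
  proof (rule lin_maps_restrictI[OF lmodule_free_module])
    fix x assume x: "x \<in> carrier (FM I)"
    show fx: "f x \<in> carrier N"
      unfolding f_def using supp[OF x] v x by (intro N.M.finsum_closed) (auto simp: free_module_closed)
    {
      fix y assume y: "y \<in> carrier (FM I)"
      let ?S = "{i. x i \<noteq> \<zero>} \<union> {i. y i \<noteq> \<zero>}"
      have S: "finite ?S" "?S \<subseteq> I" using supp x y by auto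
      have vS: "i \<in> ?S \<Longrightarrow> v i \<in> carrier N" for i using S v by auto
      have "f (x \<oplus>\<^bsub>FM I\<^esub> y) = (\<Oplus>\<^bsub>N\<^esub>i\<in>?S. (x i \<oplus> y i) \<odot>\<^bsub>N\<^esub> v i)"
        using S F.M.add.m_closed[OF x y] by (subst sup[of _ ?S]) auto
      also have "\<dots> = (\<Oplus>\<^bsub>N\<^esub>i\<in>?S. x i \<odot>\<^bsub>N\<^esub> v i \<oplus>\<^bsub>N\<^esub> y i \<odot>\<^bsub>N\<^esub> v i)"
        using vS x y by (intro N.M.add.finprod_cong') (auto simp: N.smult_l_distr free_module_closed)
      also have "\<dots> = f x \<oplus>\<^bsub>N\<^esub> f y"
        using S vS x y by (subst N.M.finsum_addf) (auto simp: sup[of _ ?S] free_module_closed)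
      finally show "f (x \<oplus>\<^bsub>FM I\<^esub> y) = f x \<oplus>\<^bsub>N\<^esub> f y" .
    next
      fix r assume r: "r \<in> carrier R"
      let ?S = "{i. x i \<noteq> \<zero>}"
      have S: "finite ?S" "?S \<subseteq> I" using supp x by auto
      have vS: "i \<in> ?S \<Longrightarrow> v i \<in> carrier N" for i using S v by auto
      have "f (r \<odot>\<^bsub>FM I\<^esub> x) = (\<Oplus>\<^bsub>N\<^esub>i\<in>?S. (r \<otimes> x i) \<odot>\<^bsub>N\<^esub> v i)"
        using S r F.smult_closed[OF r x] by (subst sup[of _ ?S]) auto
      also have "\<dots> = (\<Oplus>\<^bsub>N\<^esub>i\<in>?S. r \<odot>\<^bsub>N\<^esub> (x i \<odot>\<^bsub>N\<^esub> v i))"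
        using vS x r by (intro N.M.add.finprod_cong') (auto simp: N.smult_assoc free_module_closed)
      also have "\<dots> = r \<odot>\<^bsub>N\<^esub> (\<Oplus>\<^bsub>N\<^esub>i\<in>?S. x i \<odot>\<^bsub>N\<^esub> v i)"
        using S(1) vS free_module_closed[OF x] r by (intro N.smult_finsum[symmetric]) auto
      finally show "f (r \<odot>\<^bsub>FM I\<^esub> x) = r \<odot>\<^bsub>N\<^esub> f x" by (simp add: f_def)
    }
  qed
  moreover have "f (basis_vec i) = v i" if i: "i \<in> I" for i
  proof -
    have "f (basis_vec i) = (\<Oplus>\<^bsub>N\<^esub>j\<in>{i}. basis_vec i j \<odot>\<^bsub>N\<^esub> v j)"
      using i by (intro sup[OF basis_vec_closed[OF i]]) (auto simp: basis_vec_def)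
    then show ?thesis using i v by (simp add: basis_vec_def)
  qed
  ultimately show ?thesis
    by (intro bexI[of _ "restrict f (carrier (FM I))"]) auto
qed

text \<open>Projectivity of free modules in the form used for chain maps and homotopies: preimages
  are chosen on the basis only, and linear maps agreeing there agree everywhere.\<close>

lemma free_module_lift:
  assumes N: "lmodule R N" and K: "lmodule R K"
    and p: "p \<in> lin_maps R (FM I) N" and q: "q \<in> lin_maps R K N"
    and sub: "\<And>x. x \<in> carrier (FM I) \<Longrightarrow> p x \<in> q ` carrier K"
  shows "\<exists>f\<in>lin_maps R (FM I) K. \<forall>x\<in>carrier (FM I). q (f x) = p x"
proof -
  have "\<forall>i\<in>I. \<exists>y. y \<in> carrier K \<and> q y = p (basis_vec i)"
    using sub basis_vec_closed by (metis imageE)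
  then obtain v where v: "\<And>i. i \<in> I \<Longrightarrow> v i \<in> carrier K" "\<And>i. i \<in> I \<Longrightarrow> q (v i) = p (basis_vec i)"
    by metis
  obtain f where f: "f \<in> lin_maps R (FM I) K" "\<forall>i\<in>I. f (basis_vec i) = v i"
    using free_module_map_exists[OF K, of I v] v by blast
  let ?c = "compose (carrier (FM I)) q f"
  have c: "?c \<in> lin_maps R (FM I) N" using lin_maps_compose[OF lmodule_free_module f(1) q] .
  have "q (f x) = p x" if x: "x \<in> carrier (FM I)" for x
    using free_module_map_eqI[OF N c p _ x] f v x by (simp add: compose_def)
  then show ?thesis using f by blast
qed

end

section \<open>Exactness and homotopies in a free resolution\<close>

locale free_res = R: ring R + M: lmodule R M
  for R :: "('r, 'x) ring_scheme" (structure) and M :: "('r, 'm) module" +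
  fixes I :: "nat \<Rightarrow> 'i set" and d :: "nat \<Rightarrow> ('i \<Rightarrow> 'r) \<Rightarrow> ('i \<Rightarrow> 'r)" and \<epsilon> :: "('i \<Rightarrow> 'r) \<Rightarrow> 'm"
  assumes free_resolution: "free_resolution R M I d \<epsilon>"
begin

abbreviation "F n \<equiv> free_module R (I n)"

text \<open>In degree 0 the augmentation takes the place of the differential, so exactness of the
  augmented complex is one statement for all degrees.\<close>

definition cycle :: "nat \<Rightarrow> ('i \<Rightarrow> 'r) \<Rightarrow> bool" where
  "cycle n x = (case n of 0 \<Rightarrow> \<epsilon> x = \<zero>\<^bsub>M\<^esub> | Suc m \<Rightarrow> d m x = (\<lambda>_. \<zero>))"

text \<open>\<open>cocycle\<close> and \<open>coboundary\<close> express the notions behind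
  \<open>cocycles\<close> and \<open>coboundaries\<close> for an arbitrary free resolution, whereas
  Ext speaks only of the selected one.\<close>

definition cocycle :: "('r, 'n) module \<Rightarrow> nat \<Rightarrow> (('i \<Rightarrow> 'r) \<Rightarrow> 'n) \<Rightarrow> bool" where
  "cocycle N n \<phi> \<longleftrightarrow> \<phi> \<in> lin_maps R (F n) N \<and> (\<forall>x\<in>carrier (F (Suc n)). \<phi> (d n x) = \<zero>\<^bsub>N\<^esub>)"

definition coboundary :: "('r, 'n) module \<Rightarrow> nat \<Rightarrow> (('i \<Rightarrow> 'r) \<Rightarrow> 'n) \<Rightarrow> bool" where
  "coboundary N n \<phi> \<longleftrightarrow> \<phi> \<in> extensional (carrier (F n)) \<and> (case n of
      0 \<Rightarrow> \<forall>x\<in>carrier (F 0). \<phi> x = \<zero>\<^bsub>N\<^esub>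
    | Suc m \<Rightarrow> \<exists>\<psi>\<in>lin_maps R (F m) N. \<forall>x\<in>carrier (F (Suc m)). \<phi> x = \<psi> (d m x))"

lemma lmodule_F: "lmodule R (F n)"
  by (rule R.lmodule_free_module)

lemma \<epsilon>_lin: "\<epsilon> \<in> lin_maps R (F 0) M"
  and d_lin: "d n \<in> lin_maps R (F (Suc n)) (F n)"
  and \<epsilon>_surj: "\<epsilon> ` carrier (F 0) = carrier M"
  using free_resolution by (simp_all add: free_resolution_def)

lemma exact: "x \<in> carrier (F n) \<Longrightarrow> cycle n x \<longleftrightarrow> x \<in> d n ` carrier (F (Suc n))"
proof (cases n)
  case 0
  have "{x \<in> carrier (F 0). \<epsilon> x = \<zero>\<^bsub>M\<^esub>} = d 0 ` carrier (F 1)"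
    using free_resolution unfolding free_resolution_def by blast
  then show "x \<in> carrier (F n) \<Longrightarrow> ?thesis" using 0 by (auto simp: cycle_def)
next
  case (Suc m)
  have "{x \<in> carrier (F (Suc m)). d m x = (\<lambda>_. \<zero>)} = d (Suc m) ` carrier (F (Suc (Suc m)))"
    using free_resolution unfolding free_resolution_def by blast
  then show "x \<in> carrier (F n) \<Longrightarrow> ?thesis" using Suc by (simp add: cycle_def) blast
qed

lemma d_closed: "x \<in> carrier (F (Suc n)) \<Longrightarrow> d n x \<in> carrier (F n)"
  using d_lin lin_maps_closed by metis

lemma cycle_d: "x \<in> carrier (F (Suc n)) \<Longrightarrow> cycle n (d n x)"
  using exact d_closed by blast

lemma d_d: "x \<in> carrier (F (Suc (Suc n))) \<Longrightarrow> d n (d (Suc n) x) = (\<lambda>_. \<zero>)"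
  using cycle_d[of x "Suc n"] by (simp add: cycle_def)

text \<open>Maps over the identity of \<open>M\<close> differ by cycles, which exactness turns into
  boundaries, and freeness makes the choice of preimages linear. Each homotopy map depends on the
  previous one, hence the dependent choice. It is applied to the composites of the two comparison
  maps.\<close>

lemma homotopy:
  assumes e: "\<And>n. e n \<in> lin_maps R (F n) (F n)"
    and e0: "\<And>x. x \<in> carrier (F 0) \<Longrightarrow> \<epsilon> (e 0 x) = \<epsilon> x"
    and ed: "\<And>n x. x \<in> carrier (F (Suc n)) \<Longrightarrow> d n (e (Suc n) x) = e n (d n x)"
  shows "\<exists>h. (\<forall>n. h n \<in> lin_maps R (F n) (F (Suc n))) \<and>
    (\<forall>x\<in>carrier (F 0). e 0 x = x \<oplus>\<^bsub>F 0\<^esub> d 0 (h 0 x)) \<and>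
    (\<forall>n. \<forall>x\<in>carrier (F (Suc n)). e (Suc n) x =
      x \<oplus>\<^bsub>F (Suc n)\<^esub> (h n (d n x) \<oplus>\<^bsub>F (Suc n)\<^esub> d (Suc n) (h (Suc n) x)))"
proof -
  \<comment> \<open>On cycles the term with \<open>d n x\<close> vanishes, so the invariant need not
    mention the previous map; it is just what makes the next defect a cycle. Degree 0 has no such
    term, hence the unconditional clause.\<close>
  let ?P = "\<lambda>n h. h \<in> lin_maps R (F n) (F (Suc n)) \<and>
      (\<forall>x\<in>carrier (F n). cycle n x \<longrightarrow> e n x = x \<oplus>\<^bsub>F n\<^esub> d n (h x)) \<and>
      (n = 0 \<longrightarrow> (\<forall>x\<in>carrier (F 0). e 0 x = x \<oplus>\<^bsub>F 0\<^esub> d 0 (h x)))"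
  let ?Q = "\<lambda>n h h'. \<forall>x\<in>carrier (F (Suc n)). e (Suc n) x =
      x \<oplus>\<^bsub>F (Suc n)\<^esub> (h (d n x) \<oplus>\<^bsub>F (Suc n)\<^esub> d (Suc n) (h' x))"
  have add_diff: "a \<oplus>\<^bsub>F n\<^esub> (b \<ominus>\<^bsub>F n\<^esub> a) = b" if "a \<in> carrier (F n)" "b \<in> carrier (F n)" for n a b
  proof -
    interpret Fn: lmodule R "F n" by (rule lmodule_F)
    show ?thesis using that
      by (metis Fn.M.a_comm Fn.M.a_inv_closed Fn.M.add.m_assoc Fn.M.l_neg Fn.M.r_zero a_minus_def)
  qed
  have "\<exists>h. \<forall>n. ?P n (h n) \<and> ?Q n (h n) (h (Suc n))"
  proof (rule dependent_nat_choice)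
    let ?D = "\<lambda>x\<in>carrier (F 0). e 0 x \<ominus>\<^bsub>F 0\<^esub> (\<lambda>x\<in>carrier (F 0). x) x"
    interpret F0: lmodule R "F 0" by (rule lmodule_F)
    have D: "?D \<in> lin_maps R (F 0) (F 0)"
      by (rule lin_maps_diff_fun[OF lmodule_F lmodule_F e lin_maps_id[OF lmodule_F]])
    have "?D x \<in> d 0 ` carrier (F (Suc 0))" if x: "x \<in> carrier (F 0)" for x
    proof -
      have "\<epsilon> (e 0 x \<ominus>\<^bsub>F 0\<^esub> x) = \<epsilon> (e 0 x) \<ominus>\<^bsub>M\<^esub> \<epsilon> x"
        using lin_maps_diff[OF lmodule_F M.lmodule_axioms \<epsilon>_lin] x lin_maps_closed[OF e] by blast
      also have "\<dots> = \<zero>\<^bsub>M\<^esub>"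
        using x e0 lin_maps_closed[OF \<epsilon>_lin] by (simp add: a_minus_def M.M.r_neg)
      finally have "cycle 0 (e 0 x \<ominus>\<^bsub>F 0\<^esub> x)" by (simp add: cycle_def)
      then show ?thesis using exact[of "e 0 x \<ominus>\<^bsub>F 0\<^esub> x" 0] x lin_maps_closed[OF e x]
        by (simp add: F0.M.minus_closed)
    qed
    then obtain h where h: "h \<in> lin_maps R (F 0) (F (Suc 0))" "\<forall>x\<in>carrier (F 0). d 0 (h x) = ?D x"
      using R.free_module_lift[OF lmodule_F lmodule_F D d_lin[of 0]] by blast
    have "e 0 x = x \<oplus>\<^bsub>F 0\<^esub> d 0 (h x)" if "x \<in> carrier (F 0)" for x
      using h(2) that add_diff[OF that lin_maps_closed[OF e that]] by simp
    with h(1) show "\<exists>h. ?P 0 h" by auto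
  next
    fix h n assume P: "?P n h"
    interpret Fn: lmodule R "F n" by (rule lmodule_F)
    interpret FS: lmodule R "F (Suc n)" by (rule lmodule_F)
    have h: "h \<in> lin_maps R (F n) (F (Suc n))" using P by blast
    let ?g = "\<lambda>x\<in>carrier (F (Suc n)). (\<lambda>x\<in>carrier (F (Suc n)). x) x \<oplus>\<^bsub>F (Suc n)\<^esub>
        compose (carrier (F (Suc n))) h (d n) x"
    have g: "?g \<in> lin_maps R (F (Suc n)) (F (Suc n))"
      by (rule lin_maps_add_fun[OF lmodule_F lmodule_F lin_maps_id[OF lmodule_F]
            lin_maps_compose[OF lmodule_F d_lin h]])
    let ?D = "\<lambda>x\<in>carrier (F (Suc n)). e (Suc n) x \<ominus>\<^bsub>F (Suc n)\<^esub> ?g x"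
    have D: "?D \<in> lin_maps R (F (Suc n)) (F (Suc n))"
      by (rule lin_maps_diff_fun[OF lmodule_F lmodule_F e g])
    have g_eq: "?g x = x \<oplus>\<^bsub>F (Suc n)\<^esub> h (d n x)" if "x \<in> carrier (F (Suc n))" for x
      using that by (simp add: compose_def)
    have gc: "x \<oplus>\<^bsub>F (Suc n)\<^esub> h (d n x) \<in> carrier (F (Suc n))" if "x \<in> carrier (F (Suc n))" for x
      using lin_maps_closed[OF g that] g_eq[OF that] by simp
    have D_eq: "?D x = e (Suc n) x \<ominus>\<^bsub>F (Suc n)\<^esub> (x \<oplus>\<^bsub>F (Suc n)\<^esub> h (d n x))"
      if "x \<in> carrier (F (Suc n))" for x
      using that g_eq[OF that] by simp
    have hd: "h (d n x) \<in> carrier (F (Suc n))" if "x \<in> carrier (F (Suc n))" for x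
      using that lin_maps_closed[OF h] d_closed by blast
    \<comment> \<open>The defect is a cycle because \<open>d n x\<close> is a cycle, to which the
      invariant for \<open>h\<close> applies.\<close>
    have "?D x \<in> d (Suc n) ` carrier (F (Suc (Suc n)))" if x: "x \<in> carrier (F (Suc n))" for x
    proof -
      have dx: "d n x \<in> carrier (F n)" "cycle n (d n x)" using x d_closed cycle_d by blast+
      have "d n (x \<oplus>\<^bsub>F (Suc n)\<^esub> h (d n x)) = d n x \<oplus>\<^bsub>F n\<^esub> d n (h (d n x))"
        by (rule lin_maps_add[OF d_lin x hd[OF x]])
      also have "\<dots> = e n (d n x)" using P dx by (metis (no_types))
      finally have dg: "d n (x \<oplus>\<^bsub>F (Suc n)\<^esub> h (d n x)) = d n (e (Suc n) x)"
        using ed[OF x] by (simp only:)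
      have "d n (?D x) = d n (e (Suc n) x) \<ominus>\<^bsub>F n\<^esub> d n (x \<oplus>\<^bsub>F (Suc n)\<^esub> h (d n x))"
        unfolding D_eq[OF x]
        by (rule lin_maps_diff[OF lmodule_F lmodule_F d_lin lin_maps_closed[OF e x] gc[OF x]])
      also have "\<dots> = \<zero>\<^bsub>F n\<^esub>"
        unfolding dg a_minus_def
        by (rule Fn.M.r_neg[OF d_closed[OF lin_maps_closed[OF e x]]])
      finally have "cycle (Suc n) (?D x)" by (simp add: cycle_def)
      then show ?thesis using exact[OF lin_maps_closed[OF D x]] by blast
    qed
    then obtain h' where h': "h' \<in> lin_maps R (F (Suc n)) (F (Suc (Suc n)))"
      "\<forall>x\<in>carrier (F (Suc n)). d (Suc n) (h' x) = ?D x"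
      using R.free_module_lift[OF lmodule_F lmodule_F D d_lin[of "Suc n"]] by blast
    have Q: "e (Suc n) x = (x \<oplus>\<^bsub>F (Suc n)\<^esub> h (d n x)) \<oplus>\<^bsub>F (Suc n)\<^esub> d (Suc n) (h' x)"
      if x: "x \<in> carrier (F (Suc n))" for x
      unfolding bspec[OF h'(2) x] D_eq[OF x]
      by (rule add_diff[symmetric, OF gc[OF x] lin_maps_closed[OF e x]])
    have dh': "d (Suc n) (h' x) \<in> carrier (F (Suc n))" if "x \<in> carrier (F (Suc n))" for x
      using d_closed lin_maps_closed[OF h'(1) that] by blast
    have Q': "e (Suc n) x = x \<oplus>\<^bsub>F (Suc n)\<^esub> (h (d n x) \<oplus>\<^bsub>F (Suc n)\<^esub> d (Suc n) (h' x))"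
      if x: "x \<in> carrier (F (Suc n))" for x
      unfolding Q[OF x] by (rule FS.M.a_assoc[OF x hd[OF x] dh'[OF x]])
    have "e (Suc n) x = x \<oplus>\<^bsub>F (Suc n)\<^esub> d (Suc n) (h' x)"
      if x: "x \<in> carrier (F (Suc n))" and c: "cycle (Suc n) x" for x
    proof -
      have dz: "d n x = \<zero>\<^bsub>F n\<^esub>" using c by (simp add: cycle_def)
      have hz: "h (d n x) = \<zero>\<^bsub>F (Suc n)\<^esub>"
        unfolding dz by (rule lin_maps_zero[OF lmodule_F lmodule_F h])
      show ?thesis unfolding Q'[OF x] hz FS.M.l_zero[OF dh'[OF x]] ..
    qed
    with h'(1) Q' show "\<exists>h'. ?P (Suc n) h' \<and> ?Q n h h'" by blast
  qed
  then obtain h where h: "\<And>n. ?P n (h n)" "\<And>n. ?Q n (h n) (h (Suc n))" by metis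
  show ?thesis using h by (intro exI[of _ h]) blast
qed

end

text \<open>The previous lift composed with the differential lands in cycles of the second
  resolution, which are boundaries there. That lifts send cycles to cycles is carried along in
  \<open>?P\<close>.\<close>

lemma chain_map_exists:
  assumes "free_res R M I d \<epsilon>" "free_res R M I' d' \<epsilon>'"
  shows "\<exists>f. (\<forall>n. f n \<in> lin_maps R (free_module R (I n)) (free_module R (I' n))) \<and>
    (\<forall>x\<in>carrier (free_module R (I 0)). \<epsilon>' (f 0 x) = \<epsilon> x) \<and>
    (\<forall>n. \<forall>x\<in>carrier (free_module R (I (Suc n))). d' n (f (Suc n) x) = f n (d n x))"
proof -
  interpret P: free_res R M I d \<epsilon> by fact
  interpret Q: free_res R M I' d' \<epsilon>' by fact
  let ?P = "\<lambda>n f. f \<in> lin_maps R (P.F n) (Q.F n) \<and>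
      (\<forall>x\<in>carrier (P.F n). P.cycle n x \<longrightarrow> Q.cycle n (f x)) \<and>
      (n = 0 \<longrightarrow> (\<forall>x\<in>carrier (P.F 0). \<epsilon>' (f x) = \<epsilon> x))"
  let ?Q = "\<lambda>n f f'. \<forall>x\<in>carrier (P.F (Suc n)). d' n (f' x) = f (d n x)"
  have "\<exists>f. \<forall>n. ?P n (f n) \<and> ?Q n (f n) (f (Suc n))"
  proof (rule dependent_nat_choice)
    have "\<epsilon> x \<in> \<epsilon>' ` carrier (Q.F 0)" if "x \<in> carrier (P.F 0)" for x
      using that Q.\<epsilon>_surj lin_maps_closed[OF P.\<epsilon>_lin] by blast
    then obtain f where f: "f \<in> lin_maps R (P.F 0) (Q.F 0)" "\<forall>x\<in>carrier (P.F 0). \<epsilon>' (f x) = \<epsilon> x"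
      using P.R.free_module_lift[OF P.M.lmodule_axioms Q.lmodule_F P.\<epsilon>_lin Q.\<epsilon>_lin] by blast
    then show "\<exists>f. ?P 0 f" by (auto simp: P.cycle_def Q.cycle_def)
  next
    fix f n assume P: "?P n f"
    then have f: "f \<in> lin_maps R (P.F n) (Q.F n)" by blast
    let ?p = "compose (carrier (P.F (Suc n))) f (d n)"
    have p: "?p \<in> lin_maps R (P.F (Suc n)) (Q.F n)"
      by (rule lin_maps_compose[OF P.lmodule_F P.d_lin f])
    have "?p x \<in> d' n ` carrier (Q.F (Suc n))" if x: "x \<in> carrier (P.F (Suc n))" for x
    proof -
      have "Q.cycle n (f (d n x))" using P P.cycle_d[OF x] P.d_closed[OF x] by blast
      then show ?thesis
        using Q.exact[OF lin_maps_closed[OF f P.d_closed[OF x]]] x by (simp add: compose_def)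
    qed
    then obtain f' where f': "f' \<in> lin_maps R (P.F (Suc n)) (Q.F (Suc n))"
      "\<forall>x\<in>carrier (P.F (Suc n)). d' n (f' x) = ?p x"
      using P.R.free_module_lift[OF Q.lmodule_F Q.lmodule_F p Q.d_lin] by blast
    have Q: "d' n (f' x) = f (d n x)" if "x \<in> carrier (P.F (Suc n))" for x
      using f'(2) that by (simp add: compose_def)
    have "Q.cycle (Suc n) (f' x)" if "x \<in> carrier (P.F (Suc n))" "P.cycle (Suc n) x" for x
      using that Q[OF that(1)] lin_maps_zero[OF P.lmodule_F Q.lmodule_F f]
      by (simp add: P.cycle_def Q.cycle_def)
    with f'(1) Q show "\<exists>f'. ?P (Suc n) f' \<and> ?Q n f f'" by blast
  qed
  then obtain f where f: "\<And>n. ?P n (f n)" "\<And>n. ?Q n (f n) (f (Suc n))" by metis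
  show ?thesis using f by (intro exI[of _ f]) blast
qed

section \<open>Transport of cocycles between two resolutions\<close>

locale res_comparison = P: free_res R M I d \<epsilon> + Q: free_res R M I' d' \<epsilon>' + N: lmodule R N
  for R :: "('r, 'x) ring_scheme" (structure) and M :: "('r, 'm) module"
    and I :: "nat \<Rightarrow> 'i set" and d \<epsilon> and I' :: "nat \<Rightarrow> 'j set" and d' \<epsilon>'
    and N :: "('r, 'n) module" +
  fixes f :: "nat \<Rightarrow> ('i \<Rightarrow> 'r) \<Rightarrow> ('j \<Rightarrow> 'r)" and g :: "nat \<Rightarrow> ('j \<Rightarrow> 'r) \<Rightarrow> ('i \<Rightarrow> 'r)"
  assumes f_lin: "f n \<in> lin_maps R (free_module R (I n)) (free_module R (I' n))"
    and g_lin: "g n \<in> lin_maps R (free_module R (I' n)) (free_module R (I n))"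
    and f_aug: "x \<in> carrier (free_module R (I 0)) \<Longrightarrow> \<epsilon>' (f 0 x) = \<epsilon> x"
    and g_aug: "y \<in> carrier (free_module R (I' 0)) \<Longrightarrow> \<epsilon> (g 0 y) = \<epsilon>' y"
    and f_chain: "x \<in> carrier (free_module R (I (Suc n))) \<Longrightarrow> d' n (f (Suc n) x) = f n (d n x)"
    and g_chain: "y \<in> carrier (free_module R (I' (Suc n))) \<Longrightarrow> d n (g (Suc n) y) = g n (d' n y)"
begin

lemma swap: "res_comparison R M I' d' \<epsilon>' I d \<epsilon> N g f"
  by unfold_locales (simp_all add: f_lin g_lin f_aug g_aug f_chain g_chain)

text \<open>Hom is contravariant: cochains on the first resolution are restricted along
  \<open>g\<close>, which runs from the second to the first.\<close>

definition pull :: "nat \<Rightarrow> (('i \<Rightarrow> 'r) \<Rightarrow> 'n) \<Rightarrow> ('j \<Rightarrow> 'r) \<Rightarrow> 'n" where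
  "pull n \<phi> = compose (carrier (Q.F n)) \<phi> (g n)"

lemma f_closed: "x \<in> carrier (P.F n) \<Longrightarrow> f n x \<in> carrier (Q.F n)"
  using f_lin lin_maps_closed by metis

lemma g_closed: "y \<in> carrier (Q.F n) \<Longrightarrow> g n y \<in> carrier (P.F n)"
  using g_lin lin_maps_closed by metis

lemma pull_apply: "y \<in> carrier (Q.F n) \<Longrightarrow> pull n \<phi> y = \<phi> (g n y)"
  by (simp add: pull_def compose_def)

lemma pull_cocycle:
  assumes "P.cocycle N n \<phi>"
  shows "Q.cocycle N n (pull n \<phi>)"
  unfolding Q.cocycle_def
proof (intro conjI ballI)
  have \<phi>: "\<phi> \<in> lin_maps R (P.F n) N" using assms by (simp add: P.cocycle_def)
  show "pull n \<phi> \<in> lin_maps R (Q.F n) N"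
    unfolding pull_def by (rule lin_maps_compose[OF Q.lmodule_F g_lin \<phi>])
  fix y assume y: "y \<in> carrier (Q.F (Suc n))"
  show "pull n \<phi> (d' n y) = \<zero>\<^bsub>N\<^esub>"
    using assms g_closed[OF y] unfolding pull_apply[OF Q.d_closed[OF y]] g_chain[OF y, symmetric]
    by (simp add: P.cocycle_def)
qed

lemma pull_coboundary:
  assumes "P.coboundary N n \<phi>"
  shows "Q.coboundary N n (pull n \<phi>)"
proof (cases n)
  case 0
  then show ?thesis
    using assms g_closed[of _ 0] pull_apply[of _ 0]
    by (simp add: P.coboundary_def Q.coboundary_def pull_def compose_def)
next
  case (Suc m)
  obtain \<psi> where \<psi>: "\<psi> \<in> lin_maps R (P.F m) N" "\<forall>x\<in>carrier (P.F (Suc m)). \<phi> x = \<psi> (d m x)"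
    using assms by (auto simp: P.coboundary_def Suc)
  let ?\<psi> = "compose (carrier (Q.F m)) \<psi> (g m)"
  have "pull (Suc m) \<phi> y = ?\<psi> (d' m y)" if y: "y \<in> carrier (Q.F (Suc m))" for y
    using \<psi>(2) g_closed[OF y] Q.d_closed[OF y] y by (simp add: pull_apply g_chain compose_def)
  moreover have "?\<psi> \<in> lin_maps R (Q.F m) N"
    by (rule lin_maps_compose[OF Q.lmodule_F g_lin \<psi>(1)])
  moreover have "pull (Suc m) \<phi> \<in> extensional (carrier (Q.F (Suc m)))"
    by (simp add: pull_def compose_def)
  ultimately show ?thesis by (auto simp: Q.coboundary_def Suc)
qed

lemma homotopy_gf:
  obtains h where "\<And>n. h n \<in> lin_maps R (P.F n) (P.F (Suc n))"
    and "\<And>x. x \<in> carrier (P.F 0) \<Longrightarrow> g 0 (f 0 x) = x \<oplus>\<^bsub>P.F 0\<^esub> d 0 (h 0 x)"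
    and "\<And>n x. x \<in> carrier (P.F (Suc n)) \<Longrightarrow> g (Suc n) (f (Suc n) x) =
      x \<oplus>\<^bsub>P.F (Suc n)\<^esub> (h n (d n x) \<oplus>\<^bsub>P.F (Suc n)\<^esub> d (Suc n) (h (Suc n) x))"
proof -
  let ?e = "\<lambda>n. compose (carrier (P.F n)) (g n) (f n)"
  have e: "?e n x = g n (f n x)" if "x \<in> carrier (P.F n)" for n x
    using that by (simp add: compose_def)
  have "\<exists>h. (\<forall>n. h n \<in> lin_maps R (P.F n) (P.F (Suc n))) \<and>
    (\<forall>x\<in>carrier (P.F 0). ?e 0 x = x \<oplus>\<^bsub>P.F 0\<^esub> d 0 (h 0 x)) \<and>
    (\<forall>n. \<forall>x\<in>carrier (P.F (Suc n)). ?e (Suc n) x =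
      x \<oplus>\<^bsub>P.F (Suc n)\<^esub> (h n (d n x) \<oplus>\<^bsub>P.F (Suc n)\<^esub> d (Suc n) (h (Suc n) x)))"
  proof (rule P.homotopy)
    show "?e n \<in> lin_maps R (P.F n) (P.F n)" for n
      by (rule lin_maps_compose[OF P.lmodule_F f_lin g_lin])
    show "\<epsilon> (?e 0 x) = \<epsilon> x" if "x \<in> carrier (P.F 0)" for x
      unfolding e[OF that] g_aug[OF f_closed[OF that]] f_aug[OF that] ..
    show "d n (?e (Suc n) x) = ?e n (d n x)" if "x \<in> carrier (P.F (Suc n))" for n x
      unfolding e[OF that] e[OF P.d_closed[OF that]] g_chain[OF f_closed[OF that]] f_chain[OF that] ..
  qed
  then obtain h where h: "\<And>n. h n \<in> lin_maps R (P.F n) (P.F (Suc n))"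
    "\<forall>x\<in>carrier (P.F 0). ?e 0 x = x \<oplus>\<^bsub>P.F 0\<^esub> d 0 (h 0 x)"
    "\<And>n. \<forall>x\<in>carrier (P.F (Suc n)). ?e (Suc n) x =
      x \<oplus>\<^bsub>P.F (Suc n)\<^esub> (h n (d n x) \<oplus>\<^bsub>P.F (Suc n)\<^esub> d (Suc n) (h (Suc n) x))" by blast
  show thesis
  proof (rule that[of h])
    show "h n \<in> lin_maps R (P.F n) (P.F (Suc n))" for n by (rule h(1))
    show "g 0 (f 0 x) = x \<oplus>\<^bsub>P.F 0\<^esub> d 0 (h 0 x)" if "x \<in> carrier (P.F 0)" for x
      unfolding e[OF that, symmetric] by (rule bspec[OF h(2) that])
    show "g (Suc n) (f (Suc n) x) =
        x \<oplus>\<^bsub>P.F (Suc n)\<^esub> (h n (d n x) \<oplus>\<^bsub>P.F (Suc n)\<^esub> d (Suc n) (h (Suc n) x))"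
      if "x \<in> carrier (P.F (Suc n))" for n x
      unfolding e[OF that, symmetric] by (rule bspec[OF h(3) that])
  qed
qed

text \<open>A cocycle kills boundaries, so of the two homotopy terms only
  \<open>\<phi> (h m (d m x))\<close> survives, and this one is a coboundary.\<close>

lemma cocycle_gf:
  assumes h: "\<And>n. h n \<in> lin_maps R (P.F n) (P.F (Suc n))"
    and h0: "\<And>x. x \<in> carrier (P.F 0) \<Longrightarrow> g 0 (f 0 x) = x \<oplus>\<^bsub>P.F 0\<^esub> d 0 (h 0 x)"
    and hS: "\<And>n x. x \<in> carrier (P.F (Suc n)) \<Longrightarrow> g (Suc n) (f (Suc n) x) =
      x \<oplus>\<^bsub>P.F (Suc n)\<^esub> (h n (d n x) \<oplus>\<^bsub>P.F (Suc n)\<^esub> d (Suc n) (h (Suc n) x))"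
    and \<phi>: "P.cocycle N n \<phi>" and x: "x \<in> carrier (P.F n)"
  shows "n = 0 \<Longrightarrow> \<phi> (g n (f n x)) = \<phi> x"
    and "n = Suc m \<Longrightarrow> \<phi> (g n (f n x)) = \<phi> x \<oplus>\<^bsub>N\<^esub> \<phi> (h m (d m x))"
proof -
  have \<phi>l: "\<phi> \<in> lin_maps R (P.F n) N" and \<phi>d: "\<And>y. y \<in> carrier (P.F (Suc n)) \<Longrightarrow> \<phi> (d n y) = \<zero>\<^bsub>N\<^esub>"
    using \<phi> by (simp_all add: P.cocycle_def)
  have hx: "h n x \<in> carrier (P.F (Suc n))" by (rule lin_maps_closed[OF h x])
  have \<phi>x: "\<phi> x \<in> carrier N" by (rule lin_maps_closed[OF \<phi>l x])
  show "\<phi> (g n (f n x)) = \<phi> x" if n: "n = 0"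
  proof -
    have "\<phi> (x \<oplus>\<^bsub>P.F n\<^esub> d n (h n x)) = \<phi> x \<oplus>\<^bsub>N\<^esub> \<phi> (d n (h n x))"
      by (rule lin_maps_add[OF \<phi>l x P.d_closed[OF hx]])
    then show ?thesis using h0 x n \<phi>d[OF hx] \<phi>x by simp
  qed
  show "\<phi> (g n (f n x)) = \<phi> x \<oplus>\<^bsub>N\<^esub> \<phi> (h m (d m x))" if n: "n = Suc m"
  proof -
    interpret Fn: lmodule R "P.F n" by (rule P.lmodule_F)
    have hd: "h m (d m x) \<in> carrier (P.F n)" using n x lin_maps_closed[OF h] P.d_closed by blast
    have dh: "d n (h n x) \<in> carrier (P.F n)" by (rule P.d_closed[OF hx])
    have "\<phi> (x \<oplus>\<^bsub>P.F n\<^esub> (h m (d m x) \<oplus>\<^bsub>P.F n\<^esub> d n (h n x))) =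
        \<phi> x \<oplus>\<^bsub>N\<^esub> (\<phi> (h m (d m x)) \<oplus>\<^bsub>N\<^esub> \<phi> (d n (h n x)))"
      unfolding lin_maps_add[OF \<phi>l x Fn.M.a_closed[OF hd dh]] lin_maps_add[OF \<phi>l hd dh] ..
    then show ?thesis
      using hS[of x m] x n \<phi>d[OF hx] lin_maps_closed[OF \<phi>l hd] by simp
  qed
qed

text \<open>Injectivity on cohomology. If \<open>\<phi>\<close> restricts to the coboundary of
  \<open>\<psi>\<close>, the homotopy shows that \<open>\<phi>\<close> is the coboundary of
  \<open>\<psi>\<close> after \<open>f\<close> minus \<open>\<phi>\<close> after
  \<open>h\<close>.\<close>

lemma coboundary_of_pull:
  assumes \<phi>: "P.cocycle N n \<phi>" and b: "Q.coboundary N n (pull n \<phi>)"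
  shows "P.coboundary N n \<phi>"
proof -
  obtain h where h: "\<And>n. h n \<in> lin_maps R (P.F n) (P.F (Suc n))"
    "\<And>x. x \<in> carrier (P.F 0) \<Longrightarrow> g 0 (f 0 x) = x \<oplus>\<^bsub>P.F 0\<^esub> d 0 (h 0 x)"
    "\<And>n x. x \<in> carrier (P.F (Suc n)) \<Longrightarrow> g (Suc n) (f (Suc n) x) =
      x \<oplus>\<^bsub>P.F (Suc n)\<^esub> (h n (d n x) \<oplus>\<^bsub>P.F (Suc n)\<^esub> d (Suc n) (h (Suc n) x))"
    using homotopy_gf by blast
  note gf = cocycle_gf[OF h \<phi>]
  have \<phi>l: "\<phi> \<in> lin_maps R (P.F n) N" using \<phi> by (simp add: P.cocycle_def)
  have pull: "\<phi> (g n (f n x)) = pull n \<phi> (f n x)" if "x \<in> carrier (P.F n)" for x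
    using f_closed[OF that] by (simp add: pull_apply)
  show ?thesis
  proof (cases n)
    case 0
    have "\<phi> x = \<zero>\<^bsub>N\<^esub>" if "x \<in> carrier (P.F 0)" for x
      using gf(1)[of x] pull[of x] b that f_closed[of x 0] 0 by (simp add: Q.coboundary_def)
    then show ?thesis using 0 lin_maps_ext[OF \<phi>l] by (simp add: P.coboundary_def)
  next
    case (Suc m)
    obtain \<psi> where \<psi>: "\<psi> \<in> lin_maps R (Q.F m) N"
      "\<forall>y\<in>carrier (Q.F (Suc m)). pull (Suc m) \<phi> y = \<psi> (d' m y)"
      using b by (auto simp: Q.coboundary_def Suc)
    let ?\<psi> = "\<lambda>x\<in>carrier (P.F m). compose (carrier (P.F m)) \<psi> (f m) x \<ominus>\<^bsub>N\<^esub>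
        compose (carrier (P.F m)) \<phi> (h m) x"
    have \<phi>l': "\<phi> \<in> lin_maps R (P.F (Suc m)) N" using \<phi>l Suc by simp
    have "?\<psi> \<in> lin_maps R (P.F m) N"
      by (rule lin_maps_diff_fun[OF P.lmodule_F N.lmodule_axioms
            lin_maps_compose[OF P.lmodule_F f_lin \<psi>(1)] lin_maps_compose[OF P.lmodule_F h(1) \<phi>l']])
    moreover have "\<phi> x = ?\<psi> (d m x)" if x: "x \<in> carrier (P.F (Suc m))" for x
    proof -
      have dx: "d m x \<in> carrier (P.F m)" by (rule P.d_closed[OF x])
      have c: "\<phi> x \<in> carrier N" "\<phi> (h m (d m x)) \<in> carrier N"
        using lin_maps_closed[OF \<phi>l'] x lin_maps_closed[OF h(1) dx] by blast+
      have "\<psi> (f m (d m x)) = \<phi> x \<oplus>\<^bsub>N\<^esub> \<phi> (h m (d m x))"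
        using gf(2)[of x m] pull[of x] \<psi>(2) f_closed[OF x] f_chain[OF x] x Suc by metis
      then have "?\<psi> (d m x) = \<phi> x \<oplus>\<^bsub>N\<^esub> \<phi> (h m (d m x)) \<ominus>\<^bsub>N\<^esub> \<phi> (h m (d m x))"
        using dx by (simp add: compose_def)
      also have "\<dots> = \<phi> x" using c by (simp add: a_minus_def N.M.a_assoc N.M.r_neg)
      finally show ?thesis by simp
    qed
    ultimately have "\<exists>\<psi>\<in>lin_maps R (P.F m) N. \<forall>x\<in>carrier (P.F (Suc m)). \<phi> x = \<psi> (d m x)"
      by blast
    then show ?thesis using Suc lin_maps_ext[OF \<phi>l] by (simp add: P.coboundary_def)
  qed
qed

text \<open>Surjectivity on cohomology. Pulling back along \<open>f\<close> and then along
  \<open>g\<close> changes \<open>\<chi>\<close> by the coboundary of \<open>\<chi>\<close> after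
  \<open>h\<close>, where \<open>h\<close> is the homotopy for the composite in the other
  order.\<close>

lemma cocycle_lift:
  assumes \<chi>: "Q.cocycle N n \<chi>"
  shows "\<exists>\<phi>. P.cocycle N n \<phi> \<and> Q.coboundary N n (\<lambda>y\<in>carrier (Q.F n). pull n \<phi> y \<ominus>\<^bsub>N\<^esub> \<chi> y)"
proof -
  interpret S: res_comparison R M I' d' \<epsilon>' I d \<epsilon> N g f by (rule swap)
  obtain h where h: "\<And>n. h n \<in> lin_maps R (Q.F n) (Q.F (Suc n))"
    "\<And>x. x \<in> carrier (Q.F 0) \<Longrightarrow> f 0 (g 0 x) = x \<oplus>\<^bsub>Q.F 0\<^esub> d' 0 (h 0 x)"
    "\<And>n x. x \<in> carrier (Q.F (Suc n)) \<Longrightarrow> f (Suc n) (g (Suc n) x) =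
      x \<oplus>\<^bsub>Q.F (Suc n)\<^esub> (h n (d' n x) \<oplus>\<^bsub>Q.F (Suc n)\<^esub> d' (Suc n) (h (Suc n) x))"
    using S.homotopy_gf by blast
  note fg = S.cocycle_gf[OF h \<chi>]
  have \<chi>l: "\<chi> \<in> lin_maps R (Q.F n) N" using \<chi> by (simp add: Q.cocycle_def)
  let ?\<phi> = "S.pull n \<chi>"
  have p: "pull n ?\<phi> y = \<chi> (f n (g n y))" if "y \<in> carrier (Q.F n)" for y
    using g_closed[OF that] that by (simp add: pull_apply S.pull_apply)
  have "Q.coboundary N n (\<lambda>y\<in>carrier (Q.F n). pull n ?\<phi> y \<ominus>\<^bsub>N\<^esub> \<chi> y)"
  proof (cases n)
    case 0
    then show ?thesis
      using p fg(1) lin_maps_closed[OF \<chi>l] by (simp add: Q.coboundary_def a_minus_def N.M.r_neg)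
  next
    case (Suc m)
    have \<chi>l': "\<chi> \<in> lin_maps R (Q.F (Suc m)) N" using \<chi>l Suc by simp
    let ?\<psi> = "compose (carrier (Q.F m)) \<chi> (h m)"
    have "?\<psi> \<in> lin_maps R (Q.F m) N" by (rule lin_maps_compose[OF Q.lmodule_F h(1) \<chi>l'])
    moreover have "pull n ?\<phi> y \<ominus>\<^bsub>N\<^esub> \<chi> y = ?\<psi> (d' m y)" if y: "y \<in> carrier (Q.F (Suc m))" for y
    proof -
      have dy: "d' m y \<in> carrier (Q.F m)" by (rule Q.d_closed[OF y])
      have c: "\<chi> y \<in> carrier N" "\<chi> (h m (d' m y)) \<in> carrier N"
        using lin_maps_closed[OF \<chi>l'] y lin_maps_closed[OF h(1) dy] by blast+
      have "pull n ?\<phi> y \<ominus>\<^bsub>N\<^esub> \<chi> y = \<chi> y \<oplus>\<^bsub>N\<^esub> \<chi> (h m (d' m y)) \<ominus>\<^bsub>N\<^esub> \<chi> y"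
        using p[of y] fg(2)[of y m] y Suc by simp
      also have "\<dots> = \<chi> (h m (d' m y))"
        using c by (simp add: a_minus_def N.M.a_comm[of "\<chi> y"] N.M.a_assoc N.M.r_neg)
      finally show ?thesis using dy by (simp add: compose_def)
    qed
    ultimately show ?thesis using Suc unfolding Q.coboundary_def by auto
  qed
  with S.pull_cocycle[OF \<chi>] show ?thesis by blast
qed

end

section \<open>Ext from an arbitrary free resolution\<close>

context free_res
begin

context
  fixes N :: "('r, 'n) module"
  assumes N: "lmodule R N"
begin

interpretation N: lmodule R N by (rule N)

lemma coboundary_Suc:
  "coboundary N (Suc m) \<phi> \<longleftrightarrow> (\<exists>\<psi>\<in>lin_maps R (F m) N. \<phi> = compose (carrier (F (Suc m))) \<psi> (d m))"
proof
  assume "coboundary N (Suc m) \<phi>"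
  then obtain \<psi> where \<psi>: "\<psi> \<in> lin_maps R (F m) N" "\<forall>x\<in>carrier (F (Suc m)). \<phi> x = \<psi> (d m x)"
    and e: "\<phi> \<in> extensional (carrier (F (Suc m)))"
    by (auto simp: coboundary_def)
  then have "\<phi> = compose (carrier (F (Suc m))) \<psi> (d m)"
    by (intro extensionalityI[OF e]) (simp_all add: compose_def)
  with \<psi>(1) show "\<exists>\<psi>\<in>lin_maps R (F m) N. \<phi> = compose (carrier (F (Suc m))) \<psi> (d m)" by blast
next
  assume "\<exists>\<psi>\<in>lin_maps R (F m) N. \<phi> = compose (carrier (F (Suc m))) \<psi> (d m)"
  then obtain \<psi> where "\<psi> \<in> lin_maps R (F m) N" "\<phi> = compose (carrier (F (Suc m))) \<psi> (d m)" by blast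
  then show "coboundary N (Suc m) \<phi>"
    by (auto simp: coboundary_def compose_def intro!: bexI[of _ \<psi>])
qed

lemma coboundary_0:
  "coboundary N 0 \<phi> \<longleftrightarrow> \<phi> = (\<lambda>x\<in>carrier (F 0). \<zero>\<^bsub>N\<^esub>)"
proof
  assume *: "coboundary N 0 \<phi>"
  show "\<phi> = (\<lambda>x\<in>carrier (F 0). \<zero>\<^bsub>N\<^esub>)"
    by (rule extensionalityI[of _ "carrier (F 0)"]) (use * in \<open>auto simp: coboundary_def\<close>)
qed (simp add: coboundary_def)

lemma cocycle_zero: "cocycle N n (\<lambda>x\<in>carrier (F n). \<zero>\<^bsub>N\<^esub>)"
  using lin_maps_zero_fun[OF lmodule_F N] d_closed by (auto simp: cocycle_def)

lemma cocycle_add: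
  assumes "cocycle N n \<phi>" "cocycle N n \<psi>"
  shows "cocycle N n (\<lambda>x\<in>carrier (F n). \<phi> x \<oplus>\<^bsub>N\<^esub> \<psi> x)"
  using lin_maps_add_fun[OF lmodule_F N, of \<phi> n \<psi>] assms d_closed by (simp add: cocycle_def)

lemma cocycle_diff:
  assumes "cocycle N n \<phi>" "cocycle N n \<psi>"
  shows "cocycle N n (\<lambda>x\<in>carrier (F n). \<phi> x \<ominus>\<^bsub>N\<^esub> \<psi> x)"
  using lin_maps_diff_fun[OF lmodule_F N, of \<phi> n \<psi>] assms d_closed
  by (simp add: cocycle_def a_minus_def N.M.r_neg)

lemma cocycle_closed: "cocycle N n \<phi> \<Longrightarrow> x \<in> carrier (F n) \<Longrightarrow> \<phi> x \<in> carrier N"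
  using lin_maps_closed[of \<phi> R "F n" N x] by (simp add: cocycle_def)

lemma cocycle_ext: "cocycle N n \<phi> \<Longrightarrow> \<phi> \<in> extensional (carrier (F n))"
  using lin_maps_ext[of \<phi> R "F n" N] by (simp add: cocycle_def)

lemma cocycle_coboundary:
  assumes "coboundary N n \<phi>"
  shows "cocycle N n \<phi>"
proof (cases n)
  case 0
  then show ?thesis using assms cocycle_zero coboundary_0 by simp
next
  case (Suc m)
  then obtain \<psi> where \<psi>: "\<psi> \<in> lin_maps R (F m) N" "\<phi> = compose (carrier (F (Suc m))) \<psi> (d m)"
    using assms coboundary_Suc by blast
  have "\<phi> (d (Suc m) x) = \<zero>\<^bsub>N\<^esub>" if "x \<in> carrier (F (Suc (Suc m)))" for x
    using \<psi>(2) that d_closed[OF that] d_d[OF that] lin_maps_zero[OF lmodule_F N \<psi>(1)]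
    by (simp add: compose_def)
  then show ?thesis
    using lin_maps_compose[OF lmodule_F d_lin \<psi>(1)] by (simp add: cocycle_def \<psi>(2) Suc)
qed

lemma coboundary_zero: "coboundary N n (\<lambda>x\<in>carrier (F n). \<zero>\<^bsub>N\<^esub>)"
proof (cases n)
  case (Suc m)
  then show ?thesis
    using d_closed[of _ m]
    by (auto simp: coboundary_def intro!: bexI[OF _ lin_maps_zero_fun[OF lmodule_F N]])
qed (simp add: coboundary_0)

lemma coboundary_diff:
  assumes "coboundary N n \<phi>" "coboundary N n \<psi>"
  shows "coboundary N n (\<lambda>x\<in>carrier (F n). \<phi> x \<ominus>\<^bsub>N\<^esub> \<psi> x)"
proof (cases n)
  case 0
  then show ?thesis using assms by (simp add: coboundary_def a_minus_def)
next
  case (Suc m)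
  obtain p q where p: "p \<in> lin_maps R (F m) N" "\<forall>x\<in>carrier (F (Suc m)). \<phi> x = p (d m x)"
    and q: "q \<in> lin_maps R (F m) N" "\<forall>x\<in>carrier (F (Suc m)). \<psi> x = q (d m x)"
    using assms by (auto simp: coboundary_def Suc)
  show ?thesis
    using p(2) q(2) d_closed[of _ m]
    by (auto simp: coboundary_def Suc intro!: bexI[OF _ lin_maps_diff_fun[OF lmodule_F N p(1) q(1)]])
qed

definition cocycle_group :: "nat \<Rightarrow> (('i \<Rightarrow> 'r) \<Rightarrow> 'n) ring" where
  "cocycle_group n = (Hom_group R (F n) N)\<lparr>carrier := {\<phi>. cocycle N n \<phi>}\<rparr>"

lemma cocycle_group_simps [simp]:
  "carrier (cocycle_group n) = {\<phi>. cocycle N n \<phi>}"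
  "\<zero>\<^bsub>cocycle_group n\<^esub> = (\<lambda>x\<in>carrier (F n). \<zero>\<^bsub>N\<^esub>)"
  "\<phi> \<oplus>\<^bsub>cocycle_group n\<^esub> \<psi> = (\<lambda>x\<in>carrier (F n). \<phi> x \<oplus>\<^bsub>N\<^esub> \<psi> x)"
  by (simp_all add: cocycle_group_def Hom_group_def)

lemma abelian_group_cocycle_group: "abelian_group (cocycle_group n)"
proof (rule abelian_groupI)
  fix \<phi> \<psi> \<chi> assume "\<phi> \<in> carrier (cocycle_group n)" "\<psi> \<in> carrier (cocycle_group n)"
    "\<chi> \<in> carrier (cocycle_group n)"
  then have c: "cocycle N n \<phi>" "cocycle N n \<psi>" "cocycle N n \<chi>" by simp_all
  show "\<phi> \<oplus>\<^bsub>cocycle_group n\<^esub> \<psi> \<in> carrier (cocycle_group n)" using c cocycle_add by simp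
  show "\<zero>\<^bsub>cocycle_group n\<^esub> \<oplus>\<^bsub>cocycle_group n\<^esub> \<phi> = \<phi>"
    by (rule extensionalityI[of _ "carrier (F n)"])
      (use c cocycle_closed cocycle_ext in auto)
  show "\<phi> \<oplus>\<^bsub>cocycle_group n\<^esub> \<psi> = \<psi> \<oplus>\<^bsub>cocycle_group n\<^esub> \<phi>"
    using c cocycle_closed by (auto simp: fun_eq_iff restrict_def N.M.a_comm)
  show "\<phi> \<oplus>\<^bsub>cocycle_group n\<^esub> \<psi> \<oplus>\<^bsub>cocycle_group n\<^esub> \<chi> =
      \<phi> \<oplus>\<^bsub>cocycle_group n\<^esub> (\<psi> \<oplus>\<^bsub>cocycle_group n\<^esub> \<chi>)"
    using c cocycle_closed by (auto simp: fun_eq_iff restrict_def N.M.a_assoc)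
  have "(\<lambda>x\<in>carrier (F n). \<zero>\<^bsub>N\<^esub> \<ominus>\<^bsub>N\<^esub> \<phi> x) \<oplus>\<^bsub>cocycle_group n\<^esub> \<phi> = \<zero>\<^bsub>cocycle_group n\<^esub>"
    using c cocycle_closed by (auto simp: fun_eq_iff restrict_def a_minus_def N.M.l_neg)
  moreover have "cocycle N n (\<lambda>x\<in>carrier (F n). \<zero>\<^bsub>N\<^esub> \<ominus>\<^bsub>N\<^esub> \<phi> x)"
    using cocycle_diff[OF cocycle_zero c(1)] by (simp cong: restrict_cong)
  ultimately show "\<exists>\<psi>\<in>carrier (cocycle_group n). \<psi> \<oplus>\<^bsub>cocycle_group n\<^esub> \<phi> = \<zero>\<^bsub>cocycle_group n\<^esub>"
    by auto
qed (use cocycle_zero in simp)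

lemma cocycle_group_minus:
  assumes "cocycle N n \<phi>" "cocycle N n \<psi>"
  shows "\<phi> \<ominus>\<^bsub>cocycle_group n\<^esub> \<psi> = (\<lambda>x\<in>carrier (F n). \<phi> x \<ominus>\<^bsub>N\<^esub> \<psi> x)"
proof -
  interpret Z: abelian_group "cocycle_group n" by (rule abelian_group_cocycle_group)
  let ?d = "\<lambda>x\<in>carrier (F n). \<phi> x \<ominus>\<^bsub>N\<^esub> \<psi> x"
  have d: "?d \<in> carrier (cocycle_group n)" using cocycle_diff[OF assms] by simp
  have p: "\<psi> \<in> carrier (cocycle_group n)" using assms by simp
  have "?d \<oplus>\<^bsub>cocycle_group n\<^esub> \<psi> = \<phi>"
    by (rule extensionalityI[of _ "carrier (F n)"])
      (use assms cocycle_closed cocycle_ext in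
        \<open>auto simp: a_minus_def N.M.a_assoc N.M.l_neg\<close>)
  then have "\<phi> \<ominus>\<^bsub>cocycle_group n\<^esub> \<psi> = (?d \<oplus>\<^bsub>cocycle_group n\<^esub> \<psi>) \<ominus>\<^bsub>cocycle_group n\<^esub> \<psi>"
    by (rule arg_cong[symmetric])
  also have "\<dots> = ?d"
    unfolding a_minus_def[of "cocycle_group n"] Z.a_assoc[OF d p Z.a_inv_closed[OF p]]
      Z.r_neg[OF p] by (rule Z.r_zero[OF d])
  finally show ?thesis .
qed

lemma abelian_subgroup_coboundary: "abelian_subgroup {\<phi>. coboundary N n \<phi>} (cocycle_group n)"
proof -
  interpret Z: abelian_group "cocycle_group n" by (rule abelian_group_cocycle_group)
  have sub: "coboundary N n (\<phi> \<ominus>\<^bsub>cocycle_group n\<^esub> \<psi>)" if "coboundary N n \<phi>" "coboundary N n \<psi>" for \<phi> \<psi>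
    using that coboundary_diff cocycle_coboundary by (simp add: cocycle_group_minus)
  have zero: "coboundary N n \<zero>\<^bsub>cocycle_group n\<^esub>" using coboundary_zero by simp
  have car: "\<phi> \<in> carrier (cocycle_group n)" if "coboundary N n \<phi>" for \<phi>
    using that cocycle_coboundary by simp
  have inv: "coboundary N n (\<ominus>\<^bsub>cocycle_group n\<^esub> \<phi>)" if "coboundary N n \<phi>" for \<phi>
    using sub[OF zero that] Z.l_zero[OF Z.a_inv_closed[OF car[OF that]]] unfolding a_minus_def by metis
  have add: "coboundary N n (\<phi> \<oplus>\<^bsub>cocycle_group n\<^esub> \<psi>)" if "coboundary N n \<phi>" "coboundary N n \<psi>" for \<phi> \<psi>
    using sub[OF that(1) inv[OF that(2)]] Z.minus_minus[OF car[OF that(2)]] unfolding a_minus_def by metis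
  have "subgroup {\<phi>. coboundary N n \<phi>} (add_monoid (cocycle_group n))"
    by (rule subgroup.intro)
      (use add inv zero car in \<open>auto simp del: cocycle_group_simps simp: a_inv_def\<close>)
  then show ?thesis
    by (intro abelian_subgroupI3 additive_subgroup.intro abelian_group_cocycle_group)
qed

end

end

lemma (in abelian_subgroup) a_rcos_eq_iff:
  assumes "x \<in> carrier G" "y \<in> carrier G"
  shows "H +> x = H +> y \<longleftrightarrow> x \<ominus> y \<in> H"
proof
  assume "H +> x = H +> y"
  then have "x \<in> H +> y" using a_rcos_self[OF assms(1)] by simp
  then show "x \<ominus> y \<in> H" using a_rcos_module_imp[OF assms(2)] by (simp add: a_minus_def)
next
  assume *: "x \<ominus> y \<in> H"
  have "x = (x \<ominus> y) \<oplus> y" using assms by (simp add: a_minus_def a_assoc l_neg)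
  then have "x \<in> H +> y" using * by (auto simp: a_r_coset_def r_coset_def)
  then show "H +> x = H +> y" using a_repr_independence'[OF _ assms(2)] by simp
qed

text \<open>The first resolution is the one selected in the definition of Ext, about which nothing
  is known except that it is a free resolution.\<close>

locale ext_comparison = res_comparison R M "fst (resolution R M)" "snd (resolution R M)" \<epsilon> I' d' \<epsilon>' N f g
  for R :: "('r, 'x) ring_scheme" (structure) and M :: "('r, 'm) module" and \<epsilon>
    and I' :: "nat \<Rightarrow> 'j set" and d' \<epsilon>' and N :: "('r, 'n) module" and f g
begin

lemma res_module_eq: "res_module R M n = P.F n"
  by (simp add: res_module_def)

lemma res_diff_eq: "res_diff R M = snd (resolution R M)"
  by (simp add: res_diff_def)

lemma cocycles_eq: "cocycles R M N n = P.cocycle_group N n"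
  by (simp add: cocycles_def P.cocycle_group_def[OF N.lmodule_axioms] res_module_eq res_diff_eq
      P.cocycle_def)

lemma coboundaries_eq: "coboundaries R M N n = {\<phi>. P.coboundary N n \<phi>}"
  by (cases n) (auto simp: coboundaries_def res_module_eq res_diff_eq
      P.coboundary_Suc[OF N.lmodule_axioms] P.coboundary_0[OF N.lmodule_axioms])

abbreviation "B n \<equiv> {\<phi>. P.coboundary N n \<phi>}"
abbreviation "Z n \<equiv> P.cocycle_group N n"
abbreviation "cls n \<phi> \<equiv> B n +>\<^bsub>Z n\<^esub> \<phi>"

lemma Ext_carrier: "carrier (Ext R n M N) = cls n ` {\<phi>. P.cocycle N n \<phi>}"
  by (auto simp: Ext_def cocycles_eq coboundaries_eq A_RCOSETS_def' a_r_coset_def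
      P.cocycle_group_simps[OF N.lmodule_axioms])

lemma sub: "abelian_subgroup (B n) (Z n)"
  by (rule P.abelian_subgroup_coboundary[OF N.lmodule_axioms])

lemma cls_eq_iff:
  assumes "P.cocycle N n \<phi>" "P.cocycle N n \<psi>"
  shows "cls n \<phi> = cls n \<psi> \<longleftrightarrow> P.coboundary N n (\<lambda>x\<in>carrier (P.F n). \<phi> x \<ominus>\<^bsub>N\<^esub> \<psi> x)"
  using abelian_subgroup.a_rcos_eq_iff[OF sub[of n], of \<phi> \<psi>] assms
  by (simp add: P.cocycle_group_simps[OF N.lmodule_axioms] P.cocycle_group_minus[OF N.lmodule_axioms])

lemma Ext_add:
  assumes "P.cocycle N n \<phi>" "P.cocycle N n \<psi>"
  shows "cls n \<phi> \<oplus>\<^bsub>Ext R n M N\<^esub> cls n \<psi> = cls n (\<lambda>x\<in>carrier (P.F n). \<phi> x \<oplus>\<^bsub>N\<^esub> \<psi> x)"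
  using abelian_subgroup.a_rcos_sum[OF sub[of n], of \<phi> \<psi>] assms
  by (simp add: Ext_def cocycles_eq P.cocycle_group_simps[OF N.lmodule_axioms])

lemma mem_cls:
  assumes "P.cocycle N n \<phi>" "\<psi> \<in> cls n \<phi>"
  shows "P.cocycle N n \<psi>" "cls n \<psi> = cls n \<phi>"
proof -
  show c: "P.cocycle N n \<psi>"
    using abelian_subgroup.a_elemrcos_carrier[OF sub[of n] _ assms(2)] assms(1)
    by (simp add: P.cocycle_group_simps[OF N.lmodule_axioms])
  show "cls n \<psi> = cls n \<phi>"
    using abelian_subgroup.a_repr_independence'[OF sub[of n] assms(2)] assms(1)
    by (simp add: P.cocycle_group_simps[OF N.lmodule_axioms])
qed

lemma self_mem_cls: "P.cocycle N n \<phi> \<Longrightarrow> \<phi> \<in> cls n \<phi>"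
  using abelian_subgroup.a_rcos_self[OF sub[of n], of \<phi>]
  by (simp add: P.cocycle_group_simps[OF N.lmodule_axioms])

lemma compose_cocycle:
  assumes \<phi>: "P.cocycle N n \<phi>" and \<theta>: "restrict \<theta> (carrier N) \<in> lin_maps R N N"
  shows "P.cocycle N n (compose (carrier (P.F n)) \<theta> \<phi>)"
proof -
  have \<phi>l: "\<phi> \<in> lin_maps R (P.F n) N" using \<phi> by (simp add: P.cocycle_def)
  have eq: "compose (carrier (P.F n)) (restrict \<theta> (carrier N)) \<phi> = compose (carrier (P.F n)) \<theta> \<phi>"
    using lin_maps_closed[OF \<phi>l] by (auto simp: compose_def restrict_def)
  have "\<theta> \<zero>\<^bsub>N\<^esub> = \<zero>\<^bsub>N\<^esub>"
    using lin_maps_zero[OF N.lmodule_axioms N.lmodule_axioms \<theta>] by simp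
  then have "compose (carrier (P.F n)) \<theta> \<phi> (snd (resolution R M) n x) = \<zero>\<^bsub>N\<^esub>"
    if "x \<in> carrier (P.F (Suc n))" for x
    using that \<phi> P.d_closed[OF that] by (simp add: P.cocycle_def compose_def)
  then show ?thesis
    using lin_maps_compose[OF P.lmodule_F \<phi>l \<theta>] unfolding eq by (simp add: P.cocycle_def)
qed

lemma compose_coboundary:
  assumes \<phi>: "P.coboundary N n \<phi>" and \<theta>: "restrict \<theta> (carrier N) \<in> lin_maps R N N"
  shows "P.coboundary N n (compose (carrier (P.F n)) \<theta> \<phi>)"
proof (cases n)
  case 0
  have "\<theta> \<zero>\<^bsub>N\<^esub> = \<zero>\<^bsub>N\<^esub>"
    using lin_maps_zero[OF N.lmodule_axioms N.lmodule_axioms \<theta>] by simp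
  then show ?thesis using \<phi> 0 by (simp add: P.coboundary_def compose_def)
next
  case (Suc m)
  obtain \<psi> where \<psi>: "\<psi> \<in> lin_maps R (P.F m) N" "\<forall>x\<in>carrier (P.F (Suc m)). \<phi> x = \<psi> (snd (resolution R M) m x)"
    using \<phi> by (auto simp: P.coboundary_def Suc)
  show ?thesis
    using \<psi>(2) P.d_closed[of _ m] lin_maps_closed[OF \<psi>(1)]
    by (auto simp: P.coboundary_def Suc compose_def
        intro!: bexI[OF _ lin_maps_compose[OF P.lmodule_F \<psi>(1) \<theta>]])
qed

text \<open>The union in \<open>Ext_map\<close> is a single class because composition with
  \<open>\<theta>\<close> preserves coboundaries.\<close>

lemma Ext_map_cls:
  assumes \<phi>: "P.cocycle N n \<phi>" and \<theta>: "restrict \<theta> (carrier N) \<in> lin_maps R N N"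
  shows "Ext_map R n M N \<theta> (cls n \<phi>) = cls n (compose (carrier (P.F n)) \<theta> \<phi>)"
proof -
  have "cls n (compose (carrier (P.F n)) \<theta> \<psi>) = cls n (compose (carrier (P.F n)) \<theta> \<phi>)"
    if "\<psi> \<in> cls n \<phi>" for \<psi>
  proof -
    have \<psi>: "P.cocycle N n \<psi>" "cls n \<psi> = cls n \<phi>" using mem_cls[OF \<phi> that] by blast+
    then have b: "P.coboundary N n (\<lambda>x\<in>carrier (P.F n). \<psi> x \<ominus>\<^bsub>N\<^esub> \<phi> x)"
      using cls_eq_iff \<phi> by blast
    have "\<theta> (\<psi> x \<ominus>\<^bsub>N\<^esub> \<phi> x) = \<theta> (\<psi> x) \<ominus>\<^bsub>N\<^esub> \<theta> (\<phi> x)" if x: "x \<in> carrier (P.F n)" for x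
      using lin_maps_diff[OF N.lmodule_axioms N.lmodule_axioms \<theta>, of "\<psi> x" "\<phi> x"]
        P.cocycle_closed[OF N.lmodule_axioms _ x] \<phi> \<psi>(1) by (simp add: N.M.minus_closed)
    then have "compose (carrier (P.F n)) \<theta> (\<lambda>x\<in>carrier (P.F n). \<psi> x \<ominus>\<^bsub>N\<^esub> \<phi> x) =
        (\<lambda>x\<in>carrier (P.F n). compose (carrier (P.F n)) \<theta> \<psi> x \<ominus>\<^bsub>N\<^esub> compose (carrier (P.F n)) \<theta> \<phi> x)"
      by (auto simp: compose_def restrict_def)
    then show ?thesis
      using compose_coboundary[OF b \<theta>] cls_eq_iff compose_cocycle[OF \<phi> \<theta>] compose_cocycle[OF \<psi>(1) \<theta>]
      by simp
  qed
  then show ?thesis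
    using self_mem_cls[OF \<phi>] unfolding Ext_map_def cocycles_eq coboundaries_eq res_module_eq by blast
qed

lemma Ext_map_closed:
  assumes X: "X \<in> carrier (Ext R n M N)" and \<theta>: "restrict \<theta> (carrier N) \<in> lin_maps R N N"
  shows "Ext_map R n M N \<theta> X \<in> carrier (Ext R n M N)"
proof -
  obtain \<phi> where "P.cocycle N n \<phi>" "X = cls n \<phi>" using X unfolding Ext_carrier by blast
  then show ?thesis
    using Ext_map_cls[of n \<phi> \<theta>] compose_cocycle[of n \<phi> \<theta>] \<theta> unfolding Ext_carrier by blast
qed

lemma Ext_trivial:
  assumes "\<And>\<chi>. Q.cocycle N n \<chi> \<Longrightarrow> Q.coboundary N n \<chi>"
  shows "\<exists>X. carrier (Ext R n M N) = {X}"
proof -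
  let ?z = "\<lambda>x\<in>carrier (P.F n). \<zero>\<^bsub>N\<^esub>"
  have z: "P.cocycle N n ?z" by (rule P.cocycle_zero[OF N.lmodule_axioms])
  have "cls n \<phi> = cls n ?z" if \<phi>: "P.cocycle N n \<phi>" for \<phi>
  proof -
    have "P.coboundary N n \<phi>" using coboundary_of_pull[OF \<phi>] assms pull_cocycle[OF \<phi>] by blast
    then have "P.coboundary N n (\<lambda>x\<in>carrier (P.F n). \<phi> x \<ominus>\<^bsub>N\<^esub> ?z x)"
      using P.coboundary_diff[OF N.lmodule_axioms _ P.coboundary_zero[OF N.lmodule_axioms]] by blast
    then show ?thesis using cls_eq_iff[OF \<phi> z] by blast
  qed
  then show ?thesis using z unfolding Ext_carrier by blast
qed

lemma pull_diff: "Q.coboundary N n (\<lambda>y\<in>carrier (Q.F n). pull n \<phi> y \<ominus>\<^bsub>N\<^esub> pull n \<psi> y) \<longleftrightarrow>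
    Q.coboundary N n (pull n (\<lambda>x\<in>carrier (P.F n). \<phi> x \<ominus>\<^bsub>N\<^esub> \<psi> x))"
proof -
  have "(\<lambda>y\<in>carrier (Q.F n). pull n \<phi> y \<ominus>\<^bsub>N\<^esub> pull n \<psi> y) =
      pull n (\<lambda>x\<in>carrier (P.F n). \<phi> x \<ominus>\<^bsub>N\<^esub> \<psi> x)"
    using g_closed[of _ n] by (auto simp: pull_def compose_def restrict_def)
  then show ?thesis by simp
qed

text \<open>Ext is not formed a second time from the other resolution. Instead any
  \<open>\<tau>\<close> that separates its cocycles exactly modulo coboundaries describes the
  classes; sums and induced maps are tracked through representing cocycles, so the algebraic
  structure on the values of \<open>\<tau>\<close> is left to the application.\<close>

lemma Ext_iso:
  assumes \<tau>: "\<And>\<chi> \<chi>'. Q.cocycle N n \<chi> \<Longrightarrow> Q.cocycle N n \<chi>' \<Longrightarrow>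
      \<tau> \<chi> = \<tau> \<chi>' \<longleftrightarrow> Q.coboundary N n (\<lambda>y\<in>carrier (Q.F n). \<chi> y \<ominus>\<^bsub>N\<^esub> \<chi>' y)"
  shows "\<exists>\<Phi>. bij_betw \<Phi> (carrier (Ext R n M N)) (\<tau> ` {\<chi>. Q.cocycle N n \<chi>}) \<and>
    (\<forall>X\<in>carrier (Ext R n M N). \<forall>Y\<in>carrier (Ext R n M N). \<exists>\<chi> \<chi>'. Q.cocycle N n \<chi> \<and> Q.cocycle N n \<chi>' \<and>
      \<Phi> X = \<tau> \<chi> \<and> \<Phi> Y = \<tau> \<chi>' \<and>
      \<Phi> (X \<oplus>\<^bsub>Ext R n M N\<^esub> Y) = \<tau> (\<lambda>y\<in>carrier (Q.F n). \<chi> y \<oplus>\<^bsub>N\<^esub> \<chi>' y)) \<and>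
    (\<forall>X\<in>carrier (Ext R n M N). \<forall>\<theta>. restrict \<theta> (carrier N) \<in> lin_maps R N N \<longrightarrow>
      (\<exists>\<chi>. Q.cocycle N n \<chi> \<and> \<Phi> X = \<tau> \<chi> \<and>
        \<Phi> (Ext_map R n M N \<theta> X) = \<tau> (compose (carrier (Q.F n)) \<theta> \<chi>)))"
proof -
  note Nm = N.lmodule_axioms
  define \<Phi> where "\<Phi> X = \<tau> (pull n (SOME \<phi>. P.cocycle N n \<phi> \<and> X = cls n \<phi>))" for X
  have pull_eq: "\<tau> (pull n \<phi>) = \<tau> (pull n \<psi>) \<longleftrightarrow> cls n \<phi> = cls n \<psi>"
    if "P.cocycle N n \<phi>" "P.cocycle N n \<psi>" for \<phi> \<psi>
  proof -
    have "Q.coboundary N n (pull n (\<lambda>x\<in>carrier (P.F n). \<phi> x \<ominus>\<^bsub>N\<^esub> \<psi> x)) \<longleftrightarrow>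
        P.coboundary N n (\<lambda>x\<in>carrier (P.F n). \<phi> x \<ominus>\<^bsub>N\<^esub> \<psi> x)"
      using coboundary_of_pull[OF P.cocycle_diff[OF Nm that]] pull_coboundary by blast
    then show ?thesis
      unfolding \<tau>[OF pull_cocycle[OF that(1)] pull_cocycle[OF that(2)]] cls_eq_iff[OF that] pull_diff .
  qed
  \<comment> \<open>The representative selected in the definition of \<open>\<Phi>\<close> is
    harmless: by \<open>pull_eq\<close> the value depends only on the class.\<close>
  have \<Phi>: "\<Phi> (cls n \<phi>) = \<tau> (pull n \<phi>)" if \<phi>: "P.cocycle N n \<phi>" for \<phi>
  proof -
    define \<psi> where "\<psi> = (SOME \<psi>. P.cocycle N n \<psi> \<and> cls n \<phi> = cls n \<psi>)"
    have \<psi>: "P.cocycle N n \<psi> \<and> cls n \<phi> = cls n \<psi>"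
      unfolding \<psi>_def by (rule someI[of _ \<phi>]) (simp add: \<phi>)
    then have "\<tau> (pull n \<psi>) = \<tau> (pull n \<phi>)"
      using pull_eq[OF conjunct1[OF \<psi>] \<phi>] by simp
    then show ?thesis unfolding \<Phi>_def \<psi>_def .
  qed
  have inj: "inj_on \<Phi> (carrier (Ext R n M N))"
    unfolding Ext_carrier
  proof (rule inj_onI)
    fix X Y assume X: "X \<in> cls n ` {\<phi>. P.cocycle N n \<phi>}" and Y: "Y \<in> cls n ` {\<phi>. P.cocycle N n \<phi>}"
      and eq: "\<Phi> X = \<Phi> Y"
    obtain \<phi> where \<phi>: "P.cocycle N n \<phi>" "X = cls n \<phi>" using X by blast
    obtain \<psi> where \<psi>: "P.cocycle N n \<psi>" "Y = cls n \<psi>" using Y by blast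
    show "X = Y" using eq unfolding \<phi>(2) \<psi>(2) \<Phi>[OF \<phi>(1)] \<Phi>[OF \<psi>(1)] pull_eq[OF \<phi>(1) \<psi>(1)] .
  qed
  have "\<Phi> ` carrier (Ext R n M N) = \<tau> ` {\<chi>. Q.cocycle N n \<chi>}"
  proof
    show "\<Phi> ` carrier (Ext R n M N) \<subseteq> \<tau> ` {\<chi>. Q.cocycle N n \<chi>}"
    proof
      fix a assume "a \<in> \<Phi> ` carrier (Ext R n M N)"
      then obtain \<phi> where \<phi>: "P.cocycle N n \<phi>" "a = \<Phi> (cls n \<phi>)" unfolding Ext_carrier by blast
      show "a \<in> \<tau> ` {\<chi>. Q.cocycle N n \<chi>}"
        unfolding \<phi>(2) \<Phi>[OF \<phi>(1)] using pull_cocycle[OF \<phi>(1)] by blast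
    qed
    show "\<tau> ` {\<chi>. Q.cocycle N n \<chi>} \<subseteq> \<Phi> ` carrier (Ext R n M N)"
    proof
      fix a assume "a \<in> \<tau> ` {\<chi>. Q.cocycle N n \<chi>}"
      then obtain \<chi> where \<chi>: "Q.cocycle N n \<chi>" "a = \<tau> \<chi>" by blast
      obtain \<phi> where \<phi>: "P.cocycle N n \<phi>"
        "Q.coboundary N n (\<lambda>y\<in>carrier (Q.F n). pull n \<phi> y \<ominus>\<^bsub>N\<^esub> \<chi> y)"
        using cocycle_lift[OF \<chi>(1)] by blast
      then have "a = \<Phi> (cls n \<phi>)"
        unfolding \<chi>(2) \<Phi>[OF \<phi>(1)] using \<tau>[OF pull_cocycle[OF \<phi>(1)] \<chi>(1)] \<phi>(2) by simp
      then show "a \<in> \<Phi> ` carrier (Ext R n M N)" using \<phi>(1) unfolding Ext_carrier by blast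
    qed
  qed
  with inj have bij: "bij_betw \<Phi> (carrier (Ext R n M N)) (\<tau> ` {\<chi>. Q.cocycle N n \<chi>})"
    by (simp add: bij_betw_def)
  have add: "\<exists>\<chi> \<chi>'. Q.cocycle N n \<chi> \<and> Q.cocycle N n \<chi>' \<and> \<Phi> X = \<tau> \<chi> \<and> \<Phi> Y = \<tau> \<chi>' \<and>
      \<Phi> (X \<oplus>\<^bsub>Ext R n M N\<^esub> Y) = \<tau> (\<lambda>y\<in>carrier (Q.F n). \<chi> y \<oplus>\<^bsub>N\<^esub> \<chi>' y)"
    if XY: "X \<in> carrier (Ext R n M N)" "Y \<in> carrier (Ext R n M N)" for X Y
  proof -
    obtain \<phi> \<psi> where *: "P.cocycle N n \<phi>" "X = cls n \<phi>" "P.cocycle N n \<psi>" "Y = cls n \<psi>"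
      using XY unfolding Ext_carrier by blast
    have "pull n (\<lambda>x\<in>carrier (P.F n). \<phi> x \<oplus>\<^bsub>N\<^esub> \<psi> x) = (\<lambda>y\<in>carrier (Q.F n). pull n \<phi> y \<oplus>\<^bsub>N\<^esub> pull n \<psi> y)"
      using g_closed[of _ n] by (auto simp: pull_def compose_def restrict_def)
    moreover have "\<Phi> (X \<oplus>\<^bsub>Ext R n M N\<^esub> Y) = \<tau> (pull n (\<lambda>x\<in>carrier (P.F n). \<phi> x \<oplus>\<^bsub>N\<^esub> \<psi> x))"
      unfolding *(2,4) Ext_add[OF *(1,3)] by (rule \<Phi>[OF P.cocycle_add[OF Nm *(1,3)]])
    ultimately show ?thesis
      using * pull_cocycle[OF *(1)] pull_cocycle[OF *(3)] \<Phi>[OF *(1)] \<Phi>[OF *(3)]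
      by (intro exI[of _ "pull n \<phi>"] exI[of _ "pull n \<psi>"]) simp
  qed
  have map: "\<exists>\<chi>. Q.cocycle N n \<chi> \<and> \<Phi> X = \<tau> \<chi> \<and>
        \<Phi> (Ext_map R n M N \<theta> X) = \<tau> (compose (carrier (Q.F n)) \<theta> \<chi>)"
    if X: "X \<in> carrier (Ext R n M N)" and \<theta>: "restrict \<theta> (carrier N) \<in> lin_maps R N N" for X \<theta>
  proof -
    obtain \<phi> where *: "P.cocycle N n \<phi>" "X = cls n \<phi>"
      using X unfolding Ext_carrier by blast
    have "pull n (compose (carrier (P.F n)) \<theta> \<phi>) = compose (carrier (Q.F n)) \<theta> (pull n \<phi>)"
      using g_closed[of _ n] by (auto simp: pull_def compose_def restrict_def)
    moreover have "\<Phi> (Ext_map R n M N \<theta> X) = \<tau> (pull n (compose (carrier (P.F n)) \<theta> \<phi>))"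
      unfolding *(2) Ext_map_cls[OF *(1) \<theta>] by (rule \<Phi>[OF compose_cocycle[OF *(1) \<theta>]])
    ultimately show ?thesis
      using * pull_cocycle[OF *(1)] \<Phi>[OF *(1)] by (intro exI[of _ "pull n \<phi>"]) simp
  qed
  show ?thesis using bij add map by blast
qed

end

text \<open>The choice in \<open>resolution\<close> is meaningful only if a free resolution over
  this very index type exists, hence the type of \<open>I'\<close>. The given resolution is the
  witness, and lifting supplies chain maps in both directions.\<close>

lemma ext_comparison_exists:
  fixes R :: "('r, 'x) ring_scheme" and M :: "('r, 'm) module" and I' :: "nat \<Rightarrow> ('m \<times> 'r \<times> nat) set"
  assumes "free_res R M I' d' \<epsilon>'" "lmodule R N"
  shows "\<exists>\<epsilon> f g. ext_comparison R M \<epsilon> I' d' \<epsilon>' N f g"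
proof -
  interpret Q: free_res R M I' d' \<epsilon>' by fact
  have "\<exists>P :: (nat \<Rightarrow> ('m \<times> 'r \<times> nat) set) \<times> (nat \<Rightarrow> ('m \<times> 'r \<times> nat \<Rightarrow> 'r) \<Rightarrow> ('m \<times> 'r \<times> nat \<Rightarrow> 'r)).
      \<exists>\<epsilon>. free_resolution R M (fst P) (snd P) \<epsilon>"
    using Q.free_resolution by (intro exI[of _ "(I', d')"] exI[of _ \<epsilon>']) simp
  then have "\<exists>\<epsilon>. free_resolution R M (fst (resolution R M)) (snd (resolution R M)) \<epsilon>"
    unfolding resolution_def by (rule someI_ex)
  then obtain \<epsilon> where "free_resolution R M (fst (resolution R M)) (snd (resolution R M)) \<epsilon>" by blast
  then have P: "free_res R M (fst (resolution R M)) (snd (resolution R M)) \<epsilon>"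
    using Q.R.ring_axioms Q.M.lmodule_axioms by (simp add: free_res_def free_res_axioms_def)
  obtain f where f: "\<forall>n. f n \<in> lin_maps R (free_module R (fst (resolution R M) n)) (free_module R (I' n))"
    "\<forall>x\<in>carrier (free_module R (fst (resolution R M) 0)). \<epsilon>' (f 0 x) = \<epsilon> x"
    "\<forall>n. \<forall>x\<in>carrier (free_module R (fst (resolution R M) (Suc n))).
      d' n (f (Suc n) x) = f n (snd (resolution R M) n x)"
    using chain_map_exists[OF P assms(1)] by blast
  obtain g where g: "\<forall>n. g n \<in> lin_maps R (free_module R (I' n)) (free_module R (fst (resolution R M) n))"
    "\<forall>x\<in>carrier (free_module R (I' 0)). \<epsilon> (g 0 x) = \<epsilon>' x"
    "\<forall>n. \<forall>x\<in>carrier (free_module R (I' (Suc n))).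
      snd (resolution R M) n (g (Suc n) x) = g n (d' n x)"
    using chain_map_exists[OF assms(1) P] by blast
  have "ext_comparison R M \<epsilon> I' d' \<epsilon>' N f g"
    unfolding ext_comparison_def res_comparison_def res_comparison_axioms_def
    using P assms f g by simp
  then show ?thesis by blast
qed

section \<open>Normal forms in a down-up algebra\<close>

definition word_monoid :: "'x list monoid" where
  "word_monoid = \<lparr>carrier = UNIV, monoid.mult = (@), one = []\<rparr>"

lemma monoid_word_monoid: "Group.monoid word_monoid"
  by (rule Group.monoidI) (auto simp: word_monoid_def)

lemma free_algebra_eq: "free_algebra = monoid_algebra word_monoid"
  by (simp add: free_algebra_def word_monoid_def)

lemma carrier_free_algebra [simp]: "carrier free_algebra = UNIV"
  by (simp add: free_algebra_eq word_monoid_def)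

lemma free_algebra_simps [simp]:
  "\<zero>\<^bsub>free_algebra\<^esub> = 0" "f \<oplus>\<^bsub>free_algebra\<^esub> g = f + g" "c \<odot>\<^bsub>free_algebra\<^esub> f = scale c f"
  "\<one>\<^bsub>free_algebra\<^esub> = Poly_Mapping.single [] 1"
  by (simp_all add: free_algebra_eq word_monoid_def)

lemma free_algebra_mult_single:
  "Poly_Mapping.single v b \<otimes>\<^bsub>free_algebra\<^esub> Poly_Mapping.single w c = Poly_Mapping.single (v @ w) (b * c)"
  by (simp add: free_algebra_eq monoid_algebra_mult_single word_monoid_def)

lemma free_algebra_distrib:
  "(f + g) \<otimes>\<^bsub>free_algebra\<^esub> h = f \<otimes>\<^bsub>free_algebra\<^esub> h + g \<otimes>\<^bsub>free_algebra\<^esub> h"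
  "h \<otimes>\<^bsub>free_algebra\<^esub> (f + g) = h \<otimes>\<^bsub>free_algebra\<^esub> f + h \<otimes>\<^bsub>free_algebra\<^esub> g"
  by (simp_all add: free_algebra_eq monoid_algebra_mult_add_left monoid_algebra_mult_add_right)

lemma k_algebra_free_algebra: "k_algebra free_algebra"
  unfolding free_algebra_eq by (rule monoid.k_algebra_monoid_algebra[OF monoid_word_monoid])

lemma free_algebra_minus: "f \<ominus>\<^bsub>free_algebra\<^esub> g = f - (g :: 'x list \<Rightarrow>\<^sub>0 'k::field)"
proof -
  interpret F: k_algebra "free_algebra :: ('k, 'x list \<Rightarrow>\<^sub>0 'k) module" by (rule k_algebra_free_algebra)
  have "\<ominus>\<^bsub>free_algebra\<^esub> g = - g" by (rule F.minus_equality) auto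
  then show ?thesis by (simp add: a_minus_def)
qed

lemma free_algebra_induct [case_names single add]:
  assumes "\<And>w c. P (Poly_Mapping.single w c)" "\<And>f g. P f \<Longrightarrow> P g \<Longrightarrow> P (f + g)"
  shows "P (f :: 'x list \<Rightarrow>\<^sub>0 'k::field)"
  using subset_UNIV[of "Poly_Mapping.keys f"]
  by (induction f rule: poly_mapping_keys_induct) (use assms(1)[of _ 0] assms in auto)

type_synonym mon = "nat \<times> nat \<times> nat"

text \<open>Word length only filters the algebra, because of the terms with \<gamma>. The number of
  letters \<open>d\<close> minus that of letters \<open>u\<close>, recorded by \<open>wt\<close>, is
  a genuine grading.\<close>

fun deg :: "mon \<Rightarrow> nat" where "deg (i, j, k) = i + 2 * j + k"

fun wt :: "mon \<Rightarrow> int" where "wt (i, j, k) = int k - int i"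

text \<open>The triple \<open>(i, j, k)\<close> stands for the normal monomial \<open>u\<^sup>i (du)\<^sup>j d\<^sup>k\<close>.\<close>

fun norm_word :: "mon \<Rightarrow> down_up_gen list" where
  "norm_word (i, j, k) = replicate i Up @ concat (replicate j [Down, Up]) @ replicate k Down"

fun word_wt :: "down_up_gen list \<Rightarrow> int" where
  "word_wt [] = 0"
| "word_wt (Down # w) = word_wt w + 1"
| "word_wt (Up # w) = word_wt w - 1"

lemma word_wt_append: "word_wt (v @ w) = word_wt v + word_wt w"
  by (induction v rule: word_wt.induct) auto

section \<open>Normal monomials span\<close>

locale down_up =
  fixes \<alpha> \<beta> \<gamma> :: "'k::field"
  assumes \<beta>_nz: "\<beta> \<noteq> 0"
begin

abbreviation "A \<equiv> down_up_algebra \<alpha> \<beta> \<gamma>"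
abbreviation (input) "Fr \<equiv> (free_algebra :: ('k, down_up_gen list \<Rightarrow>\<^sub>0 'k) module)"

definition "J = genideal Fr (down_up_relations \<alpha> \<beta> \<gamma>)"

lemma algebra_ideal_J: "algebra_ideal Fr J"
proof -
  interpret F: k_algebra Fr by (rule k_algebra_free_algebra)
  show ?thesis unfolding J_def by (intro algebra_ideal.intro k_algebra_free_algebra F.genideal_ideal) simp
qed

sublocale F: algebra_ideal Fr J by (rule algebra_ideal_J)

lemma A_eq: "A = quotient_algebra Fr J"
  by (simp add: down_up_algebra_def J_def)

sublocale A: k_algebra A
  unfolding A_eq by (rule F.k_algebra_quotient)

abbreviation "cl f \<equiv> J +>\<^bsub>Fr\<^esub> f"

lemma carrier_A: "carrier A = range cl"
  by (simp add: A_eq F.carrier_Q)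

lemma cl_closed [simp, intro]: "cl f \<in> carrier A"
  by (simp add: carrier_A)

lemma cl_simps: "cl f \<otimes>\<^bsub>A\<^esub> cl g = cl (f \<otimes>\<^bsub>Fr\<^esub> g)" "cl f \<oplus>\<^bsub>A\<^esub> cl g = cl (f + g)"
  "\<one>\<^bsub>A\<^esub> = cl (Poly_Mapping.single [] 1)" "c \<odot>\<^bsub>A\<^esub> cl f = cl (scale c f)" "\<zero>\<^bsub>A\<^esub> = cl 0"
  using F.cls_mult F.cls_add F.cls_one F.cls_smult F.cls_zero by (simp_all add: A_eq)

lemma cl_eq_iff: "cl f = cl g \<longleftrightarrow> f - g \<in> J"
  using F.cls_eq_iff[of f g] by (simp add: free_algebra_minus)

definition wd :: "down_up_gen list \<Rightarrow> (down_up_gen list \<Rightarrow>\<^sub>0 'k) set" where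
  "wd w = cl (Poly_Mapping.single w 1)"

definition "dn = wd [Down]"
definition "up = wd [Up]"

lemma wd_closed [simp, intro]: "wd w \<in> carrier A" "dn \<in> carrier A" "up \<in> carrier A"
  by (simp_all add: wd_def dn_def up_def)

lemma wd_append: "wd (v @ w) = wd v \<otimes>\<^bsub>A\<^esub> wd w"
  by (simp add: wd_def cl_simps free_algebra_mult_single)

lemma wd_Cons: "wd (Down # w) = dn \<otimes>\<^bsub>A\<^esub> wd w" "wd (Up # w) = up \<otimes>\<^bsub>A\<^esub> wd w"
  using wd_append[of "[Down]" w] wd_append[of "[Up]" w] by (simp_all add: dn_def up_def)

lemma wd_Nil: "wd [] = \<one>\<^bsub>A\<^esub>"
  by (simp add: wd_def cl_simps)

lemma A_induct [consumes 1, case_names word add]: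
  assumes "a \<in> carrier A" "\<And>w c. P (c \<odot>\<^bsub>A\<^esub> wd w)"
    "\<And>a b. a \<in> carrier A \<Longrightarrow> b \<in> carrier A \<Longrightarrow> P a \<Longrightarrow> P b \<Longrightarrow> P (a \<oplus>\<^bsub>A\<^esub> b)"
  shows "P a"
proof -
  have "P (cl f)" for f
  proof (induction f rule: free_algebra_induct)
    case (single w c)
    show ?case using assms(2)[of c w] by (simp add: wd_def cl_simps)
  next
    case (add f g)
    then show ?case using assms(3)[of "cl f" "cl g"] by (simp add: cl_simps)
  qed
  then show ?thesis using assms(1) by (auto simp: carrier_A)
qed

lemma relation_word:
  "wd [Down, Down, Up] = \<alpha> \<odot>\<^bsub>A\<^esub> wd [Down, Up, Down] \<oplus>\<^bsub>A\<^esub> \<beta> \<odot>\<^bsub>A\<^esub> wd [Up, Down, Down] \<oplus>\<^bsub>A\<^esub> \<gamma> \<odot>\<^bsub>A\<^esub> wd [Down]"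
  "wd [Down, Up, Up] = \<alpha> \<odot>\<^bsub>A\<^esub> wd [Up, Down, Up] \<oplus>\<^bsub>A\<^esub> \<beta> \<odot>\<^bsub>A\<^esub> wd [Up, Up, Down] \<oplus>\<^bsub>A\<^esub> \<gamma> \<odot>\<^bsub>A\<^esub> wd [Up]"
proof -
  have "down_up_relations \<alpha> \<beta> \<gamma> \<subseteq> J" unfolding J_def by (rule F.genideal_self) simp
  then show "wd [Down, Down, Up] = \<alpha> \<odot>\<^bsub>A\<^esub> wd [Down, Up, Down] \<oplus>\<^bsub>A\<^esub> \<beta> \<odot>\<^bsub>A\<^esub> wd [Up, Down, Down] \<oplus>\<^bsub>A\<^esub> \<gamma> \<odot>\<^bsub>A\<^esub> wd [Down]"
    "wd [Down, Up, Up] = \<alpha> \<odot>\<^bsub>A\<^esub> wd [Up, Down, Up] \<oplus>\<^bsub>A\<^esub> \<beta> \<odot>\<^bsub>A\<^esub> wd [Up, Up, Down] \<oplus>\<^bsub>A\<^esub> \<gamma> \<odot>\<^bsub>A\<^esub> wd [Up]"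
    by (auto simp: wd_def cl_simps cl_eq_iff down_up_relations_def diff_diff_eq)
qed

lemma relation_ddu:
  assumes a: "a \<in> carrier A"
  shows "dn \<otimes>\<^bsub>A\<^esub> (dn \<otimes>\<^bsub>A\<^esub> (up \<otimes>\<^bsub>A\<^esub> a)) = \<alpha> \<odot>\<^bsub>A\<^esub> (dn \<otimes>\<^bsub>A\<^esub> (up \<otimes>\<^bsub>A\<^esub> (dn \<otimes>\<^bsub>A\<^esub> a))) \<oplus>\<^bsub>A\<^esub>
    \<beta> \<odot>\<^bsub>A\<^esub> (up \<otimes>\<^bsub>A\<^esub> (dn \<otimes>\<^bsub>A\<^esub> (dn \<otimes>\<^bsub>A\<^esub> a))) \<oplus>\<^bsub>A\<^esub> \<gamma> \<odot>\<^bsub>A\<^esub> (dn \<otimes>\<^bsub>A\<^esub> a)"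
proof -
  have "wd [Down, Down, Up] \<otimes>\<^bsub>A\<^esub> a = (\<alpha> \<odot>\<^bsub>A\<^esub> wd [Down, Up, Down] \<oplus>\<^bsub>A\<^esub> \<beta> \<odot>\<^bsub>A\<^esub> wd [Up, Down, Down]
      \<oplus>\<^bsub>A\<^esub> \<gamma> \<odot>\<^bsub>A\<^esub> wd [Down]) \<otimes>\<^bsub>A\<^esub> a"
    by (simp only: relation_word)
  then show ?thesis
    using a by (simp add: wd_Cons wd_Nil A.l_distr A.smult_mult_left A.m_assoc)
qed

lemma relation_duu:
  assumes a: "a \<in> carrier A"
  shows "dn \<otimes>\<^bsub>A\<^esub> (up \<otimes>\<^bsub>A\<^esub> (up \<otimes>\<^bsub>A\<^esub> a)) = \<alpha> \<odot>\<^bsub>A\<^esub> (up \<otimes>\<^bsub>A\<^esub> (dn \<otimes>\<^bsub>A\<^esub> (up \<otimes>\<^bsub>A\<^esub> a))) \<oplus>\<^bsub>A\<^esub>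
    \<beta> \<odot>\<^bsub>A\<^esub> (up \<otimes>\<^bsub>A\<^esub> (up \<otimes>\<^bsub>A\<^esub> (dn \<otimes>\<^bsub>A\<^esub> a))) \<oplus>\<^bsub>A\<^esub> \<gamma> \<odot>\<^bsub>A\<^esub> (up \<otimes>\<^bsub>A\<^esub> a)"
proof -
  have "wd [Down, Up, Up] \<otimes>\<^bsub>A\<^esub> a = (\<alpha> \<odot>\<^bsub>A\<^esub> wd [Up, Down, Up] \<oplus>\<^bsub>A\<^esub> \<beta> \<odot>\<^bsub>A\<^esub> wd [Up, Up, Down]
      \<oplus>\<^bsub>A\<^esub> \<gamma> \<odot>\<^bsub>A\<^esub> wd [Up]) \<otimes>\<^bsub>A\<^esub> a"
    by (simp only: relation_word)
  then show ?thesis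
    using a by (simp add: wd_Cons wd_Nil A.l_distr A.smult_mult_left A.m_assoc)
qed

definition e :: "mon \<Rightarrow> (down_up_gen list \<Rightarrow>\<^sub>0 'k) set" where
  "e m = wd (norm_word m)"

lemma e_closed [simp, intro]: "e m \<in> carrier A"
  by (simp add: e_def)

lemma e_zero: "e (0, 0, 0) = \<one>\<^bsub>A\<^esub>"
  by (simp add: e_def wd_Nil)

lemma up_e: "up \<otimes>\<^bsub>A\<^esub> e (i, j, k) = e (Suc i, j, k)"
  by (simp add: e_def wd_Cons)

lemma dn_e_Suc: "dn \<otimes>\<^bsub>A\<^esub> e (Suc 0, j, k) = e (0, Suc j, k)"
  by (simp add: e_def wd_Cons)

lemma dn_e_zero: "dn \<otimes>\<^bsub>A\<^esub> e (0, 0, k) = e (0, 0, Suc k)"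
  by (simp add: e_def wd_Cons)

definition lin :: "(mon \<Rightarrow>\<^sub>0 'k) \<Rightarrow> (down_up_gen list \<Rightarrow>\<^sub>0 'k) set" where
  "lin b = (\<Oplus>\<^bsub>A\<^esub>m\<in>Poly_Mapping.keys b. Poly_Mapping.lookup b m \<odot>\<^bsub>A\<^esub> e m)"

lemma lin_superset:
  assumes "finite S" "Poly_Mapping.keys b \<subseteq> S"
  shows "lin b = (\<Oplus>\<^bsub>A\<^esub>m\<in>S. Poly_Mapping.lookup b m \<odot>\<^bsub>A\<^esub> e m)"
  unfolding lin_def
  by (rule A.add.finprod_mono_neutral_cong_left) (use assms in \<open>auto simp: in_keys_iff\<close>)

lemma lin_closed [simp, intro]: "lin b \<in> carrier A"
  unfolding lin_def by (rule A.finsum_closed) auto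

lemma lin_zero [simp]: "lin 0 = \<zero>\<^bsub>A\<^esub>"
  by (simp add: lin_def)

lemma lin_add: "lin (b + c) = lin b \<oplus>\<^bsub>A\<^esub> lin c"
proof -
  let ?S = "Poly_Mapping.keys b \<union> Poly_Mapping.keys c"
  have S: "finite ?S" "Poly_Mapping.keys (b + c) \<subseteq> ?S"
    using keys_add[of b c] by auto
  have "lin (b + c) = (\<Oplus>\<^bsub>A\<^esub>m\<in>?S. Poly_Mapping.lookup b m \<odot>\<^bsub>A\<^esub> e m \<oplus>\<^bsub>A\<^esub> Poly_Mapping.lookup c m \<odot>\<^bsub>A\<^esub> e m)"
    using S by (subst lin_superset[of ?S]) (auto simp: lookup_add A.smult_l_distr)
  also have "\<dots> = lin b \<oplus>\<^bsub>A\<^esub> lin c"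
    using S by (subst A.finsum_addf) (auto simp: lin_superset[of ?S])
  finally show ?thesis .
qed

lemma lin_single [simp]: "lin (Poly_Mapping.single m c) = c \<odot>\<^bsub>A\<^esub> e m"
  by (subst lin_superset[of "{m}"]) auto

lemma lin_scale: "lin (scale c b) = c \<odot>\<^bsub>A\<^esub> lin b"
  using subset_UNIV[of "Poly_Mapping.keys b"]
  by (induction b rule: poly_mapping_keys_induct)
    (auto simp: lin_add scale_add A.smult_r_distr A.smult_smult)

definition spn :: "mon set \<Rightarrow> (down_up_gen list \<Rightarrow>\<^sub>0 'k) set set" where
  "spn S = {a. \<exists>b. Poly_Mapping.keys b \<subseteq> S \<and> a = lin b}"

lemma spn_e: "m \<in> S \<Longrightarrow> e m \<in> spn S"
  unfolding spn_def by (intro CollectI exI[of _ "Poly_Mapping.single m 1"]) auto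

lemma spn_add: "a \<in> spn S \<Longrightarrow> b \<in> spn S \<Longrightarrow> a \<oplus>\<^bsub>A\<^esub> b \<in> spn S"
  unfolding spn_def by clarsimp (metis keys_add_subset lin_add)

lemma spn_smult: "a \<in> spn S \<Longrightarrow> c \<odot>\<^bsub>A\<^esub> a \<in> spn S"
  unfolding spn_def by clarsimp (metis keys_scale_subset lin_scale)

lemma spn_zero: "\<zero>\<^bsub>A\<^esub> \<in> spn S"
  unfolding spn_def by (intro CollectI exI[of _ 0]) auto

lemma spn_mult:
  assumes a: "a \<in> spn S" and x: "x \<in> carrier A" and e: "\<And>m. m \<in> S \<Longrightarrow> x \<otimes>\<^bsub>A\<^esub> e m \<in> spn S'"
  shows "x \<otimes>\<^bsub>A\<^esub> a \<in> spn S'"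
proof -
  obtain b where b: "Poly_Mapping.keys b \<subseteq> S" "a = lin b" using a by (auto simp: spn_def)
  from b(1) have "x \<otimes>\<^bsub>A\<^esub> lin b \<in> spn S'"
    by (induction b rule: poly_mapping_keys_induct)
      (use x e in \<open>auto simp: lin_add A.r_distr A.smult_mult_right intro: spn_add spn_smult spn_zero\<close>)
  with b(2) show ?thesis by simp
qed

text \<open>The weight accompanies the degree bound because the grading automorphisms require the
  normal form of a word to be homogeneous of its weight.\<close>

definition level :: "nat \<Rightarrow> int \<Rightarrow> mon set" where
  "level n t = {m. deg m \<le> n \<and> wt m = t}"

lemma level_mono: "n \<le> n' \<Longrightarrow> level n t \<subseteq> level n' t"
  by (auto simp: level_def)

lemma spn_mono: "S \<subseteq> S' \<Longrightarrow> spn S \<subseteq> spn S'"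
  by (auto simp: spn_def)

lemma spn_level_mono: "a \<in> spn (level n t) \<Longrightarrow> n \<le> n' \<Longrightarrow> a \<in> spn (level n' t)"
  using spn_mono[OF level_mono] by blast

lemma up_spn: "a \<in> spn (level n t) \<Longrightarrow> up \<otimes>\<^bsub>A\<^esub> a \<in> spn (level (Suc n) (t - 1) \<inter> {m. 0 < fst m})"
  by (rule spn_mult) (auto simp: up_e level_def intro!: spn_e)

lemma up_spn': "a \<in> spn (level n t) \<Longrightarrow> up \<otimes>\<^bsub>A\<^esub> a \<in> spn (level (Suc n) (t - 1))"
  using up_spn spn_mono[of "level (Suc n) (t - 1) \<inter> {m. 0 < fst m}" "level (Suc n) (t - 1)"] by blast

text \<open>Prepending \<open>u\<close> keeps a monomial normal, so rewriting is only needed for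
  \<open>d\<close>. In front of \<open>uu\<close> or \<open>du\<close> a relation moves it inwards,
  to monomials already handled.\<close>

lemma dn_e: "dn \<otimes>\<^bsub>A\<^esub> e m \<in> spn (level (Suc (deg m)) (wt m + 1))"
proof (induction "deg m" arbitrary: m rule: less_induct)
  case less
  have dn_spn: "dn \<otimes>\<^bsub>A\<^esub> a \<in> spn (level (Suc n) (t + 1))"
    if a: "a \<in> spn (level n t)" and n: "n < deg m" for a n t
  proof (rule spn_mult[OF a])
    fix m' assume m': "m' \<in> level n t"
    then have "deg m' < deg m" using n by (simp add: level_def)
    then have "dn \<otimes>\<^bsub>A\<^esub> e m' \<in> spn (level (Suc (deg m')) (wt m' + 1))" by (rule less)
    then show "dn \<otimes>\<^bsub>A\<^esub> e m' \<in> spn (level (Suc n) (t + 1))"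
      using m' spn_mono[OF level_mono[of "Suc (deg m')" "Suc n" "t + 1"]] by (auto simp: level_def)
  qed auto
  \<comment> \<open>Monomials beginning with \<open>u\<close> are treated first and up to the full
    degree of \<open>m\<close>: for a leading \<open>du\<close> the relation applies
    \<open>dn\<close> to elements whose degree has not dropped, but which begin with
    \<open>u\<close>.\<close>
  have pos: "dn \<otimes>\<^bsub>A\<^esub> e m' \<in> spn (level (Suc n) (wt m' + 1))"
    if m': "deg m' \<le> n" "0 < fst m'" and n: "n \<le> deg m" for m' n
  proof -
    obtain i j k where ijk: "m' = (Suc i, j, k)" using m'(2) by (cases m') (auto simp: gr0_conv_Suc)
    show ?thesis
    proof (cases i)
      case 0
      then show ?thesis using m' by (auto simp: ijk dn_e_Suc level_def intro!: spn_e)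
    next
      case (Suc i')
      let ?e = "e (i', j, k)"
      define t where "t = wt m' + 1"
      have n2: "2 \<le> n" "i' + 2 * j + k \<le> n - 2" using m'(1) by (auto simp: ijk Suc)
      have n1: "Suc (n - 2) = n - 1" using n2 by simp
      have e2: "?e \<in> spn (level (n - 2) (t + 1))"
        using n2 by (intro spn_e) (auto simp: level_def ijk Suc t_def)
      have ue: "up \<otimes>\<^bsub>A\<^esub> ?e \<in> spn (level (n - 1) t)"
        using up_spn'[OF e2] unfolding n1 by simp
      have "dn \<otimes>\<^bsub>A\<^esub> (up \<otimes>\<^bsub>A\<^esub> ?e) \<in> spn (level n (t + 1))"
        using dn_spn[OF ue] n n2 by simp
      then have 1: "up \<otimes>\<^bsub>A\<^esub> (dn \<otimes>\<^bsub>A\<^esub> (up \<otimes>\<^bsub>A\<^esub> ?e)) \<in> spn (level (Suc n) t)"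
        using up_spn'[of _ n "t + 1"] by simp
      have "dn \<otimes>\<^bsub>A\<^esub> ?e \<in> spn (level (n - 1) (t + 2))"
        using dn_spn[OF e2] n n2 unfolding n1 by (simp add: algebra_simps)
      then have "up \<otimes>\<^bsub>A\<^esub> (dn \<otimes>\<^bsub>A\<^esub> ?e) \<in> spn (level n (t + 1))"
        using up_spn'[of _ "n - 1" "t + 2"] n2 by (simp add: add.commute)
      then have 2: "up \<otimes>\<^bsub>A\<^esub> (up \<otimes>\<^bsub>A\<^esub> (dn \<otimes>\<^bsub>A\<^esub> ?e)) \<in> spn (level (Suc n) t)"
        using up_spn'[of _ n "t + 1"] by simp
      have 3: "up \<otimes>\<^bsub>A\<^esub> ?e \<in> spn (level (Suc n) t)"
        by (rule spn_level_mono[OF ue]) arith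
      have "e m' = up \<otimes>\<^bsub>A\<^esub> (up \<otimes>\<^bsub>A\<^esub> ?e)" by (simp add: ijk Suc up_e)
      then show ?thesis using 1 2 3 by (simp add: relation_duu spn_add spn_smult t_def)
    qed
  qed
  show ?case
  proof (cases "0 < fst m")
    case True
    then show ?thesis using pos[of m "deg m"] by simp
  next
    case False
    then obtain j k where jk: "m = (0, j, k)" by (cases m) auto
    show ?thesis
    proof (cases j)
      case 0
      then show ?thesis by (auto simp: jk dn_e_zero level_def intro!: spn_e)
    next
      case (Suc j')
      let ?e = "e (0, j', k)" and ?n = "deg m" and ?t = "wt m"
      have n2: "2 \<le> ?n" by (simp add: jk Suc)
      have n1: "Suc (?n - 2) = ?n - 1" using n2 by simp
      have e2: "?e \<in> spn (level (?n - 2) ?t)"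
        by (intro spn_e) (auto simp: level_def jk Suc)
      have de: "dn \<otimes>\<^bsub>A\<^esub> ?e \<in> spn (level (?n - 1) (?t + 1))"
        using dn_spn[OF e2] n2 unfolding n1 by simp
      have ude: "up \<otimes>\<^bsub>A\<^esub> (dn \<otimes>\<^bsub>A\<^esub> ?e) \<in> spn (level ?n ?t \<inter> {m. 0 < fst m})"
        using up_spn[OF de] n2 by simp
      have 1: "dn \<otimes>\<^bsub>A\<^esub> (up \<otimes>\<^bsub>A\<^esub> (dn \<otimes>\<^bsub>A\<^esub> ?e)) \<in> spn (level (Suc ?n) (?t + 1))"
      proof (rule spn_mult[OF ude])
        fix m' assume m': "m' \<in> level ?n ?t \<inter> {m. 0 < fst m}"
        then have "deg m' \<le> ?n" "0 < fst m'" and wt: "wt m' = ?t" by (simp_all add: level_def)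
        then show "dn \<otimes>\<^bsub>A\<^esub> e m' \<in> spn (level (Suc ?n) (?t + 1))"
          using pos[of m' ?n] unfolding wt by blast
      qed auto
      have "dn \<otimes>\<^bsub>A\<^esub> (dn \<otimes>\<^bsub>A\<^esub> ?e) \<in> spn (level ?n (?t + 2))"
        using dn_spn[OF de] n2 by (simp add: algebra_simps)
      then have 2: "up \<otimes>\<^bsub>A\<^esub> (dn \<otimes>\<^bsub>A\<^esub> (dn \<otimes>\<^bsub>A\<^esub> ?e)) \<in> spn (level (Suc ?n) (?t + 1))"
        using up_spn'[of _ ?n "?t + 2"] by (simp add: add.commute)
      have 3: "dn \<otimes>\<^bsub>A\<^esub> ?e \<in> spn (level (Suc ?n) (?t + 1))"
        by (rule spn_level_mono[OF de]) arith
      have "e m = dn \<otimes>\<^bsub>A\<^esub> (up \<otimes>\<^bsub>A\<^esub> ?e)" by (simp add: jk Suc up_e dn_e_Suc)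
      then show ?thesis using 1 2 3 by (simp add: relation_ddu spn_add spn_smult)
    qed
  qed
qed

lemma dn_spn: "a \<in> spn (level n t) \<Longrightarrow> dn \<otimes>\<^bsub>A\<^esub> a \<in> spn (level (Suc n) (t + 1))"
proof (rule spn_mult)
  fix m assume m: "m \<in> level n t"
  then show "dn \<otimes>\<^bsub>A\<^esub> e m \<in> spn (level (Suc n) (t + 1))"
    using dn_e[of m] spn_mono[OF level_mono[of "Suc (deg m)" "Suc n" "t + 1"]] by (auto simp: level_def)
qed auto

lemma wd_spn: "wd w \<in> spn (level (length w) (word_wt w))"
proof (induction w rule: word_wt.induct)
  case 1
  then show ?case using spn_e[of "(0, 0, 0)" "level 0 0"] by (simp add: e_zero wd_Nil level_def)
next
  case (2 w)
  then show ?case using dn_spn by (simp add: wd_Cons)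
next
  case (3 w)
  then show ?case using up_spn' by (simp add: wd_Cons)
qed

lemma lin_surj:
  assumes "a \<in> carrier A"
  shows "\<exists>b. a = lin b"
proof -
  have "a \<in> spn UNIV"
    using assms
  proof (induction a rule: A_induct)
    case (word w c)
    show ?case using wd_spn[of w] spn_mono[of "level (length w) (word_wt w)" UNIV] by (auto intro: spn_smult)
  qed (auto intro: spn_add)
  then show ?thesis by (auto simp: spn_def)
qed

end

text \<open>In the shift action \<open>du\<close> multiplies by \<open>lam (n + 1)\<close> and
  \<open>ud\<close> by \<open>lam n\<close>, so both relations reduce to the recurrence for
  \<open>lam\<close>. Scalars enter through \<open>\<iota>\<close>, which lets the weights live in a
  polynomial ring over the field.\<close>

locale down_up_rep = down_up \<alpha> \<beta> \<gamma> for \<alpha> \<beta> \<gamma> :: "'k::field" +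
  fixes \<iota> :: "'k \<Rightarrow> 'r::comm_ring_1" and lam :: "int \<Rightarrow> 'r"
  assumes \<iota>_add: "\<iota> (a + b) = \<iota> a + \<iota> b" and \<iota>_mult: "\<iota> (a * b) = \<iota> a * \<iota> b" and \<iota>_one: "\<iota> 1 = 1"
    and lam: "lam (n + 2) = \<iota> \<alpha> * lam (n + 1) + \<iota> \<beta> * lam n + \<iota> \<gamma>"
begin

text \<open>The generators act on functions \<open>int \<Rightarrow> 'r\<close> by weighted shifts.\<close>

fun wact :: "down_up_gen list \<Rightarrow> (int \<Rightarrow> 'r) \<Rightarrow> int \<Rightarrow> 'r" where
  "wact [] s = s"
| "wact (Down # w) s = (\<lambda>n. wact w s (n + 1))"
| "wact (Up # w) s = (\<lambda>n. lam n * wact w s (n - 1))"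

definition act :: "(down_up_gen list \<Rightarrow>\<^sub>0 'k) \<Rightarrow> (int \<Rightarrow> 'r) \<Rightarrow> int \<Rightarrow> 'r" where
  "act f s n = (\<Sum>w\<in>Poly_Mapping.keys f. \<iota> (Poly_Mapping.lookup f w) * wact w s n)"

lemma \<iota>_zero [simp]: "\<iota> 0 = 0"
  using \<iota>_add[of 0 0] by simp

lemma act_superset:
  assumes "finite S" "Poly_Mapping.keys f \<subseteq> S"
  shows "act f s n = (\<Sum>w\<in>S. \<iota> (Poly_Mapping.lookup f w) * wact w s n)"
  unfolding act_def by (rule sum.mono_neutral_left) (use assms in \<open>auto simp: in_keys_iff\<close>)

lemma act_add: "act (f + g) s n = act f s n + act g s n"
proof -
  let ?S = "Poly_Mapping.keys f \<union> Poly_Mapping.keys g"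
  show ?thesis
    using keys_add[of f g]
    by (simp add: act_superset[of ?S] lookup_add \<iota>_add algebra_simps sum.distrib)
qed

lemma act_single [simp]: "act (Poly_Mapping.single w c) s n = \<iota> c * wact w s n"
  by (subst act_superset[of "{w}"]) auto

lemma act_zero [simp]: "act 0 s n = 0"
  by (simp add: act_def)

lemma act_diff: "act (f - g) s n = act f s n - act g s n"
  using act_add[of "f - g" g s n] by simp

lemma wact_append: "wact (v @ w) s = wact v (wact w s)"
  by (induction v s rule: wact.induct) auto

lemma wact_add: "wact w (\<lambda>n. s n + t n) = (\<lambda>n. wact w s n + wact w t n)"
  by (induction w s rule: wact.induct) (auto simp: algebra_simps)

lemma wact_scale: "wact w (\<lambda>n. c * s n) = (\<lambda>n. c * wact w s n)"
  by (induction w s rule: wact.induct) (auto simp: algebra_simps)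

lemma act_mult: "act (f \<otimes>\<^bsub>Fr\<^esub> g) s n = act f (act g s) n"
proof (induction f arbitrary: n rule: free_algebra_induct)
  case (single v c)
  show ?case
  proof (induction g arbitrary: n rule: free_algebra_induct)
    case (single w c')
    have "act (Poly_Mapping.single w c') s = (\<lambda>n. \<iota> c' * wact w s n)" by auto
    then show ?case by (simp add: free_algebra_mult_single wact_append wact_scale \<iota>_mult mult.assoc)
  next
    case (add f g)
    have "act (f + g) s = (\<lambda>n. act f s n + act g s n)" by (auto simp: act_add)
    with add show ?case by (simp add: free_algebra_distrib act_add wact_add algebra_simps)
  qed
qed (simp add: free_algebra_distrib act_add)

lemma act_linear_zero: "act f (\<lambda>_. 0) n = 0"
  by (simp add: act_def wact_scale[of _ 0, simplified])

text \<open>Multiplicativity of \<open>act\<close> makes the elements acting as zero a two-sided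
  ideal, and the recurrence puts the relations into it.\<close>

lemma act_J:
  assumes "f \<in> J"
  shows "act f s n = 0"
proof -
  let ?N = "{f. \<forall>s n. act f s n = 0}"
  have "ideal ?N Fr"
  proof (rule idealI)
    show "ring Fr" by (rule F.ring_axioms)
    show "subgroup ?N (add_monoid Fr)"
    proof (rule subgroup.intro)
      fix x assume x: "x \<in> ?N"
      have "\<ominus>\<^bsub>Fr\<^esub> x = - x" using free_algebra_minus[of 0 x] F.l_zero[of "\<ominus>\<^bsub>Fr\<^esub> x"]
        by (simp add: a_minus_def)
      then show "inv\<^bsub>add_monoid Fr\<^esub> x \<in> ?N"
        using x act_diff[of 0 x] by (simp add: a_inv_def)
    qed (auto simp: act_add)
    fix a x assume a: "a \<in> ?N"
    have "act a s = (\<lambda>_. 0)" for s using a by auto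
    then show "x \<otimes>\<^bsub>Fr\<^esub> a \<in> ?N" "a \<otimes>\<^bsub>Fr\<^esub> x \<in> ?N" using a by (simp_all add: act_mult act_linear_zero)
  qed
  moreover have "down_up_relations \<alpha> \<beta> \<gamma> \<subseteq> ?N"
  proof -
    have L: "lam (n + 1) = \<iota> \<alpha> * lam n + \<iota> \<beta> * lam (n - 1) + \<iota> \<gamma>" for n
      using lam[of "n - 1"] by (simp add: add.commute)
    show ?thesis
      by (auto simp: down_up_relations_def act_diff act_add \<iota>_one) (simp_all add: L lam algebra_simps)
  qed
  ultimately have "J \<subseteq> ?N" unfolding J_def by (rule F.genideal_minimal)
  with assms show ?thesis by blast
qed

definition rho :: "(down_up_gen list \<Rightarrow>\<^sub>0 'k) set \<Rightarrow> (int \<Rightarrow> 'r) \<Rightarrow> int \<Rightarrow> 'r" where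
  "rho a = act (SOME f. cl f = a)"

lemma rho_cl: "rho (cl f) = act f"
proof -
  define g where "g = (SOME g. cl g = cl f)"
  have "cl g = cl f" unfolding g_def by (rule someI[of _ f]) simp
  then have "g - f \<in> J" by (simp add: cl_eq_iff)
  then have "act g s n = act f s n" for s n using act_J[of "g - f" s n] act_diff[of g f s n] by simp
  then show ?thesis by (auto simp: rho_def g_def)
qed

lemma rho_mult: "a \<in> carrier A \<Longrightarrow> b \<in> carrier A \<Longrightarrow> rho (a \<otimes>\<^bsub>A\<^esub> b) s n = rho a (rho b s) n"
  by (auto simp: carrier_A cl_simps rho_cl act_mult)

lemma rho_add: "a \<in> carrier A \<Longrightarrow> b \<in> carrier A \<Longrightarrow> rho (a \<oplus>\<^bsub>A\<^esub> b) s n = rho a s n + rho b s n"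
  by (auto simp: carrier_A cl_simps rho_cl act_add)

lemma act_scale: "act (scale c f) s n = \<iota> c * act f s n"
  by (induction f rule: free_algebra_induct) (auto simp: scale_add act_add \<iota>_mult algebra_simps)

lemma rho_smult: "a \<in> carrier A \<Longrightarrow> rho (c \<odot>\<^bsub>A\<^esub> a) s n = \<iota> c * rho a s n"
  by (auto simp: carrier_A cl_simps rho_cl act_scale)

lemma rho_wd: "rho (wd w) s n = wact w s n"
  by (simp add: wd_def rho_cl \<iota>_one)

lemma rho_one: "rho \<one>\<^bsub>A\<^esub> s n = s n"
  by (simp add: wd_Nil[symmetric] rho_wd)

lemma rho_zero: "rho \<zero>\<^bsub>A\<^esub> s n = 0"
  by (simp add: cl_simps rho_cl)

lemma rho_dn: "rho dn s n = s (n + 1)"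
  by (simp add: dn_def rho_wd)

lemma rho_lin: "rho (lin b) s n = (\<Sum>m\<in>Poly_Mapping.keys b. \<iota> (Poly_Mapping.lookup b m) * wact (norm_word m) s n)"
proof -
  have "rho (\<Oplus>\<^bsub>A\<^esub>m\<in>S. Poly_Mapping.lookup b m \<odot>\<^bsub>A\<^esub> e m) s n =
      (\<Sum>m\<in>S. \<iota> (Poly_Mapping.lookup b m) * wact (norm_word m) s n)" if "finite S" for S
    using that
    by (induction S rule: finite_induct)
      (auto simp: rho_zero rho_add rho_smult e_def rho_wd)
  then show ?thesis by (simp add: lin_def)
qed

text \<open>\<open>u^i\<close> collects the weights met on the way from \<open>n\<close> down to
  \<open>n - i\<close>, each \<open>du\<close> then multiplies by the weight at
  \<open>n - i + 1\<close>, and \<open>d^k\<close> moves up by \<open>k\<close>.\<close>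

lemma wact_norm_word:
  "wact (norm_word (i, j, k)) s n =
    (\<Prod>l<i. lam (n - int l)) * lam (n - int i + 1) ^ j * s (n - int i + int k)"
proof -
  have 1: "wact (replicate k Down) s = (\<lambda>n. s (n + int k))" for s
    by (induction k) (auto simp: algebra_simps)
  have 2: "wact (concat (replicate j [Down, Up])) s = (\<lambda>n. lam (n + 1) ^ j * s n)" for s
    by (induction j) (auto simp: algebra_simps)
  have 3: "wact (replicate i Up) s n = (\<Prod>l<i. lam (n - int l)) * s (n - int i)" for s n
  proof (induction i arbitrary: n)
    case (Suc i)
    have "(\<Prod>l<Suc i. lam (n - int l)) = lam n * (\<Prod>l<i. lam (n - 1 - int l))"
      by (subst prod.lessThan_Suc_shift) (simp add: algebra_simps)
    then show ?case using Suc[of "n - 1"] by (simp add: algebra_simps)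
  qed simp
  show ?thesis by (simp add: wact_append 1 2 3 algebra_simps)
qed

end

text \<open>
  The two-sided recurrence with arbitrary initial values \<open>a\<close> and \<open>b\<close> at \<open>0\<close> and \<open>1\<close>; it can be run
  backwards because \<open>\<beta>\<close> is a unit.
\<close>

fun fwd :: "'r::comm_ring_1 \<Rightarrow> 'r \<Rightarrow> 'r \<Rightarrow> 'r \<Rightarrow> 'r \<Rightarrow> nat \<Rightarrow> 'r" where
  "fwd p q r a b 0 = a"
| "fwd p q r a b (Suc 0) = b"
| "fwd p q r a b (Suc (Suc n)) = p * fwd p q r a b (Suc n) + q * fwd p q r a b n + r"

fun bwd :: "'r::comm_ring_1 \<Rightarrow> 'r \<Rightarrow> 'r \<Rightarrow> 'r \<Rightarrow> 'r \<Rightarrow> nat \<Rightarrow> 'r" where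
  "bwd p q' r a b 0 = b"
| "bwd p q' r a b (Suc 0) = a"
| "bwd p q' r a b (Suc (Suc n)) = q' * (bwd p q' r a b n - p * bwd p q' r a b (Suc n) - r)"

text \<open>\<open>bwd\<close> counts downwards from 1: its argument \<open>k\<close> stands for the
  integer \<open>1 - k\<close>. The two halves agree at 0 and 1, so for negative \<open>n\<close>
  the recurrence lies entirely in the backward half.\<close>

lemma two_sided_recurrence:
  fixes p q q' r a b :: "'r::comm_ring_1"
  assumes "q * q' = 1"
  defines "l \<equiv> \<lambda>n::int. if 0 \<le> n then fwd p q r a b (nat n) else bwd p q' r a b (nat (1 - n))"
  shows "l (n + 2) = p * l (n + 1) + q * l n + r"
proof (cases "0 \<le> n")
  case True
  then have "nat (n + 2) = Suc (Suc (nat n))" "nat (n + 1) = Suc (nat n)" by auto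
  then show ?thesis using True by (simp add: l_def)
next
  case False
  have l: "l m = bwd p q' r a b (nat (1 - m))" if "m \<le> 1" for m
  proof (cases "m = 0 \<or> m = 1")
    case True
    then show ?thesis by (auto simp: l_def)
  next
    case False
    then have "m < 0" using that by auto
    then show ?thesis by (simp add: l_def)
  qed
  obtain k where n: "n = - 1 - int k"
    using False by (intro that[of "nat (- 1 - n)"]) simp
  have "l (n + 2) = bwd p q' r a b k" "l (n + 1) = bwd p q' r a b (Suc k)"
    "l n = bwd p q' r a b (Suc (Suc k))"
    using l[of "n + 2"] l[of "n + 1"] l[of n] by (simp_all add: n nat_add_distrib)
  moreover have "q * (q' * x) = x" for x
    using assms(1) by (simp add: mult.assoc[symmetric])
  ultimately show ?thesis by simp
qed

text \<open>The weights are affine forms in the initial values, and the determinant of two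
  consecutive linear parts is multiplied by \<open>- b\<close> in each step. For nonzero
  \<open>b\<close> no weight can therefore vanish.\<close>

lemma fwd_linear_form:
  fixes a b c :: "'k::field"
  shows "\<exists>p q r. p 0 = 1 \<and> q 0 = 0 \<and> p 1 = 0 \<and> q (Suc 0) = 1 \<and>
    (\<forall>n. fwd [:[:a:]:] [:[:b:]:] [:[:c:]:] [:0, 1:] [:[:0, 1:]:] n = [:[:r n, q n:], [:p n:]:] \<and>
      p n * q (Suc n) - p (Suc n) * q n = (- b) ^ n)"
proof -
  let ?p = "fwd a b 0 1 0" and ?q = "fwd a b 0 0 1" and ?r = "fwd a b c 0 0"
  have "fwd [:[:a:]:] [:[:b:]:] [:[:c:]:] [:0, 1:] [:[:0, 1:]:] n = [:[:?r n, ?q n:], [:?p n:]:] \<and>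
      fwd [:[:a:]:] [:[:b:]:] [:[:c:]:] [:0, 1:] [:[:0, 1:]:] (Suc n) =
        [:[:?r (Suc n), ?q (Suc n):], [:?p (Suc n):]:] \<and>
      ?p n * ?q (Suc n) - ?p (Suc n) * ?q n = (- b) ^ n" for n
  proof (induction n)
    case 0
    show ?case by (simp add: one_pCons)
  next
    case (Suc n)
    have "?p (Suc n) * ?q (Suc (Suc n)) - ?p (Suc (Suc n)) * ?q (Suc n) =
        - b * (?p n * ?q (Suc n) - ?p (Suc n) * ?q n)" by (simp add: algebra_simps)
    with Suc show ?case by (simp add: algebra_simps)
  qed
  then show ?thesis by (intro exI[of _ ?p] exI[of _ ?q] exI[of _ ?r]) simp
qed

section \<open>Normal monomials are linearly independent\<close>

context down_up
begin

text \<open>Generic weights separate the exponents: the position of evaluation singles out the least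
  \<open>i\<close>, a delta sequence singles out \<open>k\<close>, and the power of the weight at 1
  reveals \<open>j\<close>.\<close>

lemma lin_eq_zero:
  assumes "lin b = \<zero>\<^bsub>A\<^esub>"
  shows "b = 0"
proof (rule ccontr)
  assume b: "b \<noteq> 0"
  let ?i = "\<lambda>c::'k. [:[:c:]:]"
  \<comment> \<open>The initial weights are independent variables: \<open>?a\<close> at position 0
    is the outer variable, \<open>?b\<close> at position 1 the inner one.\<close>
  let ?a = "[:0, 1:] :: 'k poly poly" and ?b = "[:[:0, 1:]:] :: 'k poly poly"
  define lam where "lam n = (if 0 \<le> n then fwd (?i \<alpha>) (?i \<beta>) (?i \<gamma>) ?a ?b (nat n)
      else bwd (?i \<alpha>) (?i (inverse \<beta>)) (?i \<gamma>) ?a ?b (nat (1 - n)))" for n :: int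
  have "?i \<beta> * ?i (inverse \<beta>) = 1" using \<beta>_nz by (simp add: one_pCons)
  then have "lam (n + 2) = ?i \<alpha> * lam (n + 1) + ?i \<beta> * lam n + ?i \<gamma>" for n
    unfolding lam_def by (rule two_sided_recurrence)
  then interpret r: down_up_rep \<alpha> \<beta> \<gamma> ?i lam
    by unfold_locales (auto simp: one_pCons)
  have lam0: "lam 0 = ?a" and lam1: "lam 1 = ?b" by (simp_all add: lam_def)
  have lam_nz: "lam (int n) \<noteq> 0" for n
  proof -
    obtain p q r where pqr: "\<And>n. fwd (?i \<alpha>) (?i \<beta>) (?i \<gamma>) ?a ?b n = [:[:r n, q n:], [:p n:]:]"
      "\<And>n. p n * q (Suc n) - p (Suc n) * q n = (- \<beta>) ^ n"
      using fwd_linear_form[of \<alpha> \<beta> \<gamma>] by metis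
    show ?thesis
    proof
      assume "lam (int n) = 0"
      then have "p n = 0" "q n = 0" using pqr(1)[of n] by (auto simp: lam_def)
      then show False using pqr(2)[of n] \<beta>_nz by simp
    qed
  qed
  let ?K = "Poly_Mapping.keys b"
  have K: "finite (fst ` ?K)" "fst ` ?K \<noteq> {}" using b by auto
  define i0 where "i0 = Min (fst ` ?K)"
  have "i0 \<in> fst ` ?K" unfolding i0_def by (rule Min_in[OF K])
  then obtain j0 k0 where m0: "(i0, j0, k0) \<in> ?K" by force
  have i0: "i0 \<le> i" if "(i, j, k) \<in> ?K" for i j k
    unfolding i0_def using that by (intro Min_le[OF K(1)]) force
  \<comment> \<open>Evaluated at \<open>i0\<close>, a monomial with \<open>i = i0\<close> reads the
    sequence at position \<open>k\<close>, so the delta at \<open>k0\<close> keeps only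
    \<open>k = k0\<close>.\<close>
  let ?s = "\<lambda>n. if n = int k0 then 1 else 0 :: 'k poly poly"
  define pr where "pr = (\<Prod>l<i0. lam (int i0 - int l))"
  have pr: "pr \<noteq> 0"
  proof -
    have "lam (int i0 - int l) \<noteq> 0" if "l < i0" for l
      using lam_nz[of "i0 - l"] that by (simp add: of_nat_diff)
    then show ?thesis by (simp add: pr_def)
  qed
  \<comment> \<open>For \<open>i > i0\<close> the descent from \<open>i0\<close> passes position 0
    and collects the factor \<open>?a\<close>. Such terms vanish in the constant coefficient for the
    outer variable; the others contribute \<open>?b ^ j\<close>.\<close>
  define G where "G m = (case m of (i, j, k) \<Rightarrow>
      if int i0 - int i + int k = int k0 then
        (if i = i0 then ?b ^ j else ?a * ((\<Prod>l\<in>{Suc i0..<i}. lam (int i0 - int l)) * lam (int i0 - int i + 1) ^ j))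
      else 0)" for m :: mon
  have wact: "r.wact (norm_word m) ?s (int i0) = pr * G m" if "m \<in> ?K" for m
  proof -
    obtain i j k where m: "m = (i, j, k)" by (cases m)
    show ?thesis
    proof (cases "int i0 - int i + int k = int k0")
      case True
      have "(\<Prod>l<i. lam (int i0 - int l)) * lam (int i0 - int i + 1) ^ j = pr * G m"
      proof (cases "i = i0")
        case True
        then show ?thesis using \<open>int i0 - int i + int k = int k0\<close> by (simp add: m G_def pr_def lam1)
      next
        case False
        then have i: "i0 < i" using i0[of i j k] that m by auto
        have "(\<Prod>l<i. lam (int i0 - int l)) = pr * (\<Prod>l\<in>{i0..<i}. lam (int i0 - int l))"
          unfolding pr_def lessThan_atLeast0 using i by (subst prod.atLeastLessThan_concat) auto
        also have "(\<Prod>l\<in>{i0..<i}. lam (int i0 - int l)) = ?a * (\<Prod>l\<in>{Suc i0..<i}. lam (int i0 - int l))"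
          using i by (subst prod.atLeast_Suc_lessThan) (auto simp: lam0)
        finally show ?thesis using True False by (simp add: m G_def mult.assoc)
      qed
      then show ?thesis using True unfolding m by (subst r.wact_norm_word) simp
    next
      case False
      then show ?thesis unfolding m by (subst r.wact_norm_word) (simp add: G_def)
    qed
  qed
  have "0 = r.rho (lin b) ?s (int i0)" unfolding assms by (simp add: r.rho_zero)
  also have "\<dots> = pr * (\<Sum>m\<in>?K. ?i (Poly_Mapping.lookup b m) * G m)"
    unfolding r.rho_lin sum_distrib_left by (rule sum.cong) (use wact in \<open>auto simp: mult_ac\<close>)
  finally have "(\<Sum>m\<in>?K. ?i (Poly_Mapping.lookup b m) * G m) = 0" using pr by simp
  then have "coeff (coeff (\<Sum>m\<in>?K. ?i (Poly_Mapping.lookup b m) * G m) 0) j0 = 0" by simp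
  moreover have "coeff (coeff (\<Sum>m\<in>?K. ?i (Poly_Mapping.lookup b m) * G m) 0) j0 =
      (\<Sum>m\<in>?K. if m = (i0, j0, k0) then Poly_Mapping.lookup b m else 0)"
    unfolding coeff_sum
  proof (rule sum.cong)
    fix m assume "m \<in> ?K"
    obtain i j k where m: "m = (i, j, k)" by (cases m)
    have bp: "coeff (?b ^ j) 0 = monom 1 j" for j
      by (induction j) (auto simp: monom_Suc one_pCons mult.commute coeff_mult monom_0)
    show "coeff (coeff (?i (Poly_Mapping.lookup b m) * G m) 0) j0 =
        (if m = (i0, j0, k0) then Poly_Mapping.lookup b m else 0)"
      by (auto simp: m G_def bp coeff_mult)
  qed simp
  ultimately show False using m0 by (simp add: in_keys_iff)
qed

end

section \<open>Coordinates on the enveloping algebra\<close>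

definition tens :: "('a \<Rightarrow>\<^sub>0 'k::field) \<Rightarrow> ('b \<Rightarrow>\<^sub>0 'k) \<Rightarrow> ('a \<times> 'b \<Rightarrow>\<^sub>0 'k)" where
  "tens x y = Abs_poly_mapping (\<lambda>p. Poly_Mapping.lookup x (fst p) * Poly_Mapping.lookup y (snd p))"

lemma lookup_tens [simp]:
  "Poly_Mapping.lookup (tens x y) p = Poly_Mapping.lookup x (fst p) * Poly_Mapping.lookup y (snd p)"
proof -
  have "{p. Poly_Mapping.lookup x (fst p) * Poly_Mapping.lookup y (snd p) \<noteq> 0} \<subseteq>
      Poly_Mapping.keys x \<times> Poly_Mapping.keys y" by (auto simp: in_keys_iff)
  then have "finite {p. Poly_Mapping.lookup x (fst p) * Poly_Mapping.lookup y (snd p) \<noteq> 0}"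
    by (rule finite_subset) simp
  then show ?thesis unfolding tens_def by simp
qed

lemma tens_add_left: "tens (x + x') y = tens x y + tens x' y"
  by (rule poly_mapping_eqI) (simp add: lookup_add algebra_simps)

lemma tens_add_right: "tens x (y + y') = tens x y + tens x y'"
  by (rule poly_mapping_eqI) (simp add: lookup_add algebra_simps)

lemma tens_scale: "tens (scale c x) y = scale c (tens x y)" "tens x (scale c y) = scale c (tens x y)"
  by (rule poly_mapping_eqI; simp)+

lemma tens_zero [simp]: "tens 0 y = 0" "tens x 0 = 0"
  by (rule poly_mapping_eqI; simp)+

lemma tens_single: "tens (Poly_Mapping.single m b) (Poly_Mapping.single n c) = Poly_Mapping.single (m, n) (b * c)"
  by (rule poly_mapping_eqI) (auto simp: lookup_single when_def)

lemma scale_scale: "scale b (scale c v) = scale (b * c) v"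
  by (rule poly_mapping_eqI) simp

lemma scale_one [simp]: "scale 1 v = v"
  by (rule poly_mapping_eqI) simp

lemma scale_minus: "scale c (- v) = - scale c v" "scale (- c) v = - scale c v"
  by (rule poly_mapping_eqI; simp)+

lemma scale_diff: "scale c (v - w) = scale c v - scale c w"
  by (rule poly_mapping_eqI) (simp add: lookup_minus algebra_simps)

section \<open>Normal form coordinates and grading automorphisms\<close>

context down_up
begin

definition nf :: "(down_up_gen list \<Rightarrow>\<^sub>0 'k) set \<Rightarrow> mon \<Rightarrow>\<^sub>0 'k" where
  "nf a = (SOME b. lin b = a)"

lemma lin_inj: "lin b = lin c \<Longrightarrow> b = c"
proof -
  assume eq: "lin b = lin c"
  have "lin (b - c) \<oplus>\<^bsub>A\<^esub> lin c = lin c" using lin_add[of "b - c" c] eq by simp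
  then have "lin (b - c) = \<zero>\<^bsub>A\<^esub>" by simp
  then show "b = c" using lin_eq_zero by fastforce
qed

lemma nf_lin [simp]: "nf (lin b) = b"
  unfolding nf_def by (rule lin_inj) (rule someI[of _ b], rule refl)

lemma lin_nf [simp]: "a \<in> carrier A \<Longrightarrow> lin (nf a) = a"
  using lin_surj[of a] by auto

lemma nf_add: "a \<in> carrier A \<Longrightarrow> b \<in> carrier A \<Longrightarrow> nf (a \<oplus>\<^bsub>A\<^esub> b) = nf a + nf b"
  by (rule lin_inj) (simp add: lin_add)

lemma nf_smult: "a \<in> carrier A \<Longrightarrow> nf (c \<odot>\<^bsub>A\<^esub> a) = scale c (nf a)"
  by (rule lin_inj) (simp add: lin_scale)

lemma nf_e: "nf (e m) = Poly_Mapping.single m 1"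
  by (rule lin_inj) simp

lemma keys_nf_spn: "a \<in> spn S \<Longrightarrow> Poly_Mapping.keys (nf a) \<subseteq> S"
  by (auto simp: spn_def)

lemma keys_nf_wd: "Poly_Mapping.keys (nf (wd w)) \<subseteq> level (length w) (word_wt w)"
  by (rule keys_nf_spn[OF wd_spn])

text \<open>The grading automorphism \<open>d \<mapsto> c d\<close>, \<open>u \<mapsto> c\<^sup>-\<^sup>1 u\<close>, in normal form coordinates.\<close>

definition tw :: "'k \<Rightarrow> (mon \<Rightarrow>\<^sub>0 'k) \<Rightarrow> (mon \<Rightarrow>\<^sub>0 'k)" where
  "tw c x = Poly_Mapping.mapp (\<lambda>m v. c powi wt m * v) x"

lemma lookup_tw [simp]: "Poly_Mapping.lookup (tw c x) m = c powi wt m * Poly_Mapping.lookup x m"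
  by (simp add: tw_def lookup_mapp when_def in_keys_iff)

lemma tw_add: "tw c (x + y) = tw c x + tw c y"
  by (rule poly_mapping_eqI) (simp add: lookup_add algebra_simps)

lemma tw_scale: "tw c (scale b x) = scale b (tw c x)"
  by (rule poly_mapping_eqI) (simp add: algebra_simps)

text \<open>The normal form of a word contains only monomials of the weight of that word, so the
  twist acts on it by one scalar.\<close>

lemma tw_nf_wd: "tw c (nf (wd w)) = scale (c powi word_wt w) (nf (wd w))"
proof (rule poly_mapping_eqI)
  fix m
  show "Poly_Mapping.lookup (tw c (nf (wd w))) m = Poly_Mapping.lookup (scale (c powi word_wt w) (nf (wd w))) m"
  proof (cases "m \<in> Poly_Mapping.keys (nf (wd w))")
    case True
    then have "wt m = word_wt w" using keys_nf_wd[of w] by (auto simp: level_def)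
    then show ?thesis by simp
  next
    case False
    then show ?thesis by (simp add: in_keys_iff)
  qed
qed

definition sig :: "'k \<Rightarrow> (down_up_gen list \<Rightarrow>\<^sub>0 'k) set \<Rightarrow> (down_up_gen list \<Rightarrow>\<^sub>0 'k) set" where
  "sig c a = lin (tw c (nf a))"

lemma sig_closed [simp, intro]: "sig c a \<in> carrier A"
  by (simp add: sig_def)

lemma nf_sig: "nf (sig c a) = tw c (nf a)"
  by (simp add: sig_def)

lemma sig_add: "a \<in> carrier A \<Longrightarrow> b \<in> carrier A \<Longrightarrow> sig c (a \<oplus>\<^bsub>A\<^esub> b) = sig c a \<oplus>\<^bsub>A\<^esub> sig c b"
  by (simp add: sig_def nf_add tw_add lin_add)

lemma sig_smult: "a \<in> carrier A \<Longrightarrow> sig c (b \<odot>\<^bsub>A\<^esub> a) = b \<odot>\<^bsub>A\<^esub> sig c a"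
  by (simp add: sig_def nf_smult tw_scale lin_scale)

lemma sig_wd: "sig c (wd w) = (c powi word_wt w) \<odot>\<^bsub>A\<^esub> wd w"
  by (simp add: sig_def tw_nf_wd lin_scale)

text \<open>On words \<open>sig\<close> is multiplication by a power of \<open>c\<close> whose
  exponent is additive under concatenation; bilinearity does the rest.\<close>

lemma sig_mult:
  assumes c: "c \<noteq> 0" and a: "a \<in> carrier A" and b: "b \<in> carrier A"
  shows "sig c (a \<otimes>\<^bsub>A\<^esub> b) = sig c a \<otimes>\<^bsub>A\<^esub> sig c b"
  using a
proof (induction a rule: A_induct)
  case (word w k)
  from b show ?case
  proof (induction b rule: A_induct)
    case (word w' k')
    then show ?case
      by (simp add: A.smult_mult_left A.smult_mult_right wd_append[symmetric] sig_smult sig_wd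
          word_wt_append power_int_add[OF disjI1, OF c] A.smult_smult[symmetric] mult_ac)
  next
    case (add a b)
    then show ?case by (simp add: A.r_distr sig_add)
  qed
next
  case (add x y)
  then show ?case using b by (simp add: A.l_distr sig_add)
qed

lemma sig_sig: "c \<noteq> 0 \<Longrightarrow> a \<in> carrier A \<Longrightarrow> sig c (sig (inverse c) a) = a"
proof -
  assume c: "c \<noteq> 0" and a: "a \<in> carrier A"
  have "tw c (tw (inverse c) x) = x" for x
    using c by (intro poly_mapping_eqI) (simp add: power_int_inverse mult.assoc[symmetric])
  then show ?thesis using a by (simp add: sig_def)
qed

lemma sig_one_left: "a \<in> carrier A \<Longrightarrow> sig 1 a = a"
proof -
  assume a: "a \<in> carrier A"
  have "tw 1 x = x" for x by (intro poly_mapping_eqI) simp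
  then show ?thesis using a by (simp add: sig_def)
qed

section \<open>The enveloping algebra as a space of functions on pairs of monomials\<close>

sublocale T: tensor A "opposite_algebra A"
  by (simp add: tensor_def A.k_algebra_axioms A.k_algebra_opposite_algebra)

abbreviation "E \<equiv> enveloping_algebra A"
abbreviation "tn \<equiv> pure_tensor A (opposite_algebra A)"

lemma E_eq: "E = T.E"
  by (simp add: enveloping_algebra_def)

lemma op_simps [simp]:
  "carrier (opposite_algebra A) = carrier A" "a \<otimes>\<^bsub>opposite_algebra A\<^esub> b = b \<otimes>\<^bsub>A\<^esub> a"
  "a \<oplus>\<^bsub>opposite_algebra A\<^esub> b = a \<oplus>\<^bsub>A\<^esub> b" "\<one>\<^bsub>opposite_algebra A\<^esub> = \<one>\<^bsub>A\<^esub>"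
  "c \<odot>\<^bsub>opposite_algebra A\<^esub> a = c \<odot>\<^bsub>A\<^esub> a"
  by (simp_all add: opposite_algebra_def)

sublocale E: k_algebra E
  unfolding E_eq by (rule T.E.k_algebra_axioms)

lemma tn_closed [simp, intro]: "a \<in> carrier A \<Longrightarrow> b \<in> carrier A \<Longrightarrow> tn a b \<in> carrier E"
  by (simp add: E_eq T.t_closed)

lemma tn_mult: "a \<in> carrier A \<Longrightarrow> b \<in> carrier A \<Longrightarrow> a' \<in> carrier A \<Longrightarrow> b' \<in> carrier A \<Longrightarrow>
    tn a b \<otimes>\<^bsub>E\<^esub> tn a' b' = tn (a \<otimes>\<^bsub>A\<^esub> a') (b' \<otimes>\<^bsub>A\<^esub> b)"
  using T.t_mult[of a b a' b'] by (simp add: E_eq)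

lemma tn_add: "a \<in> carrier A \<Longrightarrow> a' \<in> carrier A \<Longrightarrow> b \<in> carrier A \<Longrightarrow>
    tn (a \<oplus>\<^bsub>A\<^esub> a') b = tn a b \<oplus>\<^bsub>E\<^esub> tn a' b"
  "a \<in> carrier A \<Longrightarrow> b \<in> carrier A \<Longrightarrow> b' \<in> carrier A \<Longrightarrow>
    tn a (b \<oplus>\<^bsub>A\<^esub> b') = tn a b \<oplus>\<^bsub>E\<^esub> tn a b'"
  using T.t_add_left[of a a' b] T.t_add_right[of a b b'] by (simp_all add: E_eq)

lemma tn_smult: "a \<in> carrier A \<Longrightarrow> b \<in> carrier A \<Longrightarrow> tn (c \<odot>\<^bsub>A\<^esub> a) b = c \<odot>\<^bsub>E\<^esub> tn a b"
  "a \<in> carrier A \<Longrightarrow> b \<in> carrier A \<Longrightarrow> tn a (c \<odot>\<^bsub>A\<^esub> b) = c \<odot>\<^bsub>E\<^esub> tn a b"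
  using T.t_smult[of a b c] by (simp_all add: E_eq)

lemma E_induct [consumes 1, case_names tensor add]:
  assumes "X \<in> carrier E" "\<And>a b. a \<in> carrier A \<Longrightarrow> b \<in> carrier A \<Longrightarrow> R (tn a b)"
    "\<And>X Y. X \<in> carrier E \<Longrightarrow> Y \<in> carrier E \<Longrightarrow> R X \<Longrightarrow> R Y \<Longrightarrow> R (X \<oplus>\<^bsub>E\<^esub> Y)"
  shows "R X"
  using assms(1)[unfolded E_eq]
  by (induction X rule: T.tensor_induct) (use assms(2,3) in \<open>auto simp: E_eq\<close>)

definition Vgroup :: "(mon \<times> mon \<Rightarrow>\<^sub>0 'k) ring" where
  "Vgroup = \<lparr>carrier = UNIV, monoid.mult = undefined, one = undefined, zero = 0, add = (+)\<rparr>"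

lemma abelian_group_Vgroup: "abelian_group Vgroup"
proof (rule abelian_groupI)
  fix x :: "mon \<times> mon \<Rightarrow>\<^sub>0 'k"
  show "\<exists>y\<in>carrier Vgroup. y \<oplus>\<^bsub>Vgroup\<^esub> x = \<zero>\<^bsub>Vgroup\<^esub>"
    by (rule bexI[of _ "- x"]) (auto simp: Vgroup_def)
qed (auto simp: Vgroup_def algebra_simps)

sublocale XB: balanced_map A "opposite_algebra A" Vgroup "\<lambda>a b. tens (nf a) (nf b)"
  unfolding balanced_map_def balanced_map_axioms_def
  by (simp add: T.tensor_axioms abelian_group_Vgroup)
    (auto simp: Vgroup_def nf_add nf_smult tens_add_left tens_add_right tens_scale)

text \<open>The universal property yields this map to coordinates, and \<open>linE\<close> inverts
  it. Hence nothing collapses in the quotient defining the tensor product, and pairs of normal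
  monomials form a basis.\<close>

definition Xi :: "((down_up_gen list \<Rightarrow>\<^sub>0 'k) set \<times> (down_up_gen list \<Rightarrow>\<^sub>0 'k) set \<Rightarrow>\<^sub>0 'k) set \<Rightarrow>
    (mon \<times> mon \<Rightarrow>\<^sub>0 'k)" where
  "Xi = XB.lift"

lemma Xi_tn: "a \<in> carrier A \<Longrightarrow> b \<in> carrier A \<Longrightarrow> Xi (tn a b) = tens (nf a) (nf b)"
  by (simp add: Xi_def XB.lift_tensor)

lemma Xi_add: "X \<in> carrier E \<Longrightarrow> Y \<in> carrier E \<Longrightarrow> Xi (X \<oplus>\<^bsub>E\<^esub> Y) = Xi X + Xi Y"
  using XB.lift_add[of X Y] by (simp add: Xi_def E_eq Vgroup_def)

lemma Xi_zero [simp]: "Xi \<zero>\<^bsub>E\<^esub> = 0"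
  using Xi_add[of "\<zero>\<^bsub>E\<^esub>" "\<zero>\<^bsub>E\<^esub>"] by simp

lemma Xi_minus: "X \<in> carrier E \<Longrightarrow> Xi (\<ominus>\<^bsub>E\<^esub> X) = - Xi X"
  using Xi_add[of "\<ominus>\<^bsub>E\<^esub> X" X] by (simp add: E.l_neg eq_neg_iff_add_eq_0)

lemma Xi_smult:
  assumes "X \<in> carrier E"
  shows "Xi (c \<odot>\<^bsub>E\<^esub> X) = scale c (Xi X)"
  using assms
  by (induction X rule: E_induct)
    (auto simp: tn_smult(1)[symmetric] Xi_tn nf_smult tens_scale E.smult_r_distr Xi_add scale_add)

definition linE :: "(mon \<times> mon \<Rightarrow>\<^sub>0 'k) \<Rightarrow>
    ((down_up_gen list \<Rightarrow>\<^sub>0 'k) set \<times> (down_up_gen list \<Rightarrow>\<^sub>0 'k) set \<Rightarrow>\<^sub>0 'k) set" where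
  "linE v = (\<Oplus>\<^bsub>E\<^esub>p\<in>Poly_Mapping.keys v. Poly_Mapping.lookup v p \<odot>\<^bsub>E\<^esub> tn (e (fst p)) (e (snd p)))"

lemma linE_superset:
  assumes "finite S" "Poly_Mapping.keys b \<subseteq> S"
  shows "linE b = (\<Oplus>\<^bsub>E\<^esub>p\<in>S. Poly_Mapping.lookup b p \<odot>\<^bsub>E\<^esub> tn (e (fst p)) (e (snd p)))"
  unfolding linE_def
  by (rule E.add.finprod_mono_neutral_cong_left) (use assms in \<open>auto simp: in_keys_iff\<close>)

lemma linE_closed [simp, intro]: "linE b \<in> carrier E"
  unfolding linE_def by (rule E.finsum_closed) auto

lemma linE_add: "linE (b + c) = linE b \<oplus>\<^bsub>E\<^esub> linE c"
proof -
  let ?S = "Poly_Mapping.keys b \<union> Poly_Mapping.keys c"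
  have S: "finite ?S" "Poly_Mapping.keys (b + c) \<subseteq> ?S"
    using keys_add[of b c] by auto
  have "linE (b + c) = (\<Oplus>\<^bsub>E\<^esub>p\<in>?S. Poly_Mapping.lookup b p \<odot>\<^bsub>E\<^esub> tn (e (fst p)) (e (snd p)) \<oplus>\<^bsub>E\<^esub>
      Poly_Mapping.lookup c p \<odot>\<^bsub>E\<^esub> tn (e (fst p)) (e (snd p)))"
    using S by (subst linE_superset[of ?S]) (auto simp: lookup_add E.smult_l_distr)
  also have "\<dots> = linE b \<oplus>\<^bsub>E\<^esub> linE c"
    using S by (subst E.finsum_addf) (auto simp: linE_superset[of ?S])
  finally show ?thesis .
qed

lemma linE_zero [simp]: "linE 0 = \<zero>\<^bsub>E\<^esub>"
  by (simp add: linE_def)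

lemma linE_single: "linE (Poly_Mapping.single (m, n) c) = c \<odot>\<^bsub>E\<^esub> tn (e m) (e n)"
  by (subst linE_superset[of "{(m, n)}"]) auto

lemma linE_tens: "linE (tens x y) = tn (lin x) (lin y)"
  using subset_UNIV[of "Poly_Mapping.keys x"]
proof (induction x rule: poly_mapping_keys_induct)
  case zero
  have "tn \<zero>\<^bsub>A\<^esub> (lin y) = \<zero>\<^bsub>E\<^esub>" using tn_smult(1)[of "\<zero>\<^bsub>A\<^esub>" "lin y" 0] by simp
  then show ?case by simp
next
  case (single m c)
  show ?case
    using subset_UNIV[of "Poly_Mapping.keys y"]
  proof (induction y rule: poly_mapping_keys_induct)
    case zero
    have "tn (lin (Poly_Mapping.single m c)) \<zero>\<^bsub>A\<^esub> = \<zero>\<^bsub>E\<^esub>"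
      using tn_smult(2)[of "lin (Poly_Mapping.single m c)" "\<zero>\<^bsub>A\<^esub>" 0] by simp
    then show ?case by simp
  next
    case (single n c')
    show ?case by (simp add: tens_single linE_single tn_smult E.smult_smult mult.commute)
  next
    case (add f g)
    then show ?case by (simp add: tens_add_right linE_add lin_add tn_add)
  qed
next
  case (add f g)
  then show ?case by (simp add: tens_add_left linE_add lin_add tn_add)
qed

lemma linE_Xi [simp]: "X \<in> carrier E \<Longrightarrow> linE (Xi X) = X"
  by (induction X rule: E_induct) (auto simp: Xi_tn linE_tens Xi_add linE_add)

lemma Xi_linE [simp]: "Xi (linE v) = v"
  using subset_UNIV[of "Poly_Mapping.keys v"]
proof (induction v rule: poly_mapping_keys_induct)
  case (single p c)
  then show ?case by (cases p) (simp add: linE_single Xi_smult Xi_tn nf_e tens_single)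
qed (auto simp: linE_add Xi_add)

lemma Xi_eq_iff: "X \<in> carrier E \<Longrightarrow> Y \<in> carrier E \<Longrightarrow> Xi X = Xi Y \<longleftrightarrow> X = Y"
  by (metis linE_Xi)

text \<open>Operator identities on coordinates can thus be checked on pure tensors, where they
  become identities between products in \<open>A\<close>.\<close>

lemma V_induct [case_names tensor add]:
  assumes "\<And>a b. a \<in> carrier A \<Longrightarrow> b \<in> carrier A \<Longrightarrow> R (tens (nf a) (nf b))"
    and "\<And>v w. R v \<Longrightarrow> R w \<Longrightarrow> R (v + w)"
  shows "R v"
proof -
  have "R (Xi X)" if "X \<in> carrier E" for X
    using that by (induction X rule: E_induct) (auto simp: Xi_tn Xi_add intro: assms)
  from this[of "linE v"] show ?thesis by simp
qed

text \<open>Right multiplication by \<open>d \<otimes> 1\<close>, \<open>u \<otimes> 1\<close>, \<open>1 \<otimes> d\<close> and \<open>1 \<otimes> u\<close>.\<close>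

definition rmul where "rmul Z v = Xi (linE v \<otimes>\<^bsub>E\<^esub> Z)"

definition "DL = rmul (tn dn \<one>\<^bsub>A\<^esub>)"
definition "UL = rmul (tn up \<one>\<^bsub>A\<^esub>)"
definition "DR = rmul (tn \<one>\<^bsub>A\<^esub> dn)"
definition "UR = rmul (tn \<one>\<^bsub>A\<^esub> up)"

lemma rmul_add: "Z \<in> carrier E \<Longrightarrow> rmul Z (v + w) = rmul Z v + rmul Z w"
  by (simp add: rmul_def linE_add E.l_distr Xi_add)

lemma linE_scale: "linE (scale c v) = c \<odot>\<^bsub>E\<^esub> linE v"
  by (metis Xi_smult linE_Xi linE_closed Xi_linE E.smult_closed)

lemma rmul_scale: "Z \<in> carrier E \<Longrightarrow> rmul Z (scale c v) = scale c (rmul Z v)"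
  by (simp add: rmul_def linE_scale E.smult_mult_left Xi_smult)

lemma rmul_diff: "Z \<in> carrier E \<Longrightarrow> rmul Z (v - w) = rmul Z v - rmul Z w"
  using rmul_add[of Z "v - w" w] by simp

lemma op_add [simp]: "DL (v + w) = DL v + DL w" "UL (v + w) = UL v + UL w"
  "DR (v + w) = DR v + DR w" "UR (v + w) = UR v + UR w"
  by (simp_all add: DL_def UL_def DR_def UR_def rmul_add)

lemma op_diff [simp]: "DL (v - w) = DL v - DL w" "UL (v - w) = UL v - UL w"
  "DR (v - w) = DR v - DR w" "UR (v - w) = UR v - UR w"
  by (simp_all add: DL_def UL_def DR_def UR_def rmul_diff)

lemma op_scale [simp]: "DL (scale c v) = scale c (DL v)" "UL (scale c v) = scale c (UL v)"
  "DR (scale c v) = scale c (DR v)" "UR (scale c v) = scale c (UR v)"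
  by (simp_all add: DL_def UL_def DR_def UR_def rmul_scale)

lemma op_zero [simp]: "DL 0 = 0" "UL 0 = 0" "DR 0 = 0" "UR 0 = 0"
  by (simp_all add: DL_def UL_def DR_def UR_def rmul_def)

lemma op_minus [simp]: "DL (- v) = - DL v" "UL (- v) = - UL v" "DR (- v) = - DR v" "UR (- v) = - UR v"
  using op_diff[of 0 v] by simp_all

lemma op_tens:
  assumes "a \<in> carrier A" "b \<in> carrier A"
  shows "DL (tens (nf a) (nf b)) = tens (nf (a \<otimes>\<^bsub>A\<^esub> dn)) (nf b)"
    "UL (tens (nf a) (nf b)) = tens (nf (a \<otimes>\<^bsub>A\<^esub> up)) (nf b)"
    "DR (tens (nf a) (nf b)) = tens (nf a) (nf (dn \<otimes>\<^bsub>A\<^esub> b))"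
    "UR (tens (nf a) (nf b)) = tens (nf a) (nf (up \<otimes>\<^bsub>A\<^esub> b))"
  using assms by (simp_all add: DL_def UL_def DR_def UR_def rmul_def linE_tens tn_mult Xi_tn)

lemma op_commute: "DR (DL v) = DL (DR v)" "DR (UL v) = UL (DR v)" "UR (DL v) = DL (UR v)"
  "UR (UL v) = UL (UR v)"
  by (induction v rule: V_induct) (simp_all add: op_tens)

lemma right_relations:
  assumes a: "a \<in> carrier A"
  shows "a \<otimes>\<^bsub>A\<^esub> dn \<otimes>\<^bsub>A\<^esub> dn \<otimes>\<^bsub>A\<^esub> up = \<alpha> \<odot>\<^bsub>A\<^esub> (a \<otimes>\<^bsub>A\<^esub> dn \<otimes>\<^bsub>A\<^esub> up \<otimes>\<^bsub>A\<^esub> dn) \<oplus>\<^bsub>A\<^esub>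
      \<beta> \<odot>\<^bsub>A\<^esub> (a \<otimes>\<^bsub>A\<^esub> up \<otimes>\<^bsub>A\<^esub> dn \<otimes>\<^bsub>A\<^esub> dn) \<oplus>\<^bsub>A\<^esub> \<gamma> \<odot>\<^bsub>A\<^esub> (a \<otimes>\<^bsub>A\<^esub> dn)"
    "a \<otimes>\<^bsub>A\<^esub> dn \<otimes>\<^bsub>A\<^esub> up \<otimes>\<^bsub>A\<^esub> up = \<alpha> \<odot>\<^bsub>A\<^esub> (a \<otimes>\<^bsub>A\<^esub> up \<otimes>\<^bsub>A\<^esub> dn \<otimes>\<^bsub>A\<^esub> up) \<oplus>\<^bsub>A\<^esub>
      \<beta> \<odot>\<^bsub>A\<^esub> (a \<otimes>\<^bsub>A\<^esub> up \<otimes>\<^bsub>A\<^esub> up \<otimes>\<^bsub>A\<^esub> dn) \<oplus>\<^bsub>A\<^esub> \<gamma> \<odot>\<^bsub>A\<^esub> (a \<otimes>\<^bsub>A\<^esub> up)"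
  using a relation_ddu[of "\<one>\<^bsub>A\<^esub>"] relation_duu[of "\<one>\<^bsub>A\<^esub>"]
  by (simp_all add: A.m_assoc A.r_distr A.smult_mult_right)

text \<open>\<open>DL\<close> and \<open>UL\<close> append letters to the first factor, so for them
  the relations appear in reversed order of composition; \<open>DR\<close> and \<open>UR\<close>
  prepend letters to the second factor and keep the order.\<close>

lemma op_relations:
  "UL (DL (DL v)) = scale \<alpha> (DL (UL (DL v))) + scale \<beta> (DL (DL (UL v))) + scale \<gamma> (DL v)"
  "UL (UL (DL v)) = scale \<alpha> (UL (DL (UL v))) + scale \<beta> (DL (UL (UL v))) + scale \<gamma> (UL v)"
  "DR (DR (UR v)) = scale \<alpha> (DR (UR (DR v))) + scale \<beta> (UR (DR (DR v))) + scale \<gamma> (DR v)"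
  "DR (UR (UR v)) = scale \<alpha> (UR (DR (UR v))) + scale \<beta> (UR (UR (DR v))) + scale \<gamma> (UR v)"
  by (induction v rule: V_induct)
    (simp_all add: op_tens right_relations relation_ddu relation_duu nf_add nf_smult tens_add_left
      tens_add_right tens_scale scale_add algebra_simps)

end

section \<open>Exactness of the small complex\<close>

context down_up
begin

text \<open>These operators are the right multiplications by the matrices of Fox derivatives and of
  the overlap; \<open>rmul_M\<close> makes the link. Stating them in coordinates first turns
  exactness into linear algebra with monomials.\<close>

definition "dA x y = DL x - DR x + (UL y - UR y)"

definition "A11 z = UR (DL z) + DR (UR z) - scale \<alpha> (UL (DL z) + UR (DR z)) -
  scale \<beta> (DL (UL z) + DR (UL z)) - scale \<gamma> z"
definition "A12 z = DL (DL z) - scale \<alpha> (DR (DL z)) - scale \<beta> (DR (DR z))"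
definition "A21 z = UR (UR z) - scale \<alpha> (UR (UL z)) - scale \<beta> (UL (UL z))"
definition "A22 z = UL (DL z) + UR (DL z) - scale \<alpha> (DL (UL z) + DR (UR z)) -
  scale \<beta> (DR (UL z) + UR (DR z)) - scale \<gamma> z"

definition "C1 w = - UR w - scale \<beta> (UL w)"
definition "C2 w = DL w + scale \<beta> (DR w)"

lemmas entry_defs = dA_def A11_def A12_def A21_def A22_def C1_def C2_def

lemma scale_commute: "scale b (scale c v) = scale c (scale b v)"
  by (simp add: scale_scale mult.commute)

lemmas op_simps' = op_commute op_relations scale_add scale_diff scale_minus

text \<open>Fundamental formula of the Fox calculus: the derivatives of a relation \<open>r\<close>,
  multiplied by \<open>x \<otimes> 1 - 1 \<otimes> x\<close> and summed over the generators
  \<open>x\<close>, give \<open>r \<otimes> 1 - 1 \<otimes> r\<close>, which is zero.\<close>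

lemma complex_1: "dA (A11 z) (A12 z) = 0" "dA (A21 z) (A22 z) = 0"
  by (simp_all add: entry_defs op_simps' scale_commute[of \<beta> \<alpha>] scale_commute[of \<gamma> \<alpha>]
      scale_commute[of \<gamma> \<beta>] algebra_simps)

text \<open>Differentiate the overlap identity \<open>r\<^sub>1u + \<beta>ur\<^sub>1 = dr\<^sub>2 +
  \<beta>r\<^sub>2d\<close>. By the Leibniz rule the terms in which an outer letter is
  differentiated keep a relation as a factor and vanish.\<close>

lemma complex_2: "A11 (C1 w) + A21 (C2 w) = 0" "A12 (C1 w) + A22 (C2 w) = 0"
  by (simp_all add: entry_defs op_simps' scale_commute[of \<beta> \<alpha>] scale_commute[of \<gamma> \<alpha>]
      scale_commute[of \<gamma> \<beta>] algebra_simps)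

lemma entry_add:
  "dA (x + x') (y + y') = dA x y + dA x' y'"
  "A11 (x + y) = A11 x + A11 y" "A12 (x + y) = A12 x + A12 y"
  "A21 (x + y) = A21 x + A21 y" "A22 (x + y) = A22 x + A22 y"
  "C1 (x + y) = C1 x + C1 y" "C2 (x + y) = C2 x + C2 y"
  by (simp_all add: entry_defs scale_add algebra_simps)

lemma entry_diff:
  "dA (x - x') (y - y') = dA x y - dA x' y'"
  "A11 (x - y) = A11 x - A11 y" "A12 (x - y) = A12 x - A12 y"
  "A21 (x - y) = A21 x - A21 y" "A22 (x - y) = A22 x - A22 y"
  "C1 (x - y) = C1 x - C1 y" "C2 (x - y) = C2 x - C2 y"
  by (simp_all add: entry_defs scale_add scale_diff algebra_simps)

lemma entry_scale:
  "dA (scale c x) (scale c y) = scale c (dA x y)"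
  "A11 (scale c x) = scale c (A11 x)" "A12 (scale c x) = scale c (A12 x)"
  "A21 (scale c x) = scale c (A21 x)" "A22 (scale c x) = scale c (A22 x)"
  "C1 (scale c x) = scale c (C1 x)" "C2 (scale c x) = scale c (C2 x)"
  by (simp_all add: entry_defs scale_add scale_diff scale_minus scale_commute[of _ c])

text \<open>Only the second tensor factor is restricted: leading terms are taken there, and
  \<open>DL\<close> and \<open>UL\<close> leave that factor alone.\<close>

definition supp :: "mon set \<Rightarrow> (mon \<times> mon \<Rightarrow>\<^sub>0 'k) set" where
  "supp S = {v. Poly_Mapping.keys v \<subseteq> UNIV \<times> S}"

text \<open>The bound is strict, so that an induction on it starts from the zero vector.\<close>

definition below :: "nat \<Rightarrow> mon set" where
  "below N = {n. deg n < N}"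

abbreviation "sg m n c \<equiv> Poly_Mapping.single (m, n) c"

lemma supp_zero [simp]: "0 \<in> supp S"
  by (simp add: supp_def)

lemma supp_add: "v \<in> supp S \<Longrightarrow> w \<in> supp S \<Longrightarrow> v + w \<in> supp S"
  by (simp add: supp_def keys_add_subset)

lemma supp_scale: "v \<in> supp S \<Longrightarrow> scale c v \<in> supp S"
  by (simp add: supp_def keys_scale_subset)

lemma supp_diff: "v \<in> supp S \<Longrightarrow> w \<in> supp S \<Longrightarrow> v - w \<in> supp S"
  by (simp add: supp_def keys_diff_subset)

lemma supp_minus: "v \<in> supp S \<Longrightarrow> - v \<in> supp S"
  using supp_diff[of 0 S v] by simp

lemma supp_single: "n \<in> S \<Longrightarrow> sg m n c \<in> supp S"
  by (auto simp: supp_def)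

lemma supp_mono: "v \<in> supp S \<Longrightarrow> S \<subseteq> S' \<Longrightarrow> v \<in> supp S'"
  by (auto simp: supp_def)

lemma supp_lookup: "v \<in> supp S \<Longrightarrow> n \<notin> S \<Longrightarrow> Poly_Mapping.lookup v (m, n) = 0"
  by (auto simp: supp_def in_keys_iff)

lemma suppI: "(\<And>m n. n \<notin> S \<Longrightarrow> Poly_Mapping.lookup v (m, n) = 0) \<Longrightarrow> v \<in> supp S"
  by (force simp: supp_def in_keys_iff)

lemma supp_op:
  assumes v: "v \<in> supp S" and add: "\<And>v w. f (v + w) = f v + f w" and zero: "f 0 = 0"
    and single: "\<And>m n c. n \<in> S \<Longrightarrow> f (sg m n c) \<in> supp S'"
  shows "f v \<in> supp S'"
proof -
  from v have "Poly_Mapping.keys v \<subseteq> UNIV \<times> S" by (simp add: supp_def)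
  then show ?thesis
  proof (induction v rule: poly_mapping_keys_induct)
    case (single p c)
    then show ?case using assms(4) by (cases p) auto
  qed (simp_all add: zero add supp_add)
qed

lemma sg_eq: "sg m n c = tens (nf (c \<odot>\<^bsub>A\<^esub> e m)) (nf (e n))"
  by (simp add: nf_smult nf_e tens_single)

lemma UR_sg: "UR (sg m (i, j, k) c) = sg m (Suc i, j, k) c"
  by (simp add: sg_eq op_tens up_e)

lemma DR_sg: "DR (sg m (Suc 0, j, k) c) = sg m (0, Suc j, k) c" "DR (sg m (0, 0, k) c) = sg m (0, 0, Suc k) c"
  by (simp_all add: sg_eq op_tens dn_e_Suc dn_e_zero)

lemma tens_supp: "Poly_Mapping.keys y \<subseteq> S \<Longrightarrow> tens x y \<in> supp S"
  by (rule suppI) (auto simp: in_keys_iff)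

lemma supp_L:
  assumes "v \<in> supp S"
  shows "DL v \<in> supp S" "UL v \<in> supp S"
proof -
  have s: "tens x (nf (e n)) \<in> supp S" if "n \<in> S" for x n
    using that by (simp add: nf_e tens_supp)
  show "DL v \<in> supp S" by (rule supp_op[OF assms]) (simp_all add: sg_eq op_tens s)
  show "UL v \<in> supp S" by (rule supp_op[OF assms]) (simp_all add: sg_eq op_tens s)
qed

lemma supp_UR: "v \<in> supp (below N) \<Longrightarrow> UR v \<in> supp (below (Suc N) \<inter> {n. 0 < fst n})"
  by (erule supp_op) (auto simp: UR_sg below_def intro!: supp_single)

lemma supp_DR: "v \<in> supp (below N) \<Longrightarrow> DR v \<in> supp (below (Suc N))"
proof (erule supp_op)
  fix m n c assume n: "n \<in> below N"
  have "Poly_Mapping.keys (nf (dn \<otimes>\<^bsub>A\<^esub> e n)) \<subseteq> level (Suc (deg n)) (wt n + 1)"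
    by (rule keys_nf_spn[OF dn_e])
  then have "Poly_Mapping.keys (nf (dn \<otimes>\<^bsub>A\<^esub> e n)) \<subseteq> below (Suc N)"
    using n by (auto simp: level_def below_def)
  then show "DR (sg m n c) \<in> supp (below (Suc N))"
    by (simp add: sg_eq op_tens tens_supp)
qed simp_all

lemma supp_UR': "v \<in> supp (below N) \<Longrightarrow> UR v \<in> supp (below (Suc N))"
  by (rule supp_mono[OF supp_UR]) auto

lemma supp_UR_pos: "UR v \<in> supp {n. 0 < fst n}"
proof -
  have "v \<in> supp UNIV" by (simp add: supp_def)
  then show ?thesis by (rule supp_op) (auto simp: UR_sg intro!: supp_single)
qed

lemma lookup_UR: "Poly_Mapping.lookup (UR v) (m, (Suc i, j, k)) = Poly_Mapping.lookup v (m, (i, j, k))"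
  using subset_UNIV[of "Poly_Mapping.keys v"]
proof (induction v rule: poly_mapping_keys_induct)
  case (single p c)
  obtain m' i' j' k' where "p = (m', (i', j', k'))" by (metis prod.exhaust)
  then show ?case by (simp add: UR_sg lookup_single when_def)
qed (simp_all add: lookup_add)

text \<open>
  Modulo the image of the second differential every element can be moved into \<open>supp Z1\<close>, and there
  \<open>DR\<close> only shifts monomials, injectively.
\<close>

definition "Z1 = {n. fst n = 0 \<and> fst (snd n) = 0} \<union> {n. fst n = Suc 0}"

lemma lookup_DR:
  assumes "v \<in> supp Z1"
  shows "Poly_Mapping.lookup (DR v) (m, (0, Suc j, k)) = Poly_Mapping.lookup v (m, (Suc 0, j, k))"
    and "Poly_Mapping.lookup (DR v) (m, (0, 0, Suc k)) = Poly_Mapping.lookup v (m, (0, 0, k))"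
  using assms unfolding supp_def mem_Collect_eq
proof (induction v rule: poly_mapping_keys_induct)
  case (single p c)
  obtain m' i' j' k' where p: "p = (m', (i', j', k'))" by (metis prod.exhaust)
  then have "i' = Suc 0 \<or> i' = 0 \<and> j' = 0" using single by (auto simp: Z1_def)
  then show "Poly_Mapping.lookup (DR (Poly_Mapping.single p c)) (m, (0, Suc j, k)) =
      Poly_Mapping.lookup (Poly_Mapping.single p c) (m, (Suc 0, j, k))"
    and "Poly_Mapping.lookup (DR (Poly_Mapping.single p c)) (m, (0, 0, Suc k)) =
      Poly_Mapping.lookup (Poly_Mapping.single p c) (m, (0, 0, k))"
    by (auto simp: p DR_sg lookup_single when_def)
qed (simp_all add: lookup_add)

lemma supp_below_exists: "\<exists>N. v \<in> supp (below N)"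
proof -
  have "finite (deg ` snd ` Poly_Mapping.keys v)" by simp
  then obtain N where "\<forall>x\<in>deg ` snd ` Poly_Mapping.keys v. x < N"
    by (metis finite_nat_set_iff_bounded)
  then have "v \<in> supp (below N)" by (auto simp: supp_def below_def)
  then show ?thesis ..
qed

lemma supp_below_0: "v \<in> supp (below 0) \<Longrightarrow> v = 0"
  by (simp add: supp_def below_def)

lemma supp_below_Suc:
  assumes "v \<in> supp (below (Suc N))" "\<And>m n. deg n = N \<Longrightarrow> Poly_Mapping.lookup v (m, n) = 0"
  shows "v \<in> supp (below N)"
proof (rule suppI)
  fix m n assume "n \<notin> below N"
  then show "Poly_Mapping.lookup v (m, n) = 0"
    using assms supp_lookup[OF assms(1), of n m] by (cases "deg n = N") (auto simp: below_def)
qed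

lemma below_lookup: "v \<in> supp (below N) \<Longrightarrow> N \<le> deg n \<Longrightarrow> Poly_Mapping.lookup v (m, n) = 0"
  by (rule supp_lookup) (auto simp: below_def)

lemma below_Suc: "v \<in> supp (below N) \<Longrightarrow> v \<in> supp (below (Suc N))"
  by (rule supp_mono) (auto simp: below_def)

lemma UR_lookup_0: "Poly_Mapping.lookup (UR v) (m, (0, j, k)) = 0"
  by (rule supp_lookup[OF supp_UR_pos]) simp

text \<open>\<open>UR\<close> raises the degree of the second factor by one and shifts monomials
  injectively, whereas \<open>UL\<close> keeps the degree. The part of top degree must therefore
  vanish.\<close>

lemma C1_inj:
  assumes "C1 w = 0"
  shows "w = 0"
proof -
  have eq: "Poly_Mapping.lookup (UR w) p = - \<beta> * Poly_Mapping.lookup (UL w) p" for p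
    using arg_cong[OF assms, of "\<lambda>v. Poly_Mapping.lookup v p"]
    unfolding C1_def lookup_minus lookup_uminus lookup_scale lookup_zero
    by (metis add.inverse_inverse eq_iff_diff_eq_0 mult_minus_left)
  have "w \<in> supp (below N) \<Longrightarrow> w = 0" for N
  proof (induction N)
    case (Suc N)
    show ?case
    proof (rule Suc.IH, rule supp_below_Suc[OF Suc.prems])
      fix m n assume n: "deg n = N"
      obtain i j k where ijk: "n = (i, j, k)" by (metis prod.exhaust)
      have "Poly_Mapping.lookup w (m, n) = Poly_Mapping.lookup (UR w) (m, (Suc i, j, k))"
        by (simp add: ijk lookup_UR)
      also have "\<dots> = 0"
        unfolding eq using below_lookup[OF supp_L(2)[OF Suc.prems], of "(Suc i, j, k)" m] n
        by (simp add: ijk)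
      finally show "Poly_Mapping.lookup w (m, n) = 0" .
    qed
  qed (rule supp_below_0)
  then show ?thesis using supp_below_exists by blast
qed

text \<open>In top degree only \<open>DR x\<close> and \<open>UR y\<close> contribute, and they have
  no monomial in common: \<open>UR\<close> yields those beginning with \<open>u\<close>, while on
  \<open>Z1\<close> the operator \<open>DR\<close> yields others, injectively.\<close>

lemma dA_inj:
  assumes x: "x \<in> supp Z1" and eq: "dA x y = 0"
  shows "x = 0 \<and> y = 0"
proof -
  have eq: "Poly_Mapping.lookup (DR x) p + Poly_Mapping.lookup (UR y) p =
      Poly_Mapping.lookup (DL x) p + Poly_Mapping.lookup (UL y) p" for p
    using arg_cong[OF eq, of "\<lambda>v. Poly_Mapping.lookup v p"]
    by (simp add: dA_def lookup_minus lookup_add algebra_simps)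
  have "x \<in> supp (below N) \<Longrightarrow> y \<in> supp (below N) \<Longrightarrow> x = 0 \<and> y = 0" for N
  proof (induction N)
    case (Suc N)
    have 0: "Poly_Mapping.lookup (DL x) (m, n) = 0" "Poly_Mapping.lookup (UL y) (m, n) = 0"
      if "deg n = Suc N" for m n
      using that Suc.prems by (auto intro: below_lookup supp_L)
    have x': "x \<in> supp (below N)"
    proof (rule supp_below_Suc[OF Suc.prems(1)])
      fix m n assume n: "deg n = N"
      obtain i j k where ijk: "n = (i, j, k)" by (metis prod.exhaust)
      consider "i = Suc 0" | "i = 0" "j = 0" | "n \<notin> Z1" by (auto simp: ijk Z1_def)
      then show "Poly_Mapping.lookup x (m, n) = 0"
      proof cases
        case 1
        then show ?thesis
          using eq[of "(m, (0, Suc j, k))"] 0[of "(0, Suc j, k)" m] n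
          by (simp add: ijk lookup_DR[OF x] UR_lookup_0)
      next
        case 2
        then show ?thesis
          using eq[of "(m, (0, 0, Suc k))"] 0[of "(0, 0, Suc k)" m] n
          by (simp add: ijk lookup_DR[OF x] UR_lookup_0)
      next
        case 3
        then show ?thesis by (rule supp_lookup[OF x])
      qed
    qed
    have y': "y \<in> supp (below N)"
    proof (rule supp_below_Suc[OF Suc.prems(2)])
      fix m n assume n: "deg n = N"
      obtain i j k where ijk: "n = (i, j, k)" by (metis prod.exhaust)
      have "Poly_Mapping.lookup (DR x) (m, (Suc i, j, k)) = 0"
        using below_lookup[OF supp_DR[OF x']] n by (simp add: ijk)
      then show "Poly_Mapping.lookup y (m, n) = 0"
        using eq[of "(m, (Suc i, j, k))"] 0[of "(Suc i, j, k)" m] n by (simp add: ijk lookup_UR)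
    qed
    show ?case using Suc.IH x' y' by blast
  qed (auto dest: supp_below_0)
  moreover obtain N1 N2 where "x \<in> supp (below N1)" "y \<in> supp (below N2)"
    using supp_below_exists by metis
  then have "x \<in> supp (below (max N1 N2))" "y \<in> supp (below (max N1 N2))"
    by (auto elim!: supp_mono simp: below_def)
  ultimately show ?thesis by blast
qed

text \<open>In top degree the monomials not beginning with \<open>u\<close> come from
  \<open>DR (UR x)\<close> alone, which bounds \<open>x\<close>. Once the degree of \<open>x\<close>
  has dropped, the monomials beginning with \<open>uu\<close> come from \<open>UR (UR y)\<close>
  alone.\<close>

lemma A1_inj:
  assumes x: "x \<in> supp {n. fst n = 0}" and eq: "A11 x + A21 y = 0"
  shows "x = 0 \<and> y = 0"
proof -
  have eq: "Poly_Mapping.lookup (A11 x) p + Poly_Mapping.lookup (A21 y) p = 0" for p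
    using arg_cong[OF eq, of "\<lambda>v. Poly_Mapping.lookup v p"] by (simp add: lookup_add)
  have URx: "UR x \<in> supp Z1"
    using x by (rule supp_op) (auto simp: UR_sg Z1_def intro!: supp_single)
  have "x \<in> supp (below N) \<Longrightarrow> y \<in> supp (below N) \<Longrightarrow> x = 0 \<and> y = 0" for N
  proof (induction N)
    case (Suc N)
    note xN = Suc.prems(1) and yN = Suc.prems(2)
    have x': "x \<in> supp (below N)"
    proof (rule supp_below_Suc[OF Suc.prems(1)])
      fix m n assume n: "deg n = N"
      obtain i j k where ijk: "n = (i, j, k)" by (metis prod.exhaust)
      show "Poly_Mapping.lookup x (m, n) = 0"
      proof (cases "i = 0")
        case True
        let ?n = "(0, Suc j, k)"
        have d: "deg ?n = Suc (Suc N)" using n by (simp add: ijk True)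
        have "Poly_Mapping.lookup (UL (DL x)) (m, ?n) = 0" "Poly_Mapping.lookup (DL (UL x)) (m, ?n) = 0"
          "Poly_Mapping.lookup (DR (UL x)) (m, ?n) = 0" "Poly_Mapping.lookup x (m, ?n) = 0"
          "Poly_Mapping.lookup (UL (UL y)) (m, ?n) = 0"
          using d by (auto intro!: below_lookup[OF supp_L(2)[OF supp_L(1)[OF xN]]]
              below_lookup[OF supp_L(1)[OF supp_L(2)[OF xN]]] below_lookup[OF supp_DR[OF supp_L(2)[OF xN]]]
              below_lookup[OF xN] below_lookup[OF supp_L(2)[OF supp_L(2)[OF yN]]])
        then show ?thesis
          using eq[of "(m, ?n)"]
          by (simp add: A11_def A21_def lookup_add lookup_minus UR_lookup_0 lookup_DR[OF URx] lookup_UR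
              ijk True)
      next
        case False
        then show ?thesis by (intro supp_lookup[OF x]) (simp add: ijk)
      qed
    qed
    have y': "y \<in> supp (below N)"
    proof (rule supp_below_Suc[OF Suc.prems(2)])
      fix m n assume n: "deg n = N"
      obtain i j k where ijk: "n = (i, j, k)" by (metis prod.exhaust)
      let ?n = "(Suc (Suc i), j, k)"
      have d: "deg ?n = Suc (Suc N)" using n by (simp add: ijk)
      have "A11 x \<in> supp (below (Suc (Suc N)))"
        unfolding A11_def using x'
        by (auto intro!: supp_add supp_diff supp_scale supp_UR' supp_DR intro: below_Suc supp_L)
      then have "Poly_Mapping.lookup (A11 x) (m, ?n) = 0" using d by (auto intro: below_lookup)
      moreover have "Poly_Mapping.lookup (UR (UL y)) (m, ?n) = 0"
        "Poly_Mapping.lookup (UL (UL y)) (m, ?n) = 0"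
        using d by (auto intro!: below_lookup[OF supp_UR'[OF supp_L(2)[OF yN]]]
            below_lookup[OF supp_L(2)[OF supp_L(2)[OF yN]]])
      ultimately show "Poly_Mapping.lookup y (m, n) = 0"
        using eq[of "(m, ?n)"] by (simp add: A21_def lookup_minus lookup_UR ijk)
    qed
    show ?case using Suc.IH x' y' by blast
  qed (auto dest: supp_below_0)
  moreover obtain N1 N2 where "x \<in> supp (below N1)" "y \<in> supp (below N2)"
    using supp_below_exists by metis
  then have "x \<in> supp (below (max N1 N2))" "y \<in> supp (below (max N1 N2))"
    by (auto elim!: supp_mono simp: below_def)
  ultimately show ?thesis by blast
qed

section \<open>Reduction modulo the images\<close>

lemma supp_additive_induct:
  assumes v: "v \<in> supp S" and zero: "R 0" and add: "\<And>v w. R v \<Longrightarrow> R w \<Longrightarrow> R (v + w)"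
    and single: "\<And>m n c. n \<in> S \<Longrightarrow> R (sg m n c)"
  shows "R v"
  using v unfolding supp_def mem_Collect_eq
  by (induction v rule: poly_mapping_keys_induct) (use assms in auto)

text \<open>The induction behind reduction by leading terms: a monomial may be exchanged for
  anything of smaller degree in the second factor.\<close>

lemma deg_induct:
  assumes zero: "R 0" and add: "\<And>v w. R v \<Longrightarrow> R w \<Longrightarrow> R (v + w)"
    and single: "\<And>m n c. (\<And>v. v \<in> supp (below (deg n)) \<Longrightarrow> R v) \<Longrightarrow> R (sg m n c)"
  shows "R v"
proof -
  have "R v" if "v \<in> supp (below N)" for N v
    using that
  proof (induction N arbitrary: v)
    case 0
    then show ?case using zero supp_below_0 by blast
  next
    case (Suc N)
    from Suc.prems show ?case
    proof (rule supp_additive_induct[OF _ zero add])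
      fix m n c assume n: "n \<in> below (Suc N)"
      show "R (sg m n c)"
      proof (rule single)
        fix v assume "v \<in> supp (below (deg n))"
        then have "v \<in> supp (below N)" by (rule supp_mono) (use n in \<open>auto simp: below_def\<close>)
        then show "R v" by (rule Suc.IH)
      qed
    qed
  qed
  then show ?thesis using supp_below_exists by blast
qed

text \<open>Up to sign the leading term of \<open>C1\<close> is \<open>UR\<close>, which hits every
  monomial beginning with \<open>u\<close>; the correction \<open>UL\<close> has lower
  degree.\<close>

lemma C1_reduce: "\<exists>w r. z = C1 w + r \<and> r \<in> supp {n. fst n = 0}"
proof (induction z rule: deg_induct)
  case 1
  show ?case by (rule exI[of _ 0], rule exI[of _ 0]) (simp add: C1_def)
next
  case (2 v v')
  then obtain w r w' r' where "v = C1 w + r" "r \<in> supp {n. fst n = 0}"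
    "v' = C1 w' + r'" "r' \<in> supp {n. fst n = 0}" by blast
  then show ?case
    by (intro exI[of _ "w + w'"] exI[of _ "r + r'"]) (simp add: entry_add supp_add)
next
  case (3 m n c)
  obtain i j k where ijk: "n = (i, j, k)" by (metis prod.exhaust)
  show ?case
  proof (cases i)
    case 0
    then show ?thesis by (intro exI[of _ 0] exI[of _ "sg m n c"]) (simp add: C1_def ijk supp_single)
  next
    case (Suc i')
    let ?w = "- sg m (i', j, k) c"
    have "scale \<beta> (UL ?w) \<in> supp (below (deg n))"
      by (intro supp_scale supp_L(2) supp_minus supp_single) (simp add: below_def ijk Suc)
    then obtain w r where w: "scale \<beta> (UL ?w) = C1 w + r" and r: "r \<in> supp {n. fst n = 0}"
      using 3 by blast
    have "sg m n c = C1 ?w + scale \<beta> (UL ?w)"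
      by (simp add: C1_def UR_sg ijk Suc)
    then have "sg m n c = C1 (?w + w) + r" unfolding w entry_add by (simp only: add.assoc)
    with r show ?thesis by blast
  qed
qed

text \<open>\<open>A21\<close> has the leading term \<open>UR (UR z)\<close> and removes monomials
  beginning with \<open>uu\<close>. \<open>A11\<close>, applied to monomials without leading
  \<open>u\<close>, removes those beginning with \<open>du\<close>. What remains is
  \<open>Z1\<close>.\<close>

lemma A1_reduce: "\<exists>z1 z2 r. y = A11 z1 + A21 z2 + r \<and> r \<in> supp Z1"
proof (induction y rule: deg_induct)
  case 1
  show ?case by (rule exI[of _ 0], rule exI[of _ 0], rule exI[of _ 0]) (simp add: A11_def A21_def)
next
  case add: (2 v v')
  then obtain a b r a' b' r' where "v = A11 a + A21 b + r" "r \<in> supp Z1"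
    "v' = A11 a' + A21 b' + r'" "r' \<in> supp Z1" by blast
  then show ?case
    by (intro exI[of _ "a + a'"] exI[of _ "b + b'"] exI[of _ "r + r'"]) (simp add: entry_add supp_add)
next
  case (3 m n c)
  let ?R = "\<lambda>y. \<exists>z1 z2 r. y = A11 z1 + A21 z2 + r \<and> r \<in> supp Z1"
  have zero: "?R 0"
    by (rule exI[of _ 0], rule exI[of _ 0], rule exI[of _ 0]) (simp add: A11_def A21_def)
  have add: "?R (v + v')" if R: "?R v" "?R v'" for v v'
  proof -
    obtain a b r a' b' r' where "v = A11 a + A21 b + r" "r \<in> supp Z1"
      "v' = A11 a' + A21 b' + r'" "r' \<in> supp Z1" using R by blast
    then show ?thesis
      by (intro exI[of _ "a + a'"] exI[of _ "b + b'"] exI[of _ "r + r'"]) (simp add: entry_add supp_add)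
  qed
  have A11: "?R (A11 z)" for z
    by (rule exI[of _ z], rule exI[of _ 0], rule exI[of _ 0]) (simp add: A21_def)
  have A21: "?R (A21 z)" for z
    by (rule exI[of _ 0], rule exI[of _ z], rule exI[of _ 0]) (simp add: A11_def)
  have Z: "?R r" if "r \<in> supp Z1" for r
    using that by (intro exI[of _ 0] exI[of _ r]) (simp add: A11_def A21_def)
  \<comment> \<open>\<open>A11\<close> has a second term of top degree, \<open>UR (DR z)\<close>. It
    begins with \<open>u\<close>, so that case must be available up to the full degree of
    \<open>n\<close> beforehand.\<close>
  have pos: "?R (sg m' n' c')" if n': "deg n' \<le> deg n" "0 < fst n'" for m' n' c'
  proof (cases "deg n' < deg n")
    case True
    then show ?thesis by (intro 3 supp_single) (simp add: below_def)
  next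
    case False
    then have d: "deg n' = deg n" using n' by simp
    obtain i j k where ijk: "n' = (Suc i, j, k)" using n'(2) by (cases n') (auto simp: gr0_conv_Suc)
    show ?thesis
    proof (cases i)
      case 0
      then show ?thesis by (intro Z supp_single) (simp add: ijk Z1_def)
    next
      case (Suc i')
      let ?z = "sg m' (i', j, k) c'"
      have b: "?z \<in> supp (below (deg n - 1))"
        using d by (intro supp_single) (auto simp: below_def ijk Suc)
      have N: "Suc (deg n - 1) = deg n" using d by (auto simp: ijk Suc)
      have "scale \<alpha> (UR (UL ?z)) + scale \<beta> (UL (UL ?z)) \<in> supp (below (deg n))"
        using supp_UR'[OF supp_L(2)[OF b]] below_Suc[OF supp_L(2)[OF supp_L(2)[OF b]]]
        unfolding N by (intro supp_add supp_scale)
      from add[OF A21[of ?z] 3[OF this]] show ?thesis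
        by (simp add: A21_def UR_sg ijk Suc)
    qed
  qed
  obtain i j k where ijk: "n = (i, j, k)" by (metis prod.exhaust)
  consider "0 < i" | "i = 0" "j = 0" | j' where "i = 0" "j = Suc j'" by (cases j) auto
  then show ?case
  proof cases
    case 1
    then show ?thesis by (intro pos) (simp_all add: ijk)
  next
    case 2
    then show ?thesis by (intro Z supp_single) (simp add: ijk Z1_def)
  next
    case (3 j')
    note IH = \<open>\<And>v. v \<in> supp (below (deg n)) \<Longrightarrow> ?R v\<close>
    let ?z = "sg m (0, j', k) c"
    have b: "?z \<in> supp (below (deg n - 1))"
      using 3 by (intro supp_single) (auto simp: below_def ijk)
    have N: "Suc (deg n - 1) = deg n" using 3 by (auto simp: ijk)
    have u: "UR (DR ?z) \<in> supp (below (Suc (deg n)) \<inter> {n. 0 < fst n})"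
      using supp_UR[OF supp_DR[OF b]] unfolding N .
    have Ru: "?R (scale \<alpha> (UR (DR ?z)))"
      using supp_scale[OF u]
      by (rule supp_additive_induct[OF _ zero add pos]) (auto simp: below_def)
    have "scale \<alpha> (UL (DL ?z)) + scale \<beta> (DL (UL ?z) + DR (UL ?z)) + scale \<gamma> ?z - UR (DL ?z)
        \<in> supp (below (deg n))"
      using supp_UR'[OF supp_L(1)[OF b]] supp_DR[OF supp_L(2)[OF b]] below_Suc[OF b]
        below_Suc[OF supp_L(2)[OF supp_L(1)[OF b]]] below_Suc[OF supp_L(1)[OF supp_L(2)[OF b]]]
      unfolding N by (intro supp_add supp_diff supp_scale)
    from add[OF add[OF A11[of ?z] Ru] IH[OF this]] show ?thesis
      by (simp add: A11_def UR_sg DR_sg ijk 3 scale_add algebra_simps)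
  qed
qed

text \<open>Every normal monomial other than 1 arises from a shorter one by prepending
  \<open>u\<close> or \<open>d\<close>. Moving that letter to the first factor shortens the second,
  down to 1.\<close>

lemma dA_reduce: "\<exists>y1 y2 x. v = dA y1 y2 + tens x (Poly_Mapping.single (0, 0, 0) 1)"
proof (induction v rule: deg_induct)
  case 1
  show ?case by (rule exI[of _ 0], rule exI[of _ 0], rule exI[of _ 0]) (simp add: dA_def)
next
  case (2 v v')
  then obtain a b r a' b' r' where "v = dA a b + tens r (Poly_Mapping.single (0, 0, 0) 1)"
    "v' = dA a' b' + tens r' (Poly_Mapping.single (0, 0, 0) 1)" by blast
  then show ?case
    by (intro exI[of _ "a + a'"] exI[of _ "b + b'"] exI[of _ "r + r'"]) (simp add: entry_add tens_add_left)
next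
  case (3 m n c)
  have step: ?case if eq: "sg m n c = dA a b + s" and s: "s \<in> supp (below (deg n))" for a b s
  proof -
    obtain a' b' x where "s = dA a' b' + tens x (Poly_Mapping.single (0, 0, 0) 1)" using 3[OF s] by blast
    then show ?thesis unfolding eq
      by (intro exI[of _ "a + a'"] exI[of _ "b + b'"] exI[of _ x]) (simp add: entry_add)
  qed
  obtain i j k where ijk: "n = (i, j, k)" by (metis prod.exhaust)
  consider i' where "i = Suc i'" | j' where "i = 0" "j = Suc j'" | k' where "i = 0" "j = 0" "k = Suc k'"
    | "i = 0" "j = 0" "k = 0" by (cases i; cases j; cases k) auto
  then show ?case
  proof cases
    case (1 i')
    let ?z = "sg m (i', j, k) c"
    have "- UL (- ?z) \<in> supp (below (deg n))"
      by (intro supp_minus supp_L(2) supp_single) (simp add: below_def ijk 1)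
    then show ?thesis by (intro step[of 0 "- ?z" "- UL (- ?z)"]) (simp_all add: dA_def UR_sg ijk 1)
  next
    case (2 j')
    let ?z = "sg m (Suc 0, j', k) c"
    have "- DL (- ?z) \<in> supp (below (deg n))"
      by (intro supp_minus supp_L(1) supp_single) (simp add: below_def ijk 2)
    then show ?thesis by (intro step[of "- ?z" 0 "- DL (- ?z)"]) (simp_all add: dA_def DR_sg ijk 2)
  next
    case (3 k')
    let ?z = "sg m (0, 0, k') c"
    have "- DL (- ?z) \<in> supp (below (deg n))"
      by (intro supp_minus supp_L(1) supp_single) (simp add: below_def ijk 3)
    then show ?thesis by (intro step[of "- ?z" 0 "- DL (- ?z)"]) (simp_all add: dA_def DR_sg ijk 3)
  next
    case 4
    then show ?thesis
      by (intro exI[of _ 0] exI[of _ "Poly_Mapping.single m c"]) (simp add: dA_def tens_single ijk)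
  qed
qed

text \<open>Subtracting a boundary brings the first component into \<open>Z1\<close>, and there
  \<open>dA\<close> is injective.\<close>

lemma exact_1:
  assumes "dA y1 y2 = 0"
  shows "\<exists>z1 z2. y1 = A11 z1 + A21 z2 \<and> y2 = A12 z1 + A22 z2"
proof -
  obtain z1 z2 r where y1: "y1 = A11 z1 + A21 z2 + r" and r: "r \<in> supp Z1"
    using A1_reduce by blast
  let ?s = "y2 - (A12 z1 + A22 z2)"
  have "dA y1 y2 = dA (A11 z1) (A12 z1) + dA (A21 z2) (A22 z2) + dA r ?s"
    by (simp add: y1 entry_add[symmetric])
  then have "dA r ?s = 0" using assms by (simp add: complex_1)
  then have "r = 0 \<and> ?s = 0" by (rule dA_inj[OF r])
  then show ?thesis using y1 by auto
qed

text \<open>Reduction modulo \<open>C1\<close>, then \<open>A1_inj\<close>. The form with a single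
  equation is the one needed for the dual complex, which is tested on one basis vector only.\<close>

lemma exact_2:
  assumes "A11 z1 + A21 z2 = 0"
  shows "\<exists>w. z1 = C1 w \<and> z2 = C2 w"
proof -
  obtain w r where z1: "z1 = C1 w + r" and r: "r \<in> supp {n. fst n = 0}"
    using C1_reduce by blast
  let ?s = "z2 - C2 w"
  have "A11 z1 + A21 z2 = (A11 (C1 w) + A21 (C2 w)) + (A11 r + A21 ?s)"
    by (simp add: z1 entry_add entry_diff)
  then have "A11 r + A21 ?s = 0" using assms by (simp add: complex_2)
  then have "r = 0 \<and> ?s = 0" by (rule A1_inj[OF r])
  then show ?thesis using z1 by auto
qed

end

section \<open>The small complex over the enveloping algebra and its dual\<close>

context down_up
begin

definition "flip v = Poly_Mapping.map_key prod.swap v" for v :: "mon \<times> mon \<Rightarrow>\<^sub>0 'k"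

lemma lookup_flip [simp]: "Poly_Mapping.lookup (flip v) (m, n) = Poly_Mapping.lookup v (n, m)"
  by (simp add: flip_def Poly_Mapping.map_key.rep_eq)

lemma flip_tens: "flip (tens x y) = tens y x"
proof (rule poly_mapping_eqI)
  fix p show "Poly_Mapping.lookup (flip (tens x y)) p = Poly_Mapping.lookup (tens y x) p"
    by (cases p) (simp add: mult.commute)
qed

lemma flip_add: "flip (v + w) = flip v + flip w"
proof (rule poly_mapping_eqI)
  fix p show "Poly_Mapping.lookup (flip (v + w)) p = Poly_Mapping.lookup (flip v + flip w) p"
    by (cases p) (simp add: lookup_add)
qed

lemma flip_flip [simp]: "flip (flip v) = v"
proof (rule poly_mapping_eqI)
  fix p show "Poly_Mapping.lookup (flip (flip v)) p = Poly_Mapping.lookup v p"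
    by (cases p) simp
qed

definition twV :: "'k \<Rightarrow> (mon \<times> mon \<Rightarrow>\<^sub>0 'k) \<Rightarrow> (mon \<times> mon \<Rightarrow>\<^sub>0 'k)" where
  "twV c v = Poly_Mapping.mapp (\<lambda>p b. c powi wt (fst p) * b) v"

lemma lookup_twV [simp]: "Poly_Mapping.lookup (twV c v) p = c powi wt (fst p) * Poly_Mapping.lookup v p"
  by (simp add: twV_def lookup_mapp when_def in_keys_iff)

lemma twV_add: "twV c (v + w) = twV c v + twV c w"
  by (rule poly_mapping_eqI) (simp add: lookup_add algebra_simps)

lemma twV_tens: "twV c (tens x y) = tens (tw c x) y"
  by (rule poly_mapping_eqI) simp

lemma twV_inverse: "c \<noteq> 0 \<Longrightarrow> twV c (twV (inverse c) v) = v" "c \<noteq> 0 \<Longrightarrow> twV (inverse c) (twV c v) = v"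
  by (rule poly_mapping_eqI; simp add: power_int_inverse mult.assoc[symmetric])+

text \<open>The eigenvalue of the twist on \<open>d\<close>. It is forced: left multiplication by
  \<open>M1\<close> becomes \<open>DR v\<close> minus \<open>lm\<close> times \<open>DL v\<close>,
  and this has to be proportional to \<open>C2 v\<close>, that is to \<open>DL v\<close> plus
  \<beta> times \<open>DR v\<close>.\<close>

definition "lm = - inverse \<beta>"

lemma lm_nz: "lm \<noteq> 0" and lm_inv: "inverse lm = - \<beta>"
  using \<beta>_nz by (simp_all add: lm_def nonzero_inverse_minus_eq)

text \<open>\<open>K\<close> sends \<open>a \<otimes> b\<close> to
  \<open>sig lm b \<otimes> a\<close>. The exchange turns the outer sides of the two factors into
  the inner ones, so left multiplications become the operators already used for right
  multiplications.\<close>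

definition "K X = twV lm (flip (Xi X))"
definition "Kinv v = linE (flip (twV (inverse lm) v))"

lemma Kinv_closed [simp, intro]: "Kinv v \<in> carrier E"
  by (simp add: Kinv_def)

lemma K_Kinv [simp]: "K (Kinv v) = v"
  by (simp add: K_def Kinv_def twV_inverse lm_nz)

lemma Kinv_K [simp]: "X \<in> carrier E \<Longrightarrow> Kinv (K X) = X"
  by (simp add: K_def Kinv_def twV_inverse lm_nz)

lemma K_eq_iff: "X \<in> carrier E \<Longrightarrow> Y \<in> carrier E \<Longrightarrow> K X = K Y \<longleftrightarrow> X = Y"
  by (metis Kinv_K)

lemma K_add: "X \<in> carrier E \<Longrightarrow> Y \<in> carrier E \<Longrightarrow> K (X \<oplus>\<^bsub>E\<^esub> Y) = K X + K Y"
  by (simp add: K_def Xi_add flip_add twV_add)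

lemma K_zero [simp]: "K \<zero>\<^bsub>E\<^esub> = 0"
  using K_add[of "\<zero>\<^bsub>E\<^esub>" "\<zero>\<^bsub>E\<^esub>"] by simp

lemma K_tn: "a \<in> carrier A \<Longrightarrow> b \<in> carrier A \<Longrightarrow> K (tn a b) = tens (nf (sig lm b)) (nf a)"
  by (simp add: K_def Xi_tn flip_tens twV_tens nf_sig)

lemma K_smult: "X \<in> carrier E \<Longrightarrow> K (c \<odot>\<^bsub>E\<^esub> X) = scale c (K X)"
  by (induction X rule: E_induct)
    (auto simp: tn_smult(1)[symmetric] K_tn nf_smult tens_scale E.smult_r_distr K_add scale_add)

definition "lmul Z v = K (Z \<otimes>\<^bsub>E\<^esub> Kinv v)"

lemma K_lmul: "X \<in> carrier E \<Longrightarrow> Z \<in> carrier E \<Longrightarrow> K (Z \<otimes>\<^bsub>E\<^esub> X) = lmul Z (K X)"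
  by (simp add: lmul_def)

lemma Xi_rmul': "X \<in> carrier E \<Longrightarrow> Z \<in> carrier E \<Longrightarrow> Xi (X \<otimes>\<^bsub>E\<^esub> Z) = rmul Z (Xi X)"
  by (simp add: rmul_def)

lemma K_minus: "X \<in> carrier E \<Longrightarrow> K (\<ominus>\<^bsub>E\<^esub> X) = - K X"
  using K_add[of "\<ominus>\<^bsub>E\<^esub> X" X] by (simp add: E.l_neg eq_neg_iff_add_eq_0)

lemma lmul_simps:
  assumes "Y \<in> carrier E" "Z \<in> carrier E"
  shows "lmul (Y \<oplus>\<^bsub>E\<^esub> Z) v = lmul Y v + lmul Z v"
    "lmul (Y \<ominus>\<^bsub>E\<^esub> Z) v = lmul Y v - lmul Z v"
    "lmul (Y \<otimes>\<^bsub>E\<^esub> Z) v = lmul Y (lmul Z v)"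
  using assms
  by (simp_all add: lmul_def E.l_distr K_add a_minus_def E.l_minus K_minus E.m_assoc)

lemma lmul_scalar:
  assumes "Z \<in> carrier E"
  shows "lmul (\<ominus>\<^bsub>E\<^esub> Z) v = - lmul Z v" "lmul (c \<odot>\<^bsub>E\<^esub> Z) v = scale c (lmul Z v)"
  using assms by (simp_all add: lmul_def E.l_minus K_minus E.smult_mult_left K_smult)

lemma rmul_simps:
  assumes "Y \<in> carrier E" "Z \<in> carrier E"
  shows "rmul (Y \<oplus>\<^bsub>E\<^esub> Z) v = rmul Y v + rmul Z v"
    "rmul (Y \<ominus>\<^bsub>E\<^esub> Z) v = rmul Y v - rmul Z v"
    "rmul (Y \<otimes>\<^bsub>E\<^esub> Z) v = rmul Z (rmul Y v)"
  using assms
  by (simp_all add: rmul_def E.r_distr Xi_add a_minus_def E.r_minus Xi_minus E.m_assoc[symmetric])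

lemma rmul_scalar:
  assumes "Z \<in> carrier E"
  shows "rmul (\<ominus>\<^bsub>E\<^esub> Z) v = - rmul Z v" "rmul (c \<odot>\<^bsub>E\<^esub> Z) v = scale c (rmul Z v)"
  using assms by (simp_all add: rmul_def E.r_minus Xi_minus E.smult_mult_right Xi_smult)

lemma one_simps: "lmul \<one>\<^bsub>E\<^esub> v = v" "rmul \<one>\<^bsub>E\<^esub> v = v"
  by (simp_all add: lmul_def rmul_def)

definition "pL = tn dn \<one>\<^bsub>A\<^esub>"
definition "qL = tn up \<one>\<^bsub>A\<^esub>"
definition "pR = tn \<one>\<^bsub>A\<^esub> dn"
definition "qR = tn \<one>\<^bsub>A\<^esub> up"

lemma gens_closed [simp, intro]: "pL \<in> carrier E" "qL \<in> carrier E" "pR \<in> carrier E" "qR \<in> carrier E"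
  by (simp_all add: pL_def qL_def pR_def qR_def)

lemma rmul_gens: "rmul pL = DL" "rmul qL = UL" "rmul pR = DR" "rmul qR = UR"
  by (simp_all add: pL_def qL_def pR_def qR_def DL_def UL_def DR_def UR_def)

lemma sig_gens: "sig c dn = c \<odot>\<^bsub>A\<^esub> dn" "sig c up = inverse c \<odot>\<^bsub>A\<^esub> up" "sig c \<one>\<^bsub>A\<^esub> = \<one>\<^bsub>A\<^esub>"
  using sig_wd[of c "[Down]"] sig_wd[of c "[Up]"] sig_wd[of c "[]"]
  by (simp_all add: dn_def up_def power_int_minus wd_Nil)

text \<open>\<open>sig lm\<close> is multiplicative with eigenvectors \<open>dn\<close> and
  \<open>up\<close>; so the twist appears only as the scalars \<open>lm\<close> and its inverse on
  the operators of the twisted factor.\<close>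

lemma lmul_gens: "lmul pL v = DR v" "lmul qL v = UR v" "lmul pR v = scale lm (DL v)"
  "lmul qR v = scale (- \<beta>) (UL v)"
proof -
  have "K (pL \<otimes>\<^bsub>E\<^esub> X) = DR (K X) \<and> K (qL \<otimes>\<^bsub>E\<^esub> X) = UR (K X) \<and> K (pR \<otimes>\<^bsub>E\<^esub> X) = scale lm (DL (K X)) \<and>
      K (qR \<otimes>\<^bsub>E\<^esub> X) = scale (- \<beta>) (UL (K X))" if "X \<in> carrier E" for X
    using that
  proof (induction X rule: E_induct)
    case (tensor a b)
    then show ?case
      by (simp add: pL_def qL_def pR_def qR_def tn_mult K_tn op_tens sig_mult[OF lm_nz] sig_gens
          A.smult_mult_right nf_smult tens_scale lm_inv)
  next
    case (add X Y)
    then show ?case by (simp add: E.r_distr K_add scale_add)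
  qed
  then show "lmul pL v = DR v" "lmul qL v = UR v" "lmul pR v = scale lm (DL v)"
    "lmul qR v = scale (- \<beta>) (UL v)"
    by (simp_all add: lmul_def)
qed

text \<open>
  Let \<open>r\<^sub>1\<close> and \<open>r\<^sub>2\<close> be the two defining relations.  The row \<open>(M11, M12)\<close> consists of the Fox
  derivatives of \<open>r\<^sub>1\<close> with respect to \<open>d\<close> and \<open>u\<close>, the row \<open>(M21, M22)\<close> of those of \<open>r\<^sub>2\<close>, and
  \<open>(M31, M32)\<close> encodes the overlap \<open>r\<^sub>1u + \<beta>ur\<^sub>1 = dr\<^sub>2 + \<beta>r\<^sub>2d\<close> in the free algebra.
\<close>

definition "M1 = pL \<ominus>\<^bsub>E\<^esub> pR"
definition "M2 = qL \<ominus>\<^bsub>E\<^esub> qR"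
definition "M11 = pL \<otimes>\<^bsub>E\<^esub> qR \<oplus>\<^bsub>E\<^esub> qR \<otimes>\<^bsub>E\<^esub> pR \<ominus>\<^bsub>E\<^esub> \<alpha> \<odot>\<^bsub>E\<^esub> (pL \<otimes>\<^bsub>E\<^esub> qL \<oplus>\<^bsub>E\<^esub> pR \<otimes>\<^bsub>E\<^esub> qR) \<ominus>\<^bsub>E\<^esub>
  \<beta> \<odot>\<^bsub>E\<^esub> (qL \<otimes>\<^bsub>E\<^esub> pL \<oplus>\<^bsub>E\<^esub> qL \<otimes>\<^bsub>E\<^esub> pR) \<ominus>\<^bsub>E\<^esub> \<gamma> \<odot>\<^bsub>E\<^esub> \<one>\<^bsub>E\<^esub>"
definition "M12 = pL \<otimes>\<^bsub>E\<^esub> pL \<ominus>\<^bsub>E\<^esub> \<alpha> \<odot>\<^bsub>E\<^esub> (pL \<otimes>\<^bsub>E\<^esub> pR) \<ominus>\<^bsub>E\<^esub> \<beta> \<odot>\<^bsub>E\<^esub> (pR \<otimes>\<^bsub>E\<^esub> pR)"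
definition "M21 = qR \<otimes>\<^bsub>E\<^esub> qR \<ominus>\<^bsub>E\<^esub> \<alpha> \<odot>\<^bsub>E\<^esub> (qL \<otimes>\<^bsub>E\<^esub> qR) \<ominus>\<^bsub>E\<^esub> \<beta> \<odot>\<^bsub>E\<^esub> (qL \<otimes>\<^bsub>E\<^esub> qL)"
definition "M22 = pL \<otimes>\<^bsub>E\<^esub> qL \<oplus>\<^bsub>E\<^esub> pL \<otimes>\<^bsub>E\<^esub> qR \<ominus>\<^bsub>E\<^esub> \<alpha> \<odot>\<^bsub>E\<^esub> (qL \<otimes>\<^bsub>E\<^esub> pL \<oplus>\<^bsub>E\<^esub> qR \<otimes>\<^bsub>E\<^esub> pR) \<ominus>\<^bsub>E\<^esub>
  \<beta> \<odot>\<^bsub>E\<^esub> (qL \<otimes>\<^bsub>E\<^esub> pR \<oplus>\<^bsub>E\<^esub> pR \<otimes>\<^bsub>E\<^esub> qR) \<ominus>\<^bsub>E\<^esub> \<gamma> \<odot>\<^bsub>E\<^esub> \<one>\<^bsub>E\<^esub>"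
definition "M31 = \<ominus>\<^bsub>E\<^esub> qR \<ominus>\<^bsub>E\<^esub> \<beta> \<odot>\<^bsub>E\<^esub> qL"
definition "M32 = pL \<oplus>\<^bsub>E\<^esub> \<beta> \<odot>\<^bsub>E\<^esub> pR"

lemmas M_defs = M1_def M2_def M11_def M12_def M21_def M22_def M31_def M32_def

lemma M_closed [simp, intro]: "M1 \<in> carrier E" "M2 \<in> carrier E" "M11 \<in> carrier E" "M12 \<in> carrier E"
  "M21 \<in> carrier E" "M22 \<in> carrier E" "M31 \<in> carrier E" "M32 \<in> carrier E"
  by (simp_all add: M_defs E.minus_closed)

lemma rmul_M:
  "rmul M1 v = DL v - DR v" "rmul M2 v = UL v - UR v"
  "rmul M11 v = A11 v" "rmul M12 v = A12 v" "rmul M21 v = A21 v" "rmul M22 v = A22 v"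
  "rmul M31 v = C1 v" "rmul M32 v = C2 v"
  by (simp_all add: M_defs rmul_simps rmul_scalar one_simps rmul_gens entry_defs E.minus_closed op_commute)

text \<open>
  In the coordinates \<open>K\<close>, which exchange the tensor factors and twist one of them, left
  multiplication by the matrices is, up to scalars, right multiplication by their transposes in
  reversed order: the complex is self-dual up to the twist.
\<close>

lemma lmul_M:
  "lmul M1 v = scale (inverse \<beta>) (C2 v)" "lmul M2 v = - C1 v"
  "lmul M11 v = A22 v" "lmul M12 v = scale lm (A12 v)"
  "lmul M21 v = scale (- \<beta>) (A21 v)" "lmul M22 v = A11 v"
  "lmul M31 v = scale \<beta> (UL v - UR v)" "lmul M32 v = DR v - DL v"
proof -
  have b: "\<beta> * lm = - 1" "lm * \<beta> = - 1" "inverse \<beta> * \<beta> = 1" using \<beta>_nz by (simp_all add: lm_def)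
  have bi: "\<beta> * (inverse \<beta> * x) = x" for x using \<beta>_nz by (simp add: mult.assoc[symmetric])
  have s: "scale (- 1) v = - v" for v by (simp add: scale_minus)
  note r = lmul_simps lmul_scalar one_simps lmul_gens E.minus_closed op_commute scale_add scale_diff scale_scale
  show "lmul M1 v = scale (inverse \<beta>) (C2 v)"
    by (simp add: M1_def C2_def r b; simp add: lm_def scale_minus)
  show "lmul M2 v = - C1 v"
    by (simp add: M2_def C1_def r b scale_minus)
  show "lmul M11 v = A22 v"
    by (simp add: M11_def A22_def r b s scale_minus mult_ac; simp add: b mult.assoc[symmetric] s scale_minus algebra_simps)
  show "lmul M12 v = scale lm (A12 v)"
    by (simp add: M12_def A12_def r b s scale_minus mult_ac; simp add: lm_def bi \<beta>_nz scale_minus algebra_simps)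
  show "lmul M21 v = scale (- \<beta>) (A21 v)"
    by (simp add: M21_def A21_def r b s scale_minus mult_ac algebra_simps)
  show "lmul M22 v = A11 v"
    by (simp add: M22_def A11_def r b s scale_minus mult_ac; simp add: b mult.assoc[symmetric] s scale_minus algebra_simps)
  show "lmul M31 v = scale \<beta> (UL v - UR v)"
    by (simp add: M31_def r b s scale_minus)
  show "lmul M32 v = DR v - DL v"
    by (simp add: M32_def r b s)
qed

section \<open>The augmentation and exactness over the enveloping algebra\<close>

abbreviation "Reg \<equiv> env_module A (regular_bimodule A)"
abbreviation "Out \<equiv> env_module A (outer_bimodule A)"

sublocale RB: bimodule_over A "regular_bimodule A"
  by (rule A.bimodule_over_regular)

sublocale Reg: lmodule E Reg
  by (rule RB.lmodule_env_module)

lemma regular_simps [simp]: "carrier (regular_bimodule A) = carrier A"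
  "\<zero>\<^bsub>regular_bimodule A\<^esub> = \<zero>\<^bsub>A\<^esub>" "x \<oplus>\<^bsub>regular_bimodule A\<^esub> y = x \<oplus>\<^bsub>A\<^esub> y"
  by (simp_all add: regular_bimodule_def)

text \<open>The multiplication map \<open>a \<otimes> b \<mapsto> ab\<close>, written as the action
  on 1, so that its linearity is an instance of the module laws.\<close>

definition "eps X = X \<odot>\<^bsub>Reg\<^esub> \<one>\<^bsub>A\<^esub>"

lemma smult_Reg_tn: "a \<in> carrier A \<Longrightarrow> b \<in> carrier A \<Longrightarrow> x \<in> carrier A \<Longrightarrow>
    tn a b \<odot>\<^bsub>Reg\<^esub> x = a \<otimes>\<^bsub>A\<^esub> (x \<otimes>\<^bsub>A\<^esub> b)"
  using RB.smult_env_tensor[of x a b] by (simp add: regular_bimodule_def)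

lemma eps_closed [simp, intro]: "X \<in> carrier E \<Longrightarrow> eps X \<in> carrier A"
  using Reg.smult_closed[of X "\<one>\<^bsub>A\<^esub>"] by (simp add: eps_def)

lemma eps_add: "X \<in> carrier E \<Longrightarrow> Y \<in> carrier E \<Longrightarrow> eps (X \<oplus>\<^bsub>E\<^esub> Y) = eps X \<oplus>\<^bsub>A\<^esub> eps Y"
  using Reg.smult_l_distr[of X Y "\<one>\<^bsub>A\<^esub>"] by (simp add: eps_def)

lemma eps_mult: "X \<in> carrier E \<Longrightarrow> Y \<in> carrier E \<Longrightarrow> eps (X \<otimes>\<^bsub>E\<^esub> Y) = X \<odot>\<^bsub>Reg\<^esub> eps Y"
  using Reg.smult_assoc[of X Y "\<one>\<^bsub>A\<^esub>"] by (simp add: eps_def)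

lemma eps_tn: "a \<in> carrier A \<Longrightarrow> b \<in> carrier A \<Longrightarrow> eps (tn a b) = a \<otimes>\<^bsub>A\<^esub> b"
  by (simp add: eps_def smult_Reg_tn)

lemma eps_minus: "X \<in> carrier E \<Longrightarrow> eps (\<ominus>\<^bsub>E\<^esub> X) = \<ominus>\<^bsub>A\<^esub> eps X"
  using eps_add[of "\<ominus>\<^bsub>E\<^esub> X" X] Reg.smult_zero_left[of "\<one>\<^bsub>A\<^esub>"]
  by (simp add: E.l_neg eps_def[of "\<zero>\<^bsub>E\<^esub>"] A.minus_equality)

lemma eps_M: "eps M1 = \<zero>\<^bsub>A\<^esub>" "eps M2 = \<zero>\<^bsub>A\<^esub>"
  by (simp_all add: M1_def M2_def a_minus_def eps_add eps_minus pL_def qL_def pR_def qR_def eps_tn A.r_neg)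

lemma eps_row: "X \<in> carrier E \<Longrightarrow> Y \<in> carrier E \<Longrightarrow> eps (X \<otimes>\<^bsub>E\<^esub> M1 \<oplus>\<^bsub>E\<^esub> Y \<otimes>\<^bsub>E\<^esub> M2) = \<zero>\<^bsub>A\<^esub>"
  using Reg.smult_zero_right[of X] Reg.smult_zero_right[of Y] by (simp add: eps_add eps_mult eps_M)

lemma eps_dA: "eps (linE (dA x y)) = \<zero>\<^bsub>A\<^esub>"
proof -
  have "Xi (linE x \<otimes>\<^bsub>E\<^esub> M1 \<oplus>\<^bsub>E\<^esub> linE y \<otimes>\<^bsub>E\<^esub> M2) = dA x y"
    by (simp add: Xi_add Xi_rmul' rmul_M dA_def)
  then have "linE (dA x y) = linE x \<otimes>\<^bsub>E\<^esub> M1 \<oplus>\<^bsub>E\<^esub> linE y \<otimes>\<^bsub>E\<^esub> M2"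
    using linE_Xi[of "linE x \<otimes>\<^bsub>E\<^esub> M1 \<oplus>\<^bsub>E\<^esub> linE y \<otimes>\<^bsub>E\<^esub> M2"] by simp
  then show ?thesis by (simp add: eps_row)
qed

text \<open>Modulo the image of \<open>dA\<close> every element is of the form
  \<open>z \<otimes> 1\<close>, and multiplication is injective on these.\<close>

lemma exact_V0: "eps (linE v) = \<zero>\<^bsub>A\<^esub> \<longleftrightarrow> (\<exists>x y. v = dA x y)"
proof
  assume 0: "eps (linE v) = \<zero>\<^bsub>A\<^esub>"
  obtain x y z where v: "v = dA x y + tens z (Poly_Mapping.single (0, 0, 0) 1)"
    using dA_reduce by blast
  have "eps (linE v) = lin z"
    unfolding v by (simp add: linE_add eps_add eps_dA linE_tens eps_tn e_zero)
  then have "z = 0" using 0 lin_eq_zero by simp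
  then show "\<exists>x y. v = dA x y" using v by auto
qed (auto simp: eps_dA)

lemma exact_E0:
  assumes X: "X \<in> carrier E" and 0: "eps X = \<zero>\<^bsub>A\<^esub>"
  shows "\<exists>Y\<in>carrier E. \<exists>Z\<in>carrier E. X = Y \<otimes>\<^bsub>E\<^esub> M1 \<oplus>\<^bsub>E\<^esub> Z \<otimes>\<^bsub>E\<^esub> M2"
proof -
  have "eps (linE (Xi X)) = \<zero>\<^bsub>A\<^esub>" using X 0 by simp
  then obtain x y where "Xi X = dA x y" using exact_V0 by blast
  then have "Xi X = Xi (linE x \<otimes>\<^bsub>E\<^esub> M1 \<oplus>\<^bsub>E\<^esub> linE y \<otimes>\<^bsub>E\<^esub> M2)"
    by (simp add: Xi_add Xi_rmul' rmul_M dA_def)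
  then have "X = linE x \<otimes>\<^bsub>E\<^esub> M1 \<oplus>\<^bsub>E\<^esub> linE y \<otimes>\<^bsub>E\<^esub> M2" using X Xi_eq_iff by simp
  then show ?thesis by blast
qed

lemma exact_E1:
  assumes X: "X \<in> carrier E" and Y: "Y \<in> carrier E" and 0: "X \<otimes>\<^bsub>E\<^esub> M1 \<oplus>\<^bsub>E\<^esub> Y \<otimes>\<^bsub>E\<^esub> M2 = \<zero>\<^bsub>E\<^esub>"
  shows "\<exists>Z\<in>carrier E. \<exists>W\<in>carrier E. X = Z \<otimes>\<^bsub>E\<^esub> M11 \<oplus>\<^bsub>E\<^esub> W \<otimes>\<^bsub>E\<^esub> M21 \<and> Y = Z \<otimes>\<^bsub>E\<^esub> M12 \<oplus>\<^bsub>E\<^esub> W \<otimes>\<^bsub>E\<^esub> M22"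
proof -
  have "dA (Xi X) (Xi Y) = 0"
    using arg_cong[OF 0, of Xi] X Y by (simp add: Xi_add Xi_rmul' rmul_M dA_def)
  then obtain z w where "Xi X = A11 z + A21 w" "Xi Y = A12 z + A22 w" using exact_1 by blast
  then have "Xi X = Xi (linE z \<otimes>\<^bsub>E\<^esub> M11 \<oplus>\<^bsub>E\<^esub> linE w \<otimes>\<^bsub>E\<^esub> M21)" "Xi Y = Xi (linE z \<otimes>\<^bsub>E\<^esub> M12 \<oplus>\<^bsub>E\<^esub> linE w \<otimes>\<^bsub>E\<^esub> M22)"
    by (simp_all add: Xi_add Xi_rmul' rmul_M)
  then have "X = linE z \<otimes>\<^bsub>E\<^esub> M11 \<oplus>\<^bsub>E\<^esub> linE w \<otimes>\<^bsub>E\<^esub> M21" "Y = linE z \<otimes>\<^bsub>E\<^esub> M12 \<oplus>\<^bsub>E\<^esub> linE w \<otimes>\<^bsub>E\<^esub> M22"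
    using X Y Xi_eq_iff by simp_all
  then show ?thesis by blast
qed

lemma complex_E1:
  assumes X: "X \<in> carrier E" and Y: "Y \<in> carrier E"
  shows "(X \<otimes>\<^bsub>E\<^esub> M11 \<oplus>\<^bsub>E\<^esub> Y \<otimes>\<^bsub>E\<^esub> M21) \<otimes>\<^bsub>E\<^esub> M1 \<oplus>\<^bsub>E\<^esub> (X \<otimes>\<^bsub>E\<^esub> M12 \<oplus>\<^bsub>E\<^esub> Y \<otimes>\<^bsub>E\<^esub> M22) \<otimes>\<^bsub>E\<^esub> M2 = \<zero>\<^bsub>E\<^esub>"
proof -
  have "Xi ((X \<otimes>\<^bsub>E\<^esub> M11 \<oplus>\<^bsub>E\<^esub> Y \<otimes>\<^bsub>E\<^esub> M21) \<otimes>\<^bsub>E\<^esub> M1 \<oplus>\<^bsub>E\<^esub> (X \<otimes>\<^bsub>E\<^esub> M12 \<oplus>\<^bsub>E\<^esub> Y \<otimes>\<^bsub>E\<^esub> M22) \<otimes>\<^bsub>E\<^esub> M2) =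
      dA (A11 (Xi X) + A21 (Xi Y)) (A12 (Xi X) + A22 (Xi Y))"
    using X Y by (simp add: Xi_add Xi_rmul' rmul_M dA_def)
  also have "\<dots> = Xi \<zero>\<^bsub>E\<^esub>" by (simp add: entry_add complex_1)
  finally show ?thesis using X Y by (subst (asm) Xi_eq_iff) auto
qed

lemma exact_E2:
  assumes X: "X \<in> carrier E" and Y: "Y \<in> carrier E" and 0: "X \<otimes>\<^bsub>E\<^esub> M11 \<oplus>\<^bsub>E\<^esub> Y \<otimes>\<^bsub>E\<^esub> M21 = \<zero>\<^bsub>E\<^esub>"
  shows "\<exists>W\<in>carrier E. X = W \<otimes>\<^bsub>E\<^esub> M31 \<and> Y = W \<otimes>\<^bsub>E\<^esub> M32"
proof -
  have "A11 (Xi X) + A21 (Xi Y) = 0"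
    using arg_cong[OF 0, of Xi] X Y by (simp add: Xi_add Xi_rmul' rmul_M)
  then obtain w where "Xi X = C1 w" "Xi Y = C2 w" using exact_2 by blast
  then have "Xi X = Xi (linE w \<otimes>\<^bsub>E\<^esub> M31)" "Xi Y = Xi (linE w \<otimes>\<^bsub>E\<^esub> M32)"
    by (simp_all add: Xi_rmul' rmul_M)
  then have "X = linE w \<otimes>\<^bsub>E\<^esub> M31" "Y = linE w \<otimes>\<^bsub>E\<^esub> M32" using X Y Xi_eq_iff by simp_all
  then show ?thesis by blast
qed

lemma complex_E2:
  assumes X: "X \<in> carrier E"
  shows "X \<otimes>\<^bsub>E\<^esub> M31 \<otimes>\<^bsub>E\<^esub> M11 \<oplus>\<^bsub>E\<^esub> X \<otimes>\<^bsub>E\<^esub> M32 \<otimes>\<^bsub>E\<^esub> M21 = \<zero>\<^bsub>E\<^esub>"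
    "X \<otimes>\<^bsub>E\<^esub> M31 \<otimes>\<^bsub>E\<^esub> M12 \<oplus>\<^bsub>E\<^esub> X \<otimes>\<^bsub>E\<^esub> M32 \<otimes>\<^bsub>E\<^esub> M22 = \<zero>\<^bsub>E\<^esub>"
proof -
  have "Xi (X \<otimes>\<^bsub>E\<^esub> M31 \<otimes>\<^bsub>E\<^esub> M11 \<oplus>\<^bsub>E\<^esub> X \<otimes>\<^bsub>E\<^esub> M32 \<otimes>\<^bsub>E\<^esub> M21) = Xi \<zero>\<^bsub>E\<^esub>"
    "Xi (X \<otimes>\<^bsub>E\<^esub> M31 \<otimes>\<^bsub>E\<^esub> M12 \<oplus>\<^bsub>E\<^esub> X \<otimes>\<^bsub>E\<^esub> M32 \<otimes>\<^bsub>E\<^esub> M22) = Xi \<zero>\<^bsub>E\<^esub>"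
    using X by (simp_all add: Xi_add Xi_rmul' rmul_M complex_2)
  then show "X \<otimes>\<^bsub>E\<^esub> M31 \<otimes>\<^bsub>E\<^esub> M11 \<oplus>\<^bsub>E\<^esub> X \<otimes>\<^bsub>E\<^esub> M32 \<otimes>\<^bsub>E\<^esub> M21 = \<zero>\<^bsub>E\<^esub>"
    "X \<otimes>\<^bsub>E\<^esub> M31 \<otimes>\<^bsub>E\<^esub> M12 \<oplus>\<^bsub>E\<^esub> X \<otimes>\<^bsub>E\<^esub> M32 \<otimes>\<^bsub>E\<^esub> M22 = \<zero>\<^bsub>E\<^esub>"
    using X by (subst (asm) (1 2) Xi_eq_iff; auto)+
qed

lemma exact_E3:
  assumes X: "X \<in> carrier E" and 0: "X \<otimes>\<^bsub>E\<^esub> M31 = \<zero>\<^bsub>E\<^esub>"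
  shows "X = \<zero>\<^bsub>E\<^esub>"
proof -
  have "C1 (Xi X) = 0" using arg_cong[OF 0, of Xi] X by (simp add: Xi_rmul' rmul_M)
  then have "Xi X = Xi \<zero>\<^bsub>E\<^esub>" using C1_inj by simp
  then show ?thesis using X by (subst (asm) Xi_eq_iff) auto
qed

section \<open>Exactness of the dual complex\<close>

lemma dual_exact_0:
  assumes X: "X \<in> carrier E" and 0: "M2 \<otimes>\<^bsub>E\<^esub> X = \<zero>\<^bsub>E\<^esub>"
  shows "X = \<zero>\<^bsub>E\<^esub>"
proof -
  have "C1 (K X) = 0" using arg_cong[OF 0, of K] X by (simp add: K_lmul lmul_M)
  then have "K X = K \<zero>\<^bsub>E\<^esub>" using C1_inj by simp
  then show ?thesis using X by (subst (asm) K_eq_iff) auto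
qed

text \<open>Under \<open>K\<close> the equation becomes that of \<open>exact_2\<close> with the two
  components exchanged and one of them scaled by -\<beta>. The sign in \<open>lmul_M\<close> for
  \<open>M2\<close> is absorbed by passing to \<open>- w\<close>.\<close>

lemma dual_exact_1:
  assumes X: "X \<in> carrier E" and Y: "Y \<in> carrier E" and 0: "M21 \<otimes>\<^bsub>E\<^esub> X \<oplus>\<^bsub>E\<^esub> M22 \<otimes>\<^bsub>E\<^esub> Y = \<zero>\<^bsub>E\<^esub>"
  shows "\<exists>Z\<in>carrier E. X = M1 \<otimes>\<^bsub>E\<^esub> Z \<and> Y = M2 \<otimes>\<^bsub>E\<^esub> Z"
proof -
  have "scale (- \<beta>) (A21 (K X)) + A11 (K Y) = 0"
    using arg_cong[OF 0, of K] X Y by (simp add: K_add K_lmul lmul_M)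
  then have "A11 (K Y) + A21 (scale (- \<beta>) (K X)) = 0" by (simp add: entry_scale add.commute)
  then obtain w where w: "K Y = C1 w" "scale (- \<beta>) (K X) = C2 w" using exact_2 by blast
  have KX: "K X = scale (- inverse \<beta>) (C2 w)"
    unfolding w(2)[symmetric] using \<beta>_nz by (simp add: scale_scale)
  have neg: "C1 (- w) = - C1 w" "C2 (- w) = - C2 w"
    by (simp_all add: C1_def C2_def scale_minus)
  have "K X = K (M1 \<otimes>\<^bsub>E\<^esub> Kinv (- w))" "K Y = K (M2 \<otimes>\<^bsub>E\<^esub> Kinv (- w))"
    by (simp_all add: K_lmul lmul_M neg KX w(1) scale_minus)
  then have "X = M1 \<otimes>\<^bsub>E\<^esub> Kinv (- w)" "Y = M2 \<otimes>\<^bsub>E\<^esub> Kinv (- w)" using X Y K_eq_iff by simp_all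
  then show ?thesis by blast
qed

text \<open>Under \<open>K\<close> the two terms combine to a value of \<open>dA\<close>, so
  \<open>exact_1\<close> applies; \<open>?Z\<close> and \<open>?W\<close> undo the scalars of
  \<open>lmul_M\<close>.\<close>

lemma dual_exact_2:
  assumes X: "X \<in> carrier E" and Y: "Y \<in> carrier E" and 0: "M31 \<otimes>\<^bsub>E\<^esub> X \<oplus>\<^bsub>E\<^esub> M32 \<otimes>\<^bsub>E\<^esub> Y = \<zero>\<^bsub>E\<^esub>"
  shows "\<exists>Z\<in>carrier E. \<exists>W\<in>carrier E. X = M11 \<otimes>\<^bsub>E\<^esub> Z \<oplus>\<^bsub>E\<^esub> M12 \<otimes>\<^bsub>E\<^esub> W \<and> Y = M21 \<otimes>\<^bsub>E\<^esub> Z \<oplus>\<^bsub>E\<^esub> M22 \<otimes>\<^bsub>E\<^esub> W"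
proof -
  have "scale \<beta> (UL (K X) - UR (K X)) + (DR (K Y) - DL (K Y)) = 0"
    using arg_cong[OF 0, of K] X Y by (simp add: K_add K_lmul lmul_M)
  then have "dA (- K Y) (scale \<beta> (K X)) = 0" by (simp add: dA_def scale_diff algebra_simps)
  then obtain z w where zw: "- K Y = A11 z + A21 w" "scale \<beta> (K X) = A12 z + A22 w"
    using exact_1 by blast
  let ?Z = "Kinv (scale (inverse \<beta>) w)" and ?W = "Kinv (- z)"
  have KX: "K X = scale (inverse \<beta>) (A12 z + A22 w)"
    unfolding zw(2)[symmetric] using \<beta>_nz by (simp add: scale_scale)
  have KY: "K Y = - A11 z - A21 w" using zw(1) by (metis minus_add_distrib minus_minus diff_conv_add_uminus)
  have m: "A11 (- z) = - A11 z" "A12 (- z) = - A12 z" using entry_diff(2,3)[of 0 z] by (simp_all add: A11_def A12_def)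
  have "K X = K (M11 \<otimes>\<^bsub>E\<^esub> ?Z \<oplus>\<^bsub>E\<^esub> M12 \<otimes>\<^bsub>E\<^esub> ?W)" "K Y = K (M21 \<otimes>\<^bsub>E\<^esub> ?Z \<oplus>\<^bsub>E\<^esub> M22 \<otimes>\<^bsub>E\<^esub> ?W)"
    using \<beta>_nz by (simp_all add: KX KY K_add K_lmul lmul_M entry_scale m scale_add scale_minus scale_scale lm_def)
  then have "X = M11 \<otimes>\<^bsub>E\<^esub> ?Z \<oplus>\<^bsub>E\<^esub> M12 \<otimes>\<^bsub>E\<^esub> ?W" "Y = M21 \<otimes>\<^bsub>E\<^esub> ?Z \<oplus>\<^bsub>E\<^esub> M22 \<otimes>\<^bsub>E\<^esub> ?W"
    using X Y by (simp_all add: K_eq_iff)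
  then show ?thesis by blast
qed

text \<open>Under \<open>K\<close> the image of the last dual map becomes the image of
  \<open>dA\<close>, so its cokernel is again \<open>A\<close> through multiplication. Explicitly
  \<open>a \<otimes> b\<close> goes to \<open>sig lm b\<close> times \<open>a\<close>.\<close>

definition "tau X = eps (linE (K X))"

lemma tau_closed [simp, intro]: "tau X \<in> carrier A"
  by (simp add: tau_def)

lemma tau_add: "X \<in> carrier E \<Longrightarrow> Y \<in> carrier E \<Longrightarrow> tau (X \<oplus>\<^bsub>E\<^esub> Y) = tau X \<oplus>\<^bsub>A\<^esub> tau Y"
  by (simp add: tau_def K_add linE_add eps_add)

lemma tau_tn: "a \<in> carrier A \<Longrightarrow> b \<in> carrier A \<Longrightarrow> tau (tn a b) = sig lm b \<otimes>\<^bsub>A\<^esub> a"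
  by (simp add: tau_def K_tn linE_tens eps_tn)

lemma tau_zero: "tau \<zero>\<^bsub>E\<^esub> = \<zero>\<^bsub>A\<^esub>"
  using tau_add[of "\<zero>\<^bsub>E\<^esub>" "\<zero>\<^bsub>E\<^esub>"] by simp

lemma tau_minus: "X \<in> carrier E \<Longrightarrow> tau (\<ominus>\<^bsub>E\<^esub> X) = \<ominus>\<^bsub>A\<^esub> tau X"
  using tau_add[of "\<ominus>\<^bsub>E\<^esub> X" X] by (simp add: E.l_neg tau_zero A.minus_equality)

text \<open>The inner left action turns \<open>x \<otimes> y\<close> into
  \<open>x \<otimes> ay\<close>, and the second factor is the twisted one. This is where the
  automorphism enters the bimodule structure of Ext.\<close>

lemma tau_left:
  assumes "X \<in> carrier E" and a: "a \<in> carrier A"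
  shows "tau (X \<otimes>\<^bsub>E\<^esub> tn \<one>\<^bsub>A\<^esub> a) = sig lm a \<otimes>\<^bsub>A\<^esub> tau X"
  using assms(1)
  by (induction X rule: E_induct)
    (use a in \<open>auto simp: tn_mult tau_tn sig_mult[OF lm_nz] A.m_assoc E.l_distr tau_add A.r_distr\<close>)

lemma tau_right:
  assumes "X \<in> carrier E" and a: "a \<in> carrier A"
  shows "tau (X \<otimes>\<^bsub>E\<^esub> tn a \<one>\<^bsub>A\<^esub>) = tau X \<otimes>\<^bsub>A\<^esub> a"
  using assms(1)
  by (induction X rule: E_induct)
    (use a in \<open>auto simp: tn_mult tau_tn A.m_assoc E.l_distr tau_add A.l_distr\<close>)

lemma tau_surj: "a \<in> carrier A \<Longrightarrow> tau (tn a \<one>\<^bsub>A\<^esub>) = a"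
  by (simp add: tau_tn sig_gens)

text \<open>\<open>K\<close> turns \<open>M31 Y + M32 Z\<close> into
  \<open>dA (- K Z) (scale \<beta> (K Y))\<close>; the witnesses solve these two equations for
  \<open>Y\<close> and \<open>Z\<close>.\<close>

lemma tau_kernel:
  assumes X: "X \<in> carrier E"
  shows "tau X = \<zero>\<^bsub>A\<^esub> \<longleftrightarrow> (\<exists>Y\<in>carrier E. \<exists>Z\<in>carrier E. X = M31 \<otimes>\<^bsub>E\<^esub> Y \<oplus>\<^bsub>E\<^esub> M32 \<otimes>\<^bsub>E\<^esub> Z)"
proof
  assume "tau X = \<zero>\<^bsub>A\<^esub>"
  then obtain x y where xy: "K X = dA x y" using exact_V0 by (auto simp: tau_def)
  let ?Y = "Kinv (scale (inverse \<beta>) y)" and ?Z = "Kinv (- x)"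
  have "K X = K (M31 \<otimes>\<^bsub>E\<^esub> ?Y \<oplus>\<^bsub>E\<^esub> M32 \<otimes>\<^bsub>E\<^esub> ?Z)"
    using \<beta>_nz by (simp add: xy K_add K_lmul lmul_M dA_def scale_diff scale_scale)
  then have "X = M31 \<otimes>\<^bsub>E\<^esub> ?Y \<oplus>\<^bsub>E\<^esub> M32 \<otimes>\<^bsub>E\<^esub> ?Z" using X by (simp add: K_eq_iff)
  then show "\<exists>Y\<in>carrier E. \<exists>Z\<in>carrier E. X = M31 \<otimes>\<^bsub>E\<^esub> Y \<oplus>\<^bsub>E\<^esub> M32 \<otimes>\<^bsub>E\<^esub> Z" by blast
next
  assume "\<exists>Y\<in>carrier E. \<exists>Z\<in>carrier E. X = M31 \<otimes>\<^bsub>E\<^esub> Y \<oplus>\<^bsub>E\<^esub> M32 \<otimes>\<^bsub>E\<^esub> Z"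
  then obtain Y Z where "Y \<in> carrier E" "Z \<in> carrier E" "X = M31 \<otimes>\<^bsub>E\<^esub> Y \<oplus>\<^bsub>E\<^esub> M32 \<otimes>\<^bsub>E\<^esub> Z" by blast
  then have "K X = dA (- K Z) (scale \<beta> (K Y))"
    by (simp add: K_add K_lmul lmul_M dA_def scale_diff)
  then show "tau X = \<zero>\<^bsub>A\<^esub>" by (simp add: tau_def eps_dA)
qed

end

type_synonym 'k du = "(down_up_gen list \<Rightarrow>\<^sub>0 'k) set"
type_synonym 'k env = "('k du \<times> 'k du \<Rightarrow>\<^sub>0 'k) set"

section \<open>The twist is not inner\<close>

context down_up_rep
begin

text \<open>The commutator with the shift, which is the action of \<open>d\<close>, on operators of
  sequences.\<close>

definition ad :: "((int \<Rightarrow> 'r) \<Rightarrow> int \<Rightarrow> 'r) \<Rightarrow> (int \<Rightarrow> 'r) \<Rightarrow> int \<Rightarrow> 'r" where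
  "ad T = (\<lambda>s n. T s (n + 1) - T (\<lambda>m. s (m + 1)) n)"

definition zop :: "(int \<Rightarrow> 'r) \<Rightarrow> int \<Rightarrow> 'r" where
  "zop = (\<lambda>_ _. 0)"

lemma ad_zop: "(ad ^^ N) zop = zop"
  by (induction N) (auto simp: ad_def zop_def)

lemma ad_add: "(ad ^^ N) (\<lambda>s n. S s n + T s n) = (\<lambda>s n. (ad ^^ N) S s n + (ad ^^ N) T s n)"
proof (induction N arbitrary: S T)
  case (Suc N)
  have "ad (\<lambda>s n. S s n + T s n) = (\<lambda>s n. ad S s n + ad T s n)"
    by (intro ext) (simp add: ad_def)
  then show ?case using Suc[of "ad S" "ad T"] by (simp add: funpow_swap1)
qed simp

lemma ad_scale: "(ad ^^ N) (\<lambda>s n. c * T s n) = (\<lambda>s n. c * (ad ^^ N) T s n)"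
proof (induction N arbitrary: T)
  case (Suc N)
  have "ad (\<lambda>s n. c * T s n) = (\<lambda>s n. c * ad T s n)"
    by (intro ext) (simp add: ad_def algebra_simps)
  then show ?case using Suc[of "ad T"] by (simp add: funpow_swap1)
qed simp

lemma ad_mono: "(ad ^^ N) T = zop \<Longrightarrow> N \<le> M \<Longrightarrow> (ad ^^ M) T = zop"
  using ad_zop[of "M - N"] funpow_add[of "M - N" N ad] by simp

lemma ad_dn: "(ad ^^ N) (\<lambda>s n. T s (n + 1)) = (\<lambda>s n. (ad ^^ N) T s (n + 1))"
proof (induction N arbitrary: T)
  case (Suc N)
  have "ad (\<lambda>s n. T s (n + 1)) = (\<lambda>s n. ad T s (n + 1))" by (intro ext) (simp add: ad_def)
  then show ?case using Suc[of "ad T"] by (simp add: funpow_swap1)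
qed simp

text \<open>For weights in arithmetic progression the commutator satisfies a Leibniz rule, in which
  differentiating \<open>u\<close> leaves only the constant \<open>w\<close>. Each letter
  \<open>u\<close> thus raises the order of nilpotence by at most one.\<close>

lemma ad_up:
  assumes w: "\<And>n. lam (n + 1) - lam n = w" and T: "(ad ^^ N) T = zop"
  shows "(ad ^^ Suc N) (\<lambda>s n. lam n * T s (n - 1)) = zop"
  using T
proof (induction N arbitrary: T)
  case 0
  then have "T = zop" by simp
  then show ?case by (auto simp: ad_def zop_def)
next
  case (Suc N)
  have "ad (\<lambda>s n. lam n * T s (n - 1)) = (\<lambda>s n. lam n * ad T s (n - 1) + w * T s n)"
  proof (intro ext)
    fix s n
    have "lam (n + 1) = lam n + w" using w[of n] by (simp add: algebra_simps)
    then show "ad (\<lambda>s n. lam n * T s (n - 1)) s n = lam n * ad T s (n - 1) + w * T s n"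
      by (simp add: ad_def algebra_simps)
  qed
  then have "(ad ^^ Suc (Suc N)) (\<lambda>s n. lam n * T s (n - 1)) =
      (ad ^^ Suc N) (\<lambda>s n. lam n * ad T s (n - 1) + w * T s n)"
    by (simp add: funpow_swap1)
  also have "\<dots> = (\<lambda>s n. (ad ^^ Suc N) (\<lambda>s n. lam n * ad T s (n - 1)) s n + w * (ad ^^ Suc N) T s n)"
    unfolding ad_add ad_scale ..
  also have "\<dots> = zop"
    using Suc.IH[of "ad T"] Suc.prems by (simp add: funpow_swap1 zop_def)
  finally show ?case .
qed

lemma ad_wact:
  assumes w: "\<And>n. lam (n + 1) - lam n = w"
  shows "\<exists>N. (ad ^^ N) (wact v) = zop"
proof (induction v rule: word_wt.induct)
  case 1
  have "(ad ^^ 1) (wact []) = zop" by (auto simp: ad_def zop_def)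
  then show ?case ..
next
  case (2 v)
  then obtain N where N: "(ad ^^ N) (wact v) = zop" ..
  have "wact (Down # v) = (\<lambda>s n. wact v s (n + 1))" by auto
  then have "(ad ^^ N) (wact (Down # v)) = zop" using N by (simp add: ad_dn zop_def)
  then show ?case ..
next
  case (3 v)
  then obtain N where N: "(ad ^^ N) (wact v) = zop" ..
  have "wact (Up # v) = (\<lambda>s n. lam n * wact v s (n - 1))" by auto
  then have "(ad ^^ Suc N) (wact (Up # v)) = zop" using ad_up[OF w N] by simp
  then show ?case ..
qed

lemma ad_rho:
  assumes w: "\<And>n. lam (n + 1) - lam n = w" and a: "a \<in> carrier A"
  shows "\<exists>N. (ad ^^ N) (rho a) = zop"
  using a
proof (induction a rule: A_induct)
  case (word v c)
  obtain N where N: "(ad ^^ N) (wact v) = zop" using ad_wact[OF w] by blast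
  have "rho (c \<odot>\<^bsub>A\<^esub> wd v) = (\<lambda>s n. \<iota> c * wact v s n)" by (intro ext) (simp add: rho_smult rho_wd)
  then have "(ad ^^ N) (rho (c \<odot>\<^bsub>A\<^esub> wd v)) = zop" using N by (simp add: ad_scale zop_def)
  then show ?case ..
next
  case (add a b)
  then obtain N M where N: "(ad ^^ N) (rho a) = zop" "(ad ^^ M) (rho b) = zop" by blast
  have "rho (a \<oplus>\<^bsub>A\<^esub> b) = (\<lambda>s n. rho a s n + rho b s n)" using add by (intro ext) (simp add: rho_add)
  then have "(ad ^^ max N M) (rho (a \<oplus>\<^bsub>A\<^esub> b)) = zop"
    using ad_mono[OF N(1), of "max N M"] ad_mono[OF N(2), of "max N M"] by (simp add: ad_add zop_def)
  then show ?case ..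
qed

lemma rho_zero_fun: "a \<in> carrier A \<Longrightarrow> rho a (\<lambda>_. 0) n = 0"
  by (auto simp: carrier_A rho_cl act_linear_zero)

end

context down_up
begin

text \<open>In either case there is a representation where \<open>c\<close> must annihilate the
  constant sequence 1, which contradicts the left inverse.\<close>

lemma twist_not_inner:
  assumes \<beta>: "\<beta> \<noteq> - 1" and c: "c \<in> carrier A" and a: "a \<in> carrier A"
    and inv: "a \<otimes>\<^bsub>A\<^esub> c = \<one>\<^bsub>A\<^esub>" and tw: "dn \<otimes>\<^bsub>A\<^esub> c = lm \<odot>\<^bsub>A\<^esub> (c \<otimes>\<^bsub>A\<^esub> dn)"
  shows False
proof -
  have lm1: "lm \<noteq> 1" using \<beta> \<beta>_nz by (auto simp: lm_def field_simps eq_neg_iff_add_eq_0)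
  show False
  proof (cases "\<exists>\<kappa>. \<kappa> = \<alpha> * \<kappa> + \<beta> * \<kappa> + \<gamma>")
    case True
    then obtain \<kappa> where \<kappa>: "\<kappa> = \<alpha> * \<kappa> + \<beta> * \<kappa> + \<gamma>" ..
    \<comment> \<open>With constant weights all operators preserve constant sequences. On these
      \<open>d\<close> is the identity, so the value of \<open>c\<close> equals \<open>lm\<close>
      times itself.\<close>
    interpret r: down_up_rep \<alpha> \<beta> \<gamma> "\<lambda>x. x" "\<lambda>_. \<kappa>" by unfold_locales (use \<kappa> in auto)
    have w: "r.wact w (\<lambda>_. 1) (n + 1) = r.wact w (\<lambda>_. 1) n" for w n
    proof (induction w arbitrary: n rule: word_wt.induct)
      case (3 w)
      then show ?case using 3[of "n - 1"] by simp
    qed simp_all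
    have const: "r.rho b (\<lambda>_. 1) (n + 1) = r.rho b (\<lambda>_. 1) n" if "b \<in> carrier A" for b n
      using that by (induction b rule: A_induct) (auto simp: r.rho_smult r.rho_wd r.rho_add w)
    have z: "r.rho c (\<lambda>_. 1) n = 0" for n
    proof -
      have "r.rho dn (\<lambda>_. 1) = (\<lambda>_. 1)" by (auto simp: r.rho_dn)
      then have "r.rho c (\<lambda>_. 1) (n + 1) = lm * r.rho c (\<lambda>_. 1) n"
        using arg_cong[OF tw, of "\<lambda>x. r.rho x (\<lambda>_. 1) n"] c
        by (simp add: r.rho_mult r.rho_smult r.rho_dn)
      then have "r.rho c (\<lambda>_. 1) n = lm * r.rho c (\<lambda>_. 1) n"
        by (rule trans[OF const[OF c, symmetric]])
      then show ?thesis using lm1 unfolding mult_cancel_right1 by blast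
    qed
    have z': "r.rho c (\<lambda>_. 1) = (\<lambda>_. 0)" by (intro ext z)
    have "r.rho (a \<otimes>\<^bsub>A\<^esub> c) (\<lambda>_. 1) 0 = 0"
      unfolding r.rho_mult[OF a c] z' by (rule r.rho_zero_fun[OF a])
    moreover have "r.rho (a \<otimes>\<^bsub>A\<^esub> c) (\<lambda>_. 1) 0 = 1" unfolding inv by (rule r.rho_one)
    ultimately have "(0::'k) = 1" by (rule trans[OF sym])
    then show False by (rule notE[OF zero_neq_one])
  next
    case False
    have ab: "\<alpha> + \<beta> = 1"
    proof (rule ccontr)
      assume "\<alpha> + \<beta> \<noteq> 1"
      then have "1 - \<alpha> - \<beta> \<noteq> 0" by (simp add: algebra_simps)
      then obtain \<kappa> where \<kappa>: "(1 - \<alpha> - \<beta>) * \<kappa> = \<gamma>"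
        by (metis nonzero_mult_div_cancel_left times_divide_eq_right)
      have "\<kappa> = \<alpha> * \<kappa> + \<beta> * \<kappa> + \<gamma>" unfolding \<kappa>[symmetric] by (simp add: algebra_simps)
      then show False using False by blast
    qed
    \<comment> \<open>With \<alpha> = 1 - \<beta> the progression \<open>n w\<close> satisfies the
      recurrence exactly if \<open>(1 + \<beta>) w = \<gamma>\<close>.\<close>
    define w where "w = \<gamma> / (1 + \<beta>)"
    have "1 + \<beta> \<noteq> 0" using \<beta> by (metis add.commute add_eq_0_iff)
    then have w: "(1 + \<beta>) * w = \<gamma>" by (simp add: w_def)
    have \<alpha>: "\<alpha> = 1 - \<beta>" using ab by (simp add: algebra_simps)
    have "of_int (n + 2) * w = \<alpha> * (of_int (n + 1) * w) + \<beta> * (of_int n * w) + \<gamma>" for n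
      unfolding w[symmetric] \<alpha> by (simp add: algebra_simps)
    then interpret r: down_up_rep \<alpha> \<beta> \<gamma> "\<lambda>x. x" "\<lambda>n. of_int n * w" by unfold_locales auto
    have tw': "r.rho c s (n + 1) = lm * r.rho c (\<lambda>m. s (m + 1)) n" for s n
    proof -
      have "r.rho dn s = (\<lambda>m. s (m + 1))" by (auto simp: r.rho_dn)
      then show ?thesis
        using arg_cong[OF tw, of "\<lambda>x. r.rho x s n"] c by (simp add: r.rho_mult r.rho_smult r.rho_dn)
    qed
    \<comment> \<open>The commutation relation makes \<open>c\<close> an eigenvector of the
      commutator up to a shift of the argument, with nonzero eigenvalue; this conflicts with local
      nilpotence unless \<open>c\<close> acts as 0.\<close>
    have ad: "(r.ad ^^ N) (r.rho c) = (\<lambda>s n. (lm - 1) ^ N * r.rho c (\<lambda>m. s (m + int N)) n)" for N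
    proof (induction N)
      case (Suc N)
      have "r.ad (\<lambda>s n. (lm - 1) ^ N * r.rho c (\<lambda>m. s (m + int N)) n) =
          (\<lambda>s n. (lm - 1) ^ Suc N * r.rho c (\<lambda>m. s (m + int (Suc N))) n)"
      proof (intro ext)
        fix s n
        show "r.ad (\<lambda>s n. (lm - 1) ^ N * r.rho c (\<lambda>m. s (m + int N)) n) s n =
            (lm - 1) ^ Suc N * r.rho c (\<lambda>m. s (m + int (Suc N))) n"
          using tw'[of "\<lambda>m. s (m + int N)" n] by (simp add: r.ad_def algebra_simps)
      qed
      then show ?case using Suc by simp
    qed simp
    have step: "of_int (n + 1) * w - of_int n * w = w" for n :: int by (simp add: algebra_simps)
    obtain N where N: "(r.ad ^^ N) (r.rho c) = r.zop" using r.ad_rho[OF step c] by blast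
    \<comment> \<open>The shift is invertible on two-sided sequences, so the argument is first moved
      back by \<open>N\<close>.\<close>
    have z: "r.rho c s n = 0" for s n
    proof -
      have "(lm - 1) ^ N * r.rho c (\<lambda>m. (\<lambda>m. s (m - int N)) (m + int N)) n = r.zop (\<lambda>m. s (m - int N)) n"
        by (rule fun_cong[OF fun_cong[OF trans[OF ad[symmetric] N]]])
      then have "(lm - 1) ^ N * r.rho c s n = 0"
        by (simp only: add_diff_cancel_right' r.zop_def)
      moreover have "(lm - 1) ^ N \<noteq> 0" by (rule power_not_zero) (use lm1 in \<open>simp only: right_minus_eq not_False_eq_True\<close>)
      ultimately show ?thesis by (simp only: mult_eq_0_iff simp_thms)
    qed
    have z': "r.rho c (\<lambda>_. 1) = (\<lambda>_. 0)" by (intro ext z)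
    have "r.rho (a \<otimes>\<^bsub>A\<^esub> c) (\<lambda>_. 1) 0 = 0"
      unfolding r.rho_mult[OF a c] z' by (rule r.rho_zero_fun[OF a])
    moreover have "r.rho (a \<otimes>\<^bsub>A\<^esub> c) (\<lambda>_. 1) 0 = 1" unfolding inv by (rule r.rho_one)
    ultimately have "(0::'k) = 1" by (rule trans[OF sym])
    then show False by (rule notE[OF zero_neq_one])
  qed
qed

text \<open>The index type of resolutions is prescribed by the definition of Ext; generators are
  placed in it along the natural number component.\<close>

definition ix :: "nat \<Rightarrow> 'k du \<times> 'k env \<times> nat" where
  "ix j = (undefined, undefined, j)"

lemma ix_eq_iff [simp]: "ix i = ix j \<longleftrightarrow> i = j"
  by (simp add: ix_def)

section \<open>The small complex as a free resolution\<close>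

definition rows :: "nat \<Rightarrow> ('k du \<times> 'k env \<times> nat) set" where
  "rows n = (if n = 0 \<or> n = 3 then {ix 0} else if n = 1 \<or> n = 2 then {ix 0, ix 1} else {})"

text \<open>Elements of all modules of the complex share this format with two entries; in rank one
  the second entry is zero.\<close>

definition row :: "'k env \<Rightarrow> 'k env \<Rightarrow> 'k du \<times> 'k env \<times> nat \<Rightarrow> 'k env" where
  "row a b = (\<lambda>x. if x = ix 0 then a else if x = ix 1 then b else \<zero>\<^bsub>E\<^esub>)"

lemma row_apply [simp]: "row a b (ix 0) = a" "row a b (ix (Suc 0)) = b"
  by (simp_all add: row_def)

lemma row_eq_iff: "row a b = row c d \<longleftrightarrow> a = c \<and> b = d"
  by (metis row_apply)

lemma row_zero: "(\<lambda>_. \<zero>\<^bsub>E\<^esub>) = row \<zero>\<^bsub>E\<^esub> \<zero>\<^bsub>E\<^esub>"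
  by (intro ext) (simp add: row_def)

lemma row_add: "(\<lambda>i. row a b i \<oplus>\<^bsub>E\<^esub> row c d i) = row (a \<oplus>\<^bsub>E\<^esub> c) (b \<oplus>\<^bsub>E\<^esub> d)"
  by (intro ext) (simp add: row_def)

lemma row_smult: "r \<in> carrier E \<Longrightarrow> (\<lambda>i. r \<otimes>\<^bsub>E\<^esub> row a b i) = row (r \<otimes>\<^bsub>E\<^esub> a) (r \<otimes>\<^bsub>E\<^esub> b)"
  by (intro ext) (simp add: row_def)

abbreviation "Q n \<equiv> free_module E (rows n)"

lemma row_finite: "finite {i. row a b i \<noteq> \<zero>\<^bsub>E\<^esub>}"
  by (rule finite_subset[of _ "{ix 0, ix 1}"]) (auto simp: row_def)

lemma carrier_Q1:
  assumes "n = 0 \<or> n = 3"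
  shows "x \<in> carrier (Q n) \<longleftrightarrow> (\<exists>a\<in>carrier E. x = row a \<zero>\<^bsub>E\<^esub>)"
proof
  assume x: "x \<in> carrier (Q n)"
  then have "x = row (x (ix 0)) \<zero>\<^bsub>E\<^esub>"
    using assms
    by (intro ext) (auto simp: E.free_module_carrier rows_def row_def simp del: split_paired_All)
  then show "\<exists>a\<in>carrier E. x = row a \<zero>\<^bsub>E\<^esub>" using E.free_module_closed[OF x] by blast
next
  assume "\<exists>a\<in>carrier E. x = row a \<zero>\<^bsub>E\<^esub>"
  then show "x \<in> carrier (Q n)"
    using assms row_finite by (auto simp: E.free_module_carrier rows_def row_def)
qed

lemma carrier_Q2:
  assumes "n = 1 \<or> n = 2"
  shows "x \<in> carrier (Q n) \<longleftrightarrow> (\<exists>a\<in>carrier E. \<exists>b\<in>carrier E. x = row a b)"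
proof
  assume x: "x \<in> carrier (Q n)"
  then have "x = row (x (ix 0)) (x (ix 1))"
    using assms
    by (intro ext) (auto simp: E.free_module_carrier rows_def row_def simp del: split_paired_All)
  then show "\<exists>a\<in>carrier E. \<exists>b\<in>carrier E. x = row a b" using E.free_module_closed[OF x] by blast
next
  assume "\<exists>a\<in>carrier E. \<exists>b\<in>carrier E. x = row a b"
  then show "x \<in> carrier (Q n)"
    using assms row_finite by (auto simp: E.free_module_carrier rows_def row_def)
qed

lemma carrier_Q0:
  assumes "3 < n"
  shows "x \<in> carrier (Q n) \<longleftrightarrow> x = row \<zero>\<^bsub>E\<^esub> \<zero>\<^bsub>E\<^esub>"
  using assms by (auto simp: E.free_module_carrier rows_def row_zero[symmetric])

definition diff_row :: "nat \<Rightarrow> 'k env \<Rightarrow> 'k env \<Rightarrow> 'k du \<times> 'k env \<times> nat \<Rightarrow> 'k env" where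
  "diff_row n a b = (
     if n = 0 then row (a \<otimes>\<^bsub>E\<^esub> M1 \<oplus>\<^bsub>E\<^esub> b \<otimes>\<^bsub>E\<^esub> M2) \<zero>\<^bsub>E\<^esub>
     else if n = 1 then row (a \<otimes>\<^bsub>E\<^esub> M11 \<oplus>\<^bsub>E\<^esub> b \<otimes>\<^bsub>E\<^esub> M21) (a \<otimes>\<^bsub>E\<^esub> M12 \<oplus>\<^bsub>E\<^esub> b \<otimes>\<^bsub>E\<^esub> M22)
     else if n = 2 then row (a \<otimes>\<^bsub>E\<^esub> M31) (a \<otimes>\<^bsub>E\<^esub> M32)
     else row \<zero>\<^bsub>E\<^esub> \<zero>\<^bsub>E\<^esub>)"

definition diff :: "nat \<Rightarrow> ('k du \<times> 'k env \<times> nat \<Rightarrow> 'k env) \<Rightarrow> 'k du \<times> 'k env \<times> nat \<Rightarrow> 'k env" where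
  "diff n = (\<lambda>x\<in>carrier (Q (Suc n)). diff_row n (x (ix 0)) (x (ix 1)))"

definition aug :: "('k du \<times> 'k env \<times> nat \<Rightarrow> 'k env) \<Rightarrow> 'k du" where
  "aug = (\<lambda>x\<in>carrier (Q 0). eps (x (ix 0)))"

lemma diff_row_closed:
  assumes "a \<in> carrier E" "b \<in> carrier E"
  shows "diff_row n a b \<in> carrier (Q n)"
proof -
  consider "n = 0" | "n = 1" | "n = 2" | "n = 3" | "3 < n" by linarith
  then show ?thesis
    using assms by cases (auto simp: diff_row_def carrier_Q0 carrier_Q1 carrier_Q2 row_eq_iff)
qed

lemma diff_lin: "diff n \<in> lin_maps E (Q (Suc n)) (Q n)"
  unfolding diff_def
proof (rule lin_maps_restrictI[OF E.lmodule_free_module])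
  fix x assume x: "x \<in> carrier (Q (Suc n))"
  note xc = E.free_module_closed[OF x]
  show "diff_row n (x (ix 0)) (x (ix 1)) \<in> carrier (Q n)" by (intro diff_row_closed xc)
  {
    fix y assume y: "y \<in> carrier (Q (Suc n))"
    note yc = E.free_module_closed[OF y]
    show "diff_row n ((x \<oplus>\<^bsub>Q (Suc n)\<^esub> y) (ix 0)) ((x \<oplus>\<^bsub>Q (Suc n)\<^esub> y) (ix 1)) =
        diff_row n (x (ix 0)) (x (ix 1)) \<oplus>\<^bsub>Q n\<^esub> diff_row n (y (ix 0)) (y (ix 1))"
      using xc yc by (simp add: diff_row_def row_add E.l_distr E.a_ac)
  next
    fix r assume "r \<in> carrier E"
    then show "diff_row n ((r \<odot>\<^bsub>Q (Suc n)\<^esub> x) (ix 0)) ((r \<odot>\<^bsub>Q (Suc n)\<^esub> x) (ix 1)) =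
        r \<odot>\<^bsub>Q n\<^esub> diff_row n (x (ix 0)) (x (ix 1))"
      using xc by (simp add: diff_row_def row_smult E.r_distr E.m_assoc)
  }
qed

lemma aug_lin: "aug \<in> lin_maps E (Q 0) Reg"
  unfolding aug_def
proof (rule lin_maps_restrictI[OF E.lmodule_free_module])
  fix x assume x: "x \<in> carrier (Q 0)"
  note xc = E.free_module_closed[OF x]
  show "eps (x (ix 0)) \<in> carrier Reg" using xc by simp
  show "eps ((x \<oplus>\<^bsub>Q 0\<^esub> y) (ix 0)) = eps (x (ix 0)) \<oplus>\<^bsub>Reg\<^esub> eps (y (ix 0))" if "y \<in> carrier (Q 0)" for y
    using xc E.free_module_closed[OF that] by (simp add: eps_add)
  show "eps ((r \<odot>\<^bsub>Q 0\<^esub> x) (ix 0)) = r \<odot>\<^bsub>Reg\<^esub> eps (x (ix 0))" if "r \<in> carrier E" for r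
    using xc that by (simp add: eps_mult)
qed

lemma free_resolution_small: "free_resolution E Reg rows diff aug"
  unfolding free_resolution_def
proof (intro conjI allI)
  show "aug \<in> lin_maps E (Q 0) Reg" by (rule aug_lin)
  show "diff n \<in> lin_maps E (Q (Suc n)) (Q n)" for n by (rule diff_lin)
  have Q1: "row a b \<in> carrier (Q (Suc 0))" "row a b \<in> carrier (Q 2)" if "a \<in> carrier E" "b \<in> carrier E" for a b
    using that by (auto simp: carrier_Q2)
  have Q0: "row a \<zero>\<^bsub>E\<^esub> \<in> carrier (Q 0)" "row a \<zero>\<^bsub>E\<^esub> \<in> carrier (Q 3)" if "a \<in> carrier E" for a
    using that by (auto simp: carrier_Q1)
  show "aug ` carrier (Q 0) = carrier Reg"
  proof
    show "aug ` carrier (Q 0) \<subseteq> carrier Reg" using lin_maps_closed[OF aug_lin] by blast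
    show "carrier Reg \<subseteq> aug ` carrier (Q 0)"
    proof
      fix a assume "a \<in> carrier Reg"
      then have "a = aug (row (tn a \<one>\<^bsub>A\<^esub>) \<zero>\<^bsub>E\<^esub>)" "tn a \<one>\<^bsub>A\<^esub> \<in> carrier E"
        using Q0(1)[of "tn a \<one>\<^bsub>A\<^esub>"] by (simp_all add: aug_def eps_tn)
      then show "a \<in> aug ` carrier (Q 0)" using Q0 by blast
    qed
  qed
  show "{x \<in> carrier (Q 0). aug x = \<zero>\<^bsub>Reg\<^esub>} = diff 0 ` carrier (Q 1)"
  proof (intro equalityI subsetI)
    fix x assume "x \<in> {x \<in> carrier (Q 0). aug x = \<zero>\<^bsub>Reg\<^esub>}"
    then have x: "x \<in> carrier (Q 0)" "aug x = \<zero>\<^bsub>A\<^esub>" by simp_all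
    obtain X where X: "X \<in> carrier E" "x = row X \<zero>\<^bsub>E\<^esub>" using x(1) carrier_Q1[of 0 x] by auto
    then have "eps X = \<zero>\<^bsub>A\<^esub>" using x by (simp add: aug_def)
    then obtain Y Z where YZ: "Y \<in> carrier E" "Z \<in> carrier E" "X = Y \<otimes>\<^bsub>E\<^esub> M1 \<oplus>\<^bsub>E\<^esub> Z \<otimes>\<^bsub>E\<^esub> M2"
      using exact_E0[OF X(1)] by blast
    then have "x = diff 0 (row Y Z)" using X Q1[of Y Z] by (simp add: diff_def diff_row_def)
    then show "x \<in> diff 0 ` carrier (Q 1)" using Q1[of Y Z] YZ by simp
  next
    fix x assume "x \<in> diff 0 ` carrier (Q 1)"
    then obtain Y Z where YZ: "Y \<in> carrier E" "Z \<in> carrier E" "x = diff 0 (row Y Z)"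
      using carrier_Q2[of 1] by auto
    then have x: "x = row (Y \<otimes>\<^bsub>E\<^esub> M1 \<oplus>\<^bsub>E\<^esub> Z \<otimes>\<^bsub>E\<^esub> M2) \<zero>\<^bsub>E\<^esub>"
      using Q1[of Y Z] by (simp add: diff_def diff_row_def)
    show "x \<in> {x \<in> carrier (Q 0). aug x = \<zero>\<^bsub>Reg\<^esub>}"
      using Q0 YZ(1,2) eps_row by (simp add: x aug_def)
  qed
  fix n :: nat
  consider "n = 0" | "n = 1" | "n = 2" | "2 < n" by linarith
  then show "{x \<in> carrier (Q (Suc n)). diff n x = (\<lambda>_. \<zero>\<^bsub>E\<^esub>)} = diff (Suc n) ` carrier (Q (Suc (Suc n)))"
  proof cases
    case 1
    show ?thesis
    proof (intro equalityI subsetI)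
      fix x assume "x \<in> {x \<in> carrier (Q (Suc n)). diff n x = (\<lambda>_. \<zero>\<^bsub>E\<^esub>)}"
      then have x: "x \<in> carrier (Q (Suc 0))" "diff 0 x = (\<lambda>_. \<zero>\<^bsub>E\<^esub>)" by (simp_all add: 1)
      obtain X Y where XY: "X \<in> carrier E" "Y \<in> carrier E" "x = row X Y" using x(1) carrier_Q2[of "Suc 0" x] by auto
      then have "X \<otimes>\<^bsub>E\<^esub> M1 \<oplus>\<^bsub>E\<^esub> Y \<otimes>\<^bsub>E\<^esub> M2 = \<zero>\<^bsub>E\<^esub>" using x by (simp add: diff_def diff_row_def row_zero row_eq_iff)
      then obtain Z W where "Z \<in> carrier E" "W \<in> carrier E"
        "X = Z \<otimes>\<^bsub>E\<^esub> M11 \<oplus>\<^bsub>E\<^esub> W \<otimes>\<^bsub>E\<^esub> M21" "Y = Z \<otimes>\<^bsub>E\<^esub> M12 \<oplus>\<^bsub>E\<^esub> W \<otimes>\<^bsub>E\<^esub> M22"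
        using exact_E1[OF XY(1,2)] by blast
      then show "x \<in> diff (Suc n) ` carrier (Q (Suc (Suc n)))"
        using XY Q1[of Z W] by (intro image_eqI[of _ _ "row Z W"]) (simp_all add: 1 diff_def diff_row_def numeral_2_eq_2)
    next
      fix x assume "x \<in> diff (Suc n) ` carrier (Q (Suc (Suc n)))"
      then obtain Z W where ZW: "Z \<in> carrier E" "W \<in> carrier E" "x = diff 1 (row Z W)"
        using carrier_Q2[of 2] by (auto simp: 1 numeral_2_eq_2)
      then have x: "x = row (Z \<otimes>\<^bsub>E\<^esub> M11 \<oplus>\<^bsub>E\<^esub> W \<otimes>\<^bsub>E\<^esub> M21) (Z \<otimes>\<^bsub>E\<^esub> M12 \<oplus>\<^bsub>E\<^esub> W \<otimes>\<^bsub>E\<^esub> M22)"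
        using Q1[of Z W] by (simp add: diff_def diff_row_def numeral_2_eq_2)
      then show "x \<in> {x \<in> carrier (Q (Suc n)). diff n x = (\<lambda>_. \<zero>\<^bsub>E\<^esub>)}"
        using ZW(1,2) Q1 complex_E1[of Z W] by (simp add: x 1 diff_def diff_row_def row_zero)
    qed
  next
    case 2
    show ?thesis
    proof (intro equalityI subsetI)
      fix x assume "x \<in> {x \<in> carrier (Q (Suc n)). diff n x = (\<lambda>_. \<zero>\<^bsub>E\<^esub>)}"
      then have x: "x \<in> carrier (Q 2)" "diff 1 x = (\<lambda>_. \<zero>\<^bsub>E\<^esub>)" by (simp_all add: 2 numeral_2_eq_2)
      obtain X Y where XY: "X \<in> carrier E" "Y \<in> carrier E" "x = row X Y" using x(1) carrier_Q2[of 2 x] by auto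
      then have "X \<otimes>\<^bsub>E\<^esub> M11 \<oplus>\<^bsub>E\<^esub> Y \<otimes>\<^bsub>E\<^esub> M21 = \<zero>\<^bsub>E\<^esub>"
        using x by (simp add: diff_def diff_row_def row_zero row_eq_iff numeral_2_eq_2)
      then obtain W where "W \<in> carrier E" "X = W \<otimes>\<^bsub>E\<^esub> M31" "Y = W \<otimes>\<^bsub>E\<^esub> M32"
        using exact_E2[OF XY(1,2)] by blast
      then show "x \<in> diff (Suc n) ` carrier (Q (Suc (Suc n)))"
        using XY Q0[of W] by (intro image_eqI[of _ _ "row W \<zero>\<^bsub>E\<^esub>"])
          (simp_all add: 2 diff_def diff_row_def numeral_2_eq_2 numeral_3_eq_3)
    next
      fix x assume "x \<in> diff (Suc n) ` carrier (Q (Suc (Suc n)))"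
      then obtain W where W: "W \<in> carrier E" "x = diff 2 (row W \<zero>\<^bsub>E\<^esub>)"
        using carrier_Q1[of 3] by (auto simp: 2 numeral_2_eq_2 numeral_3_eq_3)
      then have x: "x = row (W \<otimes>\<^bsub>E\<^esub> M31) (W \<otimes>\<^bsub>E\<^esub> M32)"
        using Q0[of W] by (simp add: diff_def diff_row_def numeral_2_eq_2 numeral_3_eq_3)
      then show "x \<in> {x \<in> carrier (Q (Suc n)). diff n x = (\<lambda>_. \<zero>\<^bsub>E\<^esub>)}"
        using W(1) Q1 complex_E2[of W] by (simp add: x 2 diff_def diff_row_def row_zero numeral_2_eq_2)
    qed
  next
    case 3
    \<comment> \<open>The next module is zero, so exactness here is injectivity of the last nonzero
      map.\<close>
    have 0: "carrier (Q 4) = {row \<zero>\<^bsub>E\<^esub> \<zero>\<^bsub>E\<^esub>}" using carrier_Q0[of 4] by auto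
    have "diff 3 (row \<zero>\<^bsub>E\<^esub> \<zero>\<^bsub>E\<^esub>) = row \<zero>\<^bsub>E\<^esub> \<zero>\<^bsub>E\<^esub>" using 0 by (simp add: diff_def diff_row_def)
    then have r: "diff 3 ` carrier (Q 4) = {row \<zero>\<^bsub>E\<^esub> \<zero>\<^bsub>E\<^esub>}" by (simp add: 0)
    have "x \<in> {x \<in> carrier (Q 3). diff 2 x = row \<zero>\<^bsub>E\<^esub> \<zero>\<^bsub>E\<^esub>} \<longleftrightarrow> x = row \<zero>\<^bsub>E\<^esub> \<zero>\<^bsub>E\<^esub>" for x
    proof
      assume x: "x \<in> {x \<in> carrier (Q 3). diff 2 x = row \<zero>\<^bsub>E\<^esub> \<zero>\<^bsub>E\<^esub>}"
      then obtain X where X: "X \<in> carrier E" "x = row X \<zero>\<^bsub>E\<^esub>" using carrier_Q1[of 3 x] by auto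
      then have "X \<otimes>\<^bsub>E\<^esub> M31 = \<zero>\<^bsub>E\<^esub>"
        using x Q0(2)[OF X(1)] by (simp add: diff_def diff_row_def row_eq_iff)
      then show "x = row \<zero>\<^bsub>E\<^esub> \<zero>\<^bsub>E\<^esub>" using exact_E3[OF X(1)] X by simp
    next
      assume "x = row \<zero>\<^bsub>E\<^esub> \<zero>\<^bsub>E\<^esub>"
      then show "x \<in> {x \<in> carrier (Q 3). diff 2 x = row \<zero>\<^bsub>E\<^esub> \<zero>\<^bsub>E\<^esub>}"
        using Q0[of "\<zero>\<^bsub>E\<^esub>"] by (simp add: diff_def diff_row_def)
    qed
    then have l: "{x \<in> carrier (Q 3). diff 2 x = row \<zero>\<^bsub>E\<^esub> \<zero>\<^bsub>E\<^esub>} = {row \<zero>\<^bsub>E\<^esub> \<zero>\<^bsub>E\<^esub>}" by blast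
    have n: "Suc 2 = (3::nat)" "Suc 3 = (4::nat)" by simp_all
    show ?thesis unfolding 3 n row_zero r l ..
  next
    case 4
    then have c: "carrier (Q (Suc n)) = {row \<zero>\<^bsub>E\<^esub> \<zero>\<^bsub>E\<^esub>}" "carrier (Q (Suc (Suc n))) = {row \<zero>\<^bsub>E\<^esub> \<zero>\<^bsub>E\<^esub>}"
      using carrier_Q0[of "Suc n"] carrier_Q0[of "Suc (Suc n)"] by auto
    then show ?thesis using 4 by (auto simp: diff_def diff_row_def row_zero)
  qed
qed

end

section \<open>Cochains on the small resolution\<close>

context down_up
begin

lemma free_res_small: "free_res E Reg rows diff aug"
  using E.ring_axioms Reg.lmodule_axioms free_resolution_small
  by (simp add: free_res_def free_res_axioms_def)

sublocale R: free_res E Reg rows diff aug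
  by (rule free_res_small)

sublocale OB: bimodule_over A "outer_bimodule A"
  by (rule A.bimodule_over_outer)

lemma outer_simps [simp]: "carrier (outer_bimodule A) = carrier E"
  "\<zero>\<^bsub>outer_bimodule A\<^esub> = \<zero>\<^bsub>E\<^esub>" "x \<oplus>\<^bsub>outer_bimodule A\<^esub> y = x \<oplus>\<^bsub>E\<^esub> y"
  by (simp_all add: outer_bimodule_def Let_def)

sublocale Out: lmodule E Out
  by (rule OB.lmodule_env_module)

lemma smult_Out [simp]: "X \<in> carrier E \<Longrightarrow> Y \<in> carrier E \<Longrightarrow> X \<odot>\<^bsub>Out\<^esub> Y = X \<otimes>\<^bsub>E\<^esub> Y"
  by (rule A.smult_env_outer)

lemma minus_Out: "X \<in> carrier E \<Longrightarrow> Y \<in> carrier E \<Longrightarrow> X \<ominus>\<^bsub>Out\<^esub> Y = X \<ominus>\<^bsub>E\<^esub> Y"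
proof -
  assume X: "X \<in> carrier E" and Y: "Y \<in> carrier E"
  have "\<ominus>\<^bsub>Out\<^esub> Y = \<ominus>\<^bsub>E\<^esub> Y"
    by (rule Out.M.minus_equality) (use Y in \<open>simp_all add: E.l_neg\<close>)
  then show ?thesis by (simp add: a_minus_def)
qed

text \<open>Cochains correspond to the values \<open>v\<close>, \<open>w\<close> on the basis
  vectors. Composing with a differential multiplies these values from the left by its matrix, so the
  dual complex consists of left multiplications.\<close>

definition from_row :: "nat \<Rightarrow> 'k env \<Rightarrow> 'k env \<Rightarrow> ('k du \<times> 'k env \<times> nat \<Rightarrow> 'k env) \<Rightarrow> 'k env" where
  "from_row n v w = (\<lambda>x\<in>carrier (Q n). x (ix 0) \<otimes>\<^bsub>E\<^esub> v \<oplus>\<^bsub>E\<^esub> x (ix 1) \<otimes>\<^bsub>E\<^esub> w)"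

lemma from_row_lin:
  assumes v: "v \<in> carrier E" and w: "w \<in> carrier E"
  shows "from_row n v w \<in> lin_maps E (Q n) Out"
  unfolding from_row_def
proof (rule lin_maps_restrictI[OF E.lmodule_free_module])
  fix x assume x: "x \<in> carrier (Q n)"
  note xc = E.free_module_closed[OF x]
  show "x (ix 0) \<otimes>\<^bsub>E\<^esub> v \<oplus>\<^bsub>E\<^esub> x (ix 1) \<otimes>\<^bsub>E\<^esub> w \<in> carrier Out" using xc v w by simp
  show "(x \<oplus>\<^bsub>Q n\<^esub> y) (ix 0) \<otimes>\<^bsub>E\<^esub> v \<oplus>\<^bsub>E\<^esub> (x \<oplus>\<^bsub>Q n\<^esub> y) (ix 1) \<otimes>\<^bsub>E\<^esub> w =
      (x (ix 0) \<otimes>\<^bsub>E\<^esub> v \<oplus>\<^bsub>E\<^esub> x (ix 1) \<otimes>\<^bsub>E\<^esub> w) \<oplus>\<^bsub>Out\<^esub> (y (ix 0) \<otimes>\<^bsub>E\<^esub> v \<oplus>\<^bsub>E\<^esub> y (ix 1) \<otimes>\<^bsub>E\<^esub> w)"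
    if "y \<in> carrier (Q n)" for y
    using xc E.free_module_closed[OF that] v w by (simp add: E.l_distr E.a_ac)
  show "(r \<odot>\<^bsub>Q n\<^esub> x) (ix 0) \<otimes>\<^bsub>E\<^esub> v \<oplus>\<^bsub>E\<^esub> (r \<odot>\<^bsub>Q n\<^esub> x) (ix 1) \<otimes>\<^bsub>E\<^esub> w =
      r \<odot>\<^bsub>Out\<^esub> (x (ix 0) \<otimes>\<^bsub>E\<^esub> v \<oplus>\<^bsub>E\<^esub> x (ix 1) \<otimes>\<^bsub>E\<^esub> w)"
    if "r \<in> carrier E" for r
    using xc that v w by (simp add: E.r_distr E.m_assoc)
qed

lemma row_mem:
  "a \<in> carrier E \<Longrightarrow> b \<in> carrier E \<Longrightarrow> row a b \<in> carrier (Q 1)"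
  "a \<in> carrier E \<Longrightarrow> b \<in> carrier E \<Longrightarrow> row a b \<in> carrier (Q 2)"
  "a \<in> carrier E \<Longrightarrow> row a \<zero>\<^bsub>E\<^esub> \<in> carrier (Q 0)"
  "a \<in> carrier E \<Longrightarrow> row a \<zero>\<^bsub>E\<^esub> \<in> carrier (Q 3)"
  by (auto simp: carrier_Q1 carrier_Q2)

lemma lin_row1:
  assumes \<chi>: "\<chi> \<in> lin_maps E (Q n) Out" and n: "n = 0 \<or> n = 3" and a: "a \<in> carrier E"
  shows "\<chi> (row a \<zero>\<^bsub>E\<^esub>) = a \<otimes>\<^bsub>E\<^esub> \<chi> (row \<one>\<^bsub>E\<^esub> \<zero>\<^bsub>E\<^esub>)"
proof -
  have m: "row \<one>\<^bsub>E\<^esub> \<zero>\<^bsub>E\<^esub> \<in> carrier (Q n)" using n row_mem by auto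
  have "\<chi> (row a \<zero>\<^bsub>E\<^esub>) = a \<odot>\<^bsub>Out\<^esub> \<chi> (row \<one>\<^bsub>E\<^esub> \<zero>\<^bsub>E\<^esub>)"
    using lin_maps_smult[OF \<chi> a m] a by (simp add: row_smult)
  also have "\<dots> = a \<otimes>\<^bsub>E\<^esub> \<chi> (row \<one>\<^bsub>E\<^esub> \<zero>\<^bsub>E\<^esub>)" using a lin_maps_closed[OF \<chi> m] by simp
  finally show ?thesis .
qed

lemma lin_row2:
  assumes \<chi>: "\<chi> \<in> lin_maps E (Q n) Out" and n: "n = 1 \<or> n = 2" and a: "a \<in> carrier E" and b: "b \<in> carrier E"
  shows "\<chi> (row a b) = a \<otimes>\<^bsub>E\<^esub> \<chi> (row \<one>\<^bsub>E\<^esub> \<zero>\<^bsub>E\<^esub>) \<oplus>\<^bsub>E\<^esub> b \<otimes>\<^bsub>E\<^esub> \<chi> (row \<zero>\<^bsub>E\<^esub> \<one>\<^bsub>E\<^esub>)"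
proof -
  have m: "row x y \<in> carrier (Q n)" if "x \<in> carrier E" "y \<in> carrier E" for x y
    using n row_mem that by auto
  have 1: "\<chi> (row a \<zero>\<^bsub>E\<^esub>) = a \<odot>\<^bsub>Out\<^esub> \<chi> (row \<one>\<^bsub>E\<^esub> \<zero>\<^bsub>E\<^esub>)"
    using lin_maps_smult[OF \<chi> a m[of "\<one>\<^bsub>E\<^esub>" "\<zero>\<^bsub>E\<^esub>"]] a by (simp add: row_smult)
  have 2: "\<chi> (row \<zero>\<^bsub>E\<^esub> b) = b \<odot>\<^bsub>Out\<^esub> \<chi> (row \<zero>\<^bsub>E\<^esub> \<one>\<^bsub>E\<^esub>)"
    using lin_maps_smult[OF \<chi> b m[of "\<zero>\<^bsub>E\<^esub>" "\<one>\<^bsub>E\<^esub>"]] b by (simp add: row_smult)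
  have "\<chi> (row a b) = \<chi> (row a \<zero>\<^bsub>E\<^esub> \<oplus>\<^bsub>Q n\<^esub> row \<zero>\<^bsub>E\<^esub> b)" using a b by (simp add: row_add)
  also have "\<dots> = \<chi> (row a \<zero>\<^bsub>E\<^esub>) \<oplus>\<^bsub>Out\<^esub> \<chi> (row \<zero>\<^bsub>E\<^esub> b)"
    using a b by (intro lin_maps_add[OF \<chi>] m) auto
  finally show ?thesis
    using a b lin_maps_closed[OF \<chi> m[of "\<one>\<^bsub>E\<^esub>" "\<zero>\<^bsub>E\<^esub>"]] lin_maps_closed[OF \<chi> m[of "\<zero>\<^bsub>E\<^esub>" "\<one>\<^bsub>E\<^esub>"]]
    by (simp add: 1 2)
qed

lemma diff_row_eq:
  "a \<in> carrier E \<Longrightarrow> b \<in> carrier E \<Longrightarrow> diff 0 (row a b) = row (a \<otimes>\<^bsub>E\<^esub> M1 \<oplus>\<^bsub>E\<^esub> b \<otimes>\<^bsub>E\<^esub> M2) \<zero>\<^bsub>E\<^esub>"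
  "a \<in> carrier E \<Longrightarrow> b \<in> carrier E \<Longrightarrow> diff 1 (row a b) =
    row (a \<otimes>\<^bsub>E\<^esub> M11 \<oplus>\<^bsub>E\<^esub> b \<otimes>\<^bsub>E\<^esub> M21) (a \<otimes>\<^bsub>E\<^esub> M12 \<oplus>\<^bsub>E\<^esub> b \<otimes>\<^bsub>E\<^esub> M22)"
  "a \<in> carrier E \<Longrightarrow> diff 2 (row a \<zero>\<^bsub>E\<^esub>) = row (a \<otimes>\<^bsub>E\<^esub> M31) (a \<otimes>\<^bsub>E\<^esub> M32)"
proof -
  have "Suc 1 = (2::nat)" "Suc 2 = (3::nat)" "Suc 0 = (1::nat)" by simp_all
  note s = this
  show "a \<in> carrier E \<Longrightarrow> b \<in> carrier E \<Longrightarrow> diff 0 (row a b) = row (a \<otimes>\<^bsub>E\<^esub> M1 \<oplus>\<^bsub>E\<^esub> b \<otimes>\<^bsub>E\<^esub> M2) \<zero>\<^bsub>E\<^esub>"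
    using row_mem(1)[of a b] unfolding diff_def s(3) by (simp add: diff_row_def)
  show "a \<in> carrier E \<Longrightarrow> b \<in> carrier E \<Longrightarrow> diff 1 (row a b) =
    row (a \<otimes>\<^bsub>E\<^esub> M11 \<oplus>\<^bsub>E\<^esub> b \<otimes>\<^bsub>E\<^esub> M21) (a \<otimes>\<^bsub>E\<^esub> M12 \<oplus>\<^bsub>E\<^esub> b \<otimes>\<^bsub>E\<^esub> M22)"
    using row_mem(2)[of a b] unfolding diff_def s(1) by (simp add: diff_row_def)
  show "a \<in> carrier E \<Longrightarrow> diff 2 (row a \<zero>\<^bsub>E\<^esub>) = row (a \<otimes>\<^bsub>E\<^esub> M31) (a \<otimes>\<^bsub>E\<^esub> M32)"
    using row_mem(4)[of a] unfolding diff_def s(2) by (simp add: diff_row_def)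
qed

lemma from_row_apply:
  "n = 1 \<or> n = 2 \<Longrightarrow> a \<in> carrier E \<Longrightarrow> b \<in> carrier E \<Longrightarrow>
    from_row n v w (row a b) = a \<otimes>\<^bsub>E\<^esub> v \<oplus>\<^bsub>E\<^esub> b \<otimes>\<^bsub>E\<^esub> w"
  "n = 0 \<or> n = 3 \<Longrightarrow> a \<in> carrier E \<Longrightarrow> v \<in> carrier E \<Longrightarrow> w \<in> carrier E \<Longrightarrow>
    from_row n v w (row a \<zero>\<^bsub>E\<^esub>) = a \<otimes>\<^bsub>E\<^esub> v"
  using row_mem by (auto simp: from_row_def)

text \<open>The cocycle condition, evaluated on one basis vector, is an equation between the values
  of the cochain; the exactness statements for left multiplication solve it. Above degree 3 the
  modules are zero.\<close>

lemma cocycle_coboundary_small: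
  assumes \<chi>: "R.cocycle Out n \<chi>" and n: "n \<noteq> 3"
  shows "R.coboundary Out n \<chi>"
proof -
  have lin: "\<chi> \<in> lin_maps E (Q n) Out" and van: "\<And>x. x \<in> carrier (Q (Suc n)) \<Longrightarrow> \<chi> (diff n x) = \<zero>\<^bsub>E\<^esub>"
    using \<chi> by (simp_all add: R.cocycle_def)
  have ext: "\<chi> \<in> extensional (carrier (Q n))" by (rule lin_maps_ext[OF lin])
  consider "n = 0" | "n = 1" | "n = 2" | "n = Suc (n - 1)" "3 \<le> n - 1" using n by linarith
  then show ?thesis
  proof cases
    case 1
    let ?v = "\<chi> (row \<one>\<^bsub>E\<^esub> \<zero>\<^bsub>E\<^esub>)"
    have v: "?v \<in> carrier E" using lin_maps_closed[OF lin, of "row \<one>\<^bsub>E\<^esub> \<zero>\<^bsub>E\<^esub>"] row_mem 1 by simp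
    \<comment> \<open>The second basis vector is the right test, since \<open>M2\<close> corresponds
      under \<open>K\<close> to the injective operator \<open>C1\<close>.\<close>
    have "\<chi> (diff 0 (row \<zero>\<^bsub>E\<^esub> \<one>\<^bsub>E\<^esub>)) = \<zero>\<^bsub>E\<^esub>" using van[of "row \<zero>\<^bsub>E\<^esub> \<one>\<^bsub>E\<^esub>"] row_mem(1) 1 by simp
    then have "M2 \<otimes>\<^bsub>E\<^esub> ?v = \<zero>\<^bsub>E\<^esub>" using lin_row1[OF lin, of M2] 1 by (simp add: diff_row_eq)
    then have "?v = \<zero>\<^bsub>E\<^esub>" by (rule dual_exact_0[OF v])
    have "\<chi> x = \<zero>\<^bsub>E\<^esub>" if x: "x \<in> carrier (Q 0)" for x
    proof -
      obtain a where a: "a \<in> carrier E" "x = row a \<zero>\<^bsub>E\<^esub>" using iffD1[OF carrier_Q1 x] by auto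
      have "\<chi> x = a \<otimes>\<^bsub>E\<^esub> ?v" unfolding a(2) by (rule lin_row1[OF lin _ a(1)]) (simp add: 1)
      then show ?thesis using a(1) by (simp add: \<open>?v = \<zero>\<^bsub>E\<^esub>\<close>)
    qed
    then show ?thesis using ext 1 by (simp add: R.coboundary_def)
  next
    case 2
    let ?v = "\<chi> (row \<one>\<^bsub>E\<^esub> \<zero>\<^bsub>E\<^esub>)" and ?w = "\<chi> (row \<zero>\<^bsub>E\<^esub> \<one>\<^bsub>E\<^esub>)"
    have vw: "?v \<in> carrier E" "?w \<in> carrier E"
      using lin_maps_closed[OF lin] row_mem(1) 2 by simp_all
    \<comment> \<open>The second basis vector again: its row \<open>M21\<close>, \<open>M22\<close>
      corresponds to \<open>A21\<close>, \<open>A11\<close>, as required for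
      \<open>exact_2\<close>.\<close>
    have "\<chi> (diff 1 (row \<zero>\<^bsub>E\<^esub> \<one>\<^bsub>E\<^esub>)) = \<zero>\<^bsub>E\<^esub>"
      using van[of "row \<zero>\<^bsub>E\<^esub> \<one>\<^bsub>E\<^esub>"] row_mem(2) 2 by (simp add: numeral_2_eq_2)
    then have "M21 \<otimes>\<^bsub>E\<^esub> ?v \<oplus>\<^bsub>E\<^esub> M22 \<otimes>\<^bsub>E\<^esub> ?w = \<zero>\<^bsub>E\<^esub>"
      using lin_row2[OF lin, of M21 M22] 2 diff_row_eq(2)[of "\<zero>\<^bsub>E\<^esub>" "\<one>\<^bsub>E\<^esub>"] by simp
    then obtain Z where Z: "Z \<in> carrier E" "?v = M1 \<otimes>\<^bsub>E\<^esub> Z" "?w = M2 \<otimes>\<^bsub>E\<^esub> Z"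
      using dual_exact_1[OF vw] by blast
    have "\<chi> x = from_row 0 Z \<zero>\<^bsub>E\<^esub> (diff 0 x)" if x: "x \<in> carrier (Q 1)" for x
    proof -
      obtain a b where ab: "a \<in> carrier E" "b \<in> carrier E" "x = row a b" using iffD1[OF carrier_Q2 x] by auto
      have "from_row 0 Z \<zero>\<^bsub>E\<^esub> (diff 0 x) = (a \<otimes>\<^bsub>E\<^esub> M1 \<oplus>\<^bsub>E\<^esub> b \<otimes>\<^bsub>E\<^esub> M2) \<otimes>\<^bsub>E\<^esub> Z"
        unfolding ab(3) diff_row_eq(1)[OF ab(1,2)] using ab(1,2) Z(1) by (intro from_row_apply) auto
      moreover have "\<chi> x = a \<otimes>\<^bsub>E\<^esub> ?v \<oplus>\<^bsub>E\<^esub> b \<otimes>\<^bsub>E\<^esub> ?w"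
        unfolding ab(3) using lin_row2[OF lin _ ab(1,2)] 2 by simp
      ultimately show ?thesis
        using ab(1,2) Z by (simp add: E.l_distr E.m_assoc)
    qed
    then show ?thesis
      using ext 2 from_row_lin[OF Z(1), of "\<zero>\<^bsub>E\<^esub>" 0] unfolding R.coboundary_def by auto
  next
    case 3
    let ?v = "\<chi> (row \<one>\<^bsub>E\<^esub> \<zero>\<^bsub>E\<^esub>)" and ?w = "\<chi> (row \<zero>\<^bsub>E\<^esub> \<one>\<^bsub>E\<^esub>)"
    have vw: "?v \<in> carrier E" "?w \<in> carrier E"
      using lin_maps_closed[OF lin] row_mem(2) 3 by simp_all
    have "\<chi> (diff 2 (row \<one>\<^bsub>E\<^esub> \<zero>\<^bsub>E\<^esub>)) = \<zero>\<^bsub>E\<^esub>"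
      using van[of "row \<one>\<^bsub>E\<^esub> \<zero>\<^bsub>E\<^esub>"] row_mem(4) 3 by simp
    then have "M31 \<otimes>\<^bsub>E\<^esub> ?v \<oplus>\<^bsub>E\<^esub> M32 \<otimes>\<^bsub>E\<^esub> ?w = \<zero>\<^bsub>E\<^esub>"
      using lin_row2[OF lin, of M31 M32] 3 diff_row_eq(3)[of "\<one>\<^bsub>E\<^esub>"] by simp
    then obtain Z W where ZW: "Z \<in> carrier E" "W \<in> carrier E"
      "?v = M11 \<otimes>\<^bsub>E\<^esub> Z \<oplus>\<^bsub>E\<^esub> M12 \<otimes>\<^bsub>E\<^esub> W" "?w = M21 \<otimes>\<^bsub>E\<^esub> Z \<oplus>\<^bsub>E\<^esub> M22 \<otimes>\<^bsub>E\<^esub> W"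
      using dual_exact_2[OF vw] by blast
    have "\<chi> x = from_row 1 Z W (diff 1 x)" if x: "x \<in> carrier (Q 2)" for x
    proof -
      obtain a b where ab: "a \<in> carrier E" "b \<in> carrier E" "x = row a b" using iffD1[OF carrier_Q2 x] by auto
      have "from_row 1 Z W (diff 1 x) = (a \<otimes>\<^bsub>E\<^esub> M11 \<oplus>\<^bsub>E\<^esub> b \<otimes>\<^bsub>E\<^esub> M21) \<otimes>\<^bsub>E\<^esub> Z \<oplus>\<^bsub>E\<^esub> (a \<otimes>\<^bsub>E\<^esub> M12 \<oplus>\<^bsub>E\<^esub> b \<otimes>\<^bsub>E\<^esub> M22) \<otimes>\<^bsub>E\<^esub> W"
        unfolding ab(3) diff_row_eq(2)[OF ab(1,2)] using ab(1,2) by (intro from_row_apply) auto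
      moreover have "\<chi> x = a \<otimes>\<^bsub>E\<^esub> ?v \<oplus>\<^bsub>E\<^esub> b \<otimes>\<^bsub>E\<^esub> ?w"
        unfolding ab(3) using lin_row2[OF lin _ ab(1,2)] 3 by simp
      ultimately show ?thesis
        using ab(1,2) ZW by (simp add: E.l_distr E.r_distr E.m_assoc E.a_ac)
    qed
    then show ?thesis
      using ext 3 from_row_lin[OF ZW(1,2), of 1] by (auto simp: R.coboundary_def numeral_2_eq_2)
  next
    case 4
    define m where "m = n - 1"
    have nm: "n = Suc m" "3 \<le> m" using 4 by (simp_all add: m_def)
    have "\<chi> x = from_row m \<zero>\<^bsub>E\<^esub> \<zero>\<^bsub>E\<^esub> (diff m x)" if x: "x \<in> carrier (Q (Suc m))" for x
    proof -
      have "x = \<zero>\<^bsub>Q n\<^esub>" using x nm carrier_Q0[of "Suc m" x] by (simp add: row_zero)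
      then have "\<chi> x = \<zero>\<^bsub>E\<^esub>" using lin_maps_zero[OF E.lmodule_free_module Out.lmodule_axioms lin] by simp
      moreover have d: "diff m x \<in> carrier (Q m)" by (rule R.d_closed[OF x])
      have "from_row m \<zero>\<^bsub>E\<^esub> \<zero>\<^bsub>E\<^esub> (diff m x) = \<zero>\<^bsub>E\<^esub>"
        using d E.free_module_closed[OF d] by (simp add: from_row_def)
      ultimately show ?thesis by simp
    qed
    then show ?thesis
      using ext nm from_row_lin[of "\<zero>\<^bsub>E\<^esub>" "\<zero>\<^bsub>E\<^esub>" m] unfolding R.coboundary_def by auto
  qed
qed

lemma cocycle_3: "\<chi> \<in> lin_maps E (Q 3) Out \<Longrightarrow> R.cocycle Out 3 \<chi>"
proof -
  assume lin: "\<chi> \<in> lin_maps E (Q 3) Out"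
  have "\<chi> (diff 3 x) = \<zero>\<^bsub>E\<^esub>" if x: "x \<in> carrier (Q (Suc 3))" for x
  proof -
    have "diff 3 x = \<zero>\<^bsub>Q 3\<^esub>" using x by (simp add: diff_def diff_row_def row_zero)
    then show ?thesis using lin_maps_zero[OF E.lmodule_free_module Out.lmodule_axioms lin] by simp
  qed
  then show ?thesis using lin by (simp add: R.cocycle_def)
qed

text \<open>Coboundaries are the cochains whose value on the generator is a combination
  \<open>M31 Y + M32 Z\<close>, and these combinations form the kernel of
  \<open>tau\<close>.\<close>

lemma coboundary_3:
  assumes \<chi>: "R.cocycle Out 3 \<chi>"
  shows "R.coboundary Out 3 \<chi> \<longleftrightarrow> tau (\<chi> (row \<one>\<^bsub>E\<^esub> \<zero>\<^bsub>E\<^esub>)) = \<zero>\<^bsub>A\<^esub>"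
proof -
  have lin: "\<chi> \<in> lin_maps E (Q 3) Out" using \<chi> by (simp add: R.cocycle_def)
  have cob: "R.coboundary Out 3 \<chi> \<longleftrightarrow> (\<exists>\<psi>\<in>lin_maps E (Q 2) Out. \<forall>x\<in>carrier (Q 3). \<chi> x = \<psi> (diff 2 x))"
    using lin_maps_ext[OF lin] by (simp add: R.coboundary_def numeral_3_eq_3 numeral_2_eq_2)
  let ?v = "\<chi> (row \<one>\<^bsub>E\<^esub> \<zero>\<^bsub>E\<^esub>)"
  have v: "?v \<in> carrier E" using lin_maps_closed[OF lin row_mem(4)] by simp
  show ?thesis unfolding cob tau_kernel[OF v]
  proof
    assume "\<exists>\<psi>\<in>lin_maps E (Q 2) Out. \<forall>x\<in>carrier (Q 3). \<chi> x = \<psi> (diff 2 x)"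
    then obtain \<psi> where \<psi>: "\<psi> \<in> lin_maps E (Q 2) Out" "\<forall>x\<in>carrier (Q 3). \<chi> x = \<psi> (diff 2 x)" by blast
    have "?v = \<psi> (row M31 M32)" using \<psi>(2) row_mem(4)[of "\<one>\<^bsub>E\<^esub>"] diff_row_eq(3)[of "\<one>\<^bsub>E\<^esub>"] by simp
    also have "\<dots> = M31 \<otimes>\<^bsub>E\<^esub> \<psi> (row \<one>\<^bsub>E\<^esub> \<zero>\<^bsub>E\<^esub>) \<oplus>\<^bsub>E\<^esub> M32 \<otimes>\<^bsub>E\<^esub> \<psi> (row \<zero>\<^bsub>E\<^esub> \<one>\<^bsub>E\<^esub>)"
      by (rule lin_row2[OF \<psi>(1)]) auto
    finally show "\<exists>Y\<in>carrier E. \<exists>Z\<in>carrier E. ?v = M31 \<otimes>\<^bsub>E\<^esub> Y \<oplus>\<^bsub>E\<^esub> M32 \<otimes>\<^bsub>E\<^esub> Z"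
      using lin_maps_closed[OF \<psi>(1) row_mem(2)] by (metis E.one_closed E.zero_closed OB.env_module_fields(1) outer_simps(1))
  next
    assume "\<exists>Y\<in>carrier E. \<exists>Z\<in>carrier E. ?v = M31 \<otimes>\<^bsub>E\<^esub> Y \<oplus>\<^bsub>E\<^esub> M32 \<otimes>\<^bsub>E\<^esub> Z"
    then obtain Y Z where YZ: "Y \<in> carrier E" "Z \<in> carrier E" "?v = M31 \<otimes>\<^bsub>E\<^esub> Y \<oplus>\<^bsub>E\<^esub> M32 \<otimes>\<^bsub>E\<^esub> Z" by blast
    have "\<chi> x = from_row 2 Y Z (diff 2 x)" if x: "x \<in> carrier (Q 3)" for x
    proof -
      obtain a where a: "a \<in> carrier E" "x = row a \<zero>\<^bsub>E\<^esub>" using iffD1[OF carrier_Q1 x] by auto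
      have "\<chi> x = a \<otimes>\<^bsub>E\<^esub> ?v" unfolding a(2) by (rule lin_row1[OF lin _ a(1)]) simp
      moreover have "from_row 2 Y Z (diff 2 x) = a \<otimes>\<^bsub>E\<^esub> M31 \<otimes>\<^bsub>E\<^esub> Y \<oplus>\<^bsub>E\<^esub> a \<otimes>\<^bsub>E\<^esub> M32 \<otimes>\<^bsub>E\<^esub> Z"
        unfolding a(2) diff_row_eq(3)[OF a(1)] using a(1) by (intro from_row_apply) auto
      ultimately show ?thesis using a(1) YZ by (simp add: E.r_distr E.m_assoc)
    qed
    then show "\<exists>\<psi>\<in>lin_maps E (Q 2) Out. \<forall>x\<in>carrier (Q 3). \<chi> x = \<psi> (diff 2 x)"
      using from_row_lin[OF YZ(1,2)] by blast
  qed
qed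

text \<open>Right multiplication commutes with the left module structure, so the inner actions
  induce maps on Ext.\<close>

lemma right_mult_lin:
  assumes Z: "Z \<in> carrier E"
  shows "restrict (\<lambda>X. X \<otimes>\<^bsub>E\<^esub> Z) (carrier Out) \<in> lin_maps E Out Out"
  by (rule lin_maps_restrictI[OF Out.lmodule_axioms]) (use Z in \<open>simp_all add: E.l_distr E.m_assoc\<close>)

section \<open>The bimodules Ext and the Calabi-Yau property\<close>

lemma Ext_bimodule_trivial:
  assumes "i \<noteq> 3"
  shows "bimodule_iso A (Ext_env_bimodule A i) zero_bimodule"
proof -
  obtain \<epsilon> f g where "ext_comparison E Reg \<epsilon> rows diff aug Out f g"
    using ext_comparison_exists[OF free_res_small Out.lmodule_axioms] by blast
  then interpret C: ext_comparison E Reg \<epsilon> rows diff aug Out f g .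
  obtain X where X: "carrier (Ext E i Reg Out) = {X}"
    using C.Ext_trivial[of i] cocycle_coboundary_small[OF _ assms] by blast
  show ?thesis
    unfolding bimodule_iso_def
    by (rule exI[of _ "\<lambda>_. ()"])
      (simp add: bij_betw_def Ext_env_bimodule_def Let_def X zero_bimodule_def)
qed

text \<open>\<open>\<Phi>\<close> evaluates a class on the generator and applies \<open>tau\<close>,
  whose behaviour under inner multiplications gives the twisted actions. Closure under the actions
  is recorded because injectivity of \<open>\<Phi>\<close> will be applied to products.\<close>

lemma Ext_bimodule_3:
  "\<exists>\<Phi>. bij_betw \<Phi> (carrier (Ext_env_bimodule A 3)) (carrier A) \<and>
    (\<forall>X\<in>carrier (Ext_env_bimodule A 3). \<forall>Y\<in>carrier (Ext_env_bimodule A 3).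
      \<Phi> (X \<oplus>\<^bsub>Ext_env_bimodule A 3\<^esub> Y) = \<Phi> X \<oplus>\<^bsub>A\<^esub> \<Phi> Y) \<and>
    (\<forall>a\<in>carrier A. \<forall>X\<in>carrier (Ext_env_bimodule A 3).
      \<Phi> (lact (Ext_env_bimodule A 3) a X) = sig lm a \<otimes>\<^bsub>A\<^esub> \<Phi> X) \<and>
    (\<forall>a\<in>carrier A. \<forall>X\<in>carrier (Ext_env_bimodule A 3).
      \<Phi> (ract (Ext_env_bimodule A 3) X a) = \<Phi> X \<otimes>\<^bsub>A\<^esub> a) \<and>
    (\<forall>a\<in>carrier A. \<forall>X\<in>carrier (Ext_env_bimodule A 3).
      lact (Ext_env_bimodule A 3) a X \<in> carrier (Ext_env_bimodule A 3) \<and>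
      ract (Ext_env_bimodule A 3) X a \<in> carrier (Ext_env_bimodule A 3))"
proof -
  obtain \<epsilon> f g where "ext_comparison E Reg \<epsilon> rows diff aug Out f g"
    using ext_comparison_exists[OF free_res_small Out.lmodule_axioms] by blast
  then interpret C: ext_comparison E Reg \<epsilon> rows diff aug Out f g .
  let ?u = "row \<one>\<^bsub>E\<^esub> \<zero>\<^bsub>E\<^esub>"
  let ?H = "Ext E 3 Reg Out" and ?Z = "R.cocycle Out 3"
  have u: "?u \<in> carrier (Q 3)" using row_mem(4) by simp
  have cl: "\<chi> ?u \<in> carrier E" if "?Z \<chi>" for \<chi>
    using R.cocycle_closed[OF Out.lmodule_axioms that u] by simp
  have \<tau>: "tau (\<chi> ?u) = tau (\<chi>' ?u) \<longleftrightarrow> R.coboundary Out 3 (\<lambda>y\<in>carrier (Q 3). \<chi> y \<ominus>\<^bsub>Out\<^esub> \<chi>' y)"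
    if c: "?Z \<chi>" "?Z \<chi>'" for \<chi> \<chi>'
  proof -
    have "R.coboundary Out 3 (\<lambda>y\<in>carrier (Q 3). \<chi> y \<ominus>\<^bsub>Out\<^esub> \<chi>' y) \<longleftrightarrow> tau (\<chi> ?u \<ominus>\<^bsub>E\<^esub> \<chi>' ?u) = \<zero>\<^bsub>A\<^esub>"
      using coboundary_3[OF R.cocycle_diff[OF Out.lmodule_axioms c]] u cl[OF c(1)] cl[OF c(2)]
      by (simp add: minus_Out)
    also have "tau (\<chi> ?u \<ominus>\<^bsub>E\<^esub> \<chi>' ?u) = tau (\<chi> ?u) \<ominus>\<^bsub>A\<^esub> tau (\<chi>' ?u)"
      using cl[OF c(1)] cl[OF c(2)] by (simp add: a_minus_def tau_add tau_minus)
    also have "tau (\<chi> ?u) \<ominus>\<^bsub>A\<^esub> tau (\<chi>' ?u) = \<zero>\<^bsub>A\<^esub> \<longleftrightarrow> tau (\<chi> ?u) = tau (\<chi>' ?u)"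
      using cl[OF c(1)] cl[OF c(2)]
      by (metis a_minus_def A.add.inv_closed A.minus_equality A.r_neg A.minus_minus tau_closed)
    finally show ?thesis ..
  qed
  obtain \<Phi> where bij: "bij_betw \<Phi> (carrier ?H) ((\<lambda>\<chi>. tau (\<chi> ?u)) ` {\<chi>. ?Z \<chi>})"
    and add: "\<forall>X\<in>carrier ?H. \<forall>Y\<in>carrier ?H. \<exists>\<chi> \<chi>'. ?Z \<chi> \<and> ?Z \<chi>' \<and> \<Phi> X = tau (\<chi> ?u) \<and>
      \<Phi> Y = tau (\<chi>' ?u) \<and> \<Phi> (X \<oplus>\<^bsub>?H\<^esub> Y) = tau ((\<lambda>y\<in>carrier (Q 3). \<chi> y \<oplus>\<^bsub>Out\<^esub> \<chi>' y) ?u)"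
    and map: "\<forall>X\<in>carrier ?H. \<forall>\<theta>. restrict \<theta> (carrier Out) \<in> lin_maps E Out Out \<longrightarrow>
      (\<exists>\<chi>. ?Z \<chi> \<and> \<Phi> X = tau (\<chi> ?u) \<and> \<Phi> (Ext_map E 3 Reg Out \<theta> X) = tau (compose (carrier (Q 3)) \<theta> \<chi> ?u))"
    using C.Ext_iso[of 3 "\<lambda>\<chi>. tau (\<chi> ?u)", OF \<tau>] by blast
  have im: "(\<lambda>\<chi>. tau (\<chi> ?u)) ` {\<chi>. ?Z \<chi>} = carrier A"
  proof (intro equalityI subsetI)
    fix a assume a: "a \<in> carrier A"
    let ?\<chi> = "from_row 3 (tn a \<one>\<^bsub>A\<^esub>) \<zero>\<^bsub>E\<^esub>"
    have "?Z ?\<chi>" using a by (intro cocycle_3 from_row_lin) auto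
    moreover have "?\<chi> ?u = tn a \<one>\<^bsub>A\<^esub>" using a by (simp add: from_row_apply)
    then have "tau (?\<chi> ?u) = a" using a by (simp add: tau_surj)
    ultimately show "a \<in> (\<lambda>\<chi>. tau (\<chi> ?u)) ` {\<chi>. ?Z \<chi>}" by force
  qed auto
  have f: "carrier (Ext_env_bimodule A 3) = carrier ?H" "add (Ext_env_bimodule A 3) = add ?H"
    "lact (Ext_env_bimodule A 3) a = Ext_map E 3 Reg Out (\<lambda>x. x \<otimes>\<^bsub>E\<^esub> tn \<one>\<^bsub>A\<^esub> a)"
    "ract (Ext_env_bimodule A 3) X a = Ext_map E 3 Reg Out (\<lambda>x. x \<otimes>\<^bsub>E\<^esub> tn a \<one>\<^bsub>A\<^esub>) X" for a X
    by (simp_all add: Ext_env_bimodule_def inner_bimodule_def Let_def)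
  have map': "\<exists>\<chi>. ?Z \<chi> \<and> \<Phi> X = tau (\<chi> ?u) \<and> \<Phi> (Ext_map E 3 Reg Out (\<lambda>x. x \<otimes>\<^bsub>E\<^esub> Z) X) = tau (\<chi> ?u \<otimes>\<^bsub>E\<^esub> Z)"
    if "X \<in> carrier ?H" "Z \<in> carrier E" for X Z
    using map[rule_format, OF that(1) right_mult_lin[OF that(2)]] u by (simp add: compose_def)
  show ?thesis
  proof (intro exI[of _ \<Phi>] conjI ballI)
    show "bij_betw \<Phi> (carrier (Ext_env_bimodule A 3)) (carrier A)" using bij by (simp add: im f)
  next
    fix X Y assume "X \<in> carrier (Ext_env_bimodule A 3)" "Y \<in> carrier (Ext_env_bimodule A 3)"
    then have XY: "X \<in> carrier ?H" "Y \<in> carrier ?H" by (simp_all only: f(1))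
    obtain \<chi> \<chi>' where *: "?Z \<chi>" "?Z \<chi>'" "\<Phi> X = tau (\<chi> ?u)" "\<Phi> Y = tau (\<chi>' ?u)"
      "\<Phi> (X \<oplus>\<^bsub>?H\<^esub> Y) = tau ((\<lambda>y\<in>carrier (Q 3). \<chi> y \<oplus>\<^bsub>Out\<^esub> \<chi>' y) ?u)"
      using add[rule_format, OF XY] by (elim exE conjE)
    then show "\<Phi> (X \<oplus>\<^bsub>Ext_env_bimodule A 3\<^esub> Y) = \<Phi> X \<oplus>\<^bsub>A\<^esub> \<Phi> Y"
      unfolding f using u by (simp add: tau_add cl)
  next
    fix a X assume a: "a \<in> carrier A" and "X \<in> carrier (Ext_env_bimodule A 3)"
    then have X: "X \<in> carrier ?H" by (simp add: f)
    show "\<Phi> (lact (Ext_env_bimodule A 3) a X) = sig lm a \<otimes>\<^bsub>A\<^esub> \<Phi> X"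
      using map'[OF X, of "tn \<one>\<^bsub>A\<^esub> a"] a by (auto simp: f tau_left cl)
    show "\<Phi> (ract (Ext_env_bimodule A 3) X a) = \<Phi> X \<otimes>\<^bsub>A\<^esub> a"
      using map'[OF X, of "tn a \<one>\<^bsub>A\<^esub>"] a by (auto simp: f tau_right cl)
    show "lact (Ext_env_bimodule A 3) a X \<in> carrier (Ext_env_bimodule A 3)"
      unfolding f using C.Ext_map_closed[OF X right_mult_lin[of "tn \<one>\<^bsub>A\<^esub> a"]] a by simp
    show "ract (Ext_env_bimodule A 3) X a \<in> carrier (Ext_env_bimodule A 3)"
      unfolding f using C.Ext_map_closed[OF X right_mult_lin[of "tn a \<one>\<^bsub>A\<^esub>"]] a by simp
  qed
qed

lemma lm_eq_one: "\<beta> = - 1 \<Longrightarrow> lm = 1"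
  unfolding lm_def by simp

text \<open>An isomorphism \<open>F\<close> of Ext with \<open>A\<close> would differ from
  \<open>\<Phi>\<close> by an automorphism of the right module \<open>A\<close>, that is by left
  multiplication with a unit \<open>c\<close>, and \<open>c\<close> would make the twist
  inner.\<close>

lemma calabi_yau_iff: "calabi_yau 3 A \<longleftrightarrow> \<beta> = - 1"
proof
  assume \<beta>: "\<beta> = - 1"
  have "sig lm a = a" if "a \<in> carrier A" for a
    unfolding lm_eq_one[OF \<beta>] by (rule sig_one_left[OF that])
  note sig = this
  have "bimodule_iso A (Ext_env_bimodule A 3) (regular_bimodule A)"
    unfolding bimodule_iso_def
    by (rule exE[OF Ext_bimodule_3], rule exI, elim conjE, intro conjI)
      (simp_all add: regular_bimodule_def sig)
  then show "calabi_yau 3 A" using Ext_bimodule_trivial by (simp add: calabi_yau_def)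
next
  assume "calabi_yau 3 A"
  then obtain F where F: "bij_betw F (carrier (Ext_env_bimodule A 3)) (carrier A)"
    "\<forall>a\<in>carrier A. \<forall>x\<in>carrier (Ext_env_bimodule A 3). F (lact (Ext_env_bimodule A 3) a x) = a \<otimes>\<^bsub>A\<^esub> F x"
    "\<forall>a\<in>carrier A. \<forall>x\<in>carrier (Ext_env_bimodule A 3). F (ract (Ext_env_bimodule A 3) x a) = F x \<otimes>\<^bsub>A\<^esub> a"
    by (auto simp: calabi_yau_def bimodule_iso_def regular_bimodule_def)
  obtain \<Phi> where \<Phi>: "bij_betw \<Phi> (carrier (Ext_env_bimodule A 3)) (carrier A)"
    "\<forall>a\<in>carrier A. \<forall>x\<in>carrier (Ext_env_bimodule A 3). \<Phi> (lact (Ext_env_bimodule A 3) a x) = sig lm a \<otimes>\<^bsub>A\<^esub> \<Phi> x"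
    "\<forall>a\<in>carrier A. \<forall>x\<in>carrier (Ext_env_bimodule A 3). \<Phi> (ract (Ext_env_bimodule A 3) x a) = \<Phi> x \<otimes>\<^bsub>A\<^esub> a"
    "\<forall>a\<in>carrier A. \<forall>x\<in>carrier (Ext_env_bimodule A 3).
      lact (Ext_env_bimodule A 3) a x \<in> carrier (Ext_env_bimodule A 3) \<and>
      ract (Ext_env_bimodule A 3) x a \<in> carrier (Ext_env_bimodule A 3)"
    by (rule exE[OF Ext_bimodule_3], elim conjE) (rule that; assumption)
  have surj: "\<exists>x\<in>X. f x = y" if "bij_betw f X Y" "y \<in> Y" for f X Y y
    using that unfolding bij_betw_def by auto
  obtain x1 where x1: "x1 \<in> carrier (Ext_env_bimodule A 3)" "\<Phi> x1 = \<one>\<^bsub>A\<^esub>"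
    using surj[OF \<Phi>(1) A.one_closed] by blast
  obtain x2 where x2: "x2 \<in> carrier (Ext_env_bimodule A 3)" "F x2 = \<one>\<^bsub>A\<^esub>"
    using surj[OF F(1) A.one_closed] by blast
  define c where "c = F x1"
  have c: "c \<in> carrier A" using bij_betwE[OF F(1)] x1 by (simp add: c_def)
  have \<Phi>_closed: "\<Phi> x \<in> carrier A" if "x \<in> carrier (Ext_env_bimodule A 3)" for x
    using bij_betwE[OF \<Phi>(1)] that by blast
  have eq: "x = y" if "x \<in> carrier (Ext_env_bimodule A 3)" "y \<in> carrier (Ext_env_bimodule A 3)" "\<Phi> x = \<Phi> y" for x y
    using inj_onD[OF bij_betw_imp_inj_on[OF \<Phi>(1)] that(3,1,2)] .
  show "\<beta> = - 1"
  proof (rule ccontr)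
    assume \<beta>: "\<beta> \<noteq> - 1"
    let ?H = "Ext_env_bimodule A 3"
    \<comment> \<open>Both \<open>a x1\<close> and \<open>x1 sig lm a\<close> have the value
      \<open>sig lm a\<close> under \<open>\<Phi>\<close>, so they agree; applying \<open>F\<close>
      gives the relation for \<open>c\<close>.\<close>
    have inner: "a \<otimes>\<^bsub>A\<^esub> c = c \<otimes>\<^bsub>A\<^esub> sig lm a" if a: "a \<in> carrier A" for a
    proof -
      have "\<Phi> (lact ?H a x1) = \<Phi> (ract ?H x1 (sig lm a))" using \<Phi>(2,3) a x1 by simp
      then have "lact ?H a x1 = ract ?H x1 (sig lm a)" using eq \<Phi>(4) a x1(1) by (metis sig_closed)
      then show ?thesis using F(2,3) a x1(1) c_def by (metis sig_closed)
    qed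
    have tw: "dn \<otimes>\<^bsub>A\<^esub> c = lm \<odot>\<^bsub>A\<^esub> (c \<otimes>\<^bsub>A\<^esub> dn)"
      using inner[of dn] c by (simp add: sig_gens A.smult_mult_right)
    \<comment> \<open>Chosen so that \<open>a x1\<close> is the element \<open>x2\<close> that
      \<open>F\<close> sends to 1; this provides the left inverse of \<open>c\<close>.\<close>
    define a where "a = sig (inverse lm) (\<Phi> x2)"
    have a: "a \<in> carrier A" "sig lm a = \<Phi> x2"
      using sig_sig[OF lm_nz \<Phi>_closed[OF x2(1)]] by (simp_all add: a_def)
    have "\<Phi> (lact ?H a x1) = \<Phi> x2" using \<Phi>(2) a x1 \<Phi>_closed[OF x2(1)] by simp
    then have "lact ?H a x1 = x2" using eq \<Phi>(4) a(1) x1(1) x2(1) by blast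
    then have "a \<otimes>\<^bsub>A\<^esub> c = \<one>\<^bsub>A\<^esub>" using F(2) a(1) x1(1) x2(2) c_def by metis
    then show False by (rule twist_not_inner[OF \<beta> c a(1) _ tw])
  qed
qed

end

theorem proposition7p5:
  fixes \<alpha> \<beta> \<gamma> :: "'k::field"
  assumes "\<beta> \<noteq> 0"
  shows "calabi_yau 3 (down_up_algebra \<alpha> \<beta> \<gamma>) \<longleftrightarrow> \<beta> = - 1"
proof -
  interpret down_up \<alpha> \<beta> \<gamma> by unfold_locales (rule assms)
  show ?thesis by (rule calabi_yau_iff)
qed

end
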